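(* Let $w(t)$, $t\in[0,1]$, be a Wiener process, $\xi$ the white noise in $L_2([0,1])$ generated by $w$, and $A$ a continuous, continuously invertible linear operator in $L_2([0,1])$ with $\|A\|\le1$. Let $x(t)=(A\mathbf{1}_{[0,t]},\xi)$, $t\in[0,1]$, let $\sigma(t)=\|A\mathbf{1}_{[0,t]}\|$, and let $\ell(u)$ be the local time of $x$ at $u$ up to time $1$. For every $u\in\mathbb{R}$, the Itô–Wiener expansion of $\ell(u)$ is $$\ell(u)=\sum_{n=0}^\infty\Gamma(A)\left(\int_{\Delta_n}a_n(t_1,\ldots,t_n)\,dw(t_1)\ldots dw(t_n)\right),$$ where the symmetric kernels $\{a_n\}$ are given by $$a_n(t_1,\ldots,t_n)=\int_{t_n^*}^1\frac{1}{\sigma(t)^n}H_n\left(\frac{u}{\sigma(t)}\right)p_{\sigma(t)^2}(u)\,dt .$$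
   Context: Notation: $t_n^*=\max\{t_1,\dots,t_n\}$ (with $t_0^*=0$ for $n=0$); $\Delta_n=\{(t_1,\dots,t_n):0\le t_1\le\dots\le t_n\le1\}$; $H_n(x)=(-1)^ne^{x^2/2}(d/dx)^ne^{-x^2/2}$; $p_\varepsilon(x)=(2\pi\varepsilon)^{-1/2}\exp(-x^2/2\varepsilon)$. The white noise generated by $w$ is $(h,\xi)=\int_0^1h(t)\,dw(t)$, $h\in L_2([0,1])$. Local time: $\ell(u)=L^2\text{-}\lim_{\varepsilon\to0^+}\int_0^1p_\varepsilon(x(t)-u)\,dt$. Itô–Wiener expansion: every square integrable $\sigma(\xi)$-measurable random variable $\alpha$ is uniquely a sum of mutually orthogonal terms $\alpha=\sum_{n\ge0}A_n(\xi,\dots,\xi)=\sum_{n\ge0}\int_{\Delta_n}a_n(t_1,\dots,t_n)\,dw(t_1)\ldots dw(t_n)$, where the $A_n$ are symmetric $n$-linear Hilbert–Schmidt forms on $L_2([0,1])$ and $A_n(\xi,\dots,\xi)$ is the corresponding Hermite polynomial from $\xi$, equal to the multiple Wiener integral of a nonrandom symmetric kernel $a_n$ (so $A_n(\varphi_1,\dots,\varphi_n)=\frac1{n!}\int_{[0,1]^n}a_n(\vec t)\varphi_1(t_1)\cdots\varphi_n(t_n)\,d\vec t$; for $n=0$ the term is the constant $a_0$). Second quantization: for a continuous linear operator $B$ in $L_2([0,1])$ with $\|B\|\le1$, put $A_n^B(\varphi_1,\dots,\varphi_n)=A_n(B^*\varphi_1,\dots,B^*\varphi_n)$ and $\Gamma(B)\alpha=\sum_{n\ge0}A_n^B(\xi,\dots,\xi)$.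 *)

theory Defs
  imports "HOL-Probability.Probability"
begin

definition sq_integrable :: "'a measure \<Rightarrow> ('a \<Rightarrow> real) \<Rightarrow> bool" where
  "sq_integrable M f \<longleftrightarrow> f \<in> borel_measurable M \<and> integrable M (\<lambda>x. (f x)\<^sup>2)"

definition L2_tendsto ::
    "'a measure \<Rightarrow> ('b \<Rightarrow> 'a \<Rightarrow> real) \<Rightarrow> ('a \<Rightarrow> real) \<Rightarrow> 'b filter \<Rightarrow> bool" where
  "L2_tendsto M X Y F \<longleftrightarrow>
     sq_integrable M Y \<and> (\<forall>\<^sub>F i in F. sq_integrable M (X i)) \<and>
     ((\<lambda>i. \<integral>\<omega>. (X i \<omega> - Y \<omega>)\<^sup>2 \<partial>M) \<longlongrightarrow> 0) F"

lemma sq_integrable_mult: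
  assumes "sq_integrable M f" "sq_integrable M g"
  shows "integrable M (\<lambda>x. f x * g x)"
proof (rule Bochner_Integration.integrable_bound)
  show "integrable M (\<lambda>x. (f x)\<^sup>2 + (g x)\<^sup>2)"
    using assms by (auto simp: sq_integrable_def)
  show "(\<lambda>x. f x * g x) \<in> borel_measurable M"
    using assms by (auto simp: sq_integrable_def)
  have "\<bar>a * b\<bar> \<le> a\<^sup>2 + b\<^sup>2" for a b :: real
  proof -
    have "2 * (\<bar>a\<bar> * \<bar>b\<bar>) \<le> a\<^sup>2 + b\<^sup>2"
      using sum_squares_bound[of "\<bar>a\<bar>" "\<bar>b\<bar>"] by simp
    moreover have "0 \<le> \<bar>a\<bar> * \<bar>b\<bar>" by simp
    ultimately show ?thesis unfolding abs_mult by linarith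
  qed
  then show "AE x in M. norm (f x * g x) \<le> norm ((f x)\<^sup>2 + (g x)\<^sup>2)" by simp
qed

lemma sq_integrable_add:
  assumes "sq_integrable M f" "sq_integrable M g"
  shows "sq_integrable M (\<lambda>x. f x + g x)"
  using assms sq_integrable_mult[OF assms]
  by (auto simp: sq_integrable_def power2_sum mult.assoc)

lemma sq_integrable_scale:
  "sq_integrable M f \<Longrightarrow> sq_integrable M (\<lambda>x. c * f x)"
  by (auto simp: sq_integrable_def power_mult_distrib)

lemma sq_integrable_zero: "sq_integrable M (\<lambda>_. 0)"
  by (simp add: sq_integrable_def)

abbreviation leb01 :: "real measure" where
  "leb01 \<equiv> restrict_space lborel {0..1}"

quotient_type l2_01 = "real \<Rightarrow> real" / partial:
  "\<lambda>f g. sq_integrable leb01 f \<and> sq_integrable leb01 g \<and> (AE x in leb01. f x = g x)"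
proof (rule part_equivpI)
  show "\<exists>f. sq_integrable leb01 f \<and> sq_integrable leb01 f \<and> (AE x in leb01. f x = f x)"
    using sq_integrable_zero by auto
qed (auto intro!: sympI transpI)

instantiation l2_01 :: real_inner
begin

lift_definition zero_l2_01 :: l2_01 is "\<lambda>_. 0"
  by (simp add: sq_integrable_zero)

lift_definition plus_l2_01 :: "l2_01 \<Rightarrow> l2_01 \<Rightarrow> l2_01" is "\<lambda>f g x. f x + g x"
  by (auto intro: sq_integrable_add)

lift_definition scaleR_l2_01 :: "real \<Rightarrow> l2_01 \<Rightarrow> l2_01" is "\<lambda>c f x. c * f x"
  by (auto intro: sq_integrable_scale)

definition uminus_l2_01 :: "l2_01 \<Rightarrow> l2_01" where "uminus_l2_01 f = (-1) *\<^sub>R f"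

definition minus_l2_01 :: "l2_01 \<Rightarrow> l2_01 \<Rightarrow> l2_01" where "minus_l2_01 f g = f + (-1) *\<^sub>R g"

lift_definition inner_l2_01 :: "l2_01 \<Rightarrow> l2_01 \<Rightarrow> real" is "\<lambda>f g. \<integral>x. f x * g x \<partial>leb01"
proof -
  fix f f' g g' :: "real \<Rightarrow> real"
  assume *: "sq_integrable leb01 f \<and> sq_integrable leb01 f' \<and> (AE x in leb01. f x = f' x)"
    "sq_integrable leb01 g \<and> sq_integrable leb01 g' \<and> (AE x in leb01. g x = g' x)"
  show "(\<integral>x. f x * g x \<partial>leb01) = (\<integral>x. f' x * g' x \<partial>leb01)"
  proof (rule integral_cong_AE)
    show "(\<lambda>x. f x * g x) \<in> borel_measurable leb01"
      "(\<lambda>x. f' x * g' x) \<in> borel_measurable leb01"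
      using * by (auto simp: sq_integrable_def intro!: borel_measurable_times)
    show "AE x in leb01. f x * g x = f' x * g' x"
      using conjunct2[OF conjunct2[OF *(1)]] conjunct2[OF conjunct2[OF *(2)]]
      by eventually_elim simp
  qed
qed

definition norm_l2_01 :: "l2_01 \<Rightarrow> real" where "norm_l2_01 f = sqrt (inner f f)"

definition sgn_l2_01 :: "l2_01 \<Rightarrow> l2_01" where "sgn_l2_01 f = inverse (norm f) *\<^sub>R f"

definition dist_l2_01 :: "l2_01 \<Rightarrow> l2_01 \<Rightarrow> real" where "dist_l2_01 f g = norm (f - g)"

definition uniformity_l2_01 :: "(l2_01 \<times> l2_01) filter" where
  "uniformity_l2_01 = (INF e\<in>{0<..}. principal {(x, y). dist x y < e})"

definition open_l2_01 :: "l2_01 set \<Rightarrow> bool" where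
  "open_l2_01 U \<longleftrightarrow> (\<forall>x\<in>U. \<forall>\<^sub>F (x', y) in uniformity. x' = x \<longrightarrow> y \<in> U)"

instance
proof
  fix f g h :: l2_01 and c d :: real
  show "f + g + h = f + (g + h)"
    by transfer (auto simp: add.assoc intro!: sq_integrable_add)
  show "f + g = g + f"
    by transfer (auto simp: add.commute intro!: sq_integrable_add)
  show "0 + f = f"
    by transfer auto
  show "- f + f = 0"
    unfolding uminus_l2_01_def
    by transfer (auto intro!: sq_integrable_add sq_integrable_scale sq_integrable_zero
        simp: sq_integrable_scale[where c="-1", simplified])
  show "f - g = f + - g"
    by (simp add: minus_l2_01_def uminus_l2_01_def)
  show "c *\<^sub>R (f + g) = c *\<^sub>R f + c *\<^sub>R g"
    by transfer (auto simp: algebra_simps intro!: sq_integrable_add sq_integrable_scale)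
  show "(c + d) *\<^sub>R f = c *\<^sub>R f + d *\<^sub>R f"
    by transfer (auto simp: algebra_simps intro!: sq_integrable_add sq_integrable_scale)
  show "c *\<^sub>R d *\<^sub>R f = (c * d) *\<^sub>R f"
    by transfer (auto simp: mult.assoc intro!: sq_integrable_scale)
  show "1 *\<^sub>R f = f"
    by transfer auto
  show "sgn f = inverse (norm f) *\<^sub>R f"
    by (fact sgn_l2_01_def)
  show "dist f g = norm (f - g)"
    by (fact dist_l2_01_def)
  show "(uniformity :: (l2_01 \<times> l2_01) filter) =
      (INF e\<in>{0<..}. principal {(x, y). dist x y < e})"
    by (fact uniformity_l2_01_def)
  show "open U = (\<forall>x\<in>U. \<forall>\<^sub>F (x', y) in uniformity. x' = x \<longrightarrow> y \<in> U)" for U :: "l2_01 set"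
    by (fact open_l2_01_def)
  show "inner f g = inner g f"
    by transfer (simp add: mult.commute)
  show "inner (f + g) h = inner f h + inner g h"
    by transfer (simp add: distrib_right sq_integrable_mult)
  show "inner (c *\<^sub>R f) g = c * inner f g"
    by transfer (simp add: mult.assoc)
  show "0 \<le> inner f f"
    by transfer simp
  show "inner f f = 0 \<longleftrightarrow> f = 0"
  proof transfer
    fix f
    assume "sq_integrable leb01 f \<and> sq_integrable leb01 f \<and> (AE x in leb01. f x = f x)"
    then have f: "sq_integrable leb01 f" by simp
    have "(\<integral>x. f x * f x \<partial>leb01) = 0 \<longleftrightarrow> (AE x in leb01. f x * f x = 0)"
      using sq_integrable_mult[OF f f] by (intro integral_nonneg_eq_0_iff_AE) auto
    then show "((\<integral>x. f x * f x \<partial>leb01) = 0) =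
        (sq_integrable leb01 f \<and> sq_integrable leb01 (\<lambda>_. 0) \<and> (AE x in leb01. f x = 0))"
      using f by (simp add: sq_integrable_zero)
  qed
  show "norm f = sqrt (inner f f)"
    by (fact norm_l2_01_def)
qed

end

lift_definition ind01 :: "real \<Rightarrow> l2_01" is "\<lambda>t. indicator {0..t}"
proof -
  fix t :: real
  have m: "(indicator {0..t} :: real \<Rightarrow> real) \<in> borel_measurable leb01"
    by (intro measurable_restrict_space1) simp
  have "finite_measure leb01"
    by (rule finite_measureI) (simp add: emeasure_restrict_space space_restrict_space)
  then have "integrable leb01 (\<lambda>x. (indicator {0..t} x :: real)\<^sup>2)"
    by (rule finite_measure.integrable_const_bound[where B=1])
      (use m in \<open>auto split: split_indicator intro!: borel_measurable_power\<close>)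
  with m show "sq_integrable leb01 (indicator {0..t}) \<and>
      sq_integrable leb01 (indicator {0..t}) \<and>
      (AE x in leb01. indicator {0..t} x = (indicator {0..t} x :: real))"
    by (simp add: sq_integrable_def)
qed

locale wiener_process = prob_space M for M :: "'a measure" +
  fixes w :: "real \<Rightarrow> 'a \<Rightarrow> real"
  assumes random_variable: "\<And>t. t \<in> {0..1} \<Longrightarrow> w t \<in> borel_measurable M"
    and starts_at_0: "AE \<omega> in M. w 0 \<omega> = 0"
    and indep_increments:
      "\<And>n s. (\<And>i. i \<le> n \<Longrightarrow> s i \<in> {0..1}) \<Longrightarrow> mono_on {..n} s \<Longrightarrow>
        indep_vars (\<lambda>_. borel) (\<lambda>i \<omega>. w (s (Suc i)) \<omega> - w (s i) \<omega>) {..<n}"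
    and normal_increments:
      "\<And>s t. 0 \<le> s \<Longrightarrow> s < t \<Longrightarrow> t \<le> 1 \<Longrightarrow>
        distributed M lborel (\<lambda>\<omega>. w t \<omega> - w s \<omega>) (normal_density 0 (sqrt (t - s)))"
    and continuous_paths: "AE \<omega> in M. continuous_on {0..1} (\<lambda>t. w t \<omega>)"

text \<open>
  The variables \<open>t\<^sub>1, \<dots>, t\<^sub>n\<close> are indexed by \<open>0, \<dots>, n - 1\<close>. For \<open>n = 0\<close> the cube is a one-point
  space of mass 1, so that kernels and integrals of order 0 are constants.
\<close>

definition cube :: "nat \<Rightarrow> (nat \<Rightarrow> real) measure" where
  "cube n = (\<Pi>\<^sub>M i\<in>{..<n}. leb01)"

definition simplex_measure :: "nat \<Rightarrow> (nat \<Rightarrow> real) measure" where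
  "simplex_measure n = restrict_space (cube n) {t. mono_on {..<n} t}"

text \<open>
  A list of triples \<open>(c, l, r)\<close> represents the step kernel that is the sum of the functions
  \<open>c 1\<^bsub>(l\<^sub>1, r\<^sub>1]\<^esub>(t\<^sub>1) \<cdots> 1\<^bsub>(l\<^sub>n, r\<^sub>n]\<^esub>(t\<^sub>n)\<close>, where
  \<open>0 \<le> l\<^sub>1 \<le> r\<^sub>1 \<le> l\<^sub>2 \<le> \<cdots> \<le> r\<^sub>n \<le> 1\<close>. The integral over the simplex
  is the continuous extension, in mean square, of the obvious integral of such kernels.
\<close>

type_synonym steps = "(real \<times> (nat \<Rightarrow> real) \<times> (nat \<Rightarrow> real)) list"

definition steps_in_simplex :: "nat \<Rightarrow> steps \<Rightarrow> bool" where
  "steps_in_simplex n S \<longleftrightarrow>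
     (\<forall>(c, l, r) \<in> set S. \<forall>i<n. 0 \<le> l i \<and> l i \<le> r i \<and> r i \<le> 1 \<and>
        (Suc i < n \<longrightarrow> r i \<le> l (Suc i)))"

definition step_kernel :: "nat \<Rightarrow> steps \<Rightarrow> (nat \<Rightarrow> real) \<Rightarrow> real" where
  "step_kernel n S t = (\<Sum>(c, l, r) \<leftarrow> S. c * (\<Prod>i<n. indicator {l i<..r i} (t i)))"

definition step_integral :: "(real \<Rightarrow> 'a \<Rightarrow> real) \<Rightarrow> nat \<Rightarrow> steps \<Rightarrow> 'a \<Rightarrow> real" where
  "step_integral w n S \<omega> = (\<Sum>(c, l, r) \<leftarrow> S. c * (\<Prod>i<n. w (r i) \<omega> - w (l i) \<omega>))"

text \<open>
  \<open>has_wiener_integral M w n a X\<close>: the random variable \<open>X\<close> is a version of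
  \<open>\<integral>\<^bsub>\<Delta>\<^sub>n\<^esub> a(t\<^sub>1, \<dots>, t\<^sub>n) dw(t\<^sub>1) \<dots> dw(t\<^sub>n)\<close>.
\<close>

definition has_wiener_integral ::
    "'a measure \<Rightarrow> (real \<Rightarrow> 'a \<Rightarrow> real) \<Rightarrow> nat \<Rightarrow> ((nat \<Rightarrow> real) \<Rightarrow> real) \<Rightarrow> ('a \<Rightarrow> real) \<Rightarrow> bool" where
  "has_wiener_integral M w n a X \<longleftrightarrow>
     (\<exists>S. (\<forall>k. steps_in_simplex n (S k)) \<and>
        L2_tendsto (simplex_measure n) (\<lambda>k. step_kernel n (S k)) a sequentially \<and>
        L2_tendsto M (\<lambda>k. step_integral w n (S k)) X sequentially)"

definition wiener_integral ::
    "'a measure \<Rightarrow> (real \<Rightarrow> 'a \<Rightarrow> real) \<Rightarrow> nat \<Rightarrow> ((nat \<Rightarrow> real) \<Rightarrow> real) \<Rightarrow> 'a \<Rightarrow> real" where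
  "wiener_integral M w n a = (SOME X. has_wiener_integral M w n a X)"

text \<open>The pairing \<open>(h, \<xi>)\<close> is the case \<open>n = 1\<close>, as \<open>\<Delta>\<^sub>1 = [0, 1]\<close>.\<close>

definition has_white_noise ::
    "'a measure \<Rightarrow> (real \<Rightarrow> 'a \<Rightarrow> real) \<Rightarrow> l2_01 \<Rightarrow> ('a \<Rightarrow> real) \<Rightarrow> bool" where
  "has_white_noise M w h X \<longleftrightarrow> has_wiener_integral M w 1 (\<lambda>t. rep_l2_01 h (t 0)) X"

definition symmetric_kernel :: "nat \<Rightarrow> ((nat \<Rightarrow> real) \<Rightarrow> real) \<Rightarrow> bool" where
  "symmetric_kernel n a \<longleftrightarrow> sq_integrable (cube n) a \<and>
     (\<forall>\<pi> t. \<pi> permutes {..<n} \<longrightarrow> t \<in> space (cube n) \<longrightarrow> a (t \<circ> \<pi>) = a t)"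

text \<open>
  Symmetric Hilbert-Schmidt forms \<open>A\<^sub>n(\<phi>\<^sub>1, \<dots>, \<phi>\<^sub>n)\<close> are functions of the sequence \<open>\<phi>\<close> that depend
  on its first \<open>n\<close> members only.
\<close>

definition kernel_form :: "nat \<Rightarrow> ((nat \<Rightarrow> real) \<Rightarrow> real) \<Rightarrow> (nat \<Rightarrow> l2_01) \<Rightarrow> real" where
  "kernel_form n a \<phi> = (1 / fact n) * (\<integral>t. a t * (\<Prod>i<n. rep_l2_01 (\<phi> i) (t i)) \<partial>cube n)"

text \<open>\<open>noise_form M w n F X\<close>: \<open>F\<close> is such a form, and \<open>X\<close> is a version of \<open>F(\<xi>, \<dots>, \<xi>)\<close>.\<close>

definition noise_form ::
    "'a measure \<Rightarrow> (real \<Rightarrow> 'a \<Rightarrow> real) \<Rightarrow> nat \<Rightarrow> ((nat \<Rightarrow> l2_01) \<Rightarrow> real) \<Rightarrow> ('a \<Rightarrow> real) \<Rightarrow> bool" where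
  "noise_form M w n F X \<longleftrightarrow>
     (\<exists>a. symmetric_kernel n a \<and> F = kernel_form n a \<and> has_wiener_integral M w n a X)"

text \<open>
  \<open>ito_wiener_expansion M w F Y \<alpha>\<close>: the expansion of \<open>\<alpha>\<close> is \<open>\<Sum>n. Y n\<close> with
  \<open>Y n = F n (\<xi>, \<dots>, \<xi>)\<close>.
\<close>

definition ito_wiener_expansion ::
    "'a measure \<Rightarrow> (real \<Rightarrow> 'a \<Rightarrow> real) \<Rightarrow> (nat \<Rightarrow> (nat \<Rightarrow> l2_01) \<Rightarrow> real) \<Rightarrow>
      (nat \<Rightarrow> 'a \<Rightarrow> real) \<Rightarrow> ('a \<Rightarrow> real) \<Rightarrow> bool" where
  "ito_wiener_expansion M w F Y \<alpha> \<longleftrightarrow>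
     (\<forall>n. noise_form M w n (F n) (Y n)) \<and>
     L2_tendsto M (\<lambda>N \<omega>. \<Sum>n<N. Y n \<omega>) \<alpha> sequentially"

definition has_second_quantization ::
    "'a measure \<Rightarrow> (real \<Rightarrow> 'a \<Rightarrow> real) \<Rightarrow> (l2_01 \<Rightarrow> l2_01) \<Rightarrow> ('a \<Rightarrow> real) \<Rightarrow> ('a \<Rightarrow> real) \<Rightarrow> bool" where
  "has_second_quantization M w B \<alpha> \<beta> \<longleftrightarrow>
     (\<exists>F Y Z. ito_wiener_expansion M w F Y \<alpha> \<and>
        ito_wiener_expansion M w (\<lambda>n \<phi>. F n (\<lambda>i. adjoint B (\<phi> i))) Z \<beta>)"

definition second_quantization ::
    "'a measure \<Rightarrow> (real \<Rightarrow> 'a \<Rightarrow> real) \<Rightarrow> (l2_01 \<Rightarrow> l2_01) \<Rightarrow> ('a \<Rightarrow> real) \<Rightarrow> 'a \<Rightarrow> real" where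
  "second_quantization M w B \<alpha> = (SOME \<beta>. has_second_quantization M w B \<alpha> \<beta>)"

definition gauss_kernel :: "real \<Rightarrow> real \<Rightarrow> real" where
  "gauss_kernel \<epsilon> x = (1 / sqrt (2 * pi * \<epsilon>)) * exp (- x\<^sup>2 / (2 * \<epsilon>))"

text \<open>
  The integral is taken along the paths, so \<open>x\<close> has to be a jointly measurable version of the process.
\<close>

definition is_local_time ::
    "'a measure \<Rightarrow> (real \<Rightarrow> 'a \<Rightarrow> real) \<Rightarrow> real \<Rightarrow> ('a \<Rightarrow> real) \<Rightarrow> bool" where
  "is_local_time M x u l \<longleftrightarrow>
     L2_tendsto M (\<lambda>\<epsilon> \<omega>. LBINT t:{0..1}. gauss_kernel \<epsilon> (x t \<omega> - u)) l (at_right 0)"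

definition hermite :: "nat \<Rightarrow> real \<Rightarrow> real" where
  "hermite n x = (-1) ^ n * exp (x\<^sup>2 / 2) * (deriv ^^ n) (\<lambda>y. exp (- y\<^sup>2 / 2)) x"

definition max_coord :: "nat \<Rightarrow> (nat \<Rightarrow> real) \<Rightarrow> real" where
  "max_coord n t = (if n = 0 then 0 else Max (t ` {..<n}))"

end

theory Submission
  imports Defs
begin

text \<open>
  Let \<open>T\<close> be the unit interval of times and let the frequency \<open>z\<close> range over the real line.
  Fourier inversion for the Gaussian kernel writes the smoothed local time as an integral of
  characters,
  \<open>1 / (2 pi) \<integral>\<^sub>T \<integral> exp (i z (x(t) - u)) exp (- \<epsilon> z\<^sup>2 / 2) dz dt\<close>,
  and everything is read off from the fact that \<open>z x(t)\<close> is a centred Gaussian variable whose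
  variance is \<open>\<parallel>z A 1\<^sub>t\<parallel>\<^sup>2\<close>, where \<open>1\<^sub>t\<close> stands for \<open>ind01 t\<close>.

  Existence. The inner product of two smoothings is an integral over two times and two
  frequencies whose integrand is dominated by \<open>exp (- \<parallel>z A 1\<^sub>s + z' A 1\<^sub>t\<parallel>\<^sup>2 / 2)\<close>. Since
  \<open>A\<close> is invertible, \<open>\<parallel>A h\<parallel> \<ge> c \<parallel>h\<parallel>\<close>, so the domination holds with \<open>1\<^sub>s\<close> and \<open>1\<^sub>t\<close> in
  place of their images, at the price of \<open>c\<^sup>2\<close>; this is the computation for Brownian motion,
  where the frequencies integrate to a multiple of \<open>1 / sqrt (s (t - s))\<close> for \<open>s < t\<close>
  (\<open>integrable_two_point\<close>). Hence all inner products have a common limit and the smoothings are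
  Cauchy in mean square (\<open>smoothed_inner_bound\<close>, \<open>local_time_exists\<close>).

  An expansion. Products of increments over ordered boxes span the multiple Wiener integrals. A
  variable orthogonal to all of them is orthogonal to all characters of white noises, because such
  a character is, up to a constant factor, a limit of products \<open>\<Prod> (1 + i h\<^sub>k \<Delta>\<^sub>k w)\<close> over finer and finer grids
  (\<open>chaos_product_distance\<close>, \<open>character_orthogonal\<close>). The local time is a limit of integrals of
  characters, so it lies in the closed span of the products, and its projections \<open>J n\<close> to the
  multiple integrals of order \<open>n\<close> sum up to it (\<open>chaos_expansion\<close>).

  The kernels. The expectation of a multiple integral of a symmetric kernel \<open>b\<close> against the
  character of the white noise in direction \<open>h\<close> is
  \<open>i\<^sup>n B(h, \<dots>, h) exp (- \<parallel>h\<parallel>\<^sup>2 / 2)\<close>, with \<open>B\<close> the form of \<open>b\<close>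
  (\<open>wint_white_noise_character\<close>). For the local time the same expectation is the Fourier integral
  of \<open>exp (- \<parallel>z A 1\<^sub>t + h\<parallel>\<^sup>2 / 2)\<close>. Expanding
  \<open>exp (- z \<langle>A 1\<^sub>t, h\<rangle>)\<close> in powers of \<open>h\<close> and integrating over \<open>z\<close> produces the Hermite
  weights, and integrating
  \<open>\<langle>A 1\<^sub>t, h\<rangle>\<^sup>n = (\<integral>\<^sub>0\<^sup>t A\<^sup>* h)\<^sup>n\<close> against them over \<open>t\<close> is the form of the stated
  kernel on \<open>A\<^sup>* h\<close> (\<open>local_time_character_series\<close>). Replacing \<open>h\<close> by \<open>y h\<close> makes
  both expressions power series in \<open>y\<close>, whose coefficients agree. So the forms agree on the
  diagonal, by polarization everywhere (\<open>expansion_form\<close>), and a form determines its kernel and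
  its multiple integral. This identifies \<open>J n\<close> with the second quantization of the integral of
  the stated kernel (\<open>second_quantization_wint\<close>).
\<close>

section \<open>Mean square convergence\<close>

definition L2n :: "'a measure \<Rightarrow> ('a \<Rightarrow> real) \<Rightarrow> real" where
  "L2n M f = sqrt (\<integral>x. (f x)\<^sup>2 \<partial>M)"

lemma sq_integrable_measurable: "sq_integrable M f \<Longrightarrow> f \<in> borel_measurable M"
  by (simp add: sq_integrable_def)

lemma sq_integrable_square: "sq_integrable M f \<Longrightarrow> integrable M (\<lambda>x. (f x)\<^sup>2)"
  by (simp add: sq_integrable_def)

lemma sq_integrable_diff:
  assumes "sq_integrable M f" "sq_integrable M g"
  shows "sq_integrable M (\<lambda>x. f x - g x)"
  using sq_integrable_add[OF assms(1) sq_integrable_scale[OF assms(2), of "-1"]] by simp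

lemma sq_integrable_sum:
  assumes "\<And>i. i \<in> I \<Longrightarrow> sq_integrable M (f i)"
  shows "sq_integrable M (\<lambda>x. \<Sum>i\<in>I. f i x)"
  using assms by (induction I rule: infinite_finite_induct)
    (auto intro: sq_integrable_add sq_integrable_zero)

lemma sq_integrable_cong_AE:
  assumes "sq_integrable M f" "AE x in M. f x = g x" "g \<in> borel_measurable M"
  shows "sq_integrable M g"
proof -
  have "integrable M (\<lambda>x. (g x)\<^sup>2) \<longleftrightarrow> integrable M (\<lambda>x. (f x)\<^sup>2)"
    using assms by (intro integrable_cong_AE) (auto simp: sq_integrable_def)
  then show ?thesis using assms by (simp add: sq_integrable_def)
qed

lemma (in finite_measure) sq_integrable_bounded:
  assumes [measurable]: "f \<in> borel_measurable M" and "\<And>x. x \<in> space M \<Longrightarrow> \<bar>f x\<bar> \<le> B"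
  shows "sq_integrable M f"
proof -
  have "integrable M (\<lambda>x. (f x)\<^sup>2)"
  proof (rule integrable_const_bound[where B="B\<^sup>2"])
    show "AE x in M. norm ((f x)\<^sup>2) \<le> B\<^sup>2"
    proof (rule AE_I2)
      fix x assume "x \<in> space M"
      then have "\<bar>f x\<bar>\<^sup>2 \<le> B\<^sup>2" using assms(2) by (intro power_mono) auto
      then show "norm ((f x)\<^sup>2) \<le> B\<^sup>2" by simp
    qed
  qed simp
  then show ?thesis by (simp add: sq_integrable_def)
qed

lemma (in finite_measure) sq_integrable_imp_integrable:
  assumes "sq_integrable M f"
  shows "integrable M f"
  using sq_integrable_mult[OF assms sq_integrable_bounded[of "\<lambda>_. 1" 1]] by simp

lemma L2n_nonneg: "0 \<le> L2n M f"
  by (simp add: L2n_def)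

lemma L2n_square: "(L2n M f)\<^sup>2 = (\<integral>x. (f x)\<^sup>2 \<partial>M)"
  by (simp add: L2n_def)

lemma integral_square_diff_scale:
  assumes "sq_integrable M f" "sq_integrable M g"
  shows "(\<integral>x. (f x - t * g x)\<^sup>2 \<partial>M) =
    (\<integral>x. (f x)\<^sup>2 \<partial>M) - 2 * t * (\<integral>x. f x * g x \<partial>M) + t\<^sup>2 * (\<integral>x. (g x)\<^sup>2 \<partial>M)"
proof -
  have "(\<integral>x. (f x - t * g x)\<^sup>2 \<partial>M) =
      (\<integral>x. (f x)\<^sup>2 - 2 * t * (f x * g x) + t\<^sup>2 * (g x)\<^sup>2 \<partial>M)"
    by (intro Bochner_Integration.integral_cong refl) (simp add: power2_eq_square algebra_simps)
  also have "\<dots> = (\<integral>x. (f x)\<^sup>2 \<partial>M) - 2 * t * (\<integral>x. f x * g x \<partial>M) + t\<^sup>2 * (\<integral>x. (g x)\<^sup>2 \<partial>M)"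
    using sq_integrable_square[OF assms(1)] sq_integrable_square[OF assms(2)]
      sq_integrable_mult[OF assms] by simp
  finally show ?thesis .
qed

lemma quadratic_nonneg_imp_discriminant:
  fixes F B G :: real
  assumes "\<And>t. 0 \<le> F - 2 * t * B + t\<^sup>2 * G" "0 \<le> F" "0 \<le> G"
  shows "B\<^sup>2 \<le> F * G"
proof (cases "G = 0")
  case True
  have "B = 0"
  proof (rule ccontr)
    assume "B \<noteq> 0"
    then show False using assms(1)[of "(F + 1) / (2 * B)"] True by simp
  qed
  then show ?thesis using True by simp
next
  case False
  then have "0 < G" using assms by simp
  have "0 \<le> F - 2 * (B / G) * B + (B / G)\<^sup>2 * G" by (rule assms)
  also have "\<dots> = F - B\<^sup>2 / G" using \<open>0 < G\<close> by (simp add: power2_eq_square field_simps)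
  finally show ?thesis using \<open>0 < G\<close> by (simp add: field_simps)
qed

lemma L2_Cauchy_Schwarz:
  assumes "sq_integrable M f" "sq_integrable M g"
  shows "\<bar>\<integral>x. f x * g x \<partial>M\<bar> \<le> L2n M f * L2n M g"
proof -
  have "(\<integral>x. f x * g x \<partial>M)\<^sup>2 \<le> (\<integral>x. (f x)\<^sup>2 \<partial>M) * (\<integral>x. (g x)\<^sup>2 \<partial>M)"
  proof (rule quadratic_nonneg_imp_discriminant)
    show "0 \<le> (\<integral>x. (f x)\<^sup>2 \<partial>M) - 2 * t * (\<integral>x. f x * g x \<partial>M) + t\<^sup>2 * (\<integral>x. (g x)\<^sup>2 \<partial>M)" for t
      unfolding integral_square_diff_scale[OF assms, symmetric] by simp
  qed auto
  then have "sqrt ((\<integral>x. f x * g x \<partial>M)\<^sup>2) \<le> sqrt ((\<integral>x. (f x)\<^sup>2 \<partial>M) * (\<integral>x. (g x)\<^sup>2 \<partial>M))"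
    by (rule real_sqrt_le_mono)
  then show ?thesis by (simp add: L2n_def real_sqrt_mult)
qed

lemma L2n_triangle:
  assumes "sq_integrable M f" "sq_integrable M g"
  shows "L2n M (\<lambda>x. f x + g x) \<le> L2n M f + L2n M g"
proof -
  have "(L2n M (\<lambda>x. f x + g x))\<^sup>2 =
      (\<integral>x. (f x)\<^sup>2 \<partial>M) + 2 * (\<integral>x. f x * g x \<partial>M) + (\<integral>x. (g x)\<^sup>2 \<partial>M)"
    using integral_square_diff_scale[OF assms, of "-1"] by (simp add: L2n_square)
  also have "\<dots> \<le> (L2n M f + L2n M g)\<^sup>2"
    using L2_Cauchy_Schwarz[OF assms] by (simp add: power2_sum L2n_square)
  finally show ?thesis
    by (rule power2_le_imp_le) (simp add: L2n_nonneg)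
qed

lemma L2n_minus_commute: "L2n M (\<lambda>x. f x - g x) = L2n M (\<lambda>x. g x - f x)"
  by (simp add: L2n_def power2_commute)

lemma L2n_triangle_diff:
  assumes "sq_integrable M f" "sq_integrable M g" "sq_integrable M h"
  shows "L2n M (\<lambda>x. f x - h x) \<le> L2n M (\<lambda>x. f x - g x) + L2n M (\<lambda>x. g x - h x)"
  using L2n_triangle[OF sq_integrable_diff[OF assms(1,2)] sq_integrable_diff[OF assms(2,3)]]
  by simp

lemma L2n_scale: "L2n M (\<lambda>x. c * f x) = \<bar>c\<bar> * L2n M f"
  by (simp add: L2n_def power_mult_distrib real_sqrt_mult)

lemma L2n_eq_0_imp_AE:
  assumes "sq_integrable M f" "L2n M f = 0"
  shows "AE x in M. f x = 0"
proof -
  have "(\<integral>x. (f x)\<^sup>2 \<partial>M) = 0" using assms(2) by (simp add: L2n_def)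
  then have "AE x in M. (f x)\<^sup>2 = 0"
    using sq_integrable_square[OF assms(1)] by (subst (asm) integral_nonneg_eq_0_iff_AE) auto
  then show ?thesis by simp
qed

lemma L2_tendstoD:
  assumes "L2_tendsto M X Y F"
  shows "sq_integrable M Y" "\<forall>\<^sub>F i in F. sq_integrable M (X i)"
    "((\<lambda>i. L2n M (\<lambda>x. X i x - Y x)) \<longlongrightarrow> 0) F"
proof -
  show "sq_integrable M Y" "\<forall>\<^sub>F i in F. sq_integrable M (X i)"
    using assms by (auto simp: L2_tendsto_def)
  have "((\<lambda>i. sqrt (\<integral>x. (X i x - Y x)\<^sup>2 \<partial>M)) \<longlongrightarrow> sqrt 0) F"
    using assms unfolding L2_tendsto_def by (intro tendsto_real_sqrt) auto
  then show "((\<lambda>i. L2n M (\<lambda>x. X i x - Y x)) \<longlongrightarrow> 0) F"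
    by (simp add: L2n_def)
qed

lemma L2_tendstoI:
  assumes "sq_integrable M Y" "\<forall>\<^sub>F i in F. sq_integrable M (X i)"
    "((\<lambda>i. L2n M (\<lambda>x. X i x - Y x)) \<longlongrightarrow> 0) F"
  shows "L2_tendsto M X Y F"
  using assms tendsto_power[OF assms(3), of 2] by (simp add: L2_tendsto_def L2n_square)

lemma L2_tendsto_le:
  assumes "sq_integrable M Y" "\<forall>\<^sub>F i in F. sq_integrable M (X i)"
    and "\<forall>\<^sub>F i in F. L2n M (\<lambda>x. X i x - Y x) \<le> b i" "(b \<longlongrightarrow> 0) F"
  shows "L2_tendsto M X Y F"
proof (rule L2_tendstoI[OF assms(1,2)])
  show "((\<lambda>i. L2n M (\<lambda>x. X i x - Y x)) \<longlongrightarrow> 0) F"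
    by (rule tendsto_sandwich[OF _ assms(3) tendsto_const assms(4)]) (simp add: L2n_nonneg)
qed

lemma L2_tendsto_const: "sq_integrable M Y \<Longrightarrow> L2_tendsto M (\<lambda>_. Y) Y F"
  by (simp add: L2_tendsto_def)

lemma L2_tendsto_add:
  assumes "L2_tendsto M X Y F" "L2_tendsto M X' Y' F"
  shows "L2_tendsto M (\<lambda>i x. X i x + X' i x) (\<lambda>x. Y x + Y' x) F"
proof (rule L2_tendsto_le)
  note D = L2_tendstoD[OF assms(1)] and D' = L2_tendstoD[OF assms(2)]
  show "sq_integrable M (\<lambda>x. Y x + Y' x)"
    by (rule sq_integrable_add) fact+
  show "\<forall>\<^sub>F i in F. sq_integrable M (\<lambda>x. X i x + X' i x)"
    using D(2) D'(2) by eventually_elim (rule sq_integrable_add)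
  show "\<forall>\<^sub>F i in F. L2n M (\<lambda>x. X i x + X' i x - (Y x + Y' x)) \<le>
      L2n M (\<lambda>x. X i x - Y x) + L2n M (\<lambda>x. X' i x - Y' x)"
    using D(2) D'(2)
  proof eventually_elim
    case (elim i)
    show ?case
      using L2n_triangle[OF sq_integrable_diff[OF elim(1) D(1)] sq_integrable_diff[OF elim(2) D'(1)]]
      by (simp add: algebra_simps)
  qed
  show "((\<lambda>i. L2n M (\<lambda>x. X i x - Y x) + L2n M (\<lambda>x. X' i x - Y' x)) \<longlongrightarrow> 0) F"
    using tendsto_add[OF D(3) D'(3)] by simp
qed

lemma L2_tendsto_scale:
  assumes "L2_tendsto M X Y F"
  shows "L2_tendsto M (\<lambda>i x. c * X i x) (\<lambda>x. c * Y x) F"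
proof (rule L2_tendsto_le)
  note D = L2_tendstoD[OF assms(1)]
  show "sq_integrable M (\<lambda>x. c * Y x)" by (rule sq_integrable_scale) fact
  show "\<forall>\<^sub>F i in F. sq_integrable M (\<lambda>x. c * X i x)"
    using D(2) by eventually_elim (rule sq_integrable_scale)
  show "\<forall>\<^sub>F i in F. L2n M (\<lambda>x. c * X i x - c * Y x) \<le> \<bar>c\<bar> * L2n M (\<lambda>x. X i x - Y x)"
    by (simp add: L2n_scale right_diff_distrib[symmetric])
  show "((\<lambda>i. \<bar>c\<bar> * L2n M (\<lambda>x. X i x - Y x)) \<longlongrightarrow> 0) F"
    using tendsto_mult_right_zero[OF D(3)] .
qed

lemma L2_tendsto_inner:
  assumes "L2_tendsto M X Y F" "L2_tendsto M X' Y' F"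
  shows "((\<lambda>i. \<integral>x. X i x * X' i x \<partial>M) \<longlongrightarrow> (\<integral>x. Y x * Y' x \<partial>M)) F"
proof -
  note D = L2_tendstoD[OF assms(1)] and D' = L2_tendstoD[OF assms(2)]
  let ?d = "\<lambda>i. L2n M (\<lambda>x. X i x - Y x)" and ?d' = "\<lambda>i. L2n M (\<lambda>x. X' i x - Y' x)"
  have "((\<lambda>i. (\<integral>x. X i x * X' i x \<partial>M) - (\<integral>x. Y x * Y' x \<partial>M)) \<longlongrightarrow> 0) F"
  proof (rule Lim_null_comparison)
    show "\<forall>\<^sub>F i in F. norm ((\<integral>x. X i x * X' i x \<partial>M) - (\<integral>x. Y x * Y' x \<partial>M)) \<le>
        ?d i * (?d' i + L2n M Y') + L2n M Y * ?d' i"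
      using D(2) D'(2)
    proof eventually_elim
      case (elim i)
      note s = elim D(1) D'(1)
      note sd = sq_integrable_diff[OF s(1,3)] sq_integrable_diff[OF s(2,4)]
      have "(\<integral>x. X i x * X' i x \<partial>M) - (\<integral>x. Y x * Y' x \<partial>M) =
          (\<integral>x. X i x * X' i x - Y x * Y' x \<partial>M)"
        using sq_integrable_mult[OF s(1,2)] sq_integrable_mult[OF s(3,4)] by simp
      also have "\<dots> = (\<integral>x. (X i x - Y x) * X' i x + Y x * (X' i x - Y' x) \<partial>M)"
        by (simp add: algebra_simps)
      also have "\<dots> = (\<integral>x. (X i x - Y x) * X' i x \<partial>M) + (\<integral>x. Y x * (X' i x - Y' x) \<partial>M)"
        using sq_integrable_mult[OF sd(1) s(2)] sq_integrable_mult[OF s(3) sd(2)] by simp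
      finally have "\<bar>(\<integral>x. X i x * X' i x \<partial>M) - (\<integral>x. Y x * Y' x \<partial>M)\<bar> \<le>
          ?d i * L2n M (X' i) + L2n M Y * ?d' i"
        using L2_Cauchy_Schwarz[OF sd(1) s(2)] L2_Cauchy_Schwarz[OF s(3) sd(2)] by linarith
      moreover have "L2n M (X' i) \<le> ?d' i + L2n M Y'"
        using L2n_triangle[OF sd(2) s(4)] by simp
      then have "?d i * L2n M (X' i) \<le> ?d i * (?d' i + L2n M Y')"
        by (intro mult_left_mono L2n_nonneg)
      ultimately show ?case by simp
    qed
    have "((\<lambda>i. ?d i * (?d' i + L2n M Y') + L2n M Y * ?d' i) \<longlongrightarrow>
        0 * (0 + L2n M Y') + L2n M Y * 0) F"
      by (intro tendsto_intros D D')
    then show "((\<lambda>i. ?d i * (?d' i + L2n M Y') + L2n M Y * ?d' i) \<longlongrightarrow> 0) F" by simp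
  qed
  then show ?thesis by (simp add: LIM_zero_iff)
qed

lemma L2_tendsto_inner_right:
  assumes "L2_tendsto M X Y F" "sq_integrable M Z"
  shows "((\<lambda>i. \<integral>x. X i x * Z x \<partial>M) \<longlongrightarrow> (\<integral>x. Y x * Z x \<partial>M)) F"
  by (rule L2_tendsto_inner[OF assms(1) L2_tendsto_const[OF assms(2)]])

lemma L2_tendsto_unique:
  assumes "L2_tendsto M X Y F" "L2_tendsto M X Z F" "F \<noteq> bot"
  shows "AE x in M. Y x = Z x"
proof -
  note D = L2_tendstoD[OF assms(1)] and D' = L2_tendstoD[OF assms(2)]
  have "L2_tendsto M (\<lambda>i x. X i x + - 1 * X i x) (\<lambda>x. Y x + - 1 * Z x) F"
    by (intro L2_tendsto_add L2_tendsto_scale assms)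
  then have "((\<lambda>i. L2n M (\<lambda>x. 0 - (Y x - Z x))) \<longlongrightarrow> 0) F"
    using L2_tendstoD(3) by fastforce
  then have "L2n M (\<lambda>x. Y x - Z x) = 0"
    using assms(3) by (simp add: tendsto_const_iff L2n_def power2_commute)
  from L2n_eq_0_imp_AE[OF sq_integrable_diff[OF D(1) D'(1)] this] show ?thesis by simp
qed

lemma L2_tendsto_cong_AE:
  assumes "L2_tendsto M X Y F" "AE x in M. Y x = Z x" "Z \<in> borel_measurable M"
  shows "L2_tendsto M X Z F"
proof -
  note D = L2_tendstoD[OF assms(1)]
  have Z: "sq_integrable M Z" using D(1) assms(2,3) by (rule sq_integrable_cong_AE)
  show ?thesis
  proof (rule L2_tendsto_le[OF Z D(2) _ D(3)])
    show "\<forall>\<^sub>F i in F. L2n M (\<lambda>x. X i x - Z x) \<le> L2n M (\<lambda>x. X i x - Y x)"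
      using D(2)
    proof eventually_elim
      case (elim i)
      have "(\<integral>x. (X i x - Z x)\<^sup>2 \<partial>M) = (\<integral>x. (X i x - Y x)\<^sup>2 \<partial>M)"
        using assms(2) elim Z D(1)
        by (intro integral_cong_AE) (auto dest!: sq_integrable_measurable)
      then show ?case by (simp add: L2n_def)
    qed
  qed
qed

lemma L2_tendsto_filterlim:
  assumes "L2_tendsto M X Y F" "filterlim g F G"
  shows "L2_tendsto M (\<lambda>i. X (g i)) Y G"
  using assms unfolding L2_tendsto_def
  by (auto intro: filterlim_compose[of _ _ F] eventually_compose_filterlim[of _ F])

lemma L2_tendsto_Cauchy:
  assumes "L2_tendsto M X Y sequentially" "0 < e"
  shows "\<exists>N. \<forall>m\<ge>N. \<forall>n\<ge>N. L2n M (\<lambda>x. X m x - X n x) < e"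
proof -
  note D = L2_tendstoD[OF assms(1)]
  have "\<forall>\<^sub>F i in sequentially. sq_integrable M (X i) \<and> L2n M (\<lambda>x. X i x - Y x) < e / 2"
    using D(2) order_tendstoD(2)[OF D(3), of "e / 2"] assms(2) by (simp add: eventually_conj)
  then obtain N where N: "\<And>i. i \<ge> N \<Longrightarrow> sq_integrable M (X i) \<and> L2n M (\<lambda>x. X i x - Y x) < e / 2"
    unfolding eventually_sequentially by auto
  have "L2n M (\<lambda>x. X m x - X n x) < e" if "m \<ge> N" "n \<ge> N" for m n
    using L2n_triangle_diff[of M "X m" Y "X n"] N[OF that(1)] N[OF that(2)] D(1)
      L2n_minus_commute[of M Y "X n"] by auto
  then show ?thesis by blast
qed

text \<open>
  Riesz--Fischer. Along a subsequence with increments of size \<open>2\<^sup>-\<^sup>k\<close> the weighted sum of squared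
  increments is integrable, so the subsequence converges almost everywhere; Fatou's lemma
  turns this into convergence in mean square.
\<close>

lemma L2_complete:
  assumes sq: "\<And>n. sq_integrable M (X n)"
    and cauchy: "\<And>e. 0 < e \<Longrightarrow> \<exists>N. \<forall>m\<ge>N. \<forall>n\<ge>N. L2n M (\<lambda>x. X m x - X n x) < e"
  shows "\<exists>Y. L2_tendsto M X Y sequentially"
proof -
  have [measurable]: "X n \<in> borel_measurable M" for n
    using sq by (rule sq_integrable_measurable)
  have "\<exists>N. \<forall>k. (\<forall>m\<ge>N k. \<forall>n\<ge>N k. L2n M (\<lambda>x. X m x - X n x) < (1/2)^k)"
    using cauchy by (intro choice) simp
  then obtain N where N: "\<And>k m n. m \<ge> N k \<Longrightarrow> n \<ge> N k \<Longrightarrow> L2n M (\<lambda>x. X m x - X n x) < (1/2)^k"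
    by blast
  \<comment> \<open>The sum dominates every earlier \<open>N j\<close>, the summand \<open>k\<close> makes the subsequence unbounded.\<close>
  define r where "r k = (\<Sum>j\<le>k. N j) + k" for k
  have rN: "N k \<le> r k" for k
    unfolding r_def by (rule trans_le_add1) (simp add: member_le_sum)
  have rN': "N k \<le> r j" if "k \<le> j" for k j
    unfolding r_def by (rule trans_le_add1) (use that in \<open>simp add: member_le_sum\<close>)
  have rk: "k \<le> r k" for k by (simp add: r_def)
  define D where "D k x = X (r (Suc k)) x - X (r k) x" for k x
  have [measurable]: "D k \<in> borel_measurable M" for k by (simp add: D_def[abs_def])
  have sqD: "sq_integrable M (D k)" for k
    unfolding D_def[abs_def] by (intro sq_integrable_diff sq)
  have D_small: "(\<integral>x. (D k x)\<^sup>2 \<partial>M) \<le> (1/4)^k" for k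
  proof -
    have "L2n M (D k) < (1/2)^k"
      unfolding D_def[abs_def] by (intro N rN' ) auto
    then have "(L2n M (D k))\<^sup>2 \<le> ((1/2)^k)\<^sup>2"
      by (intro power_mono L2n_nonneg) auto
    then show ?thesis
      by (simp add: L2n_square power_mult[symmetric] mult.commute[of k 2] power_divide)
        (simp add: power_mult)
  qed
  have "(\<integral>\<^sup>+x. (\<Sum>k. ennreal (2^k * (D k x)\<^sup>2)) \<partial>M) = (\<Sum>k. \<integral>\<^sup>+x. ennreal (2^k * (D k x)\<^sup>2) \<partial>M)"
    by (intro nn_integral_suminf) simp
  also have "\<dots> \<le> (\<Sum>k. ennreal ((1/2)^k))"
  proof (rule suminf_le)
    fix k
    have "(\<integral>\<^sup>+x. ennreal (2^k * (D k x)\<^sup>2) \<partial>M) = ennreal (\<integral>x. 2^k * (D k x)\<^sup>2 \<partial>M)"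
      using sq_integrable_square[OF sqD[of k]] by (intro nn_integral_eq_integral) auto
    also have "(\<integral>x. 2^k * (D k x)\<^sup>2 \<partial>M) = 2^k * (\<integral>x. (D k x)\<^sup>2 \<partial>M)"
      by simp
    also have "ennreal \<dots> \<le> ennreal (2^k * (1/4)^k)"
      using D_small[of k] by (intro ennreal_leI mult_left_mono) auto
    also have "(2::real)^k * (1/4)^k = (1/2)^k" by (simp flip: power_mult_distrib)
    finally show "(\<integral>\<^sup>+x. ennreal (2^k * (D k x)\<^sup>2) \<partial>M) \<le> ennreal ((1/2)^k)" .
  qed auto
  also have "\<dots> = ennreal (\<Sum>k. (1/2::real)^k)"
    by (intro suminf_ennreal2) (auto intro: summable_geometric)
  also have "\<dots> < \<infinity>" by simp
  finally have fin: "(\<integral>\<^sup>+x. (\<Sum>k. ennreal (2^k * (D k x)\<^sup>2)) \<partial>M) \<noteq> \<infinity>" by simp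
  have "AE x in M. (\<Sum>k. ennreal (2^k * (D k x)\<^sup>2)) \<noteq> \<infinity>"
    using fin by (intro nn_integral_PInf_AE) auto
  then have conv: "AE x in M. convergent (\<lambda>k. X (r k) x)"
  proof eventually_elim
    case (elim x)
    have "summable (\<lambda>k. 2^k * (D k x)\<^sup>2)"
      using elim by (intro summable_suminf_not_top) auto
    then have "(\<lambda>k. 2^k * (D k x)\<^sup>2) \<longlonglongrightarrow> 0" by (rule summable_LIMSEQ_zero)
    then have "Bseq (\<lambda>k. 2^k * (D k x)\<^sup>2)" by (intro convergent_imp_Bseq convergentI)
    then obtain C where C: "0 < C" "\<And>k. norm (2^k * (D k x)\<^sup>2) \<le> C"
      by (auto simp: Bseq_def)
    have b: "norm (D k x) \<le> sqrt C * (1 / sqrt 2)^k" for k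
    proof -
      have "(D k x)\<^sup>2 \<le> C * (1/2)^k"
        using C(2)[of k] by (simp add: abs_mult field_simps)
      then have "sqrt ((D k x)\<^sup>2) \<le> sqrt (C * (1/2)^k)" by (rule real_sqrt_le_mono)
      then show ?thesis
        unfolding real_sqrt_abs by (simp add: real_sqrt_mult real_sqrt_power real_sqrt_divide)
    qed
    have "summable (\<lambda>k. D k x)"
    proof (rule summable_comparison_test'[where N=0])
      show "summable (\<lambda>k. sqrt C * (1 / sqrt 2)^k)"
        by (intro summable_mult summable_geometric) simp
    qed (rule b)
    then have "convergent (\<lambda>n. \<Sum>k<n. D k x)" by (simp add: summable_iff_convergent)
    moreover have "(\<Sum>k<n. D k x) = X (r n) x - X (r 0) x" for n
      unfolding D_def by (rule sum_lessThan_telescope)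
    ultimately have "convergent (\<lambda>n. X (r n) x - X (r 0) x + X (r 0) x)"
      by (intro convergent_add convergent_const) simp
    then show ?case by simp
  qed
  define Y where "Y x = lim (\<lambda>k. X (r k) x)" for x
  have [measurable]: "Y \<in> borel_measurable M"
    unfolding Y_def[abs_def] by measurable
  have lim: "AE x in M. (\<lambda>k. X (r k) x) \<longlonglongrightarrow> Y x"
    using conv by eventually_elim (simp add: Y_def convergent_LIMSEQ_iff)
  have fatou: "(\<integral>\<^sup>+x. ennreal ((X n x - Y x)\<^sup>2) \<partial>M) \<le> ennreal (((1/2)^k)\<^sup>2)"
    if "n \<ge> N k" for n k
  proof -
    have "(\<integral>\<^sup>+x. ennreal ((X n x - Y x)\<^sup>2) \<partial>M) =
        (\<integral>\<^sup>+x. liminf (\<lambda>j. ennreal ((X n x - X (r j) x)\<^sup>2)) \<partial>M)"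
    proof (rule nn_integral_cong_AE)
      show "AE x in M. ennreal ((X n x - Y x)\<^sup>2) = liminf (\<lambda>j. ennreal ((X n x - X (r j) x)\<^sup>2))"
        using lim
      proof eventually_elim
        case (elim x)
        have "(\<lambda>j. ennreal ((X n x - X (r j) x)\<^sup>2)) \<longlonglongrightarrow> ennreal ((X n x - Y x)\<^sup>2)"
          by (intro tendsto_ennrealI tendsto_intros elim)
        from lim_imp_Liminf[OF sequentially_bot this] show ?case by simp
      qed
    qed
    also have "\<dots> \<le> liminf (\<lambda>j. \<integral>\<^sup>+x. ennreal ((X n x - X (r j) x)\<^sup>2) \<partial>M)"
      by (intro nn_integral_liminf) simp
    also have "\<dots> \<le> liminf (\<lambda>j::nat. ennreal (((1/2)^k)\<^sup>2))"
    proof (rule Liminf_mono)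
      show "\<forall>\<^sub>F j in sequentially. (\<integral>\<^sup>+x. ennreal ((X n x - X (r j) x)\<^sup>2) \<partial>M) \<le> ennreal (((1/2)^k)\<^sup>2)"
        using eventually_ge_at_top[of k]
      proof eventually_elim
        case (elim j)
        have "L2n M (\<lambda>x. X n x - X (r j) x) < (1/2)^k"
          using elim that by (intro N rN')
        then have "(L2n M (\<lambda>x. X n x - X (r j) x))\<^sup>2 \<le> ((1/2)^k)\<^sup>2"
          by (intro power_mono L2n_nonneg) auto
        then have "ennreal (\<integral>x. (X n x - X (r j) x)\<^sup>2 \<partial>M) \<le> ennreal (((1/2)^k)\<^sup>2)"
          by (intro ennreal_leI) (simp add: L2n_square)
        then show ?case
          using sq_integrable_square[OF sq_integrable_diff[OF sq sq]]
          by (subst nn_integral_eq_integral) auto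
      qed
    qed
    also have "\<dots> = ennreal (((1/2)^k)\<^sup>2)" by (simp add: Liminf_const)
    finally show ?thesis .
  qed
  have diff: "sq_integrable M (\<lambda>x. X (N 0) x - Y x)"
    using fatou[of 0 "N 0"] unfolding sq_integrable_def
    by (intro conjI integrableI_bounded) (auto simp: less_top top_unique intro: le_less_trans)
  have Y: "sq_integrable M Y"
    using sq_integrable_diff[OF sq[of "N 0"] diff] by simp
  have "(\<lambda>n. L2n M (\<lambda>x. X n x - Y x)) \<longlonglongrightarrow> 0"
  proof (rule LIMSEQ_I)
    fix e :: real assume "0 < e"
    then obtain k where k: "(1/2)^k < e"
      using real_arch_pow_inv[of e "1/2"] by auto
    have "norm (L2n M (\<lambda>x. X n x - Y x) - 0) < e" if "n \<ge> N k" for n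
    proof -
      have "ennreal ((L2n M (\<lambda>x. X n x - Y x))\<^sup>2) \<le> ennreal (((1/2)^k)\<^sup>2)"
        unfolding L2n_square
        using fatou[OF that] sq_integrable_square[OF sq_integrable_diff[OF sq[of n] Y]]
        by (subst nn_integral_eq_integral[symmetric]) auto
      then have "L2n M (\<lambda>x. X n x - Y x) \<le> (1/2)^k"
        by (subst (asm) ennreal_le_iff) (auto intro: power2_le_imp_le)
      then show ?thesis using k by (simp add: L2n_nonneg)
    qed
    then show "\<exists>no. \<forall>n\<ge>no. norm (L2n M (\<lambda>x. X n x - Y x) - 0) < e" by blast
  qed
  then have "L2_tendsto M X Y sequentially"
    using Y sq by (intro L2_tendstoI) auto
  then show ?thesis by blast
qed

definition L2_subspace :: "'a measure \<Rightarrow> ('a \<Rightarrow> real) set \<Rightarrow> bool" where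
  "L2_subspace M V \<longleftrightarrow> (\<lambda>_. 0) \<in> V \<and> (\<forall>f\<in>V. sq_integrable M f) \<and>
     (\<forall>f\<in>V. \<forall>g\<in>V. \<forall>c. (\<lambda>x. f x + c * g x) \<in> V)"

text \<open>
  The nearest point to \<open>f\<close> in the closure of \<open>V\<close>: a minimizing sequence is Cauchy by the
  parallelogram law, and minimality forces orthogonality.
\<close>

lemma L2_projection:
  assumes V: "L2_subspace M V" and f: "sq_integrable M f"
  shows "\<exists>v g. (\<forall>k::nat. v k \<in> V) \<and> L2_tendsto M v g sequentially \<and>
    (\<forall>h\<in>V. (\<integral>x. (f x - g x) * h x \<partial>M) = 0)"
proof -
  have sqV: "h \<in> V \<Longrightarrow> sq_integrable M h" for h using V by (auto simp: L2_subspace_def)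
  have Vadd: "h \<in> V \<Longrightarrow> g \<in> V \<Longrightarrow> (\<lambda>x. h x + c * g x) \<in> V" for h g c
    using V by (auto simp: L2_subspace_def)
  have V0: "(\<lambda>_. 0) \<in> V" using V by (auto simp: L2_subspace_def)
  define d where "d = Inf ((\<lambda>h. \<integral>x. (f x - h x)\<^sup>2 \<partial>M) ` V)"
  have bdd: "bdd_below ((\<lambda>h. \<integral>x. (f x - h x)\<^sup>2 \<partial>M) ` V)"
    by (intro bdd_belowI2[where m=0]) auto
  have d_le: "d \<le> (\<integral>x. (f x - h x)\<^sup>2 \<partial>M)" if "h \<in> V" for h
    unfolding d_def by (rule cINF_lower[OF bdd that])
  have "\<exists>h\<in>V. (\<integral>x. (f x - h x)\<^sup>2 \<partial>M) < d + 1 / real (Suc k)" for k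
    using V0 cINF_less_iff[of V "\<lambda>h. \<integral>x. (f x - h x)\<^sup>2 \<partial>M" "d + 1 / real (Suc k)"] bdd
    unfolding d_def by fastforce
  then obtain v where v: "\<And>k. v k \<in> V" "\<And>k. (\<integral>x. (f x - v k x)\<^sup>2 \<partial>M) < d + 1 / real (Suc k)"
    by metis
  have cauchy_bound: "(L2n M (\<lambda>x. v m x - v n x))\<^sup>2 \<le> 2 / real (Suc m) + 2 / real (Suc n)" for m n
  proof -
    have s: "sq_integrable M (\<lambda>x. f x - v m x)" "sq_integrable M (\<lambda>x. f x - v n x)"
      by (intro sq_integrable_diff f sqV v)+
    note i = s[THEN sq_integrable_square] sq_integrable_mult[OF s]
    have "(\<lambda>x. (1/2) * v m x + (1/2) * v n x) \<in> V"
      using Vadd[OF Vadd[OF V0 v(1)[of m], of "1/2"] v(1)[of n], of "1/2"] by simp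
    then have "d \<le> (\<integral>x. (f x - ((1/2) * v m x + (1/2) * v n x))\<^sup>2 \<partial>M)"
      by (rule d_le)
    also have "\<dots> = (\<integral>x. (1/4) * (f x - v m x)\<^sup>2 + (1/4) * (f x - v n x)\<^sup>2 +
        (1/2) * ((f x - v m x) * (f x - v n x)) \<partial>M)"
      by (intro Bochner_Integration.integral_cong refl) (simp add: power2_eq_square field_simps)
    also have "\<dots> = (1/4) * (\<integral>x. (f x - v m x)\<^sup>2 \<partial>M) + (1/4) * (\<integral>x. (f x - v n x)\<^sup>2 \<partial>M) +
        (1/2) * (\<integral>x. (f x - v m x) * (f x - v n x) \<partial>M)"
      using i by simp
    finally have 1: "4 * d \<le> (\<integral>x. (f x - v m x)\<^sup>2 \<partial>M) + (\<integral>x. (f x - v n x)\<^sup>2 \<partial>M) +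
        2 * (\<integral>x. (f x - v m x) * (f x - v n x) \<partial>M)" by simp
    have "(\<integral>x. (v m x - v n x)\<^sup>2 \<partial>M) = (\<integral>x. (f x - v m x)\<^sup>2 + (f x - v n x)\<^sup>2 -
        2 * ((f x - v m x) * (f x - v n x)) \<partial>M)"
      by (intro Bochner_Integration.integral_cong refl) (simp add: power2_eq_square algebra_simps)
    also have "\<dots> = (\<integral>x. (f x - v m x)\<^sup>2 \<partial>M) + (\<integral>x. (f x - v n x)\<^sup>2 \<partial>M) -
        2 * (\<integral>x. (f x - v m x) * (f x - v n x) \<partial>M)"
      using i by simp
    finally have "(\<integral>x. (v m x - v n x)\<^sup>2 \<partial>M) \<le>
        2 * (\<integral>x. (f x - v m x)\<^sup>2 \<partial>M) + 2 * (\<integral>x. (f x - v n x)\<^sup>2 \<partial>M) - 4 * d"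
      using 1 by linarith
    also have "\<dots> \<le> 2 / real (Suc m) + 2 / real (Suc n)"
      using v(2)[of m] v(2)[of n] by simp
    finally show ?thesis by (simp add: L2n_square)
  qed
  have "\<exists>g. L2_tendsto M v g sequentially"
  proof (rule L2_complete)
    show "sq_integrable M (v n)" for n by (intro sqV v)
    fix e :: real assume e: "0 < e"
    obtain N where N: "4 / e\<^sup>2 < real N"
      using reals_Archimedean2 by blast
    have "L2n M (\<lambda>x. v m x - v n x) < e" if "m \<ge> N" "n \<ge> N" for m n
    proof -
      have "0 < 4 / e\<^sup>2" using e by simp
      then have N0: "0 < real N" using N by linarith
      have "2 / real (Suc m) < 2 / real N" "2 / real (Suc n) < 2 / real N"
        using that N0 by (intro divide_strict_left_mono; simp)+
      then have "(L2n M (\<lambda>x. v m x - v n x))\<^sup>2 < 4 / real N"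
        using cauchy_bound[of m n] by simp
      also have "\<dots> < e\<^sup>2" using N N0 e by (simp add: field_simps)
      finally show ?thesis using e by (rule_tac power2_less_imp_less) auto
    qed
    then show "\<exists>N. \<forall>m\<ge>N. \<forall>n\<ge>N. L2n M (\<lambda>x. v m x - v n x) < e" by blast
  qed
  then obtain g where g: "L2_tendsto M v g sequentially" by blast
  have sg: "sq_integrable M g" using g by (rule L2_tendstoD)
  have fg: "L2_tendsto M (\<lambda>k x. f x + - 1 * v k x) (\<lambda>x. f x + - 1 * g x) sequentially"
    by (intro L2_tendsto_add L2_tendsto_scale g L2_tendsto_const f)
  have dlim: "(\<integral>x. (f x - g x)\<^sup>2 \<partial>M) \<le> d"
  proof (rule LIMSEQ_le)
    show "(\<lambda>k. \<integral>x. (f x - v k x)\<^sup>2 \<partial>M) \<longlonglongrightarrow> (\<integral>x. (f x - g x)\<^sup>2 \<partial>M)"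
      using L2_tendsto_inner[OF fg fg] by (simp add: power2_eq_square)
    show "(\<lambda>k. d + 1 / real (Suc k)) \<longlonglongrightarrow> d"
      using tendsto_add[OF tendsto_const LIMSEQ_Suc[OF lim_1_over_n]] by fastforce
    show "\<exists>N. \<forall>n\<ge>N. (\<integral>x. (f x - v n x)\<^sup>2 \<partial>M) \<le> d + 1 / real (Suc n)"
      using v(2) less_imp_le by blast
  qed
  have "(\<integral>x. (f x - g x) * h x \<partial>M) = 0" if h: "h \<in> V" for h
  proof -
    have low: "d \<le> (\<integral>x. ((f x - g x) - t * h x)\<^sup>2 \<partial>M)" for t
    proof (rule LIMSEQ_le_const)
      have "L2_tendsto M (\<lambda>k x. (f x + - 1 * v k x) + - t * h x) (\<lambda>x. (f x + - 1 * g x) + - t * h x) sequentially"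
        by (intro L2_tendsto_add fg L2_tendsto_const sq_integrable_scale sqV h)
      from L2_tendsto_inner[OF this this]
      show "(\<lambda>k. \<integral>x. ((f x - v k x) - t * h x)\<^sup>2 \<partial>M) \<longlonglongrightarrow> (\<integral>x. ((f x - g x) - t * h x)\<^sup>2 \<partial>M)"
        by (simp add: power2_eq_square)
      have "d \<le> (\<integral>x. (f x - v k x - t * h x)\<^sup>2 \<partial>M)" for k
        using d_le[OF Vadd[OF v(1)[of k] h, of t]] by (simp add: algebra_simps)
      then show "\<exists>N. \<forall>n\<ge>N. d \<le> (\<integral>x. (f x - v n x - t * h x)\<^sup>2 \<partial>M)" by blast
    qed
    have "(\<integral>x. (f x - g x) * h x \<partial>M)\<^sup>2 \<le> 0 * (\<integral>x. (h x)\<^sup>2 \<partial>M)"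
    proof (rule quadratic_nonneg_imp_discriminant)
      fix t
      show "0 \<le> 0 - 2 * t * (\<integral>x. (f x - g x) * h x \<partial>M) + t\<^sup>2 * (\<integral>x. (h x)\<^sup>2 \<partial>M)"
        using low[of t] dlim integral_square_diff_scale[OF sq_integrable_diff[OF f sg] sqV[OF h], of t]
        by linarith
    qed auto
    then show ?thesis by simp
  qed
  then show ?thesis using v(1) g by blast
qed

text \<open>
  The difference of \<open>f\<close> and its projection to the closure of \<open>V\<close> is orthogonal to \<open>V\<close>, hence to
  \<open>f\<close> by hypothesis and to the projection as a limit; so it is orthogonal to itself.
\<close>

lemma L2_limit_of_subspace:
  assumes V: "L2_subspace M V" and f: "sq_integrable M f"
    and orth: "\<And>Y. sq_integrable M Y \<Longrightarrow> (\<And>h. h \<in> V \<Longrightarrow> (\<integral>x. Y x * h x \<partial>M) = 0) \<Longrightarrow>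
      (\<integral>x. f x * Y x \<partial>M) = 0"
  shows "\<exists>v. (\<forall>k::nat. v k \<in> V) \<and> L2_tendsto M v f sequentially"
proof -
  from L2_projection[OF V f] obtain v g where v: "\<And>k. v k \<in> V" "L2_tendsto M v g sequentially"
    and o: "\<And>h. h \<in> V \<Longrightarrow> (\<integral>x. (f x - g x) * h x \<partial>M) = 0" by blast
  have g: "sq_integrable M g" using v(2) by (rule L2_tendstoD)
  note fg = sq_integrable_diff[OF f g]
  have "(\<integral>x. f x * (f x - g x) \<partial>M) = 0" by (rule orth[OF fg o])
  moreover have "(\<integral>x. g x * (f x - g x) \<partial>M) = 0"
  proof (rule LIMSEQ_unique)
    show "(\<lambda>k. \<integral>x. v k x * (f x - g x) \<partial>M) \<longlonglongrightarrow> (\<integral>x. g x * (f x - g x) \<partial>M)"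
      by (rule L2_tendsto_inner_right[OF v(2) fg])
    show "(\<lambda>k. \<integral>x. v k x * (f x - g x) \<partial>M) \<longlonglongrightarrow> 0"
      using o[OF v(1)] by (simp add: mult.commute)
  qed
  moreover have "(\<integral>x. f x * (f x - g x) \<partial>M) - (\<integral>x. g x * (f x - g x) \<partial>M) = (\<integral>x. (f x - g x)\<^sup>2 \<partial>M)"
    using sq_integrable_mult[OF f fg] sq_integrable_mult[OF g fg]
    by (subst Bochner_Integration.integral_diff[symmetric])
      (auto simp: power2_eq_square algebra_simps)
  ultimately have "L2n M (\<lambda>x. f x - g x) = 0" by (simp add: L2n_def)
  from L2n_eq_0_imp_AE[OF fg this] have "AE x in M. g x = f x" by auto
  then have "L2_tendsto M v f sequentially"
    by (rule L2_tendsto_cong_AE[OF v(2)]) (rule sq_integrable_measurable[OF f])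
  then show ?thesis using v by blast
qed

section \<open>The Hilbert space of square integrable functions on the unit interval\<close>

lemma rep_l2_01_sq_integrable: "sq_integrable leb01 (rep_l2_01 h)"
  using Quotient_rep_reflp[OF Quotient_l2_01, of h] by simp

lemma rep_l2_01_measurable [measurable]: "rep_l2_01 h \<in> borel_measurable leb01"
  by (rule sq_integrable_measurable[OF rep_l2_01_sq_integrable])

lemma abs_rep_l2_01: "abs_l2_01 (rep_l2_01 h) = h"
  by (rule Quotient_abs_rep[OF Quotient_l2_01])

lemma rep_abs_l2_01_AE:
  assumes "sq_integrable leb01 f"
  shows "AE x in leb01. rep_l2_01 (abs_l2_01 f) x = f x"
  using Quotient_rep_abs[OF Quotient_l2_01, of f] assms by simp

lemma inner_l2_01_eq: "inner h g = (\<integral>x. rep_l2_01 h x * rep_l2_01 g x \<partial>leb01)"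
  by (simp add: inner_l2_01_def)

lemma norm_l2_01_eq: "norm h = L2n leb01 (rep_l2_01 h)"
  by (simp add: norm_l2_01_def inner_l2_01_eq L2n_def power2_eq_square)

lemma inner_abs_l2_01:
  assumes "sq_integrable leb01 f"
  shows "inner (abs_l2_01 f) h = (\<integral>x. f x * rep_l2_01 h x \<partial>leb01)"
  unfolding inner_l2_01_eq
proof (rule integral_cong_AE)
  note [measurable] = sq_integrable_measurable[OF assms]
  show "(\<lambda>x. rep_l2_01 (abs_l2_01 f) x * rep_l2_01 h x) \<in> borel_measurable leb01"
    "(\<lambda>x. f x * rep_l2_01 h x) \<in> borel_measurable leb01" by measurable
  show "AE x in leb01. rep_l2_01 (abs_l2_01 f) x * rep_l2_01 h x = f x * rep_l2_01 h x"
    using rep_abs_l2_01_AE[OF assms] by eventually_elim simp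
qed

lemma abs_l2_01_add_scale:
  assumes "sq_integrable leb01 f" "sq_integrable leb01 g"
  shows "abs_l2_01 (\<lambda>x. f x + c * g x) = abs_l2_01 f + c *\<^sub>R abs_l2_01 g"
proof -
  have "c *\<^sub>R abs_l2_01 g = abs_l2_01 (\<lambda>x. c * g x)"
    using scaleR_l2_01.abs_eq[of g c] assms by simp
  then show ?thesis
    using plus_l2_01.abs_eq[of f "\<lambda>x. c * g x"] assms sq_integrable_scale[OF assms(2), of c] by simp
qed

lemma rep_l2_01_add_scale_AE:
  "AE x in leb01. rep_l2_01 (h + c *\<^sub>R g) x = rep_l2_01 h x + c * rep_l2_01 g x"
proof -
  have "h + c *\<^sub>R g = abs_l2_01 (\<lambda>x. rep_l2_01 h x + c * rep_l2_01 g x)"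
    using abs_l2_01_add_scale[OF rep_l2_01_sq_integrable[of h] rep_l2_01_sq_integrable[of g], of c]
    by (simp add: abs_rep_l2_01)
  then show ?thesis
    using rep_abs_l2_01_AE[OF sq_integrable_add[OF rep_l2_01_sq_integrable[of h]
          sq_integrable_scale[OF rep_l2_01_sq_integrable[of g], of c]]] by simp
qed

lemma leb01_prob: "prob_space leb01"
  by (rule prob_spaceI) (simp add: emeasure_restrict_space space_restrict_space)

lemma space_leb01 [simp]: "space leb01 = {0..1}"
  by (simp add: space_restrict_space)

lemma leb01_measurableI [measurable (raw)]: "f \<in> borel_measurable borel \<Longrightarrow> f \<in> borel_measurable leb01"
  for f :: "real \<Rightarrow> 'b::topological_space"
  by (intro measurable_restrict_space1) simp

lemma sq_integrable_indicator01: "sq_integrable leb01 (indicator {a..b})"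
proof -
  interpret prob_space leb01 by (rule leb01_prob)
  show ?thesis
    by (rule sq_integrable_bounded[where B=1]) (auto split: split_indicator)
qed

lemma ind01_eq: "ind01 t = abs_l2_01 (indicator {0..t})"
  by (simp add: ind01_def)

lemma inner_ind01: "inner (ind01 t) h = (\<integral>x. indicator {0..t} x * rep_l2_01 h x \<partial>leb01)"
  unfolding ind01_eq by (rule inner_abs_l2_01[OF sq_integrable_indicator01])

text \<open>
  The length of the part of \<open>{0..t}\<close> inside the unit interval; it makes the formulas for \<open>ind01 t\<close>
  valid for every real \<open>t\<close>, in particular its continuity on the whole line.
\<close>

definition clamp01 :: "real \<Rightarrow> real" where "clamp01 t = max 0 (min 1 t)"

lemma clamp01_id [simp]: "t \<in> {0..1} \<Longrightarrow> clamp01 t = t"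
  by (auto simp: clamp01_def)

lemma clamp01_mono: "s \<le> t \<Longrightarrow> clamp01 s \<le> clamp01 t"
  unfolding clamp01_def by (intro max.mono min.mono order_refl)

lemma integral_leb01_indicator: "(\<integral>x. indicator {0..t} x \<partial>leb01) = clamp01 t" for t :: real
proof -
  have "(\<integral>x. indicator {0..t} x \<partial>leb01) = (\<integral>x. indicator {0..1} x *\<^sub>R (indicator {0..t} x :: real) \<partial>lborel)"
    by (rule integral_restrict_space) simp
  also have "\<dots> = (\<integral>x. indicator {0..min 1 t} x \<partial>lborel)"
    by (intro Bochner_Integration.integral_cong) (auto split: split_indicator)
  also have "\<dots> = clamp01 t" by (auto simp: clamp01_def)
  finally show ?thesis .
qed

lemma inner_ind01_ind01: "inner (ind01 s) (ind01 t) = clamp01 (min s t)"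
proof -
  have "inner (ind01 s) (ind01 t) = (\<integral>x. indicator {0..t} x * indicator {0..s} x \<partial>leb01)"
    unfolding inner_ind01
  proof (rule integral_cong_AE)
    show "AE x in leb01. indicator {0..s} x * rep_l2_01 (ind01 t) x = indicator {0..t} x * (indicator {0..s} x :: real)"
      using rep_abs_l2_01_AE[OF sq_integrable_indicator01[of 0 t]] unfolding ind01_eq
      by eventually_elim simp
  qed measurable
  also have "\<dots> = (\<integral>x. indicator {0..min s t} x \<partial>leb01)"
    by (intro Bochner_Integration.integral_cong) (auto split: split_indicator)
  finally show ?thesis unfolding integral_leb01_indicator .
qed

lemma norm_ind01: "t \<in> {0..1} \<Longrightarrow> norm (ind01 t) = sqrt t"
  by (simp add: norm_eq_sqrt_inner inner_ind01_ind01)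

lemma norm_ind01_diff: "(norm (ind01 s - ind01 t))\<^sup>2 = \<bar>clamp01 s - clamp01 t\<bar>"
proof (cases "s \<le> t")
  case True
  then show ?thesis
    using clamp01_mono[of s t] unfolding power2_norm_eq_inner inner_diff_left inner_diff_right inner_ind01_ind01
    by (simp add: min_absorb1 min_absorb2)
next
  case False
  then show ?thesis
    using clamp01_mono[of t s] unfolding power2_norm_eq_inner inner_diff_left inner_diff_right inner_ind01_ind01
    by (simp add: min_absorb1 min_absorb2)
qed

lemma norm_two_ind01:
  assumes "0 \<le> s" "s \<le> t" "t \<le> 1"
  shows "(norm (a *\<^sub>R ind01 s + b *\<^sub>R ind01 t))\<^sup>2 = (a + b)\<^sup>2 * s + b\<^sup>2 * (t - s)"
  using assms unfolding power2_norm_eq_inner inner_add_left inner_add_right inner_scaleR_left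
    inner_scaleR_right inner_ind01_ind01
  by (simp add: min_absorb1 min_absorb2 power2_eq_square algebra_simps)

lemma isCont_ind01: "isCont ind01 t"
proof -
  have "(\<lambda>s. norm (ind01 s - ind01 t)) \<midarrow>t\<rightarrow> sqrt \<bar>clamp01 t - clamp01 t\<bar>"
  proof -
    have "norm (ind01 s - ind01 t) = sqrt \<bar>clamp01 s - clamp01 t\<bar>" for s
      using norm_ind01_diff[of s t] by (metis norm_ge_zero real_sqrt_unique)
    moreover have "(\<lambda>s. sqrt \<bar>clamp01 s - clamp01 t\<bar>) \<midarrow>t\<rightarrow> sqrt \<bar>clamp01 t - clamp01 t\<bar>"
      unfolding clamp01_def by (intro tendsto_intros)
    ultimately show ?thesis by simp
  qed
  then show ?thesis
    unfolding isCont_def by (subst tendsto_dist_iff) (simp add: dist_norm)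
qed

text \<open>
  Riesz representation: a vector orthogonal to the kernel of \<open>\<phi>\<close> on which \<open>\<phi>\<close> does not vanish
  represents \<open>\<phi>\<close> up to a scalar.
\<close>

lemma riesz_l2_01:
  assumes "bounded_linear \<phi>"
  shows "\<exists>y. \<forall>h::l2_01. \<phi> h = inner h y"
proof (cases "\<forall>h. \<phi> h = (0::real)")
  case True
  then show ?thesis by (intro exI[of _ 0]) simp
next
  case False
  interpret \<phi>: bounded_linear \<phi> by fact
  obtain h0 where h0: "\<phi> h0 \<noteq> 0" using False by blast
  define V where "V = {f. sq_integrable leb01 f \<and> \<phi> (abs_l2_01 f) = 0}"
  have V: "L2_subspace leb01 V"
    unfolding L2_subspace_def V_def
  proof (safe)
    show "sq_integrable leb01 (\<lambda>_. 0)" by (rule sq_integrable_zero)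
    show "\<phi> (abs_l2_01 (\<lambda>_. 0)) = 0" using zero_l2_01.abs_eq \<phi>.zero by simp
    fix f g c assume *: "sq_integrable leb01 f" "sq_integrable leb01 g"
      "\<phi> (abs_l2_01 f) = 0" "\<phi> (abs_l2_01 g) = 0"
    show "sq_integrable leb01 (\<lambda>x. f x + c * g x)" using * by (intro sq_integrable_add sq_integrable_scale)
    show "\<phi> (abs_l2_01 (\<lambda>x. f x + c * g x)) = 0"
      using * by (simp add: abs_l2_01_add_scale \<phi>.add \<phi>.scale)
  qed
  from L2_projection[OF V rep_l2_01_sq_integrable[of h0]] obtain v g where
    v: "\<And>k::nat. v k \<in> V" "L2_tendsto leb01 v g sequentially"
    and o: "\<And>h. h \<in> V \<Longrightarrow> (\<integral>x. (rep_l2_01 h0 x - g x) * h x \<partial>leb01) = 0" by blast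
  have g: "sq_integrable leb01 g" using v(2) by (rule L2_tendstoD)
  have sv: "sq_integrable leb01 (v k)" for k using v(1) by (simp add: V_def)
  have "(\<lambda>k. abs_l2_01 (v k)) \<longlonglongrightarrow> abs_l2_01 g"
  proof (rule iffD2[OF tendsto_dist_iff], rule Lim_transform_eventually[OF L2_tendstoD(3)[OF v(2)]], rule always_eventually, rule allI)
    fix k
    have "abs_l2_01 (v k) - abs_l2_01 g = abs_l2_01 (\<lambda>x. v k x - g x)"
      using abs_l2_01_add_scale[OF sv g, of k "-1"] by simp
    then have "dist (abs_l2_01 (v k)) (abs_l2_01 g) = L2n leb01 (rep_l2_01 (abs_l2_01 (\<lambda>x. v k x - g x)))"
      by (simp add: dist_norm norm_l2_01_eq)
    also have "\<dots> = L2n leb01 (\<lambda>x. v k x - g x)"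
      unfolding L2n_def using rep_abs_l2_01_AE[OF sq_integrable_diff[OF sv g], of k]
        sq_integrable_measurable[OF sv[of k]] sq_integrable_measurable[OF g]
      by (intro arg_cong[where f=sqrt] integral_cong_AE) auto
    finally show "L2n leb01 (\<lambda>x. v k x - g x) = dist (abs_l2_01 (v k)) (abs_l2_01 g)" by simp
  qed
  then have "(\<lambda>k. \<phi> (abs_l2_01 (v k))) \<longlonglongrightarrow> \<phi> (abs_l2_01 g)"
    by (rule \<phi>.tendsto)
  then have \<phi>g: "\<phi> (abs_l2_01 g) = 0"
    using v(1) by (simp add: V_def tendsto_const_iff)
  define y where "y = h0 - abs_l2_01 g"
  have \<phi>y: "\<phi> y = \<phi> h0" by (simp add: y_def \<phi>.diff \<phi>g)
  have y_orth: "inner y h = 0" if "\<phi> h = 0" for h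
  proof -
    have "y = abs_l2_01 (\<lambda>x. rep_l2_01 h0 x - g x)"
      using abs_l2_01_add_scale[OF rep_l2_01_sq_integrable[of h0] g, of "-1"]
      by (simp add: y_def abs_rep_l2_01)
    then have "inner y h = (\<integral>x. (rep_l2_01 h0 x - g x) * rep_l2_01 h x \<partial>leb01)"
      using inner_abs_l2_01[OF sq_integrable_diff[OF rep_l2_01_sq_integrable[of h0] g]] by simp
    also have "\<dots> = 0"
      using that by (intro o) (simp add: V_def rep_l2_01_sq_integrable abs_rep_l2_01)
    finally show ?thesis .
  qed
  have "y \<noteq> 0" using \<phi>y h0 \<phi>.zero by auto
  then have yy: "inner y y \<noteq> 0" by simp
  have "\<phi> h = inner h ((\<phi> y / inner y y) *\<^sub>R y)" for h
  proof -
    have "inner y (h - (\<phi> h / \<phi> y) *\<^sub>R y) = 0"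
      using h0 \<phi>y by (intro y_orth) (simp add: \<phi>.diff \<phi>.scale)
    then have "inner h y = (\<phi> h / \<phi> y) * inner y y"
      by (simp add: inner_diff_right inner_commute)
    then show ?thesis using yy h0 \<phi>y by (simp add: field_simps)
  qed
  then show ?thesis by blast
qed

lemma adjoint_l2_01:
  assumes "bounded_linear (A :: l2_01 \<Rightarrow> l2_01)"
  shows "inner (A x) y = inner x (adjoint A y)"
proof -
  have "\<forall>y. \<exists>z. \<forall>x. inner (A x) y = inner x z"
    by (rule allI)
       (rule riesz_l2_01[OF bounded_linear_compose[OF bounded_linear_inner_left assms]])
  from choice[OF this] obtain f' where "\<forall>y x. inner (A x) y = inner x (f' y)" by blast
  then have "adjoint A = f'" by (intro adjoint_unique) simp
  then show ?thesis using \<open>\<forall>y x. inner (A x) y = inner x (f' y)\<close> by simp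
qed

text \<open>
  For an invertible operator this bounds the norms of images, and thus the variances of the white
  noises in their directions, from below.
\<close>

lemma invertible_bounded_below:
  fixes A :: "'a::real_normed_vector \<Rightarrow> 'b::real_normed_vector"
  assumes "bounded_linear B" "B \<circ> A = id"
  shows "\<exists>c>0. \<forall>h. c * norm h \<le> norm (A h)"
proof -
  obtain K where K: "0 < K" "\<And>x. norm (B x) \<le> norm x * K"
    using bounded_linear.pos_bounded[OF assms(1)] by blast
  have "1 / K * norm h \<le> norm (A h)" for h
  proof -
    have "norm h = norm (B (A h))" using fun_cong[OF assms(2), of h] by simp
    also have "\<dots> \<le> norm (A h) * K" by (rule K)
    finally show ?thesis using K(1) by (simp add: field_simps)
  qed
  then show ?thesis using K(1) by (intro exI[of _ "1 / K"]) auto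
qed

section \<open>The cube, its chambers, and symmetric functions\<close>

lemma cube_prob: "prob_space (cube n)"
  unfolding cube_def by (intro prob_space_PiM leb01_prob)

lemma leb01_product: "product_sigma_finite (\<lambda>_::nat. leb01)"
proof -
  interpret prob_space leb01 by (rule leb01_prob)
  show ?thesis ..
qed

lemma space_cube: "space (cube n) = (\<Pi>\<^sub>E i\<in>{..<n}. {0..1})"
  by (simp add: cube_def space_PiM)

lemma cube_component: "i < n \<Longrightarrow> (\<lambda>t. t i) \<in> measurable (cube n) leb01"
  unfolding cube_def by (rule measurable_component_singleton) simp

lemma cube_component_borel [measurable]: "(\<lambda>t. t i) \<in> borel_measurable (cube n)"
proof (cases "i < n")
  case True
  have "(\<lambda>x. x) \<in> measurable leb01 borel" by measurable
  from measurable_compose[OF cube_component[OF True] this] show ?thesis .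
next
  case False
  have "(\<lambda>t. t i) \<in> borel_measurable (cube n) \<longleftrightarrow> (\<lambda>t. undefined :: real) \<in> borel_measurable (cube n)"
    using False by (intro measurable_cong) (auto simp: space_cube PiE_def extensional_def)
  then show ?thesis by simp
qed

text \<open>
  The open part of the simplex, with strictly increasing positive coordinates. It differs from the
  simplex by a null set, and its images under permutations of the coordinates are disjoint.
\<close>

definition chamber :: "nat \<Rightarrow> (nat \<Rightarrow> real) set" where
  "chamber n = {t \<in> space (cube n). (\<forall>i<n. 0 < t i) \<and> (\<forall>j<n. \<forall>i<j. t i < t j)}"

lemma chamber_sets [measurable]: "chamber n \<in> sets (cube n)"
proof -
  have "{t \<in> space (cube n). (\<forall>i<n. 0 < t i) \<and> (\<forall>j<n. \<forall>i<j. t i < t j)} =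
      {t \<in> space (cube n). (\<forall>i\<in>{..<n}. 0 < t i) \<and> (\<forall>j\<in>{..<n}. \<forall>i\<in>{..<j}. t i < t j)}" by auto
  also have "\<dots> \<in> sets (cube n)" by measurable
  finally show ?thesis by (simp add: chamber_def)
qed

lemma simplex_sets: "{t. mono_on {..<n} t} \<inter> space (cube n) \<in> sets (cube n)"
proof -
  have "{t. mono_on {..<n} t} \<inter> space (cube n) =
      {t \<in> space (cube n). \<forall>i\<in>{..<n}. \<forall>j\<in>{..<n}. i \<le> j \<longrightarrow> t i \<le> t j}"
    unfolding monotone_on_def by auto
  also have "\<dots> \<in> sets (cube n)"
    by (intro sets.sets_Collect_finite_All sets.sets_Collect_imp borel_measurable_le) auto
  finally show ?thesis .
qed

lemma chamber_subset_simplex: "t \<in> chamber n \<Longrightarrow> mono_on {..<n} t"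
  by (auto simp: chamber_def monotone_on_def le_less)

lemma cube_AE_pos: "AE t in cube n. \<forall>i<n. 0 < t i"
proof -
  have "AE x in lborel. x \<noteq> (0::real)" by (rule AE_lborel_singleton)
  then have "AE x in leb01. 0 < x"
    by (subst AE_restrict_space_iff) (auto elim!: eventually_mono)
  then have "\<forall>i\<in>{..<n}. AE t in cube n. 0 < t i"
    unfolding cube_def by (intro ballI AE_PiM_component leb01_prob) auto
  then have "AE t in cube n. \<forall>i\<in>{..<n}. 0 < t i" by (intro AE_finite_allI) auto
  then show ?thesis by (auto elim!: eventually_mono)
qed

lemma cube_AE_neq:
  assumes ij: "i < n" "j < n" "i \<noteq> j"
  shows "AE t in cube n. t i \<noteq> t j"
proof -
  interpret product_sigma_finite "\<lambda>_::nat. leb01" by (rule leb01_product)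
  let ?I = "{..<n} - {i}"
  have ins: "insert i ?I = {..<n}" using ij by auto
  have [measurable]: "{t \<in> space (cube n). t i = t j} \<in> sets (cube n)" by measurable
  have "emeasure (cube n) {t \<in> space (cube n). t i = t j} =
      (\<integral>\<^sup>+t. indicator {t \<in> space (cube n). t i = t j} t \<partial>PiM (insert i ?I) (\<lambda>_. leb01))"
    unfolding ins cube_def[symmetric] by simp
  also have "\<dots> = (\<integral>\<^sup>+x. (\<integral>\<^sup>+y. indicator {t \<in> space (cube n). t i = t j} (x(i := y)) \<partial>leb01)
      \<partial>PiM ?I (\<lambda>_. leb01))"
  proof (rule product_nn_integral_insert)
    show "indicator {t \<in> space (cube n). t i = t j} \<in> borel_measurable (PiM (insert i ?I) (\<lambda>_. leb01))"
      unfolding ins cube_def[symmetric] by (rule borel_measurable_indicator) fact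
  qed auto
  also have "\<dots> = (\<integral>\<^sup>+x. 0 \<partial>PiM ?I (\<lambda>_. leb01))"
  proof (rule nn_integral_cong)
    fix x assume "x \<in> space (PiM ?I (\<lambda>_. leb01))"
    have "AE y in lborel. y \<noteq> x j" by (rule AE_lborel_singleton)
    then have "AE y in lborel. y \<in> {0..1} \<longrightarrow> indicator {t \<in> space (cube n). t i = t j} (x(i := y)) = (0::ennreal)"
      by eventually_elim (use ij in \<open>auto split: split_indicator\<close>)
    then have "AE y in leb01. indicator {t \<in> space (cube n). t i = t j} (x(i := y)) = (0::ennreal)"
      by (subst AE_restrict_space_iff) auto
    then show "(\<integral>\<^sup>+y. indicator {t \<in> space (cube n). t i = t j} (x(i := y)) \<partial>leb01) = 0"
      by (subst nn_integral_cong_AE[where v="\<lambda>_. 0"]) auto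
  qed
  finally have "emeasure (cube n) {t \<in> space (cube n). t i = t j} = 0" by simp
  then show ?thesis
    by (intro AE_I'[where N="{t \<in> space (cube n). t i = t j}"]) auto
qed

lemma cube_AE_generic: "AE t in cube n. (\<forall>i<n. 0 < t i) \<and> inj_on t {..<n}"
proof -
  have "AE t in cube n. \<forall>i\<in>{..<n}. \<forall>j\<in>{..<n}. i \<noteq> j \<longrightarrow> t i \<noteq> t j"
  proof (intro AE_finite_allI finite_lessThan)
    fix i j assume "i \<in> {..<n}" "j \<in> {..<n}"
    then show "AE t in cube n. i \<noteq> j \<longrightarrow> t i \<noteq> t j"
      using cube_AE_neq[of i n j] by (cases "i = j") (auto elim!: eventually_mono)
  qed
  with cube_AE_pos[of n] show ?thesis
    by eventually_elim (auto simp: inj_on_def)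
qed

lemma generic_simplex_iff_chamber:
  assumes "t \<in> space (cube n)" "\<forall>i<n. 0 < t i" "inj_on t {..<n}"
  shows "mono_on {..<n} t \<longleftrightarrow> t \<in> chamber n"
proof
  assume m: "mono_on {..<n} t"
  have "t i < t j" if "j < n" "i < j" for i j
  proof -
    have "t i \<le> t j" using monotone_onD[OF m, of i j] that by simp
    moreover have "t i \<noteq> t j" using inj_onD[OF assms(3), of i j] that by auto
    ultimately show ?thesis by simp
  qed
  then show "t \<in> chamber n" using assms by (auto simp: chamber_def)
qed (rule chamber_subset_simplex)

lemma AE_simplex_iff:
  "(AE t in simplex_measure n. P t) \<longleftrightarrow> (AE t in cube n. t \<in> chamber n \<longrightarrow> P t)"
proof -
  have "(AE t in simplex_measure n. P t) \<longleftrightarrow> (AE t in cube n. t \<in> {t. mono_on {..<n} t} \<longrightarrow> P t)"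
    unfolding simplex_measure_def by (rule AE_restrict_space_iff[OF simplex_sets])
  also have "\<dots> \<longleftrightarrow> (AE t in cube n. t \<in> chamber n \<longrightarrow> P t)"
  proof
    assume "AE t in cube n. t \<in> {t. mono_on {..<n} t} \<longrightarrow> P t"
    with AE_space cube_AE_generic[of n] show "AE t in cube n. t \<in> chamber n \<longrightarrow> P t"
      by eventually_elim (use chamber_subset_simplex in blast)
  next
    assume "AE t in cube n. t \<in> chamber n \<longrightarrow> P t"
    with AE_space cube_AE_generic[of n] show "AE t in cube n. t \<in> {t. mono_on {..<n} t} \<longrightarrow> P t"
      by eventually_elim (use generic_simplex_iff_chamber in blast)
  qed
  finally show ?thesis .
qed

lemma finite_simplex_measure: "finite_measure (simplex_measure n)"
proof -
  interpret prob_space "cube n" by (rule cube_prob)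
  show ?thesis
    unfolding simplex_measure_def
    by (intro finite_measureI) (simp add: emeasure_restrict_space[OF simplex_sets] space_restrict_space)
qed

lemma simplex_measurable_component [measurable]: "(\<lambda>t. t i) \<in> borel_measurable (simplex_measure n)"
  unfolding simplex_measure_def by (intro measurable_restrict_space1 cube_component_borel)

lemma integral_simplex_eq:
  fixes f :: "(nat \<Rightarrow> real) \<Rightarrow> 'b::{banach, second_countable_topology}"
  assumes "f \<in> borel_measurable (simplex_measure n)"
  shows "(\<lambda>t. indicator (chamber n) t *\<^sub>R f t) \<in> borel_measurable (cube n)"
    "(\<integral>t. f t \<partial>simplex_measure n) = (\<integral>t. indicator (chamber n) t *\<^sub>R f t \<partial>cube n)"
    "integrable (simplex_measure n) f \<longleftrightarrow> integrable (cube n) (\<lambda>t. indicator (chamber n) t *\<^sub>R f t)"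
proof -
  let ?D = "{t. mono_on {..<n} t}"
  have m: "(\<lambda>t. indicator ?D t *\<^sub>R f t) \<in> borel_measurable (cube n)"
    using assms unfolding simplex_measure_def
    by (subst (asm) borel_measurable_restrict_space_iff[OF simplex_sets])
  have eq: "indicator (chamber n) t *\<^sub>R f t = indicator (chamber n) t *\<^sub>R (indicator ?D t *\<^sub>R f t)" for t
    using chamber_subset_simplex by (auto split: split_indicator)
  show m': "(\<lambda>t. indicator (chamber n) t *\<^sub>R f t) \<in> borel_measurable (cube n)"
    unfolding eq by (intro borel_measurable_scaleR borel_measurable_indicator chamber_sets m)
  have ae: "AE t in cube n. indicator ?D t *\<^sub>R f t = indicator (chamber n) t *\<^sub>R f t"
    using AE_space cube_AE_generic[of n]
  proof eventually_elim
    case (elim t)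
    then show ?case using generic_simplex_iff_chamber[of t n] by (auto split: split_indicator)
  qed
  show "(\<integral>t. f t \<partial>simplex_measure n) = (\<integral>t. indicator (chamber n) t *\<^sub>R f t \<partial>cube n)"
    unfolding simplex_measure_def integral_restrict_space[OF simplex_sets]
    by (rule integral_cong_AE[OF m m' ae])
  show "integrable (simplex_measure n) f \<longleftrightarrow> integrable (cube n) (\<lambda>t. indicator (chamber n) t *\<^sub>R f t)"
    unfolding simplex_measure_def integrable_restrict_space[OF simplex_sets]
    by (rule integrable_cong_AE[OF m m' ae])
qed

lemma cube_measurable_imp_simplex:
  "f \<in> borel_measurable (cube n) \<Longrightarrow> f \<in> borel_measurable (simplex_measure n)"
  unfolding simplex_measure_def by (rule measurable_restrict_space1)

lemma integrable_cube_imp_simplex: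
  fixes f :: "(nat \<Rightarrow> real) \<Rightarrow> 'b::{banach, second_countable_topology}"
  assumes "integrable (cube n) f"
  shows "integrable (simplex_measure n) f"
  using assms integral_simplex_eq(3)[OF cube_measurable_imp_simplex, of f n]
    integrable_mult_indicator[OF chamber_sets assms]
  by (simp add: borel_measurable_integrable)

lemma sq_integrable_cube_imp_simplex:
  "sq_integrable (cube n) f \<Longrightarrow> sq_integrable (simplex_measure n) f"
  by (auto simp: sq_integrable_def intro: integrable_cube_imp_simplex cube_measurable_imp_simplex)

lemma cube_permute_space:
  assumes "\<pi> permutes {..<n}" "t \<in> space (cube n)"
  shows "t \<circ> \<pi> \<in> space (cube n)"
proof -
  have "t (\<pi> i) \<in> {0..1}" if "i < n" for i
  proof -
    have "\<pi> i \<in> {..<n}" using permutes_in_image[OF assms(1), of i] that by simp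
    then show ?thesis using assms(2) by (auto simp: space_cube PiE_def Pi_def)
  qed
  moreover have "t (\<pi> i) = undefined" if "\<not> i < n" for i
    using assms that by (simp add: permutes_not_in space_cube PiE_def extensional_def)
  ultimately show ?thesis by (auto simp: space_cube PiE_def extensional_def)
qed

lemma cube_permute:
  assumes p: "\<pi> permutes {..<n}"
  shows "(\<lambda>t. t \<circ> \<pi>) \<in> measurable (cube n) (cube n)" "distr (cube n) (cube n) (\<lambda>t. t \<circ> \<pi>) = cube n"
proof -
  have eq: "t \<circ> \<pi> = (\<lambda>i\<in>{..<n}. t (\<pi> i))" if "t \<in> space (cube n)" for t
    using cube_permute_space[OF p that] by (auto simp: space_cube PiE_def extensional_def fun_eq_iff)
  have "(\<lambda>t. \<lambda>i\<in>{..<n}. t (\<pi> i)) \<in> measurable (cube n) (cube n)"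
    unfolding cube_def using permutes_in_image[OF p]
    by (intro measurable_restrict measurable_component_singleton) auto
  then show "(\<lambda>t. t \<circ> \<pi>) \<in> measurable (cube n) (cube n)"
    by (subst measurable_cong[OF eq])
  have "distr (cube n) (cube n) (\<lambda>t. t \<circ> \<pi>) = distr (cube n) (cube n) (\<lambda>t. \<lambda>i\<in>{..<n}. t (\<pi> i))"
    by (intro distr_cong refl eq)
  also have "\<dots> = cube n"
    unfolding cube_def using permutes_in_image[OF p] permutes_inj[OF p]
    by (intro distr_PiM_reindex leb01_prob) (auto intro: inj_on_subset)
  finally show "distr (cube n) (cube n) (\<lambda>t. t \<circ> \<pi>) = cube n" .
qed

lemma integral_cube_permute:
  fixes f :: "(nat \<Rightarrow> real) \<Rightarrow> 'b::{banach, second_countable_topology}"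
  assumes "\<pi> permutes {..<n}" "f \<in> borel_measurable (cube n)"
  shows "(\<integral>t. f (t \<circ> \<pi>) \<partial>cube n) = (\<integral>t. f t \<partial>cube n)"
    "integrable (cube n) (\<lambda>t. f (t \<circ> \<pi>)) \<longleftrightarrow> integrable (cube n) f"
    "(\<lambda>t. f (t \<circ> \<pi>)) \<in> borel_measurable (cube n)"
  using integral_distr[OF cube_permute(1)[OF assms(1)] assms(2)]
    integrable_distr_eq[OF cube_permute(1)[OF assms(1)] assms(2)]
    measurable_compose[OF cube_permute(1)[OF assms(1)] assms(2)]
  by (simp_all add: cube_permute(2)[OF assms(1)])

lemma AE_cube_permute:
  assumes "\<pi> permutes {..<n}" "AE t in cube n. P t"
  shows "AE t in cube n. P (t \<circ> \<pi>)"
  by (rule AE_distrD[OF cube_permute(1)[OF assms(1)]]) (simp only: cube_permute(2)[OF assms(1)] assms(2))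

text \<open>Distinct coordinates are put into increasing order by exactly one permutation.\<close>

lemma chamber_permutation_unique:
  assumes t: "t \<in> space (cube n)" "\<forall>i<n. 0 < t i" "inj_on t {..<n}"
  shows "\<exists>!\<pi>. \<pi> permutes {..<n} \<and> t \<circ> \<pi> \<in> chamber n"
proof (rule ex_ex1I)
  define xs where "xs = sorted_list_of_set (t ` {..<n})"
  have len: "length xs = n" and set: "set xs = t ` {..<n}" and sorted: "sorted_wrt (<) xs"
    using card_image[OF t(3)] by (auto simp: xs_def strict_sorted_list_of_set)
  define \<pi> where "\<pi> i = (if i < n then inv_into {..<n} t (xs ! i) else i)" for i
  have nth: "xs ! i \<in> t ` {..<n}" if "i < n" for i
    using that len set nth_mem by metis
  have t\<pi>: "t (\<pi> i) = xs ! i" if "i < n" for i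
    using nth[OF that] that by (simp add: \<pi>_def f_inv_into_f)
  have \<pi>n: "\<pi> i \<in> {..<n}" if "i < n" for i
    using inv_into_into[OF nth[OF that]] that by (simp add: \<pi>_def)
  have inj: "inj_on \<pi> {..<n}"
  proof (rule inj_onI)
    fix i j assume "i \<in> {..<n}" "j \<in> {..<n}" "\<pi> i = \<pi> j"
    then have "xs ! i = xs ! j" using t\<pi>[of i] t\<pi>[of j] by simp
    then show "i = j"
      using \<open>i \<in> {..<n}\<close> \<open>j \<in> {..<n}\<close> sorted_wrt_nth_less[OF sorted, of i j]
        sorted_wrt_nth_less[OF sorted, of j i] len
      by (cases i j rule: linorder_cases) auto
  qed
  have img: "\<pi> ` {..<n} = {..<n}"
    using \<pi>n by (intro endo_inj_surj inj) auto
  have perm: "\<pi> permutes {..<n}"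
    using inj img by (intro bij_imp_permutes) (auto simp: bij_betw_def \<pi>_def)
  have "t \<circ> \<pi> \<in> chamber n"
    unfolding chamber_def
  proof (intro CollectI conjI allI impI)
    show "t \<circ> \<pi> \<in> space (cube n)" by (rule cube_permute_space[OF perm t(1)])
    show "0 < (t \<circ> \<pi>) i" if "i < n" for i using t(2) \<pi>n[OF that] by auto
    show "(t \<circ> \<pi>) i < (t \<circ> \<pi>) j" if "j < n" "i < j" for i j
      using t\<pi>[of i] t\<pi>[of j] sorted_wrt_nth_less[OF sorted, of i j] that len by simp
  qed
  with perm show "\<exists>\<pi>. \<pi> permutes {..<n} \<and> t \<circ> \<pi> \<in> chamber n" by blast
next
  fix \<pi> \<rho>
  assume *: "\<pi> permutes {..<n} \<and> t \<circ> \<pi> \<in> chamber n" "\<rho> permutes {..<n} \<and> t \<circ> \<rho> \<in> chamber n"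
  have sorted: "sorted_wrt (<) (map (t \<circ> \<sigma>) [0..<n])" and st: "set (map (t \<circ> \<sigma>) [0..<n]) = t ` {..<n}"
    if "\<sigma> permutes {..<n} \<and> t \<circ> \<sigma> \<in> chamber n" for \<sigma>
  proof -
    show "sorted_wrt (<) (map (t \<circ> \<sigma>) [0..<n])"
      unfolding sorted_wrt_iff_nth_less using that by (auto simp: chamber_def)
    have "set (map (t \<circ> \<sigma>) [0..<n]) = t ` (\<sigma> ` {..<n})" by (auto simp: atLeast0LessThan)
    also have "\<sigma> ` {..<n} = {..<n}" using that by (simp add: permutes_image)
    finally show "set (map (t \<circ> \<sigma>) [0..<n]) = t ` {..<n}" .
  qed
  have "map (t \<circ> \<pi>) [0..<n] = map (t \<circ> \<rho>) [0..<n]"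
    using sorted[OF *(1)] sorted[OF *(2)] st[OF *(1)] st[OF *(2)]
    by (intro sorted_distinct_set_unique) (simp_all add: strict_sorted_iff)
  then have "t (\<pi> i) = t (\<rho> i)" if "i < n" for i using that by simp
  moreover have "\<pi> i \<in> {..<n}" "\<rho> i \<in> {..<n}" if "i < n" for i
    using * that permutes_in_image[of \<pi> "{..<n}" i] permutes_in_image[of \<rho> "{..<n}" i] by simp_all
  ultimately have "\<pi> i = \<rho> i" if "i < n" for i
    using t(3) that by (meson inj_onD)
  moreover have "\<pi> i = \<rho> i" if "\<not> i < n" for i
    using * that permutes_not_in[of \<pi> "{..<n}" i] permutes_not_in[of \<rho> "{..<n}" i] by simp
  ultimately show "\<pi> = \<rho>" by blast
qed

lemma AE_sum_chambers: "AE t in cube n. (\<Sum>\<pi> | \<pi> permutes {..<n}. indicator (chamber n) (t \<circ> \<pi>)) = (1::real)"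
  using AE_space cube_AE_generic[of n]
proof eventually_elim
  case (elim t)
  have "\<exists>!\<pi>. \<pi> permutes {..<n} \<and> t \<circ> \<pi> \<in> chamber n"
    using elim by (intro chamber_permutation_unique) auto
  then obtain \<pi> where \<pi>: "\<pi> permutes {..<n}" "t \<circ> \<pi> \<in> chamber n"
    and u: "\<forall>\<rho>. \<rho> permutes {..<n} \<and> t \<circ> \<rho> \<in> chamber n \<longrightarrow> \<rho> = \<pi>"
    unfolding Ex1_def by (elim exE conjE) (rule that)
  have "(\<Sum>\<rho> | \<rho> permutes {..<n}. indicator (chamber n) (t \<circ> \<rho>)) =
      (\<Sum>\<rho> | \<rho> permutes {..<n}. if \<rho> = \<pi> then 1 else (0::real))"
  proof (intro sum.cong refl)
    fix \<rho> assume \<rho>: "\<rho> \<in> {\<rho>. \<rho> permutes {..<n}}"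
    show "indicator (chamber n) (t \<circ> \<rho>) = (if \<rho> = \<pi> then 1 else (0::real))"
    proof (cases "\<rho> = \<pi>")
      case True
      then show ?thesis using \<pi>(2) by simp
    next
      case False
      then have "t \<circ> \<rho> \<notin> chamber n" using u \<rho> by blast
      then show ?thesis using False by simp
    qed
  qed
  also have "\<dots> = (if \<pi> \<in> {\<rho>. \<rho> permutes {..<n}} then 1 else 0)"
    by (rule sum.delta) (simp add: finite_permutations)
  also have "\<dots> = 1" using \<pi>(1) by simp
  finally show ?case .
qed

text \<open>The permuted chambers cover the cube up to a null set, and permutations preserve the measure.\<close>

lemma integral_cube_symmetric:
  fixes f :: "(nat \<Rightarrow> real) \<Rightarrow> 'b::{banach, second_countable_topology}"
  assumes f: "integrable (cube n) f"
    and sym: "\<And>\<pi> t. \<pi> permutes {..<n} \<Longrightarrow> t \<in> space (cube n) \<Longrightarrow> f (t \<circ> \<pi>) = f t"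
  shows "(\<integral>t. f t \<partial>cube n) = fact n *\<^sub>R (\<integral>t. f t \<partial>simplex_measure n)"
proof -
  have [measurable]: "f \<in> borel_measurable (cube n)" using f by auto
  let ?g = "\<lambda>t. indicator (chamber n) t *\<^sub>R f t"
  have g: "integrable (cube n) ?g" by (rule integrable_mult_indicator[OF chamber_sets f])
  have gm: "?g \<in> borel_measurable (cube n)" using g by auto
  have gp: "integrable (cube n) (\<lambda>t. indicator (chamber n) (t \<circ> \<pi>) *\<^sub>R f (t \<circ> \<pi>))"
    if "\<pi> permutes {..<n}" for \<pi>
    using integral_cube_permute(2)[OF that gm] g by simp
  have "(\<integral>t. f t \<partial>cube n) =
      (\<integral>t. (\<Sum>\<pi> | \<pi> permutes {..<n}. indicator (chamber n) (t \<circ> \<pi>) *\<^sub>R f (t \<circ> \<pi>)) \<partial>cube n)"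
  proof (rule integral_cong_AE)
    show "(\<lambda>t. \<Sum>\<pi> | \<pi> permutes {..<n}. indicator (chamber n) (t \<circ> \<pi>) *\<^sub>R f (t \<circ> \<pi>)) \<in> borel_measurable (cube n)"
      using gp by (intro borel_measurable_sum) auto
    show "AE t in cube n. f t = (\<Sum>\<pi> | \<pi> permutes {..<n}. indicator (chamber n) (t \<circ> \<pi>) *\<^sub>R f (t \<circ> \<pi>))"
      using AE_space AE_sum_chambers[of n]
    proof eventually_elim
      case (elim t)
      have "(\<Sum>\<pi> | \<pi> permutes {..<n}. indicator (chamber n) (t \<circ> \<pi>) *\<^sub>R f (t \<circ> \<pi>)) =
          (\<Sum>\<pi> | \<pi> permutes {..<n}. indicator (chamber n) (t \<circ> \<pi>) *\<^sub>R f t)"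
        using sym[OF _ elim(1)] by (intro sum.cong refl arg_cong2[where f=scaleR]) simp
      also have "\<dots> = f t" using elim by (simp add: scaleR_left.sum[symmetric])
      finally show ?case by simp
    qed
  qed simp
  also have "\<dots> = (\<Sum>\<pi> | \<pi> permutes {..<n}. (\<integral>t. indicator (chamber n) (t \<circ> \<pi>) *\<^sub>R f (t \<circ> \<pi>) \<partial>cube n))"
    using gp by (intro Bochner_Integration.integral_sum) auto
  also have "\<dots> = (\<Sum>\<pi> | \<pi> permutes {..<n}. (\<integral>t. ?g t \<partial>cube n))"
    using integral_cube_permute(1)[OF _ gm] by (intro sum.cong) auto
  also have "\<dots> = fact n *\<^sub>R (\<integral>t. ?g t \<partial>cube n)"
    by (simp add: sum_constant_scaleR card_permutations[of "{..<n}" n])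
  also have "(\<integral>t. ?g t \<partial>cube n) = (\<integral>t. f t \<partial>simplex_measure n)"
    by (rule integral_simplex_eq(2)[symmetric]) (simp add: cube_measurable_imp_simplex)
  finally show ?thesis .
qed

lemma symmetric_AE_simplex_imp_cube:
  assumes a: "symmetric_kernel n a" and b: "symmetric_kernel n b"
    and ae: "AE t in simplex_measure n. a t = b t"
  shows "AE t in cube n. a t = b t"
proof -
  have 1: "\<forall>\<pi>\<in>{\<pi>. \<pi> permutes {..<n}}. AE t in cube n. t \<circ> \<pi> \<in> chamber n \<longrightarrow> a (t \<circ> \<pi>) = b (t \<circ> \<pi>)"
  proof
    fix \<pi> assume \<pi>: "\<pi> \<in> {\<pi>. \<pi> permutes {..<n}}"
    show "AE t in cube n. t \<circ> \<pi> \<in> chamber n \<longrightarrow> a (t \<circ> \<pi>) = b (t \<circ> \<pi>)"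
      using \<pi> ae by (intro AE_cube_permute[where P="\<lambda>t. t \<in> chamber n \<longrightarrow> a t = b t"]) (simp_all add: AE_simplex_iff)
  qed
  have "AE t in cube n. \<forall>\<pi>\<in>{\<pi>. \<pi> permutes {..<n}}. t \<circ> \<pi> \<in> chamber n \<longrightarrow> a (t \<circ> \<pi>) = b (t \<circ> \<pi>)"
    using 1 by (intro AE_finite_allI finite_permutations) auto
  with AE_space cube_AE_generic[of n] show ?thesis
  proof eventually_elim
    case (elim t)
    then obtain \<pi> where \<pi>: "\<pi> permutes {..<n}" "t \<circ> \<pi> \<in> chamber n"
      using ex1_implies_ex[OF chamber_permutation_unique[of t n]] by blast
    then have "a (t \<circ> \<pi>) = b (t \<circ> \<pi>)" using elim by blast
    then show ?case using a b \<pi>(1) elim(1) by (simp add: symmetric_kernel_def)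
  qed
qed

text \<open>
  The symmetric extension reads off the value at the increasing rearrangement of the coordinates,
  as the sum over all permutations has a single nonzero term.
\<close>

lemma symmetrize_kernel:
  assumes b: "sq_integrable (simplex_measure n) b"
  shows "\<exists>a. symmetric_kernel n a \<and> (AE t in simplex_measure n. b t = a t)"
proof -
  define c where "c t = indicator (chamber n) t *\<^sub>R b t" for t
  define a where "a t = (\<Sum>\<pi> | \<pi> permutes {..<n}. c (t \<circ> \<pi>))" for t
  have bm: "b \<in> borel_measurable (simplex_measure n)" "(\<lambda>t. (b t)\<^sup>2) \<in> borel_measurable (simplex_measure n)"
    using b by (auto simp: sq_integrable_def)
  have c2: "(c t)\<^sup>2 = indicator (chamber n) t *\<^sub>R (b t)\<^sup>2" for t
    by (auto simp: c_def split: split_indicator)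
  have cm: "c \<in> borel_measurable (cube n)" "(\<lambda>t. (c t)\<^sup>2) \<in> borel_measurable (cube n)"
    unfolding c2 unfolding c_def[abs_def] using integral_simplex_eq(1)[OF bm(1)] integral_simplex_eq(1)[OF bm(2)] by simp_all
  have c: "integrable (cube n) (\<lambda>t. (c t)\<^sup>2)"
    unfolding c2 using integral_simplex_eq(3)[OF bm(2)] b by (simp add: sq_integrable_def)
  have "sq_integrable (cube n) a"
    unfolding a_def[abs_def]
    using integral_cube_permute(2)[OF _ cm(2)] integral_cube_permute(3)[OF _ cm(1)] c
    by (intro sq_integrable_sum) (auto simp: sq_integrable_def)
  moreover have "a (t \<circ> \<rho>) = a t" if "\<rho> permutes {..<n}" for \<rho> t
    unfolding a_def comp_assoc
    using setum_permutations_compose_left[OF that, of "\<lambda>\<pi>. c (t \<circ> \<pi>)"] by simp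
  ultimately have sym: "symmetric_kernel n a" by (simp add: symmetric_kernel_def)
  have "AE t in simplex_measure n. b t = a t"
    unfolding AE_simplex_iff using AE_space cube_AE_generic[of n]
  proof eventually_elim
    case (elim t)
    show ?case
    proof
      assume t: "t \<in> chamber n"
      have u: "\<rho> = id" if "\<rho> permutes {..<n}" "t \<circ> \<rho> \<in> chamber n" for \<rho>
        using chamber_permutation_unique[of t n] elim that t permutes_id[of "{..<n}"]
        by (metis comp_id)
      have "a t = (\<Sum>\<pi> | \<pi> permutes {..<n}. if \<pi> = id then b t else 0)"
        unfolding a_def
      proof (intro sum.cong refl)
        fix \<rho> assume \<rho>: "\<rho> \<in> {\<rho>. \<rho> permutes {..<n}}"
        show "c (t \<circ> \<rho>) = (if \<rho> = id then b t else 0)"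
        proof (cases "\<rho> = id")
          case True
          then show ?thesis using t by (simp add: c_def)
        next
          case False
          then have "t \<circ> \<rho> \<notin> chamber n" using u \<rho> by blast
          then show ?thesis using False by (simp add: c_def)
        qed
      qed
      also have "\<dots> = (if id \<in> {\<rho>. \<rho> permutes {..<n}} then b t else 0)"
        by (rule sum.delta) (simp add: finite_permutations)
      also have "\<dots> = b t" using permutes_id[of "{..<n}"] by simp
      finally show "b t = a t" by simp
    qed
  qed
  with sym show ?thesis by blast
qed

section \<open>Step kernels on the simplex\<close>

definition ordered_corners :: "nat \<Rightarrow> (nat \<Rightarrow> real) \<Rightarrow> (nat \<Rightarrow> real) \<Rightarrow> bool" where
  "ordered_corners n l r \<longleftrightarrow> (\<forall>i<n. 0 \<le> l i \<and> l i \<le> r i \<and> r i \<le> 1 \<and> (Suc i < n \<longrightarrow> r i \<le> l (Suc i)))"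

definition box_indicator :: "nat \<Rightarrow> (nat \<Rightarrow> real) \<Rightarrow> (nat \<Rightarrow> real) \<Rightarrow> (nat \<Rightarrow> real) \<Rightarrow> real" where
  "box_indicator n l r t = (\<Prod>i<n. indicator {l i<..r i} (t i))"

definition half_open_box :: "nat \<Rightarrow> (nat \<Rightarrow> real) \<Rightarrow> (nat \<Rightarrow> real) \<Rightarrow> (nat \<Rightarrow> real) set" where
  "half_open_box n l r = {t \<in> space (cube n). \<forall>i<n. l i < t i \<and> t i \<le> r i}"

lemma steps_in_simplex_iff:
  "steps_in_simplex n S \<longleftrightarrow> (\<forall>(c, l, r) \<in> set S. ordered_corners n l r)"
  by (simp add: steps_in_simplex_def ordered_corners_def)

lemma step_kernel_box: "step_kernel n S t = (\<Sum>(c, l, r) \<leftarrow> S. c * box_indicator n l r t)"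
  by (simp add: step_kernel_def box_indicator_def)

lemma ordered_cornersD:
  assumes "ordered_corners n l r" "i < n"
  shows "0 \<le> l i" "l i \<le> r i" "r i \<le> 1" "0 \<le> r i" "l i \<le> 1"
  using assms unfolding ordered_corners_def by (meson order_trans)+

lemma ordered_corners_less:
  assumes "ordered_corners n l r" "j < n" "i < j"
  shows "r i \<le> l j"
  using assms(3,2)
proof (induction j)
  case (Suc j)
  have step: "r j \<le> l (Suc j)" using assms(1) Suc.prems by (simp add: ordered_corners_def)
  show ?case
  proof (cases "i = j")
    case False
    then have "r i \<le> l j" using Suc by simp
    also have "\<dots> \<le> r j" using ordered_cornersD(2)[OF assms(1), of j] Suc.prems by simp
    finally show ?thesis using step by simp
  qed (use step in simp)
qed simp

lemma box_indicator_eq: "t \<in> space (cube n) \<Longrightarrow> box_indicator n l r t = indicator (half_open_box n l r) t"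
proof -
  assume t: "t \<in> space (cube n)"
  show ?thesis
  proof (cases "t \<in> half_open_box n l r")
    case True
    then have "box_indicator n l r t = (\<Prod>i<n. 1)"
      unfolding box_indicator_def by (intro prod.cong) (auto simp: half_open_box_def)
    then show ?thesis using True by simp
  next
    case False
    then obtain i where i: "i < n" "t i \<notin> {l i<..r i}" using t by (auto simp: half_open_box_def)
    have "box_indicator n l r t = 0"
      unfolding box_indicator_def by (rule prod_zero) (use i in \<open>auto intro!: bexI[of _ i]\<close>)
    then show ?thesis using False by simp
  qed
qed

lemma half_open_box_subset_chamber:
  assumes "ordered_corners n l r"
  shows "half_open_box n l r \<subseteq> chamber n"
proof
  fix t assume t: "t \<in> half_open_box n l r"
  then have b: "t \<in> space (cube n)" "\<And>i. i < n \<Longrightarrow> l i < t i" "\<And>i. i < n \<Longrightarrow> t i \<le> r i"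
    by (auto simp: half_open_box_def)
  show "t \<in> chamber n"
    unfolding chamber_def
  proof (intro CollectI conjI allI impI b(1))
    show "0 < t i" if "i < n" for i
      using b(2)[OF that] ordered_cornersD(1)[OF assms that] by simp
    show "t i < t j" if "j < n" "i < j" for i j
      using b(3)[of i] b(2)[of j] ordered_corners_less[OF assms that] that by simp
  qed
qed

lemma box_indicator_chamber:
  assumes "ordered_corners n l r" "t \<in> space (cube n)"
  shows "indicator (chamber n) t * box_indicator n l r t = box_indicator n l r t"
  using half_open_box_subset_chamber[OF assms(1)] unfolding box_indicator_eq[OF assms(2)]
  by (cases "t \<in> half_open_box n l r") auto

lemma box_indicator_measurable_cube [measurable]: "box_indicator n l r \<in> borel_measurable (cube n)"
proof -
  have "(\<lambda>t. indicator {l i<..r i} (t i) :: real) \<in> borel_measurable (cube n)" for i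
    by (rule measurable_compose[OF cube_component_borel]) simp
  then show ?thesis unfolding box_indicator_def[abs_def] by (intro borel_measurable_prod)
qed

lemma box_indicator_bounds: "0 \<le> box_indicator n l r t" "box_indicator n l r t \<le> 1"
  unfolding box_indicator_def by (auto intro!: prod_nonneg prod_le_1 simp: indicator_def)

lemma box_indicator_sq_integrable_cube: "sq_integrable (cube n) (box_indicator n l r)"
proof -
  interpret prob_space "cube n" by (rule cube_prob)
  show ?thesis
    by (rule sq_integrable_bounded[where B=1]) (use box_indicator_bounds[of n l r] in auto)
qed

lemma box_indicator_sq_integrable: "sq_integrable (simplex_measure n) (box_indicator n l r)"
  by (rule sq_integrable_cube_imp_simplex[OF box_indicator_sq_integrable_cube])

lemma sq_integrable_sum_list:
  assumes "\<And>x. x \<in> set xs \<Longrightarrow> sq_integrable M (f x)"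
  shows "sq_integrable M (\<lambda>t. \<Sum>x\<leftarrow>xs. f x t)"
  using assms by (induction xs) (auto intro: sq_integrable_add sq_integrable_zero)

lemma step_kernel_sq_integrable: "sq_integrable (simplex_measure n) (step_kernel n S)"
proof -
  have "sq_integrable (simplex_measure n) (\<lambda>t. \<Sum>x\<leftarrow>S. (case x of (c, l, r) \<Rightarrow> c * box_indicator n l r t))"
    by (rule sq_integrable_sum_list) (auto intro: sq_integrable_scale box_indicator_sq_integrable)
  then show ?thesis by (simp add: step_kernel_box[abs_def])
qed

lemma product_sq_integrable_cube:
  assumes "\<And>i. i < n \<Longrightarrow> sq_integrable leb01 (g i)"
  shows "sq_integrable (cube n) (\<lambda>t. \<Prod>i<n. g i (t i))"
proof -
  interpret product_sigma_finite "\<lambda>_::nat. leb01" by (rule leb01_product)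
  have "(\<lambda>t. g i (t i)) \<in> borel_measurable (cube n)" if "i < n" for i
    using cube_component[OF that] sq_integrable_measurable[OF assms[OF that]] by (rule measurable_compose)
  then have 1: "(\<lambda>t. \<Prod>i<n. g i (t i)) \<in> borel_measurable (cube n)"
    by (intro borel_measurable_prod) auto
  have "integrable (cube n) (\<lambda>t. \<Prod>i<n. (g i (t i))\<^sup>2)"
    unfolding cube_def using assms by (intro product_integrable_prod) (auto simp: sq_integrable_def)
  then show ?thesis using 1 by (simp add: sq_integrable_def prod_power_distrib)
qed

lemma integral_cube_product:
  assumes "\<And>i. i < n \<Longrightarrow> integrable leb01 (g i)"
  shows "(\<integral>t. (\<Prod>i<n. g i (t i)) \<partial>cube n) = (\<Prod>i<n. \<integral>x. (g i x :: real) \<partial>leb01)"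
proof -
  interpret product_sigma_finite "\<lambda>_::nat. leb01" by (rule leb01_product)
  show ?thesis unfolding cube_def using assms by (intro product_integral_prod) auto
qed

lemma sq_integrable_indicator_half_open: "sq_integrable leb01 (indicator {a<..b})"
proof -
  interpret prob_space leb01 by (rule leb01_prob)
  show ?thesis
    by (rule sq_integrable_bounded[where B=1]) (auto split: split_indicator)
qed

lemma integral_simplex_box:
  assumes o: "ordered_corners n l r" and f: "f \<in> borel_measurable (cube n)"
  shows "(\<integral>t. f t * box_indicator n l r t \<partial>simplex_measure n) = (\<integral>t. f t * box_indicator n l r t \<partial>cube n)"
proof -
  have "(\<integral>t. f t * box_indicator n l r t \<partial>simplex_measure n) =
      (\<integral>t. indicator (chamber n) t *\<^sub>R (f t * box_indicator n l r t) \<partial>cube n)"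
    using f by (intro integral_simplex_eq(2) cube_measurable_imp_simplex) simp
  also have "\<dots> = (\<integral>t. f t * box_indicator n l r t \<partial>cube n)"
  proof (intro Bochner_Integration.integral_cong refl)
    fix t assume "t \<in> space (cube n)"
    from box_indicator_chamber[OF o this]
    show "indicator (chamber n) t *\<^sub>R (f t * box_indicator n l r t) = f t * box_indicator n l r t"
      by (metis mult.left_commute real_scaleR_def)
  qed
  finally show ?thesis .
qed

lemma integral_simplex_box_product:
  assumes o: "ordered_corners n l r" and g: "\<And>i. i < n \<Longrightarrow> sq_integrable leb01 (g i)"
  shows "(\<integral>t. (\<Prod>i<n. g i (t i)) * box_indicator n l r t \<partial>simplex_measure n) =
    (\<Prod>i<n. \<integral>x. indicator {l i<..r i} x * g i x \<partial>leb01)"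
proof -
  have "(\<integral>t. (\<Prod>i<n. g i (t i)) * box_indicator n l r t \<partial>simplex_measure n) =
      (\<integral>t. (\<Prod>i<n. g i (t i)) * box_indicator n l r t \<partial>cube n)"
    using sq_integrable_measurable[OF product_sq_integrable_cube[OF g]] by (intro integral_simplex_box o)
  also have "\<dots> = (\<integral>t. (\<Prod>i<n. (\<lambda>x. indicator {l i<..r i} x * g i x) (t i)) \<partial>cube n)"
    by (simp add: box_indicator_def prod.distrib mult.commute)
  also have "\<dots> = (\<Prod>i<n. \<integral>x. indicator {l i<..r i} x * g i x \<partial>leb01)"
    using sq_integrable_mult[OF sq_integrable_indicator_half_open g]
    by (rule integral_cube_product)
  finally show ?thesis .
qed

lemma integral_leb01_indicator_half_open:
  fixes a b :: real
  assumes "0 \<le> a" "b \<le> 1"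
  shows "(\<integral>x. indicator {a<..b} x \<partial>leb01) = max 0 (b - a)"
proof -
  have "(\<integral>x. indicator {a<..b} x \<partial>leb01) = (\<integral>x. indicator {0..1} x *\<^sub>R (indicator {a<..b} x :: real) \<partial>lborel)"
    by (rule integral_restrict_space) simp
  also have "\<dots> = (\<integral>x. indicator {a<..b} x \<partial>lborel)"
    using assms by (intro Bochner_Integration.integral_cong) (auto split: split_indicator)
  also have "\<dots> = max 0 (b - a)" by (cases "a \<le> b") (simp_all add: measure_def)
  finally show ?thesis .
qed

lemma integral_simplex_two_boxes:
  assumes o: "ordered_corners n l r" "ordered_corners n l' r'"
  shows "(\<integral>t. box_indicator n l' r' t * box_indicator n l r t \<partial>simplex_measure n) =
    (\<Prod>i<n. max 0 (min (r i) (r' i) - max (l i) (l' i)))"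
proof -
  have "(\<integral>t. box_indicator n l' r' t * box_indicator n l r t \<partial>simplex_measure n) =
      (\<Prod>i<n. \<integral>x. indicator {l i<..r i} x * indicator {l' i<..r' i} x \<partial>leb01)"
    unfolding box_indicator_def[of n l' r']
    by (rule integral_simplex_box_product[OF o(1) sq_integrable_indicator_half_open])
  also have "\<dots> = (\<Prod>i<n. max 0 (min (r i) (r' i) - max (l i) (l' i)))"
  proof (intro prod.cong refl)
    fix i assume "i \<in> {..<n}"
    then have i: "0 \<le> max (l i) (l' i)" "min (r i) (r' i) \<le> 1"
      using ordered_cornersD[OF o(1), of i] by auto
    have "(\<integral>x. indicator {l i<..r i} x * indicator {l' i<..r' i} x \<partial>leb01) =
        (\<integral>x. (indicator {max (l i) (l' i)<..min (r i) (r' i)} x :: real) \<partial>leb01)"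
      by (intro Bochner_Integration.integral_cong refl) (auto split: split_indicator)
    also have "\<dots> = max 0 (min (r i) (r' i) - max (l i) (l' i))"
      by (rule integral_leb01_indicator_half_open[OF i])
    finally show "(\<integral>x. indicator {l i<..r i} x * indicator {l' i<..r' i} x \<partial>leb01) =
        max 0 (min (r i) (r' i) - max (l i) (l' i))" .
  qed
  finally show ?thesis .
qed

lemma space_cube_range:
  assumes "t \<in> space (cube n)" "i < n"
  shows "0 \<le> t i \<and> t i \<le> 1"
  using PiE_mem[OF assms(1)[unfolded space_cube], of i] assms(2) by simp

text \<open>
  The boxes with ordered corners generate the Borel sets of the open chamber, because each of its
  points has rational boxes with separated sides around it.
\<close>

lemma chamber_rational_box:
  assumes t: "t \<in> chamber n" and i: "i < n \<Longrightarrow> t i < c"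
  shows "\<exists>l\<in>{..<n} \<rightarrow>\<^sub>E \<rat>. \<exists>r\<in>{..<n} \<rightarrow>\<^sub>E \<rat>. ordered_corners n l r \<and> t \<in> half_open_box n l r \<and> (i < n \<longrightarrow> r i < c)"
proof -
  have sp: "t \<in> space (cube n)" and pos: "\<And>j. j < n \<Longrightarrow> 0 < t j"
    and less: "\<And>j k. k < n \<Longrightarrow> j < k \<Longrightarrow> t j < t k"
    using t by (auto simp: chamber_def)
  have le1: "t j \<le> 1" if "j < n" for j using space_cube_range[OF sp that] by simp
  \<comment> \<open>Right corners come first: each lies below the next coordinate, or is 1 at the boundary.
      The left corners are then chosen above the right corner of the preceding side.\<close>
  define R where "R j q \<longleftrightarrow> q \<in> \<rat> \<and> t j \<le> q \<and> q \<le> 1 \<and> (Suc j < n \<longrightarrow> q < t (Suc j)) \<and> (j = i \<longrightarrow> q < c)" for j q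
  have exR: "\<exists>q. R j q" if j: "j < n" for j
  proof (cases "t j = 1")
    case True
    then have S: "\<not> Suc j < n" using less[of "Suc j" j] le1[of "Suc j"] by linarith
    have "j = i \<longrightarrow> 1 < c" using True i j by auto
    then have "R j 1" using True S unfolding R_def by simp
    then show ?thesis by blast
  next
    case False
    define m where "m = min 1 (min (if Suc j < n then t (Suc j) else 1) (if j = i then c else 1))"
    have "Suc j < n \<longrightarrow> t j < t (Suc j)" using less[of "Suc j" j] by simp
    moreover have "j = i \<longrightarrow> t j < c" using i j by blast
    moreover have "t j < 1" using False le1[OF j] by simp
    ultimately have "t j < m" by (auto simp: m_def)
    then obtain q where q: "q \<in> \<rat>" "t j < q" "q < m" using Rats_dense_in_real by blast
    then have "R j q" unfolding R_def m_def by (auto split: if_splits)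
    then show ?thesis by blast
  qed
  have "\<forall>j\<in>{..<n}. \<exists>q. R j q" by (intro ballI exR) simp
  from bchoice[OF this] obtain r where Rr: "\<forall>j\<in>{..<n}. R j (r j)" by (elim exE)
  have r: "\<And>j. j < n \<Longrightarrow> r j \<in> \<rat>" "\<And>j. j < n \<Longrightarrow> t j \<le> r j" "\<And>j. j < n \<Longrightarrow> r j \<le> 1"
    "\<And>j. Suc j < n \<Longrightarrow> r j < t (Suc j)" "i < n \<Longrightarrow> r i < c"
    using Rr by (simp_all add: R_def)
  define L where "L j q \<longleftrightarrow> q \<in> \<rat> \<and> 0 \<le> q \<and> q < t j \<and> (\<forall>k. j = Suc k \<longrightarrow> r k \<le> q)" for j q
  have exL: "\<exists>q. L j q" if j: "j < n" for j
  proof -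
    have "max 0 (if j = 0 then 0 else r (j - 1)) < t j"
    proof (cases j)
      case 0
      then show ?thesis using pos[OF j] by simp
    next
      case (Suc k)
      then show ?thesis using pos[OF j] r(4)[of k] j by simp
    qed
    then obtain q where "q \<in> \<rat>" "max 0 (if j = 0 then 0 else r (j - 1)) < q" "q < t j"
      using Rats_dense_in_real by blast
    then have "L j q" unfolding L_def by auto
    then show ?thesis by blast
  qed
  have "\<forall>j\<in>{..<n}. \<exists>q. L j q" by (intro ballI exL) simp
  from bchoice[OF this] obtain l where Ll: "\<forall>j\<in>{..<n}. L j (l j)" by (elim exE)
  have l: "\<And>j. j < n \<Longrightarrow> l j \<in> \<rat>" "\<And>j. j < n \<Longrightarrow> 0 \<le> l j" "\<And>j. j < n \<Longrightarrow> l j < t j"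
    "\<And>k. Suc k < n \<Longrightarrow> r k \<le> l (Suc k)"
    using Ll by (simp_all add: L_def)
  define l' where "l' = restrict l {..<n}"
  define r' where "r' = restrict r {..<n}"
  have "l' \<in> {..<n} \<rightarrow>\<^sub>E \<rat>" "r' \<in> {..<n} \<rightarrow>\<^sub>E \<rat>" using l(1) r(1) by (auto simp: l'_def r'_def)
  moreover have "ordered_corners n l' r'"
    unfolding ordered_corners_def
  proof (intro allI impI conjI)
    fix j assume j: "j < n"
    show "0 \<le> l' j" "r' j \<le> 1" using j l(2) r(3) by (auto simp: l'_def r'_def)
    show "l' j \<le> r' j" using j l(3)[OF j] r(2)[OF j] by (simp add: l'_def r'_def)
    show "r' j \<le> l' (Suc j)" if "Suc j < n" using j that l(4) by (simp add: l'_def r'_def)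
  qed
  moreover have "t \<in> half_open_box n l' r'"
    using sp l(3) r(2) by (simp add: half_open_box_def l'_def r'_def)
  moreover have "i < n \<longrightarrow> r' i < c" using r(5) by (simp add: r'_def)
  ultimately show ?thesis by blast
qed

definition ordered_boxes :: "nat \<Rightarrow> (nat \<Rightarrow> real) set set" where
  "ordered_boxes n = {half_open_box n l r | l r. ordered_corners n l r}"

definition rational_corners :: "nat \<Rightarrow> ((nat \<Rightarrow> real) \<times> (nat \<Rightarrow> real)) set" where
  "rational_corners n = {(l, r). l \<in> {..<n} \<rightarrow>\<^sub>E \<rat> \<and> r \<in> {..<n} \<rightarrow>\<^sub>E \<rat> \<and> ordered_corners n l r}"

lemma countable_rational_corners: "countable (rational_corners n)"
proof (rule countable_subset)
  show "rational_corners n \<subseteq> ({..<n} \<rightarrow>\<^sub>E \<rat>) \<times> ({..<n} \<rightarrow>\<^sub>E \<rat>)" by (auto simp: rational_corners_def)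
  show "countable (({..<n} \<rightarrow>\<^sub>E (\<rat> :: real set)) \<times> ({..<n} \<rightarrow>\<^sub>E (\<rat> :: real set)))"
    by (intro countable_SIGMA countable_PiE countable_rat) auto
qed

text \<open>
  The outer maximum in the right corner gives an empty intersection the shape of a box, too, so that
  boxes with ordered corners are stable under intersection.
\<close>

lemma half_open_box_Int:
  "half_open_box n l r \<inter> half_open_box n l' r' =
     half_open_box n (\<lambda>i. max (l i) (l' i)) (\<lambda>i. max (max (l i) (l' i)) (min (r i) (r' i)))"
proof (intro set_eqI iffI)
  fix t assume t: "t \<in> half_open_box n (\<lambda>i. max (l i) (l' i)) (\<lambda>i. max (max (l i) (l' i)) (min (r i) (r' i)))"
  have "l i < t i \<and> t i \<le> r i \<and> l' i < t i \<and> t i \<le> r' i" if "i < n" for i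
  proof -
    have "max (l i) (l' i) < t i" "t i \<le> max (max (l i) (l' i)) (min (r i) (r' i))"
      using t that by (simp_all add: half_open_box_def)
    then show ?thesis by linarith
  qed
  then show "t \<in> half_open_box n l r \<inter> half_open_box n l' r'"
    using t by (simp add: half_open_box_def)
next
  fix t assume t: "t \<in> half_open_box n l r \<inter> half_open_box n l' r'"
  then show "t \<in> half_open_box n (\<lambda>i. max (l i) (l' i)) (\<lambda>i. max (max (l i) (l' i)) (min (r i) (r' i)))"
    by (simp add: half_open_box_def le_max_iff_disj)
qed

lemma Int_stable_ordered_boxes: "Int_stable (ordered_boxes n)"
proof (rule Int_stableI)
  fix a b assume "a \<in> ordered_boxes n" "b \<in> ordered_boxes n"
  then obtain l r l' r' where ab: "a = half_open_box n l r" "b = half_open_box n l' r'"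
    and o: "ordered_corners n l r" "ordered_corners n l' r'" by (auto simp: ordered_boxes_def)
  have "ordered_corners n (\<lambda>i. max (l i) (l' i)) (\<lambda>i. max (max (l i) (l' i)) (min (r i) (r' i)))"
    unfolding ordered_corners_def
  proof (intro allI impI conjI)
    fix i assume i: "i < n"
    note d = ordered_cornersD[OF o(1) i] ordered_cornersD[OF o(2) i]
    show "0 \<le> max (l i) (l' i)" using d by simp
    show "max (l i) (l' i) \<le> max (max (l i) (l' i)) (min (r i) (r' i))" by simp
    show "max (max (l i) (l' i)) (min (r i) (r' i)) \<le> 1" using d by simp
    assume s: "Suc i < n"
    have "r i \<le> l (Suc i)" "r' i \<le> l' (Suc i)" using o s by (auto simp: ordered_corners_def)
    then show "max (max (l i) (l' i)) (min (r i) (r' i)) \<le> max (l (Suc i)) (l' (Suc i))"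
      using d by (auto simp: max_def min_def)
  qed
  then show "a \<inter> b \<in> ordered_boxes n" unfolding ab half_open_box_Int ordered_boxes_def by blast
qed

lemma half_open_box_sets: "half_open_box n l r \<in> sets (cube n)"
proof -
  have "half_open_box n l r = {t \<in> space (cube n). \<forall>i\<in>{..<n}. l i < t i \<and> t i \<le> r i}"
    by (auto simp: half_open_box_def)
  also have "\<dots> \<in> sets (cube n)"
    by (intro sets.sets_Collect_finite_All sets.sets_Collect_conj borel_measurable_le borel_measurable_less) auto
  finally show ?thesis .
qed

lemma sets_chamber_generated:
  "sets (restrict_space (cube n) (chamber n)) = sigma_sets (chamber n) (ordered_boxes n)"
proof
  have sub: "ordered_boxes n \<subseteq> Pow (chamber n)"
    using half_open_box_subset_chamber by (auto simp: ordered_boxes_def)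
  have sp: "space (restrict_space (cube n) (chamber n)) = chamber n"
    by (auto simp: space_restrict_space chamber_def)
  show "sigma_sets (chamber n) (ordered_boxes n) \<subseteq> sets (restrict_space (cube n) (chamber n))"
  proof -
    have "ordered_boxes n \<subseteq> sets (restrict_space (cube n) (chamber n))"
    proof
      fix b assume "b \<in> ordered_boxes n"
      then obtain l r where b: "b = half_open_box n l r" "ordered_corners n l r" by (auto simp: ordered_boxes_def)
      then show "b \<in> sets (restrict_space (cube n) (chamber n))"
        using half_open_box_subset_chamber[OF b(2)] half_open_box_sets[of n l r]
        by (subst sets_restrict_space_iff) (auto simp: chamber_def)
    qed
    then show ?thesis using sets.sigma_sets_subset[of "ordered_boxes n" "restrict_space (cube n) (chamber n)"]
      by (simp add: sp)
  qed
  define N where "N = sigma (chamber n) (ordered_boxes n)"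
  have N: "space N = chamber n" "sets N = sigma_sets (chamber n) (ordered_boxes n)"
    using sub by (simp_all add: N_def space_measure_of_conv)
  have half: "{t \<in> chamber n. t i < c} \<in> sets N" if i: "i < n" for i c
  proof -
    have "{t \<in> chamber n. t i < c} =
        (\<Union>(l, r)\<in>{(l, r). (l, r) \<in> rational_corners n \<and> r i < c}. half_open_box n l r)"
    proof (intro equalityI subsetI)
      fix t assume "t \<in> {t \<in> chamber n. t i < c}"
      then obtain l r where "l \<in> {..<n} \<rightarrow>\<^sub>E \<rat>" "r \<in> {..<n} \<rightarrow>\<^sub>E \<rat>" "ordered_corners n l r"
        "t \<in> half_open_box n l r" "r i < c"
        using chamber_rational_box[of t n i c] i by blast
      then show "t \<in> (\<Union>(l, r)\<in>{(l, r). (l, r) \<in> rational_corners n \<and> r i < c}. half_open_box n l r)"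
        by (auto simp: rational_corners_def)
    next
      fix t assume "t \<in> (\<Union>(l, r)\<in>{(l, r). (l, r) \<in> rational_corners n \<and> r i < c}. half_open_box n l r)"
      then obtain l r where lr: "ordered_corners n l r" "r i < c" "t \<in> half_open_box n l r"
        by (auto simp: rational_corners_def)
      then have "t i \<le> r i" using i by (simp add: half_open_box_def)
      then show "t \<in> {t \<in> chamber n. t i < c}"
        using lr half_open_box_subset_chamber[OF lr(1)] by auto
    qed
    also have "\<dots> \<in> sets N"
    proof (rule sets.countable_UN')
      show "countable {(l, r). (l, r) \<in> rational_corners n \<and> r i < c}"
        by (rule countable_subset[OF _ countable_rational_corners[of n]]) auto
      show "(\<lambda>(l, r). half_open_box n l r) ` {(l, r). (l, r) \<in> rational_corners n \<and> r i < c} \<subseteq> sets N"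
        unfolding N(2) by (auto simp: ordered_boxes_def rational_corners_def intro!: sigma_sets.Basic)
    qed
    finally show ?thesis .
  qed
  have "(\<lambda>t i. t i) \<in> measurable N (PiM {..<n} (\<lambda>_. leb01))"
  proof (rule measurable_PiM_single')
    show "(\<lambda>\<omega> i. \<omega> i) \<in> space N \<rightarrow> (\<Pi>\<^sub>E i\<in>{..<n}. space leb01)"
      unfolding N(1) by (auto simp: chamber_def space_cube simp del: PiE_iff)
    fix i assume "i \<in> {..<n}"
    then have i: "i < n" by simp
    show "(\<lambda>t. t i) \<in> measurable N leb01"
    proof (rule measurable_restrict_space2)
      show "(\<lambda>t. t i) \<in> space N \<rightarrow> {0..1}"
        unfolding N(1) using space_cube_range[OF _ i] by (auto simp: chamber_def)
      have "(\<lambda>t. t i) \<in> borel_measurable N"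
        unfolding borel_measurable_iff_less using half[OF i] by (simp add: N(1))
      then show "(\<lambda>t. t i) \<in> measurable N lborel" by simp
    qed
  qed
  then have id: "(\<lambda>t. t) \<in> measurable N (cube n)" by (simp add: cube_def)
  show "sets (restrict_space (cube n) (chamber n)) \<subseteq> sigma_sets (chamber n) (ordered_boxes n)"
  proof
    fix B assume "B \<in> sets (restrict_space (cube n) (chamber n))"
    then obtain B' where B': "B' \<in> sets (cube n)" "B = chamber n \<inter> B'" by (auto simp: sets_restrict_space)
    have "(\<lambda>t. t) -` B' \<inter> space N \<in> sets N" by (rule measurable_sets[OF id B'(1)])
    then show "B \<in> sigma_sets (chamber n) (ordered_boxes n)" by (simp add: N B' Int_commute)
  qed
qed

text \<open>
  The positive and the negative part of \<open>a\<close> are densities of measures that agree on a generator of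
  the Borel sets of the chamber that is stable under intersections; hence they coincide.
\<close>

lemma AE_zero_if_orthogonal_to_boxes:
  assumes a: "integrable (simplex_measure n) a"
    and orth: "\<And>l r. ordered_corners n l r \<Longrightarrow> (\<integral>t. a t * box_indicator n l r t \<partial>simplex_measure n) = 0"
  shows "AE t in simplex_measure n. a t = 0"
proof -
  interpret C: prob_space "cube n" by (rule cube_prob)
  define R where "R = restrict_space (cube n) (chamber n)"
  have ch: "chamber n \<inter> space (cube n) \<in> sets (cube n)" by auto
  have spR: "space R = chamber n" by (auto simp: R_def space_restrict_space chamber_def)
  interpret R: finite_measure R
    unfolding R_def by (intro finite_measureI) (simp add: emeasure_restrict_space[OF ch] space_restrict_space)
  have am: "a \<in> borel_measurable (simplex_measure n)" using a by auto
  have aR: "integrable R a"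
    unfolding R_def integrable_restrict_space[OF ch] using integral_simplex_eq(3)[OF am] a by simp
  then have [measurable]: "a \<in> borel_measurable R" by auto
  define p m where "p t = max 0 (a t)" and "m t = max 0 (- a t)" for t
  have pm: "integrable R p" "integrable R m"
    unfolding p_def[abs_def] m_def[abs_def] using aR Bochner_Integration.integrable_minus[OF aR]
    by (auto intro: integrable_max)
  have apm: "a t = p t - m t" for t by (simp add: p_def m_def)
  have pos: "0 \<le> p t" "0 \<le> m t" for t by (auto simp: p_def m_def)
  have [measurable]: "p \<in> borel_measurable R" "m \<in> borel_measurable R" using pm by auto
  have boxR: "half_open_box n l r \<in> sets R" if "ordered_corners n l r" for l r
    using that unfolding R_def sets_chamber_generated ordered_boxes_def by (intro sigma_sets.Basic) blast
  have int_box: "(\<integral>t. p t * indicator (half_open_box n l r) t \<partial>R) = (\<integral>t. m t * indicator (half_open_box n l r) t \<partial>R)"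
    if o: "ordered_corners n l r" for l r
  proof -
    have "0 = (\<integral>t. a t * box_indicator n l r t \<partial>simplex_measure n)" using orth[OF o] by simp
    also have "\<dots> = (\<integral>t. indicator (chamber n) t *\<^sub>R (a t * box_indicator n l r t) \<partial>cube n)"
      by (intro integral_simplex_eq(2) borel_measurable_times am
          cube_measurable_imp_simplex[OF box_indicator_measurable_cube])
    also have "\<dots> = (\<integral>t. a t * box_indicator n l r t \<partial>R)"
      unfolding R_def by (rule integral_restrict_space[OF ch, symmetric])
    also have "\<dots> = (\<integral>t. a t * indicator (half_open_box n l r) t \<partial>R)"
      by (intro Bochner_Integration.integral_cong refl) (simp add: spR chamber_def box_indicator_eq)
    also have "\<dots> = (\<integral>t. p t * indicator (half_open_box n l r) t - m t * indicator (half_open_box n l r) t \<partial>R)"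
      by (simp add: apm left_diff_distrib)
    also have "\<dots> = (\<integral>t. p t * indicator (half_open_box n l r) t \<partial>R) - (\<integral>t. m t * indicator (half_open_box n l r) t \<partial>R)"
      using integrable_real_mult_indicator[OF boxR[OF o] pm(1)] integrable_real_mult_indicator[OF boxR[OF o] pm(2)]
      by (intro Bochner_Integration.integral_diff)
    finally show ?thesis by simp
  qed
  have em: "emeasure (density R (\<lambda>t. ennreal (q t))) (half_open_box n l r) = ennreal (\<integral>t. q t * indicator (half_open_box n l r) t \<partial>R)"
    if o: "ordered_corners n l r" and q: "integrable R q" "\<And>t. 0 \<le> q t" for q l r
  proof -
    have qm: "q \<in> borel_measurable R" using q(1) by auto
    have "emeasure (density R (\<lambda>t. ennreal (q t))) (half_open_box n l r) =
        (\<integral>\<^sup>+t. ennreal (q t) * indicator (half_open_box n l r) t \<partial>R)"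
      using boxR[OF o] qm by (intro emeasure_density) auto
    also have "\<dots> = (\<integral>\<^sup>+t. ennreal (q t * indicator (half_open_box n l r) t) \<partial>R)"
      by (intro nn_integral_cong) (auto split: split_indicator)
    also have "\<dots> = ennreal (\<integral>t. q t * indicator (half_open_box n l r) t \<partial>R)"
      using integrable_real_mult_indicator[OF boxR[OF o] q(1)] q(2)
      by (intro nn_integral_eq_integral) auto
    finally show ?thesis .
  qed
  have "density R (\<lambda>t. ennreal (p t)) = density R (\<lambda>t. ennreal (m t))"
  proof (rule measure_eqI_generator_eq_countable)
    show "Int_stable (ordered_boxes n)" by (rule Int_stable_ordered_boxes)
    show "ordered_boxes n \<subseteq> Pow (chamber n)"
      using half_open_box_subset_chamber by (auto simp: ordered_boxes_def)
    show "emeasure (density R (\<lambda>t. ennreal (p t))) X = emeasure (density R (\<lambda>t. ennreal (m t))) X"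
      if X: "X \<in> ordered_boxes n" for X
    proof -
      obtain l r where "X = half_open_box n l r" "ordered_corners n l r"
        using X by (auto simp: ordered_boxes_def)
      then show ?thesis using em[OF _ pm(1) pos(1)] em[OF _ pm(2) pos(2)] int_box by simp
    qed
    show "sets (density R (\<lambda>t. ennreal (p t))) = sigma_sets (chamber n) (ordered_boxes n)"
      "sets (density R (\<lambda>t. ennreal (m t))) = sigma_sets (chamber n) (ordered_boxes n)"
      unfolding R_def by (simp_all add: sets_chamber_generated)
    let ?A = "(\<lambda>(l, r). half_open_box n l r) ` rational_corners n"
    show "?A \<subseteq> ordered_boxes n" by (auto simp: ordered_boxes_def rational_corners_def)
    show "countable ?A" by (intro countable_image countable_rational_corners)
    show "\<Union>?A = chamber n"
    proof
      show "\<Union>?A \<subseteq> chamber n" using half_open_box_subset_chamber by (auto simp: rational_corners_def)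
      show "chamber n \<subseteq> \<Union>?A"
      proof
        fix t assume "t \<in> chamber n"
        from chamber_rational_box[OF this, of n] show "t \<in> \<Union>?A" by (auto simp: rational_corners_def)
      qed
    qed
    fix X assume "X \<in> ?A"
    then obtain l r where "X = half_open_box n l r" "ordered_corners n l r" by (auto simp: rational_corners_def)
    then show "emeasure (density R (\<lambda>t. ennreal (p t))) X \<noteq> \<infinity>" using em[OF _ pm(1) pos(1)] by simp
  qed
  then have "AE t in R. ennreal (p t) = ennreal (m t)"
    by (subst (asm) R.density_unique_iff) auto
  then have "AE t in R. a t = 0"
    by eventually_elim (auto simp: pos apm)
  then show ?thesis
    unfolding AE_simplex_iff R_def by (subst (asm) AE_restrict_space_iff[OF ch])
qed

lemma step_kernel_single: "step_kernel n [(1, l, r)] = box_indicator n l r"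
  by (simp add: step_kernel_box fun_eq_iff)

lemma step_kernel_add_scale:
  "step_kernel n (S @ map (\<lambda>(d, l, r). (c * d, l, r)) T) t = step_kernel n S t + c * step_kernel n T t"
proof -
  have "step_kernel n (map (\<lambda>(d, l, r). (c * d, l, r)) T) t = c * step_kernel n T t"
    unfolding step_kernel_def sum_list_const_mult[symmetric] map_map
    by (intro arg_cong[where f=sum_list] map_cong) (auto simp: mult.assoc)
  then show ?thesis by (simp add: step_kernel_def)
qed

lemma steps_in_simplex_add_scale:
  "steps_in_simplex n S \<Longrightarrow> steps_in_simplex n T \<Longrightarrow>
    steps_in_simplex n (S @ map (\<lambda>(d, l, r). (c * d, l, r)) T)"
  unfolding steps_in_simplex_iff by fastforce

text \<open>A kernel orthogonal to all boxes vanishes, so by projection step kernels are dense.\<close>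

lemma step_kernels_dense:
  assumes a: "sq_integrable (simplex_measure n) a"
  shows "\<exists>S. (\<forall>k. steps_in_simplex n (S k)) \<and>
    L2_tendsto (simplex_measure n) (\<lambda>k. step_kernel n (S k)) a sequentially"
proof -
  let ?V = "step_kernel n ` {S. steps_in_simplex n S}"
  interpret finite_measure "simplex_measure n" by (rule finite_simplex_measure)
  have V: "L2_subspace (simplex_measure n) ?V"
    unfolding L2_subspace_def
  proof (intro conjI ballI allI)
    have "step_kernel n [] = (\<lambda>_. 0)" by (simp add: step_kernel_def fun_eq_iff)
    moreover have "steps_in_simplex n []" by (simp add: steps_in_simplex_def)
    ultimately show "(\<lambda>_. 0) \<in> ?V" by (metis imageI mem_Collect_eq)
    fix f assume "f \<in> ?V"
    then obtain S where S: "f = step_kernel n S" "steps_in_simplex n S" by auto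
    then show "sq_integrable (simplex_measure n) f" by (simp add: step_kernel_sq_integrable)
    fix g c assume "g \<in> ?V"
    then obtain T where T: "g = step_kernel n T" "steps_in_simplex n T" by auto
    have "(\<lambda>t. f t + c * g t) = step_kernel n (S @ map (\<lambda>(d, l, r). (c * d, l, r)) T)"
      unfolding S(1) T(1) by (intro ext) (rule step_kernel_add_scale[symmetric])
    then show "(\<lambda>t. f t + c * g t) \<in> ?V"
      using steps_in_simplex_add_scale[OF S(2) T(2)] by auto
  qed
  have "\<exists>v. (\<forall>k::nat. v k \<in> ?V) \<and> L2_tendsto (simplex_measure n) v a sequentially"
  proof (rule L2_limit_of_subspace[OF V a])
    fix Y assume Y: "sq_integrable (simplex_measure n) Y"
      and o: "\<And>h. h \<in> ?V \<Longrightarrow> (\<integral>t. Y t * h t \<partial>simplex_measure n) = 0"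
    have "AE t in simplex_measure n. Y t = 0"
    proof (rule AE_zero_if_orthogonal_to_boxes[OF sq_integrable_imp_integrable[OF Y]])
      fix l r assume "ordered_corners n l r"
      then have "step_kernel n [(1, l, r)] \<in> ?V" by (auto simp: steps_in_simplex_iff)
      then show "(\<integral>t. Y t * box_indicator n l r t \<partial>simplex_measure n) = 0"
        using o by (simp add: step_kernel_single)
    qed
    then show "(\<integral>t. a t * Y t \<partial>simplex_measure n) = 0"
      by (intro integral_eq_zero_AE) (auto elim: eventually_mono)
  qed
  then obtain v where v: "\<And>k. v k \<in> ?V" "L2_tendsto (simplex_measure n) v a sequentially" by blast
  have "\<forall>k. \<exists>S. steps_in_simplex n S \<and> v k = step_kernel n S" using v(1) by auto
  from choice[OF this] obtain S where S: "\<And>k. steps_in_simplex n (S k)" "\<And>k. v k = step_kernel n (S k)" by auto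
  have "v = (\<lambda>k. step_kernel n (S k))" using S(2) by auto
  then show ?thesis using v(2) S(1) by auto
qed

section \<open>Gaussian characters and Hermite polynomials\<close>

lemma cis_measurable [measurable]: "cis \<in> borel_measurable borel"
  by (intro borel_measurable_continuous_onI continuous_intros)

lemma norm_cis_diff_le: "norm (cis a - cis b) \<le> \<bar>a - b\<bar>"
proof -
  have "cis a - cis b = cis b * (cis (a - b) - 1)" by (simp add: algebra_simps cis_mult)
  then have "norm (cis a - cis b) = norm (cis (a - b) - 1)" by (simp add: norm_mult)
  also have "\<dots> \<le> \<bar>a - b\<bar>" using iexp_approx1[of "a - b" 0] by (simp add: cis_conv_exp)
  finally show ?thesis .
qed

text \<open>The derivative of order \<open>n\<close> of the characteristic function of the standard normal law.\<close>

definition gauss_moment :: "nat \<Rightarrow> real \<Rightarrow> complex" where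
  "gauss_moment n x = (\<integral>z. (\<i> * z) ^ n * cis (z * x) \<partial>std_normal_distribution)"

lemma integrable_std_normal_abs_moment: "integrable std_normal_distribution (\<lambda>x. \<bar>x\<bar> ^ k)"
  using integrable_norm[OF integrable_std_normal_distribution_moment[of k]] by (simp add: power_abs)

lemma integrable_std_normal_bound:
  assumes "f \<in> borel_measurable borel" "\<And>z. norm (f z) \<le> C * \<bar>z\<bar> ^ k"
  shows "integrable std_normal_distribution (f :: real \<Rightarrow> 'b::{banach, second_countable_topology})"
proof (rule Bochner_Integration.integrable_bound)
  show "integrable std_normal_distribution (\<lambda>z. C * \<bar>z\<bar> ^ k)"
    using integrable_std_normal_abs_moment by simp
  show "f \<in> borel_measurable std_normal_distribution" using assms(1) by simp
  show "AE z in std_normal_distribution. norm (f z) \<le> norm (C * \<bar>z\<bar> ^ k)"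
    using assms(2) by (intro AE_I2) (metis abs_ge_self order_trans real_norm_def)
qed

lemma integrable_gauss_moment: "integrable std_normal_distribution (\<lambda>z. (\<i> * of_real z) ^ n * cis (z * x))"
  by (rule integrable_std_normal_bound[where C=1 and k=n]) (simp_all add: norm_mult norm_power)

lemma gauss_moment_bound: "norm (gauss_moment n x) \<le> (\<integral>z. \<bar>z\<bar> ^ n \<partial>std_normal_distribution)"
proof -
  have "norm (gauss_moment n x) \<le> (\<integral>z. norm ((\<i> * of_real z) ^ n * cis (z * x)) \<partial>std_normal_distribution)"
    unfolding gauss_moment_def by (rule integral_norm_bound)
  then show ?thesis by (simp add: norm_mult norm_power)
qed

lemma gauss_moment_deriv: "(gauss_moment n has_vector_derivative gauss_moment (Suc n) x) (at x)"
proof -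
  let ?N = std_normal_distribution
  let ?C = "(\<integral>z. \<bar>z\<bar> ^ (n + 2) \<partial>?N)"
  have bound: "norm (gauss_moment n (x + h) - gauss_moment n x - h *\<^sub>R gauss_moment (Suc n) x) \<le> h\<^sup>2 * ?C" for h
  proof -
    let ?f = "\<lambda>z. (\<i> * of_real z) ^ n * cis (z * x) * (cis (z * h) - 1 - \<i> * of_real (z * h))"
    have eq: "(\<i> * of_real z) ^ n * cis (z * (x + h)) - (\<i> * of_real z) ^ n * cis (z * x) -
        h *\<^sub>R ((\<i> * of_real z) ^ Suc n * cis (z * x)) = ?f z" for z
      by (simp add: distrib_left cis_mult[symmetric] scaleR_conv_of_real algebra_simps)
    have "gauss_moment n (x + h) - gauss_moment n x - h *\<^sub>R gauss_moment (Suc n) x =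
        (\<integral>z. (\<i> * of_real z) ^ n * cis (z * (x + h)) - (\<i> * of_real z) ^ n * cis (z * x) -
          h *\<^sub>R ((\<i> * of_real z) ^ Suc n * cis (z * x)) \<partial>?N)"
      unfolding gauss_moment_def
      by (simp only: Bochner_Integration.integral_diff Bochner_Integration.integrable_diff
          integral_scaleR_right integrable_scaleR_right integrable_gauss_moment)
    also have "\<dots> = (\<integral>z. ?f z \<partial>?N)" by (simp only: eq)
    finally have "norm (gauss_moment n (x + h) - gauss_moment n x - h *\<^sub>R gauss_moment (Suc n) x) \<le>
        (\<integral>z. norm (?f z) \<partial>?N)" by (simp only: integral_norm_bound)
    also have "\<dots> \<le> (\<integral>z. h\<^sup>2 * \<bar>z\<bar> ^ (n + 2) \<partial>?N)"
    proof (rule integral_mono)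
      have fb: "norm (?f z) \<le> h\<^sup>2 * \<bar>z\<bar> ^ (n + 2)" for z
      proof -
        have "norm (cis (z * h) - 1 - \<i> * of_real (z * h)) \<le> \<bar>z * h\<bar>\<^sup>2 / 2"
          using iexp_approx1[of "z * h" 1] by (simp add: cis_conv_exp eval_nat_numeral algebra_simps)
        also have "\<dots> \<le> \<bar>z * h\<bar>\<^sup>2" by simp
        finally have "norm (?f z) \<le> \<bar>z\<bar> ^ n * \<bar>z * h\<bar>\<^sup>2"
          by (simp add: norm_mult norm_power mult_left_mono)
        also have "\<bar>z * h\<bar>\<^sup>2 = \<bar>z\<bar>\<^sup>2 * h\<^sup>2" by (simp add: power_mult_distrib)
        also have "\<bar>z\<bar> ^ n * (\<bar>z\<bar>\<^sup>2 * h\<^sup>2) = h\<^sup>2 * \<bar>z\<bar> ^ (n + 2)" by (simp only: power_add mult_ac)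
        finally show ?thesis .
      qed
      then show "norm (?f z) \<le> h\<^sup>2 * \<bar>z\<bar> ^ (n + 2)" for z .
      show "integrable ?N (\<lambda>z. norm (?f z))"
        using fb by (intro integrable_std_normal_bound[where C="h\<^sup>2" and k="n + 2"]) simp_all
      show "integrable ?N (\<lambda>z. h\<^sup>2 * \<bar>z\<bar> ^ (n + 2))"
        by (rule integrable_mult_right[OF integrable_std_normal_abs_moment])
    qed
    also have "\<dots> = h\<^sup>2 * ?C" by (rule integral_mult_right_zero)
    finally show ?thesis .
  qed
  show ?thesis
    unfolding has_vector_derivative_def has_derivative_at
  proof (intro conjI bounded_linear_scaleR_left)
    show "(\<lambda>h. norm (gauss_moment n (x + h) - gauss_moment n x - h *\<^sub>R gauss_moment (Suc n) x) / norm h) \<midarrow>0\<rightarrow> 0"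
    proof (rule Lim_null_comparison)
      show "\<forall>\<^sub>F h in at 0. norm (norm (gauss_moment n (x + h) - gauss_moment n x - h *\<^sub>R gauss_moment (Suc n) x) / norm h) \<le> \<bar>h\<bar> * ?C"
        unfolding eventually_at
      proof (intro exI[of _ 1] conjI ballI impI)
        fix h :: real assume h: "h \<noteq> 0 \<and> dist h 0 < 1"
        have "norm (gauss_moment n (x + h) - gauss_moment n x - h *\<^sub>R gauss_moment (Suc n) x) / norm h \<le> h\<^sup>2 * ?C / norm h"
          by (intro divide_right_mono bound) simp
        also have "h\<^sup>2 * ?C / norm h = \<bar>h\<bar> * ?C" using h by (simp add: power2_eq_square abs_if)
        finally show "norm (norm (gauss_moment n (x + h) - gauss_moment n x - h *\<^sub>R gauss_moment (Suc n) x) / norm h) \<le> \<bar>h\<bar> * ?C"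
          by simp
      qed simp
      show "(\<lambda>h. \<bar>h\<bar> * ?C) \<midarrow>0\<rightarrow> 0"
        by (rule tendsto_eq_intros refl | simp)+
    qed
  qed
qed

lemma gauss_moment_0: "gauss_moment 0 x = of_real (exp (- x\<^sup>2 / 2))"
  using fun_cong[OF char_std_normal_distribution, of x]
  by (simp add: gauss_moment_def char_def cis_conv_exp mult.commute)

text \<open>
  Differentiating the Fourier transform of the Gaussian brings down a factor of \<open>\<i> z\<close>, so the
  moments of a character under the Gaussian law are the derivatives of \<open>exp (- x\<^sup>2 / 2)\<close>.
\<close>

lemma gauss_moment_eq_deriv: "gauss_moment n x = of_real ((deriv ^^ n) (\<lambda>y. exp (- y\<^sup>2 / 2)) x)"
proof (induction n arbitrary: x)
  case 0
  then show ?case by (simp add: gauss_moment_0)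
next
  case (Suc n)
  let ?f = "(deriv ^^ n) (\<lambda>y::real. exp (- y\<^sup>2 / 2))"
  have "((\<lambda>y. Re (gauss_moment n y)) has_vector_derivative Re (gauss_moment (Suc n) x)) (at x)"
    by (rule bounded_linear.has_vector_derivative[OF bounded_linear_Re gauss_moment_deriv])
  then have re: "(?f has_real_derivative Re (gauss_moment (Suc n) x)) (at x)"
    by (simp add: Suc.IH has_real_derivative_iff_has_vector_derivative)
  have "((\<lambda>y. Im (gauss_moment n y)) has_vector_derivative Im (gauss_moment (Suc n) x)) (at x)"
    by (rule bounded_linear.has_vector_derivative[OF bounded_linear_Im gauss_moment_deriv])
  then have "((\<lambda>y::real. 0::real) has_real_derivative Im (gauss_moment (Suc n) x)) (at x)"
    by (simp add: Suc.IH has_real_derivative_iff_has_vector_derivative)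
  then have "Im (gauss_moment (Suc n) x) = 0"
    using DERIV_unique[OF _ DERIV_const[of 0 "at x"]] by blast
  moreover have "Re (gauss_moment (Suc n) x) = (deriv ^^ Suc n) (\<lambda>y. exp (- y\<^sup>2 / 2)) x"
    using DERIV_imp_deriv[OF re] by simp
  ultimately show ?case by (simp add: complex_eq_iff)
qed

lemma gauss_moment_hermite:
  "gauss_moment n x = of_real ((-1) ^ n * hermite n x * exp (- x\<^sup>2 / 2))"
proof -
  have "(-1) ^ n * hermite n x * exp (- x\<^sup>2 / 2) =
      ((-1) ^ n * (-1) ^ n) * (exp (x\<^sup>2 / 2) * exp (- x\<^sup>2 / 2)) * (deriv ^^ n) (\<lambda>y. exp (- y\<^sup>2 / 2)) x"
    by (simp add: hermite_def)
  also have "\<dots> = (deriv ^^ n) (\<lambda>y. exp (- y\<^sup>2 / 2)) x"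
    by (simp add: power_mult_distrib[symmetric] exp_add[symmetric])
  finally show ?thesis by (simp add: gauss_moment_eq_deriv)
qed

lemma isCont_gauss_moment: "isCont (gauss_moment n) x"
  using gauss_moment_deriv by (rule has_vector_derivative_continuous)

definition hermite_gauss :: "nat \<Rightarrow> real \<Rightarrow> real \<Rightarrow> real" where
  "hermite_gauss n u s = 1 / s ^ n * hermite n (u / s) * gauss_kernel (s\<^sup>2) u"

lemma hermite_gauss_eq:
  assumes "0 < s"
  shows "of_real (hermite_gauss n u s) = (-1) ^ n * gauss_moment n (u / s) / of_real (s ^ Suc n * sqrt (2 * pi))"
proof -
  have "gauss_kernel (s\<^sup>2) u = exp (- (u / s)\<^sup>2 / 2) / (s * sqrt (2 * pi))"
    using assms by (simp add: gauss_kernel_def real_sqrt_mult power_divide field_simps)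
  then have "hermite_gauss n u s = hermite n (u / s) * exp (- (u / s)\<^sup>2 / 2) / (s ^ Suc n * sqrt (2 * pi))"
    by (simp add: hermite_gauss_def)
  moreover have "(-1) ^ n * gauss_moment n (u / s) = of_real (((-1) ^ n * (-1) ^ n) * hermite n (u / s) * exp (- (u / s)\<^sup>2 / 2))"
    by (simp add: gauss_moment_hermite)
  moreover have "((-1) ^ n * (-1) ^ n :: real) = 1" by (simp add: power_mult_distrib[symmetric])
  ultimately show ?thesis by simp
qed

lemma hermite_gauss_measurable [measurable]: "hermite_gauss n u \<in> borel_measurable borel"
proof -
  have [measurable]: "gauss_moment n \<in> borel_measurable borel"
    using isCont_gauss_moment by (intro borel_measurable_continuous_onI) (simp add: continuous_on_eq_continuous_within continuous_at_imp_continuous_at_within)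
  have h: "hermite n x = Re (gauss_moment n x) * (-1) ^ n * exp (x\<^sup>2 / 2)" for x
    unfolding gauss_moment_eq_deriv hermite_def by simp
  show ?thesis
    unfolding hermite_gauss_def[abs_def] gauss_kernel_def h by measurable
qed

text \<open>The Gaussian moment is bounded uniformly in its argument, which leaves the power of \<open>s\<close>.\<close>

lemma hermite_gauss_bound:
  "\<exists>C\<ge>0. \<forall>s>0. \<bar>hermite_gauss n u s\<bar> \<le> C / s ^ Suc n"
proof (intro exI[of _ "(\<integral>z. \<bar>z\<bar> ^ n \<partial>std_normal_distribution)"] conjI allI impI)
  show "0 \<le> (\<integral>z. \<bar>z\<bar> ^ n \<partial>std_normal_distribution)" by simp
  fix s :: real assume s: "0 < s"
  let ?C = "(\<integral>z. \<bar>z\<bar> ^ n \<partial>std_normal_distribution)"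
  have s1: "1 \<le> sqrt (2 * pi)" using pi_gt3 by simp
  have "\<bar>hermite_gauss n u s\<bar> = norm (of_real (hermite_gauss n u s) :: complex)" by simp
  also have "\<dots> = norm (gauss_moment n (u / s)) / (s ^ Suc n * sqrt (2 * pi))"
    unfolding hermite_gauss_eq[OF s] using s by (simp add: norm_mult norm_divide norm_power abs_mult)
  also have "\<dots> \<le> ?C / (s ^ Suc n * sqrt (2 * pi))"
    using s by (intro divide_right_mono gauss_moment_bound) simp
  also have "\<dots> \<le> ?C / (s ^ Suc n * 1)"
    using s s1 by (intro divide_left_mono mult_left_mono mult_pos_pos) auto
  finally show "\<bar>hermite_gauss n u s\<bar> \<le> ?C / s ^ Suc n" by simp
qed

lemma exp_square_eq_std_normal: "exp (- z\<^sup>2 / 2) = sqrt (2 * pi) * std_normal_density z"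
  by (simp add: std_normal_density_def)

lemma integrable_gauss_power:
  fixes s :: real
  assumes s: "0 < s"
  shows "integrable lborel (\<lambda>z::real. \<bar>z\<bar> ^ n * exp (- (s\<^sup>2 * z\<^sup>2) / 2))"
proof -
  have "integrable lborel (\<lambda>z. std_normal_density z * \<bar>z\<bar> ^ n)" by (rule integrable_std_normal_moment_abs)
  then have "integrable lborel (\<lambda>z. (sqrt (2 * pi) / s ^ n) * (std_normal_density (0 + s * z) * \<bar>0 + s * z\<bar> ^ n))"
    using lborel_integrable_real_affine[of "\<lambda>z. std_normal_density z * \<bar>z\<bar> ^ n" s 0] s
    by (intro integrable_mult_right) auto
  then show ?thesis
    using s by (simp add: std_normal_density_def power_mult_distrib abs_mult mult.commute)
qed

text \<open>Rescaling the frequency by \<open>s\<close> turns the integral into a Gaussian moment at \<open>u / s\<close>.\<close>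

lemma fourier_hermite:
  fixes s u :: real
  assumes s: "0 < s"
  shows "(\<integral>z. cis (- (z * u)) * of_real ((- z) ^ n * exp (- (s\<^sup>2 * z\<^sup>2) / 2)) \<partial>lborel) =
    2 * pi * \<i> ^ n * of_real (hermite_gauss n u s)"
proof -
  let ?g = "\<lambda>z. (\<i> * of_real z) ^ n * cis (z * (u / s))"
  have "(\<integral>z. cis (- (z * u)) * of_real ((- z) ^ n * exp (- (s\<^sup>2 * z\<^sup>2) / 2)) \<partial>lborel) =
      \<bar>- (1 / s)\<bar> *\<^sub>R (\<integral>z. cis (- ((0 + (- (1 / s)) * z) * u)) *
        of_real ((- (0 + (- (1 / s)) * z)) ^ n * exp (- (s\<^sup>2 * (0 + (- (1 / s)) * z)\<^sup>2) / 2)) \<partial>lborel)"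
    using s by (intro lborel_integral_real_affine) simp
  also have "\<dots> = (1 / s) *\<^sub>R (\<integral>z. ((-\<i>) ^ n * of_real (sqrt (2 * pi) / s ^ n)) * (std_normal_density z *\<^sub>R ?g z) \<partial>lborel)"
  proof (intro arg_cong2[where f=scaleR] Bochner_Integration.integral_cong refl)
    show "\<bar>- (1 / s)\<bar> = 1 / s" using s by simp
    fix z :: real
    have "(-\<i>) ^ n * (\<i> * complex_of_real z) ^ n = of_real (z ^ n)"
      by (simp add: power_mult_distrib[symmetric])
    then have "(-\<i>) ^ n * of_real (sqrt (2 * pi) / s ^ n) * (std_normal_density z *\<^sub>R ?g z) =
        of_real (z ^ n) * of_real (sqrt (2 * pi) / s ^ n) * of_real (std_normal_density z) * cis (z * (u / s))"
      by (simp add: scaleR_conv_of_real mult_ac)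
    also have "\<dots> = cis (z * (u / s)) * of_real ((z / s) ^ n * (sqrt (2 * pi) * std_normal_density z))"
      by (simp add: power_divide)
    also have "\<dots> = cis (- ((0 + (- (1 / s)) * z) * u)) *
        of_real ((- (0 + (- (1 / s)) * z)) ^ n * exp (- (s\<^sup>2 * (0 + (- (1 / s)) * z)\<^sup>2) / 2))"
      unfolding exp_square_eq_std_normal[symmetric] using s by (simp add: power_mult_distrib power_divide)
    finally show "cis (- ((0 + (- (1 / s)) * z) * u)) *
        of_real ((- (0 + (- (1 / s)) * z)) ^ n * exp (- (s\<^sup>2 * (0 + (- (1 / s)) * z)\<^sup>2) / 2)) =
        (-\<i>) ^ n * of_real (sqrt (2 * pi) / s ^ n) * (std_normal_density z *\<^sub>R ?g z)" by simp
  qed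
  also have "\<dots> = (1 / s) *\<^sub>R ((-\<i>) ^ n * of_real (sqrt (2 * pi) / s ^ n) * (\<integral>z. std_normal_density z *\<^sub>R ?g z \<partial>lborel))"
    by (simp only: integral_mult_right_zero)
  also have "(\<integral>z. std_normal_density z *\<^sub>R ?g z \<partial>lborel) = gauss_moment n (u / s)"
    unfolding gauss_moment_def by (rule integral_density[symmetric]) auto
  also have "gauss_moment n (u / s) = (-1) ^ n * of_real (s ^ Suc n * sqrt (2 * pi)) * of_real (hermite_gauss n u s)"
    unfolding hermite_gauss_eq[OF s] using s by (simp add: power_mult_distrib[symmetric])
  also have "(1 / s) *\<^sub>R ((-\<i>) ^ n * of_real (sqrt (2 * pi) / s ^ n) *
      ((-1) ^ n * of_real (s ^ Suc n * sqrt (2 * pi)) * of_real (hermite_gauss n u s))) =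
      ((-\<i>) ^ n * (-1) ^ n) * of_real (1 / s * (sqrt (2 * pi) / s ^ n) * (s ^ Suc n * sqrt (2 * pi))) *
        of_real (hermite_gauss n u s)"
    by (simp only: scaleR_conv_of_real of_real_mult mult_ac)
  also have "(-\<i>) ^ n * (-1) ^ n = \<i> ^ n" by (simp add: power_mult_distrib[symmetric])
  also have "1 / s * (sqrt (2 * pi) / s ^ n) * (s ^ Suc n * sqrt (2 * pi)) = sqrt (2 * pi) * sqrt (2 * pi)"
    using s by simp
  also have "\<dots> = 2 * pi" by simp
  finally show ?thesis by simp
qed

lemma fourier_gauss_kernel:
  assumes "0 < \<epsilon>"
  shows "of_real (gauss_kernel \<epsilon> y) = (1 / (2 * pi)) * (\<integral>z. cis (z * y) * of_real (exp (- (\<epsilon> * z\<^sup>2) / 2)) \<partial>lborel)"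
proof -
  have h: "hermite_gauss 0 (- y) (sqrt \<epsilon>) = gauss_kernel \<epsilon> y"
    using assms by (simp add: hermite_gauss_def hermite_def exp_minus gauss_kernel_def)
  show ?thesis
    using fourier_hermite[of "sqrt \<epsilon>" "- y" 0] assms by (simp add: h)
qed

context prob_space
begin

lemma normal_characters:
  assumes d: "0 < d" and X: "distributed M lborel X (normal_density 0 (sqrt d))"
  shows "integrable M X" "integrable M (\<lambda>\<omega>. (X \<omega>)\<^sup>2)" "expectation X = 0" "expectation (\<lambda>\<omega>. (X \<omega>)\<^sup>2) = d"
    "(\<integral>\<omega>. cis (a * X \<omega>) \<partial>M) = of_real (exp (- (a\<^sup>2 * d) / 2))"
    "(\<integral>\<omega>. of_real (X \<omega>) * cis (a * X \<omega>) \<partial>M) = \<i> * of_real (a * d * exp (- (a\<^sup>2 * d) / 2))"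
proof -
  define Z where "Z \<omega> = X \<omega> / sqrt d" for \<omega>
  have XZ: "X \<omega> = sqrt d * Z \<omega>" for \<omega> using d by (simp add: Z_def)
  have "distributed M lborel Z std_normal_density"
    unfolding Z_def[abs_def] using normal_standard_normal_convert[of "sqrt d" X 0] d X by simp
  then have [measurable]: "Z \<in> borel_measurable M" and distr: "distr M lborel Z = std_normal_distribution"
    by (auto simp: distributed_def)
  have tr: "(\<integral>\<omega>. f (Z \<omega>) \<partial>M) = (\<integral>z. f z \<partial>std_normal_distribution)"
    "integrable M (\<lambda>\<omega>. f (Z \<omega>)) \<longleftrightarrow> integrable std_normal_distribution f"
    if "f \<in> borel_measurable borel" for f :: "real \<Rightarrow> 'b::{banach, second_countable_topology}"
    unfolding distr[symmetric] using that by (simp_all add: integral_distr integrable_distr_eq)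
  have mom: "integrable M (\<lambda>\<omega>. Z \<omega> ^ k)" for k
    using tr(2)[of "\<lambda>z. z ^ k"] integrable_std_normal_distribution_moment[of k] by simp
  show "integrable M X" unfolding XZ[abs_def] using mom[of 1] by simp
  show "integrable M (\<lambda>\<omega>. (X \<omega>)\<^sup>2)" unfolding XZ power_mult_distrib using mom[of 2] by simp
  show "expectation X = 0"
    unfolding XZ[abs_def] using tr(1)[of "\<lambda>z. z"] integral_std_normal_distribution_moment_odd[of 1] by simp
  show "expectation (\<lambda>\<omega>. (X \<omega>)\<^sup>2) = d"
    unfolding XZ power_mult_distrib
    using d tr(1)[of "\<lambda>z. z\<^sup>2"] std_normal_distribution_even_moments(1)[of 1] by simp
  have "(\<integral>\<omega>. cis (a * X \<omega>) \<partial>M) = (\<integral>z. cis (z * (a * sqrt d)) \<partial>std_normal_distribution)"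
    unfolding XZ using tr(1)[of "\<lambda>z. cis (z * (a * sqrt d))"] by (simp add: mult_ac)
  also have "\<dots> = gauss_moment 0 (a * sqrt d)" by (simp add: gauss_moment_def)
  also have "\<dots> = of_real (exp (- (a\<^sup>2 * d) / 2))" using d by (simp add: gauss_moment_0 power_mult_distrib)
  finally show "(\<integral>\<omega>. cis (a * X \<omega>) \<partial>M) = of_real (exp (- (a\<^sup>2 * d) / 2))" .
  have der: "deriv (\<lambda>y. exp (- y\<^sup>2 / 2)) x = - x * exp (- x\<^sup>2 / 2)" for x :: real
    by (rule DERIV_imp_deriv) (auto intro!: derivative_eq_intros)
  have sq: "complex_of_real (sqrt d) * complex_of_real (sqrt d) = complex_of_real d"
    using d by (simp only: of_real_mult[symmetric] real_sqrt_mult_self abs_of_pos)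
  have "(\<integral>\<omega>. of_real (X \<omega>) * cis (a * X \<omega>) \<partial>M) =
      (\<integral>z. (- \<i> * of_real (sqrt d)) * ((\<i> * of_real z) ^ 1 * cis (z * (a * sqrt d))) \<partial>std_normal_distribution)"
    unfolding XZ using tr(1)[of "\<lambda>z. (- \<i> * of_real (sqrt d)) * ((\<i> * of_real z) ^ 1 * cis (z * (a * sqrt d)))"]
    by (simp add: mult_ac)
  also have "\<dots> = (- \<i> * of_real (sqrt d)) * gauss_moment 1 (a * sqrt d)"
    unfolding gauss_moment_def by (rule integral_mult_right_zero)
  also have "\<dots> = \<i> * of_real (a * d * exp (- (a\<^sup>2 * d) / 2))"
    unfolding gauss_moment_eq_deriv funpow_simps_right funpow_0 o_apply One_nat_def id_apply der
    using d sq by (simp add: power_mult_distrib mult_ac)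
  finally show "(\<integral>\<omega>. of_real (X \<omega>) * cis (a * X \<omega>) \<partial>M) = \<i> * of_real (a * d * exp (- (a\<^sup>2 * d) / 2))" .
qed

lemma integrable_cis: "X \<in> borel_measurable M \<Longrightarrow> integrable M (\<lambda>\<omega>. cis (X \<omega>))"
  by (rule integrable_const_bound[where B=1]) auto

end

section \<open>Increments of the Wiener process over a grid\<close>

definition increment_product :: "(real \<Rightarrow> 'a \<Rightarrow> real) \<Rightarrow> nat \<Rightarrow> (nat \<Rightarrow> real) \<Rightarrow> (nat \<Rightarrow> real) \<Rightarrow> 'a \<Rightarrow> real" where
  "increment_product w n l r \<omega> = (\<Prod>i<n. w (r i) \<omega> - w (l i) \<omega>)"

lemma step_integral_products:
  "step_integral w n S \<omega> = (\<Sum>(c, l, r) \<leftarrow> S. c * increment_product w n l r \<omega>)"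
  by (simp add: step_integral_def increment_product_def)

lemma finite_set_enumeration:
  fixes P :: "'b::linorder set"
  assumes "finite P"
  shows "\<exists>q. strict_mono_on {..<card P} q \<and> q ` {..<card P} = P"
proof (intro exI conjI)
  let ?xs = "sorted_list_of_set P"
  have len: "length ?xs = card P" by simp
  show "strict_mono_on {..<card P} (\<lambda>i. ?xs ! i)"
    using len sorted_wrt_nth_less[of "(<)" ?xs] strict_sorted_list_of_set[of P]
    by (auto simp: monotone_on_def)
  have "(\<lambda>i. ?xs ! i) ` {..<card P} = set ?xs" using len by (auto simp: set_conv_nth image_iff)
  then show "(\<lambda>i. ?xs ! i) ` {..<card P} = P" using assms by simp
qed

lemma finite_set_as_grid:
  fixes P :: "real set"
  assumes "finite P" "P \<noteq> {}"
  shows "\<exists>(N::nat) q. strict_mono_on {..N} q \<and> q ` {..N} = P"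
proof -
  have "0 < card P" using assms by (simp add: card_gt_0_iff)
  then have "{..card P - 1} = {..<card P}" by auto
  moreover obtain q where "strict_mono_on {..<card P} q" "q ` {..<card P} = P"
    using finite_set_enumeration[OF assms(1)] by blast
  ultimately have "strict_mono_on {..card P - 1} q \<and> q ` {..card P - 1} = P" by simp
  then show ?thesis by blast
qed

text \<open>
  A set of cells remembers the increasing list of its members, so different choices of cells give
  different products.
\<close>

lemma strict_mono_enumerations_eq:
  fixes f g :: "nat \<Rightarrow> nat" and n m :: nat
  assumes "strict_mono_on {..<n} f" "strict_mono_on {..<m} g" "f ` {..<n} = g ` {..<m}"
  shows "n = m \<and> (\<forall>i<n. f i = g i)"
proof -
  have inj: "inj_on f {..<n}" "inj_on g {..<m}"
    by (rule strict_mono_on_imp_inj_on[OF assms(1)], rule strict_mono_on_imp_inj_on[OF assms(2)])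
  have nm: "n = m" using card_image[OF inj(1)] card_image[OF inj(2)] assms(3) by simp
  have s: "sorted_wrt (<) (map h [0..<k])" if "strict_mono_on {..<k} h" for h :: "nat \<Rightarrow> nat" and k
    unfolding sorted_wrt_iff_nth_less using that by (auto simp: strict_mono_on_def)
  have "map f [0..<n] = map g [0..<m]"
    using s[OF assms(1)] s[OF assms(2)] assms(3)
    by (intro sorted_distinct_set_unique) (simp_all add: strict_sorted_iff atLeast0LessThan)
  then show ?thesis using nm by (auto simp: map_eq_conv)
qed

text \<open>From \<open>ln (1 + x) \<ge> x - x\<^sup>2\<close>: a product over a fine grid is close to the exponential of the sum.\<close>

lemma one_plus_ge_exp_quadratic:
  fixes x :: "nat \<Rightarrow> real"
  assumes x: "\<And>k. k < N \<Longrightarrow> 0 \<le> x k" "\<And>k. k < N \<Longrightarrow> x k \<le> e" and e: "e \<le> 1" and v: "v = (\<Sum>k<N. x k)"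
  shows "exp v - (\<Prod>k<N. 1 + x k) \<le> exp v * (e * v)"
proof -
  have "exp (x k - e * x k) \<le> 1 + x k" if k: "k < N" for k
  proof -
    have "x k - e * x k \<le> x k - (x k)\<^sup>2"
      using x[OF k] by (simp add: power2_eq_square mult_right_mono)
    also have "\<dots> \<le> ln (1 + x k)" using x[OF k] e by (intro ln_one_plus_pos_lower_bound) auto
    finally have "exp (x k - e * x k) \<le> exp (ln (1 + x k))" by simp
    also have "\<dots> = 1 + x k" using x(1)[OF k] by simp
    finally show ?thesis .
  qed
  then have "(\<Prod>k<N. exp (x k - e * x k)) \<le> (\<Prod>k<N. 1 + x k)" by (intro prod_mono) auto
  also have "(\<Prod>k<N. exp (x k - e * x k)) = exp (v - e * v)"
    by (simp add: exp_sum[symmetric] sum_subtractf sum_distrib_left v)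
  also have "exp (v - e * v) = exp v * exp (- (e * v))" by (simp add: exp_add[symmetric])
  finally have "exp v * exp (- (e * v)) \<le> (\<Prod>k<N. 1 + x k)" .
  moreover have "exp v * (1 - e * v) \<le> exp v * exp (- (e * v))"
    using exp_ge_add_one_self[of "- (e * v)"] by (intro mult_left_mono) auto
  ultimately show ?thesis by (simp add: algebra_simps)
qed

text \<open>
  A grid is a partition of a subinterval into cells of positive length. Every finite set of boxes
  with ordered corners is adapted to some grid, and over a grid all products of increments become
  polynomials in finitely many independent normal variables.
\<close>

locale wiener_grid = wiener_process M w for M :: "'a measure" and w +
  fixes N :: nat and q :: "nat \<Rightarrow> real"
  assumes mono_grid: "strict_mono_on {..N} q" and grid_01: "\<And>k. k \<le> N \<Longrightarrow> q k \<in> {0..1}"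
begin

definition cell :: "nat \<Rightarrow> 'a \<Rightarrow> real" where "cell k \<omega> = w (q (Suc k)) \<omega> - w (q k) \<omega>"

definition len :: "nat \<Rightarrow> real" where "len k = q (Suc k) - q k"

lemma grid_less: "i < j \<Longrightarrow> j \<le> N \<Longrightarrow> q i < q j"
  using mono_grid by (auto simp: strict_mono_on_def)

lemma grid_le: "i \<le> j \<Longrightarrow> j \<le> N \<Longrightarrow> q i \<le> q j"
  using grid_less[of i j] by (cases "i = j") auto

lemma grid_le_iff: "i \<le> N \<Longrightarrow> j \<le> N \<Longrightarrow> q i \<le> q j \<longleftrightarrow> i \<le> j"
  using grid_less[of j i] grid_le[of i j] by (meson not_le)

lemma len_pos: "k < N \<Longrightarrow> 0 < len k"
  using grid_less[of k "Suc k"] by (simp add: len_def)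

lemma cell_indep: "indep_vars (\<lambda>_. borel) cell {..<N}"
  unfolding cell_def[abs_def]
  by (rule indep_increments) (use grid_01 grid_le in \<open>auto simp: monotone_on_def\<close>)

lemma cell_normal: "k < N \<Longrightarrow> distributed M lborel (cell k) (normal_density 0 (sqrt (len k)))"
  unfolding cell_def[abs_def] len_def using grid_01[of k] grid_01[of "Suc k"] grid_less[of k "Suc k"]
  by (intro normal_increments) auto

lemma cell_measurable: "k < N \<Longrightarrow> cell k \<in> borel_measurable M"
  using cell_normal[of k] by (auto simp: distributed_def)

lemmas cell_moments = normal_characters[OF len_pos cell_normal]

lemma cell_product:
  fixes \<phi> :: "nat \<Rightarrow> real \<Rightarrow> 'b::{real_normed_field, banach, second_countable_topology}"
  assumes m: "\<And>k. k < N \<Longrightarrow> \<phi> k \<in> borel_measurable borel"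
    and i: "\<And>k. k < N \<Longrightarrow> integrable M (\<lambda>\<omega>. \<phi> k (cell k \<omega>))"
  shows "(\<integral>\<omega>. (\<Prod>k<N. \<phi> k (cell k \<omega>)) \<partial>M) = (\<Prod>k<N. \<integral>\<omega>. \<phi> k (cell k \<omega>) \<partial>M)"
    "integrable M (\<lambda>\<omega>. \<Prod>k<N. \<phi> k (cell k \<omega>))"
proof -
  have "indep_vars (\<lambda>_. borel) (\<lambda>k \<omega>. \<phi> k (cell k \<omega>)) {..<N}"
    using m by (intro indep_vars_compose2[OF cell_indep]) auto
  then show "(\<integral>\<omega>. (\<Prod>k<N. \<phi> k (cell k \<omega>)) \<partial>M) = (\<Prod>k<N. \<integral>\<omega>. \<phi> k (cell k \<omega>) \<partial>M)"
    "integrable M (\<lambda>\<omega>. \<Prod>k<N. \<phi> k (cell k \<omega>))"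
    using i by (auto intro!: indep_vars_lebesgue_integral indep_vars_integrable)
qed

lemma sum_cells: "a \<le> b \<Longrightarrow> b \<le> N \<Longrightarrow> w (q b) \<omega> - w (q a) \<omega> = (\<Sum>k\<in>{a..<b}. cell k \<omega>)"
  unfolding cell_def by (subst sum_Suc_diff') auto

lemma sum_len: "a \<le> b \<Longrightarrow> (\<Sum>k\<in>{a..<b}. len k) = q b - q a"
  unfolding len_def by (subst sum_Suc_diff') auto

lemma prod_subset_as_all:
  "K \<subseteq> {..<N} \<Longrightarrow> (\<Prod>k\<in>K. f k) = (\<Prod>k<N. if k \<in> K then f k else (1 :: 'b::comm_monoid_mult))"
  by (subst prod.inter_restrict[symmetric]) (simp_all add: Int_absorb1)

text \<open>A cell that occurs in only one of the two products has mean zero and is independent of the rest.\<close>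

lemma cells_orthogonal:
  assumes K: "K \<subseteq> {..<N}" "L \<subseteq> {..<N}"
  shows "(\<integral>\<omega>. (\<Prod>k\<in>K. cell k \<omega>) * (\<Prod>k\<in>L. cell k \<omega>) \<partial>M) = (if K = L then \<Prod>k\<in>K. len k else 0)"
    "integrable M (\<lambda>\<omega>. (\<Prod>k\<in>K. cell k \<omega>) * (\<Prod>k\<in>L. cell k \<omega>))"
proof -
  define \<phi> where "\<phi> k x = (if k \<in> K then x else 1) * (if k \<in> L then x else (1::real))" for k x
  have eq: "(\<Prod>k\<in>K. cell k \<omega>) * (\<Prod>k\<in>L. cell k \<omega>) = (\<Prod>k<N. \<phi> k (cell k \<omega>))" for \<omega>
    unfolding prod_subset_as_all[OF K(1)] prod_subset_as_all[OF K(2)] \<phi>_def by (simp add: prod.distrib)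
  have m: "\<phi> k \<in> borel_measurable borel" for k
    unfolding \<phi>_def by (cases "k \<in> K"; cases "k \<in> L") simp_all
  have i: "integrable M (\<lambda>\<omega>. \<phi> k (cell k \<omega>))" if "k < N" for k
    unfolding \<phi>_def using cell_moments(1,2)[OF that that]
    by (cases "k \<in> K"; cases "k \<in> L") (simp_all add: power2_eq_square)
  have v: "(\<integral>\<omega>. \<phi> k (cell k \<omega>) \<partial>M) = (if k \<in> K \<and> k \<in> L then len k else if k \<in> K \<or> k \<in> L then 0 else 1)"
    if "k < N" for k
    unfolding \<phi>_def using cell_moments(3,4)[OF that that]
    by (cases "k \<in> K"; cases "k \<in> L") (simp_all add: power2_eq_square prob_space)
  show "integrable M (\<lambda>\<omega>. (\<Prod>k\<in>K. cell k \<omega>) * (\<Prod>k\<in>L. cell k \<omega>))"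
    unfolding eq by (rule cell_product(2)[OF m i])
  have "(\<integral>\<omega>. (\<Prod>k\<in>K. cell k \<omega>) * (\<Prod>k\<in>L. cell k \<omega>) \<partial>M) = (\<Prod>k<N. \<integral>\<omega>. \<phi> k (cell k \<omega>) \<partial>M)"
    unfolding eq by (rule cell_product(1)[OF m i])
  also have "\<dots> = (\<Prod>k<N. if k \<in> K \<and> k \<in> L then len k else if k \<in> K \<or> k \<in> L then 0 else 1)"
    using v by (intro prod.cong) auto
  also have "\<dots> = (if K = L then \<Prod>k\<in>K. len k else 0)"
  proof (cases "K = L")
    case True
    then show ?thesis unfolding True prod_subset_as_all[OF K(2)] by (auto intro!: prod.cong)
  next
    case False
    then obtain k where "k < N" "(k \<in> K) \<noteq> (k \<in> L)" using K by blast
    then have "(\<Prod>k<N. if k \<in> K \<and> k \<in> L then len k else if k \<in> K \<or> k \<in> L then 0 else 1) = 0"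
      by (intro prod_zero bexI[of _ k]) auto
    then show ?thesis using False by simp
  qed
  finally show "(\<integral>\<omega>. (\<Prod>k\<in>K. cell k \<omega>) * (\<Prod>k\<in>L. cell k \<omega>) \<partial>M) = (if K = L then \<Prod>k\<in>K. len k else 0)" .
qed

text \<open>Indices into the grid of the corners of a box with ordered corners.\<close>

definition adapted :: "nat \<Rightarrow> (nat \<Rightarrow> nat) \<Rightarrow> (nat \<Rightarrow> nat) \<Rightarrow> bool" where
  "adapted n a b \<longleftrightarrow> (\<forall>i<n. a i \<le> b i \<and> b i \<le> N \<and> (Suc i < n \<longrightarrow> b i \<le> a (Suc i)))"

text \<open>
  One cell from each side of the box: multiplying out a product of increments, each of which is a sum
  of cells, gives a sum over these choices.
\<close>

definition choices :: "nat \<Rightarrow> (nat \<Rightarrow> nat) \<Rightarrow> (nat \<Rightarrow> nat) \<Rightarrow> (nat \<Rightarrow> nat) set" where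
  "choices n a b = (\<Pi>\<^sub>E i\<in>{..<n}. {a i..<b i})"

lemma finite_choices: "finite (choices n a b)"
  unfolding choices_def by (intro finite_PiE) auto

lemma adapted_less:
  assumes "adapted n a b" "j < n" "i < j"
  shows "b i \<le> a j"
  using assms(3,2)
proof (induction j)
  case (Suc j)
  have step: "b j \<le> a (Suc j)" "a j \<le> b j" using assms(1) Suc.prems by (auto simp: adapted_def)
  show ?case
  proof (cases "i = j")
    case False
    then have "b i \<le> a j" using Suc by simp
    then show ?thesis using step by simp
  qed (use step in simp)
qed simp

lemma choices_range: "f \<in> choices n a b \<Longrightarrow> i < n \<Longrightarrow> a i \<le> f i \<and> f i < b i"
  unfolding choices_def by (drule PiE_mem[where x=i]) auto

lemma choices_strict_mono:
  assumes "adapted n a b" "f \<in> choices n a b"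
  shows "strict_mono_on {..<n} f"
proof (rule strict_mono_onI)
  fix i j assume ij: "i \<in> {..<n}" "j \<in> {..<n}" "i < j"
  have "f i < b i" using choices_range[OF assms(2), of i] ij by simp
  also have "\<dots> \<le> a j" using adapted_less[OF assms(1)] ij by simp
  also have "\<dots> \<le> f j" using choices_range[OF assms(2), of j] ij by simp
  finally show "f i < f j" .
qed

lemma choices_image:
  assumes "adapted n a b" "f \<in> choices n a b"
  shows "f ` {..<n} \<subseteq> {..<N}"
proof
  fix k assume "k \<in> f ` {..<n}"
  then obtain i where i: "i < n" "k = f i" by auto
  then have "f i < b i" using choices_range[OF assms(2)] by blast
  also have "b i \<le> N" using assms(1) i by (simp add: adapted_def)
  finally show "k \<in> {..<N}" using i by simp
qed

abbreviation grid_product :: "nat \<Rightarrow> (nat \<Rightarrow> nat) \<Rightarrow> (nat \<Rightarrow> nat) \<Rightarrow> 'a \<Rightarrow> real" where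
  "grid_product n a b \<equiv> increment_product w n (\<lambda>i. q (a i)) (\<lambda>i. q (b i))"

lemma increment_product_cells:
  assumes ad: "adapted n a b"
  shows "grid_product n a b \<omega> =
    (\<Sum>f\<in>choices n a b. \<Prod>k\<in>f ` {..<n}. cell k \<omega>)"
proof -
  have "grid_product n a b \<omega> = (\<Prod>i<n. \<Sum>k\<in>{a i..<b i}. cell k \<omega>)"
    unfolding increment_product_def using ad by (intro prod.cong refl sum_cells) (auto simp: adapted_def)
  also have "\<dots> = (\<Sum>f\<in>choices n a b. \<Prod>i<n. cell (f i) \<omega>)"
    unfolding choices_def by (rule prod_sum_PiE) auto
  also have "\<dots> = (\<Sum>f\<in>choices n a b. \<Prod>k\<in>f ` {..<n}. cell k \<omega>)"
    using strict_mono_on_imp_inj_on[OF choices_strict_mono[OF ad]]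
    by (intro sum.cong refl) (simp add: prod.reindex)
  finally show ?thesis .
qed

lemma choices_eqI:
  assumes "f \<in> choices n a b" "g \<in> choices n a' b'" "\<forall>i<n. f i = g i"
  shows "f = g"
proof (rule extensionalityI)
  show "f \<in> extensional {..<n}" "g \<in> extensional {..<n}"
    using assms(1,2) by (simp_all add: choices_def PiE_def)
  show "f i = g i" if "i \<in> {..<n}" for i using assms(3) that by simp
qed

text \<open>
  Expanding both products over the grid leaves only the pairs of equal choices of cells; these are
  the cells in the intersection of the two boxes.
\<close>

lemma increment_products_inner:
  assumes ad: "adapted n a b" "adapted m a' b'"
  shows "(\<integral>\<omega>. grid_product n a b \<omega> *
      grid_product m a' b' \<omega> \<partial>M) =
    (if n = m then \<Prod>i<n. max 0 (min (q (b i)) (q (b' i)) - max (q (a i)) (q (a' i))) else 0)"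
    and "integrable M (\<lambda>\<omega>. grid_product n a b \<omega> *
      grid_product m a' b' \<omega>)"
proof -
  let ?C = "choices n a b" and ?C' = "choices m a' b'"
  let ?W = "\<lambda>f n \<omega>. \<Prod>k\<in>f ` {..<n::nat}. cell k \<omega>"
  have eq: "grid_product n a b \<omega> *
      grid_product m a' b' \<omega> = (\<Sum>f\<in>?C. \<Sum>g\<in>?C'. ?W f n \<omega> * ?W g m \<omega>)" for \<omega>
    unfolding increment_product_cells[OF ad(1)] increment_product_cells[OF ad(2)] sum_product ..
  note im = choices_image[OF ad(1)] choices_image[OF ad(2)]
  have int: "integrable M (\<lambda>\<omega>. ?W f n \<omega> * ?W g m \<omega>)" if "f \<in> ?C" "g \<in> ?C'" for f g
    by (rule cells_orthogonal(2)[OF im(1)[OF that(1)] im(2)[OF that(2)]])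
  show "integrable M (\<lambda>\<omega>. grid_product n a b \<omega> *
      grid_product m a' b' \<omega>)"
    unfolding eq by (intro Bochner_Integration.integrable_sum int)
  have "(\<integral>\<omega>. (\<Sum>f\<in>?C. \<Sum>g\<in>?C'. ?W f n \<omega> * ?W g m \<omega>) \<partial>M) =
      (\<Sum>f\<in>?C. \<integral>\<omega>. (\<Sum>g\<in>?C'. ?W f n \<omega> * ?W g m \<omega>) \<partial>M)"
    by (intro Bochner_Integration.integral_sum Bochner_Integration.integrable_sum int)
  also have "\<dots> = (\<Sum>f\<in>?C. \<Sum>g\<in>?C'. \<integral>\<omega>. ?W f n \<omega> * ?W g m \<omega> \<partial>M)"
    by (intro sum.cong refl Bochner_Integration.integral_sum int)
  also have "\<dots> = (\<Sum>f\<in>?C. \<Sum>g\<in>?C'. if f ` {..<n} = g ` {..<m} then \<Prod>k\<in>f ` {..<n}. len k else 0)"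
    by (intro sum.cong refl cells_orthogonal(1) im)
  also have "\<dots> = (if n = m then \<Prod>i<n. max 0 (min (q (b i)) (q (b' i)) - max (q (a i)) (q (a' i))) else 0)"
  proof (cases "n = m")
    case False
    have "f ` {..<n} \<noteq> g ` {..<m}" if "f \<in> ?C" "g \<in> ?C'" for f g
      using strict_mono_enumerations_eq[OF choices_strict_mono[OF ad(1) that(1)] choices_strict_mono[OF ad(2) that(2)]]
        False by blast
    then show ?thesis using False by (intro trans[OF sum.neutral]) (auto intro!: sum.neutral)
  next
    case True
    have "(\<Sum>f\<in>?C. \<Sum>g\<in>?C'. if f ` {..<n} = g ` {..<m} then \<Prod>k\<in>f ` {..<n}. len k else 0) =
        (\<Sum>f\<in>?C. \<Sum>g\<in>?C'. if g = f then \<Prod>i<n. len (f i) else 0)"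
    proof (intro sum.cong refl)
      fix f g assume fg: "f \<in> ?C" "g \<in> ?C'"
      have "f ` {..<n} = g ` {..<m} \<longleftrightarrow> g = f"
      proof
        assume "f ` {..<n} = g ` {..<m}"
        then have "\<forall>i<n. f i = g i"
          using strict_mono_enumerations_eq[OF choices_strict_mono[OF ad(1) fg(1)] choices_strict_mono[OF ad(2) fg(2)]]
          by blast
        then show "g = f" using choices_eqI[of f n a b g a' b'] fg True by simp
      qed (use True in simp)
      moreover have "(\<Prod>k\<in>f ` {..<n}. len k) = (\<Prod>i<n. len (f i))"
        using strict_mono_on_imp_inj_on[OF choices_strict_mono[OF ad(1) fg(1)]] by (simp add: prod.reindex)
      ultimately show "(if f ` {..<n} = g ` {..<m} then \<Prod>k\<in>f ` {..<n}. len k else 0) =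
          (if g = f then \<Prod>i<n. len (f i) else 0)" by simp
    qed
    also have "\<dots> = (\<Sum>f\<in>?C. if f \<in> ?C' then \<Prod>i<n. len (f i) else 0)"
      by (intro sum.cong refl) (simp add: finite_choices)
    also have "\<dots> = (\<Sum>f\<in>?C \<inter> ?C'. \<Prod>i<n. len (f i))"
      by (rule sum.inter_restrict[symmetric]) (rule finite_choices)
    also have "?C \<inter> ?C' = (\<Pi>\<^sub>E i\<in>{..<n}. {max (a i) (a' i)..<min (b i) (b' i)})"
      unfolding choices_def True PiE_Int by (intro PiE_cong) auto
    also have "(\<Sum>f\<in>\<dots>. \<Prod>i<n. len (f i)) = (\<Prod>i<n. \<Sum>k\<in>{max (a i) (a' i)..<min (b i) (b' i)}. len k)"
      by (rule prod_sum_PiE[symmetric]) auto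
    also have "\<dots> = (\<Prod>i<n. max 0 (min (q (b i)) (q (b' i)) - max (q (a i)) (q (a' i))))"
    proof (intro prod.cong refl)
      fix i assume "i \<in> {..<n}"
      then have i: "i < n" "i < m" using True by auto
      have b: "a i \<le> N" "b i \<le> N" "a' i \<le> N" "b' i \<le> N"
        using ad i by (auto simp: adapted_def intro: order_trans)
      have mx: "max (q (a i)) (q (a' i)) = q (max (a i) (a' i))"
        using grid_le_iff[OF b(1,3)] grid_le_iff[OF b(3,1)] by (auto simp: max_def)
      have mn: "min (q (b i)) (q (b' i)) = q (min (b i) (b' i))"
        using grid_le_iff[OF b(2,4)] grid_le_iff[OF b(4,2)] by (auto simp: min_def)
      show "(\<Sum>k\<in>{max (a i) (a' i)..<min (b i) (b' i)}. len k) =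
          max 0 (min (q (b i)) (q (b' i)) - max (q (a i)) (q (a' i)))"
      proof (cases "max (a i) (a' i) \<le> min (b i) (b' i)")
        case True
        have "q (max (a i) (a' i)) \<le> q (min (b i) (b' i))" using True b by (intro grid_le) auto
        then show ?thesis unfolding mx mn sum_len[OF True] by simp
      next
        case False
        then have "q (min (b i) (b' i)) \<le> q (max (a i) (a' i))" using b by (intro grid_le) auto
        moreover have "(\<Sum>k\<in>{max (a i) (a' i)..<min (b i) (b' i)}. len k) = 0"
          using False by (intro sum.neutral ballI) (simp only: atLeastLessThan_iff, linarith)
        ultimately show ?thesis unfolding mx mn by simp
      qed
    qed
    finally show ?thesis using True by simp
  qed
  finally show "(\<integral>\<omega>. grid_product n a b \<omega> *
      grid_product m a' b' \<omega> \<partial>M) =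
    (if n = m then \<Prod>i<n. max 0 (min (q (b i)) (q (b' i)) - max (q (a i)) (q (a' i))) else 0)"
    unfolding eq .
qed

end

section \<open>Characters of first order step integrals\<close>

lemma cis_sum: "cis (\<Sum>k<n. f k) = (\<Prod>k<n. cis (f k))" for n :: nat
  by (induction n) (simp_all add: cis_mult[symmetric])

context wiener_grid
begin

definition linear :: "(nat \<Rightarrow> real) \<Rightarrow> 'a \<Rightarrow> real" where
  "linear h \<omega> = (\<Sum>k<N. h k * cell k \<omega>)"

definition variance_of :: "(nat \<Rightarrow> real) \<Rightarrow> real" where
  "variance_of h = (\<Sum>k<N. (h k)\<^sup>2 * len k)"

lemma cis_linear: "cis (linear h \<omega>) = (\<Prod>k<N. cis (h k * cell k \<omega>))"
  by (simp add: linear_def cis_sum)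

lemma cells_inner:
  assumes "j < N" "k < N"
  shows "(\<integral>\<omega>. cell j \<omega> * cell k \<omega> \<partial>M) = (if j = k then len k else 0)" "integrable M (\<lambda>\<omega>. cell j \<omega> * cell k \<omega>)"
  using cells_orthogonal[of "{j}" "{k}"] assms by auto

lemma linear_inner:
  assumes "a \<le> b" "b \<le> N"
  shows "(\<integral>\<omega>. (w (q b) \<omega> - w (q a) \<omega>) * linear h \<omega> \<partial>M) = (\<Sum>k\<in>{a..<b}. h k * len k)"
proof -
  have i: "integrable M (\<lambda>\<omega>. h k * (cell j \<omega> * cell k \<omega>))" if "j < N" "k < N" for j k
    using cells_inner(2)[OF that] by simp
  have "(\<integral>\<omega>. (w (q b) \<omega> - w (q a) \<omega>) * linear h \<omega> \<partial>M) =
      (\<integral>\<omega>. (\<Sum>j\<in>{a..<b}. \<Sum>k<N. h k * (cell j \<omega> * cell k \<omega>)) \<partial>M)"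
    unfolding sum_cells[OF assms] linear_def sum_product by (simp add: mult_ac)
  also have "\<dots> = (\<Sum>j\<in>{a..<b}. \<integral>\<omega>. (\<Sum>k<N. h k * (cell j \<omega> * cell k \<omega>)) \<partial>M)"
    using i assms by (intro Bochner_Integration.integral_sum Bochner_Integration.integrable_sum) auto
  also have "\<dots> = (\<Sum>j\<in>{a..<b}. \<Sum>k<N. \<integral>\<omega>. h k * (cell j \<omega> * cell k \<omega>) \<partial>M)"
    using i assms by (intro sum.cong refl Bochner_Integration.integral_sum) auto
  also have "\<dots> = (\<Sum>j\<in>{a..<b}. \<Sum>k<N. if k = j then h k * len k else 0)"
    using assms by (intro sum.cong refl) (simp add: cells_inner(1))
  also have "\<dots> = (\<Sum>j\<in>{a..<b}. h j * len j)" using assms by (intro sum.cong refl) simp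
  finally show ?thesis .
qed

lemma linear_second_moment: "(\<integral>\<omega>. (linear h \<omega>)\<^sup>2 \<partial>M) = variance_of h"
proof -
  have i: "integrable M (\<lambda>\<omega>. h j * h k * (cell j \<omega> * cell k \<omega>))" if "j < N" "k < N" for j k
    using cells_inner(2)[OF that] by simp
  have "(\<integral>\<omega>. (linear h \<omega>)\<^sup>2 \<partial>M) = (\<integral>\<omega>. (\<Sum>j<N. \<Sum>k<N. h j * h k * (cell j \<omega> * cell k \<omega>)) \<partial>M)"
    unfolding power2_eq_square linear_def sum_product by (simp add: mult_ac)
  also have "\<dots> = (\<Sum>j<N. \<integral>\<omega>. (\<Sum>k<N. h j * h k * (cell j \<omega> * cell k \<omega>)) \<partial>M)"
    using i by (intro Bochner_Integration.integral_sum Bochner_Integration.integrable_sum) auto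
  also have "\<dots> = (\<Sum>j<N. \<Sum>k<N. \<integral>\<omega>. h j * h k * (cell j \<omega> * cell k \<omega>) \<partial>M)"
    using i by (intro sum.cong refl Bochner_Integration.integral_sum) auto
  also have "\<dots> = (\<Sum>j<N. \<Sum>k<N. if k = j then h j * h k * len k else 0)"
    by (intro sum.cong refl) (simp add: cells_inner(1))
  also have "\<dots> = variance_of h" by (simp add: variance_of_def power2_eq_square)
  finally show ?thesis .
qed

lemma integrable_cell_cis: "k < N \<Longrightarrow> integrable M (\<lambda>\<omega>. of_real (cell k \<omega>) * cis (a * cell k \<omega>))"
proof (rule Bochner_Integration.integrable_bound)
  assume k: "k < N"
  note [measurable] = cell_measurable[OF k]
  show "integrable M (cell k)" by (rule cell_moments(1)[OF k k])
  show "(\<lambda>\<omega>. of_real (cell k \<omega>) * cis (a * cell k \<omega>)) \<in> borel_measurable M" by measurable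
qed (simp add: norm_mult)

lemma prod_exp_half: "(\<Prod>k<N. exp (- ((h k)\<^sup>2 * len k) / 2)) = exp (- variance_of h / 2)"
  by (simp add: variance_of_def exp_sum[symmetric] sum_negf sum_divide_distrib)

text \<open>
  By independence the expectation factors: a cell in \<open>K\<close> contributes the derivative of its
  characteristic function, any other cell the characteristic function itself.
\<close>

lemma cells_character:
  assumes K: "K \<subseteq> {..<N}"
  shows "(\<integral>\<omega>. of_real (\<Prod>k\<in>K. cell k \<omega>) * cis (linear h \<omega>) \<partial>M) =
      (\<Prod>k\<in>K. \<i> * of_real (h k * len k)) * of_real (exp (- variance_of h / 2))"
    "integrable M (\<lambda>\<omega>. of_real (\<Prod>k\<in>K. cell k \<omega>) * cis (linear h \<omega>))"
proof -
  define \<phi> :: "nat \<Rightarrow> real \<Rightarrow> complex" where "\<phi> k x = (if k \<in> K then of_real x else 1) * cis (h k * x)" for k x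
  have eq: "of_real (\<Prod>k\<in>K. cell k \<omega>) * cis (linear h \<omega>) = (\<Prod>k<N. \<phi> k (cell k \<omega>))" for \<omega>
    unfolding cis_linear of_real_prod prod_subset_as_all[OF K] \<phi>_def
    by (simp add: prod.distrib) (auto intro!: prod.cong)
  have m: "\<phi> k \<in> borel_measurable borel" for k
    unfolding \<phi>_def by (cases "k \<in> K") simp_all
  have i: "integrable M (\<lambda>\<omega>. \<phi> k (cell k \<omega>))" if "k < N" for k
    unfolding \<phi>_def using integrable_cell_cis[OF that] cell_measurable[OF that]
    by (cases "k \<in> K") (simp_all add: integrable_cis)
  have v: "(\<integral>\<omega>. \<phi> k (cell k \<omega>) \<partial>M) = (if k \<in> K then \<i> * of_real (h k * len k) else 1) *
      of_real (exp (- ((h k)\<^sup>2 * len k) / 2))" if "k < N" for k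
    unfolding \<phi>_def using cell_moments(5,6)[OF that that] by (cases "k \<in> K") simp_all
  show "integrable M (\<lambda>\<omega>. of_real (\<Prod>k\<in>K. cell k \<omega>) * cis (linear h \<omega>))"
    unfolding eq by (rule cell_product(2)[OF m i])
  have "(\<integral>\<omega>. of_real (\<Prod>k\<in>K. cell k \<omega>) * cis (linear h \<omega>) \<partial>M) = (\<Prod>k<N. \<integral>\<omega>. \<phi> k (cell k \<omega>) \<partial>M)"
    unfolding eq by (rule cell_product(1)[OF m i])
  also have "\<dots> = (\<Prod>k<N. (if k \<in> K then \<i> * of_real (h k * len k) else 1) *
      of_real (exp (- ((h k)\<^sup>2 * len k) / 2)))"
    using v by (intro prod.cong) auto
  also have "\<dots> = (\<Prod>k\<in>K. \<i> * of_real (h k * len k)) * of_real (\<Prod>k<N. exp (- ((h k)\<^sup>2 * len k) / 2))"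
    unfolding prod_subset_as_all[OF K] of_real_prod by (rule prod.distrib)
  finally show "(\<integral>\<omega>. of_real (\<Prod>k\<in>K. cell k \<omega>) * cis (linear h \<omega>) \<partial>M) =
      (\<Prod>k\<in>K. \<i> * of_real (h k * len k)) * of_real (exp (- variance_of h / 2))"
    unfolding prod_exp_half .
qed

lemma increment_product_character:
  assumes ad: "adapted n a b"
  shows "(\<integral>\<omega>. of_real (grid_product n a b \<omega>) * cis (linear h \<omega>) \<partial>M) =
    (\<Prod>i<n. \<i> * of_real (\<integral>\<omega>. (w (q (b i)) \<omega> - w (q (a i)) \<omega>) * linear h \<omega> \<partial>M)) *
      of_real (exp (- (\<integral>\<omega>. (linear h \<omega>)\<^sup>2 \<partial>M) / 2))"
proof -
  let ?C = "choices n a b"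
  note im = choices_image[OF ad]
  have "(\<integral>\<omega>. of_real (grid_product n a b \<omega>) * cis (linear h \<omega>) \<partial>M) =
      (\<integral>\<omega>. (\<Sum>f\<in>?C. of_real (\<Prod>k\<in>f ` {..<n}. cell k \<omega>) * cis (linear h \<omega>)) \<partial>M)"
    unfolding increment_product_cells[OF ad] of_real_sum sum_distrib_right ..
  also have "\<dots> = (\<Sum>f\<in>?C. \<integral>\<omega>. of_real (\<Prod>k\<in>f ` {..<n}. cell k \<omega>) * cis (linear h \<omega>) \<partial>M)"
    by (intro Bochner_Integration.integral_sum cells_character(2) im)
  also have "\<dots> = (\<Sum>f\<in>?C. (\<Prod>k\<in>f ` {..<n}. \<i> * of_real (h k * len k)) * of_real (exp (- variance_of h / 2)))"
    by (intro sum.cong refl cells_character(1) im)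
  also have "\<dots> = (\<Sum>f\<in>?C. (\<Prod>i<n. \<i> * of_real (h (f i) * len (f i)))) * of_real (exp (- variance_of h / 2))"
    unfolding sum_distrib_right using strict_mono_on_imp_inj_on[OF choices_strict_mono[OF ad]]
    by (intro sum.cong refl arg_cong2[where f="(*)"]) (simp add: prod.reindex)
  also have "(\<Sum>f\<in>?C. (\<Prod>i<n. \<i> * of_real (h (f i) * len (f i)))) =
      (\<Prod>i<n. \<Sum>k\<in>{a i..<b i}. \<i> * complex_of_real (h k * len k))"
    unfolding choices_def by (rule prod_sum_PiE[symmetric]) auto
  also have "\<dots> = (\<Prod>i<n. \<i> * of_real (\<integral>\<omega>. (w (q (b i)) \<omega> - w (q (a i)) \<omega>) * linear h \<omega> \<partial>M))"
    using ad by (intro prod.cong refl) (simp add: linear_inner adapted_def sum_distrib_left)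
  finally show ?thesis by (simp add: linear_second_moment)
qed

definition chaos_product :: "(nat \<Rightarrow> real) \<Rightarrow> 'a \<Rightarrow> complex" where
  "chaos_product h \<omega> = (\<Prod>k<N. 1 + \<i> * of_real (h k * cell k \<omega>))"

text \<open>
  The Wick exponential \<open>exp (\<i> X + E X\<^sup>2 / 2)\<close> of \<open>X = linear h\<close> differs from a product over the
  cells, which is a finite sum of step integrals, by an error that is computed exactly and that
  vanishes with the mesh.
\<close>

lemma chaos_product_distance:
  "(\<integral>\<omega>. (norm (of_real (exp (variance_of h / 2)) * cis (linear h \<omega>) - chaos_product h \<omega>))\<^sup>2 \<partial>M) =
    exp (variance_of h) - (\<Prod>k<N. 1 + (h k)\<^sup>2 * len k)"
  "integrable M (\<lambda>\<omega>. (norm (of_real (exp (variance_of h / 2)) * cis (linear h \<omega>) - chaos_product h \<omega>))\<^sup>2)"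
  "chaos_product h \<in> borel_measurable M"
proof -
  let ?e = "exp (variance_of h / 2)"
  have [measurable]: "k \<in> {..<N} \<Longrightarrow> cell k \<in> borel_measurable M" for k using cell_measurable by simp
  show [measurable]: "chaos_product h \<in> borel_measurable M"
    unfolding chaos_product_def[abs_def] by measurable
  define \<phi> where "\<phi> k x = cis (h k * x) * (1 - \<i> * of_real (h k * x))" for k x
  define \<psi> where "\<psi> k x = 1 + (h k * x)\<^sup>2" for k x
  have "continuous_on UNIV (\<phi> k)" for k unfolding \<phi>_def by (intro continuous_intros)
  then have m\<phi>: "\<phi> k \<in> borel_measurable borel" for k by (rule borel_measurable_continuous_onI)
  have i\<phi>: "integrable M (\<lambda>\<omega>. \<phi> k (cell k \<omega>))" if "k < N" for k
  proof -
    have "integrable M (\<lambda>\<omega>. cis (h k * cell k \<omega>) - (\<i> * of_real (h k)) * (of_real (cell k \<omega>) * cis (h k * cell k \<omega>)))"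
      using integrable_cell_cis[OF that] cell_measurable[OF that] by (intro Bochner_Integration.integrable_diff integrable_cis) auto
    then show ?thesis by (simp add: \<phi>_def algebra_simps)
  qed
  have v\<phi>: "(\<integral>\<omega>. \<phi> k (cell k \<omega>) \<partial>M) = of_real (exp (- ((h k)\<^sup>2 * len k) / 2) * (1 + (h k)\<^sup>2 * len k))" if "k < N" for k
  proof -
    have "(\<integral>\<omega>. \<phi> k (cell k \<omega>) \<partial>M) =
        (\<integral>\<omega>. cis (h k * cell k \<omega>) - (\<i> * of_real (h k)) * (of_real (cell k \<omega>) * cis (h k * cell k \<omega>)) \<partial>M)"
      by (simp add: \<phi>_def algebra_simps)
    also have "\<dots> = (\<integral>\<omega>. cis (h k * cell k \<omega>) \<partial>M) - (\<i> * of_real (h k)) * (\<integral>\<omega>. of_real (cell k \<omega>) * cis (h k * cell k \<omega>) \<partial>M)"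
      using integrable_cell_cis[OF that] cell_measurable[OF that]
      by (subst Bochner_Integration.integral_diff) (auto intro!: integrable_cis)
    also have "\<dots> = of_real (exp (- ((h k)\<^sup>2 * len k) / 2)) - (\<i> * of_real (h k)) * (\<i> * of_real (h k * len k * exp (- ((h k)\<^sup>2 * len k) / 2)))"
      unfolding cell_moments(5)[OF that that] cell_moments(6)[OF that that] ..
    also have "\<dots> = of_real (exp (- ((h k)\<^sup>2 * len k) / 2) * (1 + (h k)\<^sup>2 * len k))"
      by (simp add: algebra_simps power2_eq_square)
    finally show ?thesis .
  qed
  have i\<psi>: "integrable M (\<lambda>\<omega>. \<psi> k (cell k \<omega>))" if "k < N" for k
    unfolding \<psi>_def power_mult_distrib using cell_moments(2)[OF that that] by simp
  have v\<psi>: "(\<integral>\<omega>. \<psi> k (cell k \<omega>) \<partial>M) = 1 + (h k)\<^sup>2 * len k" if "k < N" for k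
    unfolding \<psi>_def power_mult_distrib using cell_moments(2,4)[OF that that] by (simp add: prob_space)
  have m\<psi>: "\<psi> k \<in> borel_measurable borel" for k unfolding \<psi>_def by measurable
  have cross: "cis (linear h \<omega>) * cnj (chaos_product h \<omega>) = (\<Prod>k<N. \<phi> k (cell k \<omega>))" for \<omega>
    by (simp add: cis_linear chaos_product_def \<phi>_def prod.distrib)
  have sq: "(norm (chaos_product h \<omega>))\<^sup>2 = (\<Prod>k<N. \<psi> k (cell k \<omega>))" for \<omega>
  proof -
    have n1: "(norm (1 + \<i> * of_real y))\<^sup>2 = 1 + y\<^sup>2" for y :: real by (simp add: cmod_power2)
    show ?thesis unfolding chaos_product_def \<psi>_def prod_norm[symmetric] prod_power_distrib n1 by (rule refl)
  qed
  have ic: "integrable M (\<lambda>\<omega>. cis (linear h \<omega>) * cnj (chaos_product h \<omega>))"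
    unfolding cross by (rule cell_product(2)[OF m\<phi> i\<phi>])
  have isq: "integrable M (\<lambda>\<omega>. (norm (chaos_product h \<omega>))\<^sup>2)"
    unfolding sq by (rule cell_product(2)[OF m\<psi> i\<psi>])
  have ee: "?e\<^sup>2 = exp (variance_of h)" by (simp add: power2_eq_square exp_add[symmetric])
  have expand: "(norm (of_real ?e * cis (linear h \<omega>) - chaos_product h \<omega>))\<^sup>2 =
      exp (variance_of h) + (norm (chaos_product h \<omega>))\<^sup>2 - 2 * ?e * Re (cis (linear h \<omega>) * cnj (chaos_product h \<omega>))" for \<omega>
  proof -
    have "(norm (a - b))\<^sup>2 = (norm a)\<^sup>2 + (norm b)\<^sup>2 - 2 * Re (a * cnj b)" for a b :: complex
      unfolding cmod_power2 by (simp add: power2_eq_square algebra_simps)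
    from this[of "of_real ?e * cis (linear h \<omega>)" "chaos_product h \<omega>"] show ?thesis
      by (simp add: norm_mult power_mult_distrib ee mult.assoc)
  qed
  have ir: "integrable M (\<lambda>\<omega>. Re (cis (linear h \<omega>) * cnj (chaos_product h \<omega>)))"
    using ic by (rule integrable_Re)
  show "integrable M (\<lambda>\<omega>. (norm (of_real ?e * cis (linear h \<omega>) - chaos_product h \<omega>))\<^sup>2)"
    unfolding expand using isq ir
    by (intro Bochner_Integration.integrable_diff Bochner_Integration.integrable_add integrable_mult_right) auto
  have "(\<integral>\<omega>. (norm (of_real ?e * cis (linear h \<omega>) - chaos_product h \<omega>))\<^sup>2 \<partial>M) =
      (\<integral>\<omega>. exp (variance_of h) + (norm (chaos_product h \<omega>))\<^sup>2 \<partial>M) -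
      (\<integral>\<omega>. 2 * ?e * Re (cis (linear h \<omega>) * cnj (chaos_product h \<omega>)) \<partial>M)"
    unfolding expand using isq ir
    by (intro Bochner_Integration.integral_diff Bochner_Integration.integrable_add integrable_mult_right) auto
  also have "(\<integral>\<omega>. exp (variance_of h) + (norm (chaos_product h \<omega>))\<^sup>2 \<partial>M) =
      exp (variance_of h) + (\<integral>\<omega>. (norm (chaos_product h \<omega>))\<^sup>2 \<partial>M)"
    using isq by (subst Bochner_Integration.integral_add) (simp_all add: prob_space)
  also have "(\<integral>\<omega>. (norm (chaos_product h \<omega>))\<^sup>2 \<partial>M) = (\<Prod>k<N. 1 + (h k)\<^sup>2 * len k)"
    unfolding sq by (rule trans[OF cell_product(1)[OF m\<psi> i\<psi>]]) (auto intro!: prod.cong simp: v\<psi>)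
  also have "(\<integral>\<omega>. 2 * ?e * Re (cis (linear h \<omega>) * cnj (chaos_product h \<omega>)) \<partial>M) =
      2 * ?e * Re (\<integral>\<omega>. cis (linear h \<omega>) * cnj (chaos_product h \<omega>) \<partial>M)"
    using ic by (simp only: integral_mult_right_zero integral_Re)
  also have "(\<integral>\<omega>. cis (linear h \<omega>) * cnj (chaos_product h \<omega>) \<partial>M) =
      of_real (exp (- variance_of h / 2) * (\<Prod>k<N. 1 + (h k)\<^sup>2 * len k))"
  proof -
    have "(\<integral>\<omega>. cis (linear h \<omega>) * cnj (chaos_product h \<omega>) \<partial>M) =
        (\<Prod>k<N. of_real (exp (- ((h k)\<^sup>2 * len k) / 2) * (1 + (h k)\<^sup>2 * len k)))"
      unfolding cross
    proof (rule trans[OF cell_product(1)[OF m\<phi> i\<phi>]])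
      show "(\<Prod>k<N. \<integral>\<omega>. \<phi> k (cell k \<omega>) \<partial>M) =
          (\<Prod>k<N. complex_of_real (exp (- ((h k)\<^sup>2 * len k) / 2) * (1 + (h k)\<^sup>2 * len k)))"
        using v\<phi> by (intro prod.cong) auto
    qed
    also have "\<dots> = of_real ((\<Prod>k<N. exp (- ((h k)\<^sup>2 * len k) / 2)) * (\<Prod>k<N. 1 + (h k)\<^sup>2 * len k))"
      by (simp only: of_real_prod[symmetric] prod.distrib)
    finally show ?thesis unfolding prod_exp_half .
  qed
  also have "exp (variance_of h) + (\<Prod>k<N. 1 + (h k)\<^sup>2 * len k) -
      2 * ?e * Re (of_real (exp (- variance_of h / 2) * (\<Prod>k<N. 1 + (h k)\<^sup>2 * len k))) =
      exp (variance_of h) - (\<Prod>k<N. 1 + (h k)\<^sup>2 * len k)"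
  proof -
    have e1: "?e * exp (- variance_of h / 2) = 1" by (simp add: exp_add[symmetric])
    have "2 * ?e * Re (of_real (exp (- variance_of h / 2) * (\<Prod>k<N. 1 + (h k)\<^sup>2 * len k))) =
        2 * (?e * exp (- variance_of h / 2)) * (\<Prod>k<N. 1 + (h k)\<^sup>2 * len k)"
      by (simp only: Re_complex_of_real mult_ac)
    then show ?thesis unfolding e1 by linarith
  qed
  finally show "(\<integral>\<omega>. (norm (of_real ?e * cis (linear h \<omega>) - chaos_product h \<omega>))\<^sup>2 \<partial>M) =
      exp (variance_of h) - (\<Prod>k<N. 1 + (h k)\<^sup>2 * len k)" .
qed

lemma cells_as_increment_product:
  assumes K: "K \<subseteq> {..<N}"
  shows "\<exists>n l r. ordered_corners n l r \<and> (\<forall>\<omega>. increment_product w n l r \<omega> = (\<Prod>k\<in>K. cell k \<omega>))"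
proof -
  obtain e where e: "strict_mono_on {..<card K} e" "e ` {..<card K} = K"
    using finite_set_enumeration[of K] K finite_subset by blast
  have eN: "e i < N" if "i < card K" for i using e(2) K that by auto
  have "ordered_corners (card K) (\<lambda>i. q (e i)) (\<lambda>i. q (Suc (e i)))"
    unfolding ordered_corners_def
  proof (intro allI impI conjI)
    fix i assume i: "i < card K"
    show "0 \<le> q (e i)" "q (Suc (e i)) \<le> 1" using grid_01[of "e i"] grid_01[of "Suc (e i)"] eN[OF i] by auto
    show "q (e i) \<le> q (Suc (e i))" using eN[OF i] by (intro grid_le) auto
    assume s: "Suc i < card K"
    have "e i < e (Suc i)" using e(1) i s by (auto simp: strict_mono_on_def)
    then show "q (Suc (e i)) \<le> q (e (Suc i))" using eN[OF s] by (intro grid_le) auto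
  qed
  moreover have "increment_product w (card K) (\<lambda>i. q (e i)) (\<lambda>i. q (Suc (e i))) \<omega> = (\<Prod>k\<in>K. cell k \<omega>)" for \<omega>
  proof -
    have "(\<Prod>k\<in>e ` {..<card K}. cell k \<omega>) = (\<Prod>i<card K. cell (e i) \<omega>)"
      using strict_mono_on_imp_inj_on[OF e(1)] by (simp add: prod.reindex)
    then show ?thesis unfolding e(2) increment_product_def cell_def by simp
  qed
  ultimately show ?thesis by blast
qed

lemma chaos_product_orthogonal:
  assumes Y: "sq_integrable M Y"
    and orth: "\<And>n l r. ordered_corners n l r \<Longrightarrow> (\<integral>\<omega>. Y \<omega> * increment_product w n l r \<omega> \<partial>M) = 0"
  shows "(\<integral>\<omega>. of_real (Y \<omega>) * chaos_product h \<omega> \<partial>M) = 0"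
proof -
  let ?c = "\<lambda>K. \<Prod>k\<in>K. \<i> * complex_of_real (h k)"
  have eq: "of_real (Y \<omega>) * chaos_product h \<omega> = (\<Sum>K\<in>Pow {..<N}. ?c K * of_real (Y \<omega> * (\<Prod>k\<in>K. cell k \<omega>)))" for \<omega>
  proof -
    have "chaos_product h \<omega> = (\<Prod>k<N. \<i> * of_real (h k * cell k \<omega>) + 1)"
      by (simp add: chaos_product_def add.commute)
    also have "\<dots> = (\<Sum>K\<in>Pow {..<N}. (\<Prod>k\<in>K. \<i> * of_real (h k * cell k \<omega>)) * (\<Prod>k\<in>{..<N} - K. 1))"
      by (rule prod_add) simp
    also have "\<dots> = (\<Sum>K\<in>Pow {..<N}. ?c K * of_real (\<Prod>k\<in>K. cell k \<omega>))"
      by (simp add: prod.distrib mult.assoc)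
    finally show ?thesis by (simp add: sum_distrib_left mult_ac)
  qed
  have sqK: "sq_integrable M (\<lambda>\<omega>. \<Prod>k\<in>K. cell k \<omega>)" if "K \<subseteq> {..<N}" for K
    unfolding sq_integrable_def using cells_orthogonal(2)[OF that that] that cell_measurable
    by (auto simp: power2_eq_square intro!: borel_measurable_prod)
  have i: "integrable M (\<lambda>\<omega>. Y \<omega> * (\<Prod>k\<in>K. cell k \<omega>))" if "K \<subseteq> {..<N}" for K
    by (rule sq_integrable_mult[OF Y sqK[OF that]])
  have z: "(\<integral>\<omega>. Y \<omega> * (\<Prod>k\<in>K. cell k \<omega>) \<partial>M) = 0" if K: "K \<subseteq> {..<N}" for K
  proof -
    obtain n l r where "ordered_corners n l r" "\<And>\<omega>. increment_product w n l r \<omega> = (\<Prod>k\<in>K. cell k \<omega>)"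
      using cells_as_increment_product[OF K] by blast
    then show ?thesis using orth[of n l r] by simp
  qed
  have "(\<integral>\<omega>. of_real (Y \<omega>) * chaos_product h \<omega> \<partial>M) =
      (\<Sum>K\<in>Pow {..<N}. \<integral>\<omega>. ?c K * of_real (Y \<omega> * (\<Prod>k\<in>K. cell k \<omega>)) \<partial>M)"
    unfolding eq using i by (intro Bochner_Integration.integral_sum integrable_mult_right integrable_of_real) auto
  also have "\<dots> = (\<Sum>K\<in>Pow {..<N}. ?c K * of_real (\<integral>\<omega>. Y \<omega> * (\<Prod>k\<in>K. cell k \<omega>) \<partial>M))"
    by (simp only: integral_mult_right_zero integral_complex_of_real)
  also have "\<dots> = 0" using z by (intro sum.neutral) auto
  finally show ?thesis .
qed

end

lemma (in finite_measure) L2_bound_complex: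
  assumes Y: "sq_integrable M Y" and Z: "Z \<in> borel_measurable M" "integrable M (\<lambda>x. (norm (Z x :: complex))\<^sup>2)"
  shows "integrable M (\<lambda>x. of_real (Y x) * Z x)"
    "norm (\<integral>x. of_real (Y x) * Z x \<partial>M) \<le> L2n M Y * sqrt (\<integral>x. (norm (Z x))\<^sup>2 \<partial>M)"
proof -
  have nZ: "sq_integrable M (\<lambda>x. norm (Z x))" using Z by (simp add: sq_integrable_def)
  have aY: "sq_integrable M (\<lambda>x. \<bar>Y x\<bar>)" using Y by (auto simp: sq_integrable_def)
  have i: "integrable M (\<lambda>x. \<bar>Y x\<bar> * norm (Z x))" by (rule sq_integrable_mult[OF aY nZ])
  show "integrable M (\<lambda>x. of_real (Y x) * Z x)"
    using Z(1) sq_integrable_measurable[OF Y]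
    by (intro Bochner_Integration.integrable_bound[OF i]) (auto simp: norm_mult)
  have "norm (\<integral>x. of_real (Y x) * Z x \<partial>M) \<le> (\<integral>x. norm (of_real (Y x) * Z x) \<partial>M)"
    by (rule integral_norm_bound)
  also have "\<dots> = (\<integral>x. \<bar>Y x\<bar> * norm (Z x) \<partial>M)" by (simp add: norm_mult)
  also have "\<dots> \<le> L2n M (\<lambda>x. \<bar>Y x\<bar>) * L2n M (\<lambda>x. norm (Z x))"
    using L2_Cauchy_Schwarz[OF aY nZ] by simp
  also have "\<dots> = L2n M Y * sqrt (\<integral>x. (norm (Z x))\<^sup>2 \<partial>M)" by (simp add: L2n_def)
  finally show "norm (\<integral>x. of_real (Y x) * Z x \<partial>M) \<le> L2n M Y * sqrt (\<integral>x. (norm (Z x))\<^sup>2 \<partial>M)" .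
qed

section \<open>Step integrals: isometry and totality\<close>

lemma (in wiener_grid) adapted_corners:
  assumes o: "ordered_corners n l r" and sub: "l ` {..<n} \<subseteq> q ` {..N}" "r ` {..<n} \<subseteq> q ` {..N}"
  shows "\<exists>a b. adapted n a b \<and> (\<forall>i<n. q (a i) = l i \<and> q (b i) = r i)"
proof -
  have ex: "\<forall>i\<in>{..<n}. \<exists>k. k \<le> N \<and> q k = g i" if g: "g ` {..<n} \<subseteq> q ` {..N}" for g
  proof
    fix i assume "i \<in> {..<n}"
    then have "g i \<in> q ` {..N}" using g by blast
    then obtain k where "g i = q k" "k \<in> {..N}" by (rule imageE)
    then show "\<exists>k. k \<le> N \<and> q k = g i" by (intro exI[of _ k]) simp
  qed
  obtain a where a: "\<forall>i\<in>{..<n}. a i \<le> N \<and> q (a i) = l i" using bchoice[OF ex[OF sub(1)]] by (elim exE)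
  obtain b where b: "\<forall>i\<in>{..<n}. b i \<le> N \<and> q (b i) = r i" using bchoice[OF ex[OF sub(2)]] by (elim exE)
  have "adapted n a b"
    unfolding adapted_def
  proof (intro allI impI conjI)
    fix i assume i: "i < n"
    show "b i \<le> N" using b i by simp
    show "a i \<le> b i"
      using grid_le_iff[of "a i" "b i"] a b i ordered_cornersD(2)[OF o i] by simp
    assume s: "Suc i < n"
    then have "r i \<le> l (Suc i)" using o by (simp add: ordered_corners_def)
    then show "b i \<le> a (Suc i)" using grid_le_iff[of "b i" "a (Suc i)"] a b i s by simp
  qed
  then show ?thesis using a b by auto
qed

lemma (in wiener_grid) step_integral_linear:
  assumes "steps_in_simplex 1 T" "\<And>c l r. (c, l, r) \<in> set T \<Longrightarrow> l 0 \<in> q ` {..N} \<and> r 0 \<in> q ` {..N}"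
  shows "\<exists>h. (\<forall>\<omega>. step_integral w 1 T \<omega> = linear h \<omega>) \<and> (\<forall>k. \<bar>h k\<bar> \<le> (\<Sum>(c, l, r)\<leftarrow>T. \<bar>c\<bar>))"
  using assms
proof (induction T)
  case Nil
  then show ?case by (intro exI[of _ "\<lambda>_. 0"]) (simp add: step_integral_def linear_def)
next
  case (Cons s T)
  obtain c l r where s: "s = (c, l, r)" by (cases s)
  have "steps_in_simplex 1 T" using Cons.prems(1) by (simp add: steps_in_simplex_def)
  then obtain h where h: "\<And>\<omega>. step_integral w 1 T \<omega> = linear h \<omega>" "\<And>k. \<bar>h k\<bar> \<le> (\<Sum>(c, l, r)\<leftarrow>T. \<bar>c\<bar>)"
    using Cons.IH Cons.prems(2) by (metis list.set_intros(2))
  obtain a b where ab: "a \<le> N" "q a = l 0" "b \<le> N" "q b = r 0"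
    using Cons.prems(2)[of c l r] s by auto
  have "l 0 \<le> r 0" using Cons.prems(1) s by (simp add: steps_in_simplex_def)
  then have le: "a \<le> b" using grid_le_iff[of a b] ab by simp
  define g where "g k = (if k \<in> {a..<b} then c else 0)" for k
  have "step_integral w 1 (s # T) \<omega> = linear (\<lambda>k. g k + h k) \<omega>" for \<omega>
  proof -
    have "(\<Sum>k<N. g k * cell k \<omega>) = (\<Sum>k<N. if k \<in> {a..<b} then c * cell k \<omega> else 0)"
      by (intro sum.cong) (auto simp: g_def)
    also have "\<dots> = (\<Sum>k\<in>{..<N} \<inter> {a..<b}. c * cell k \<omega>)" by (rule sum.inter_restrict[symmetric]) simp
    also have "{..<N} \<inter> {a..<b} = {a..<b}" using ab by auto
    also have "(\<Sum>k\<in>{a..<b}. c * cell k \<omega>) = c * (w (r 0) \<omega> - w (l 0) \<omega>)"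
      unfolding sum_distrib_left[symmetric] sum_cells[OF le ab(3), symmetric] ab ..
    finally have "linear (\<lambda>k. g k + h k) \<omega> = c * (w (r 0) \<omega> - w (l 0) \<omega>) + linear h \<omega>"
      by (simp add: linear_def distrib_right sum.distrib)
    then show ?thesis using h(1)[of \<omega>] by (simp add: s step_integral_def)
  qed
  moreover have "\<bar>g k + h k\<bar> \<le> (\<Sum>(c, l, r)\<leftarrow>s # T. \<bar>c\<bar>)" for k
  proof -
    have "\<bar>g k + h k\<bar> \<le> \<bar>g k\<bar> + \<bar>h k\<bar>" by (rule abs_triangle_ineq)
    also have "\<dots> \<le> \<bar>c\<bar> + (\<Sum>(c, l, r)\<leftarrow>T. \<bar>c\<bar>)" using h(2)[of k] by (intro add_mono) (auto simp: g_def)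
    finally show ?thesis by (simp add: s)
  qed
  ultimately show ?case by blast
qed

lemma (in wiener_grid) mesh_le:
  assumes m: "0 < m" and sub: "(\<lambda>j. real j / real m) ` {..m} \<subseteq> q ` {..N}" and k: "k < N"
  shows "len k \<le> 1 / real m"
proof -
  have q: "0 \<le> q k" "q k < 1" using grid_01[of k] grid_01[of "Suc k"] grid_less[of k "Suc k"] k by auto
  define j where "j = Suc (nat \<lfloor>q k * real m\<rfloor>)"
  have fl: "real (nat \<lfloor>q k * real m\<rfloor>) \<le> q k * real m" "q k * real m < real j"
    using q m by (auto simp: j_def of_nat_nat) linarith+
  have "q k * real m < real m" using q m by simp
  then have "nat \<lfloor>q k * real m\<rfloor> < m" using fl(1) by linarith
  then have "j \<le> m" by (simp add: j_def)
  then have "real j / real m \<in> q ` {..N}" using sub by blast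
  then obtain i where "real j / real m = q i" "i \<in> {..N}" by (rule imageE)
  then have i: "i \<le> N" "q i = real j / real m" by simp_all
  have "q k * real m < q i * real m" using fl(2) m i by simp
  then have "q k < q i" using m by simp
  then have "k < i" using grid_le_iff[of i k] i k by (meson less_imp_le not_le order_less_le_trans)
  then have "q (Suc k) \<le> q i" using i by (intro grid_le) auto
  also have "q i \<le> q k + 1 / real m"
  proof -
    have "real j \<le> q k * real m + 1" using fl(1) by (simp add: j_def)
    then show ?thesis using m i by (simp add: field_simps)
  qed
  finally show ?thesis by (simp add: len_def)
qed

context wiener_process
begin

lemma wiener_grid_of_set:
  assumes "finite P" "P \<noteq> {}" "P \<subseteq> {0..1}"
  shows "\<exists>N q. wiener_grid M w N q \<and> q ` {..N} = P"
proof -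
  obtain N :: nat and q where q: "strict_mono_on {..N} q" "q ` {..N} = P"
    using finite_set_as_grid[OF assms(1,2)] by blast
  have "wiener_grid M w N q"
    using q assms(3) by unfold_locales (auto simp: image_subset_iff)
  then show ?thesis using q(2) by blast
qed

lemma corners_01:
  assumes "ordered_corners n l r"
  shows "l ` {..<n} \<union> r ` {..<n} \<subseteq> {0..1}"
  using ordered_cornersD[OF assms] by auto

lemma increment_product_cong:
  "(\<And>i. i < n \<Longrightarrow> l i = l' i \<and> r i = r' i) \<Longrightarrow> increment_product w n l r \<omega> = increment_product w n l' r' \<omega>"
  unfolding increment_product_def by (intro prod.cong) auto

lemma increment_product_inner:
  assumes o: "ordered_corners n l r" "ordered_corners m l' r'"
  shows "(\<integral>\<omega>. increment_product w n l r \<omega> * increment_product w m l' r' \<omega> \<partial>M) =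
      (if n = m then \<Prod>i<n. max 0 (min (r i) (r' i) - max (l i) (l' i)) else 0)"
    and "integrable M (\<lambda>\<omega>. increment_product w n l r \<omega> * increment_product w m l' r' \<omega>)"
proof -
  let ?P = "{0} \<union> (l ` {..<n} \<union> r ` {..<n}) \<union> (l' ` {..<m} \<union> r' ` {..<m})"
  obtain N q where q: "wiener_grid M w N q" "q ` {..N} = ?P"
    using wiener_grid_of_set[of ?P] corners_01[OF o(1)] corners_01[OF o(2)] by auto
  interpret wiener_grid M w N q by fact
  obtain a b where ab: "adapted n a b" "\<forall>i<n. q (a i) = l i \<and> q (b i) = r i"
    using adapted_corners[OF o(1)] q(2) by auto
  obtain a' b' where ab': "adapted m a' b'" "\<forall>i<m. q (a' i) = l' i \<and> q (b' i) = r' i"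
    using adapted_corners[OF o(2)] q(2) by auto
  have eq: "increment_product w n l r \<omega> * increment_product w m l' r' \<omega> =
      grid_product n a b \<omega> * grid_product m a' b' \<omega>" for \<omega>
    using ab(2) ab'(2) by (intro arg_cong2[where f="(*)"] increment_product_cong) auto
  show "integrable M (\<lambda>\<omega>. increment_product w n l r \<omega> * increment_product w m l' r' \<omega>)"
    unfolding eq by (rule increment_products_inner(2)[OF ab(1) ab'(1)])
  have "(\<integral>\<omega>. increment_product w n l r \<omega> * increment_product w m l' r' \<omega> \<partial>M) =
      (if n = m then \<Prod>i<n. max 0 (min (q (b i)) (q (b' i)) - max (q (a i)) (q (a' i))) else 0)"
    unfolding eq by (rule increment_products_inner(1)[OF ab(1) ab'(1)])
  also have "\<dots> = (if n = m then \<Prod>i<n. max 0 (min (r i) (r' i) - max (l i) (l' i)) else 0)"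
    using ab(2) ab'(2) by (auto intro!: prod.cong)
  finally show "(\<integral>\<omega>. increment_product w n l r \<omega> * increment_product w m l' r' \<omega> \<partial>M) =
      (if n = m then \<Prod>i<n. max 0 (min (r i) (r' i) - max (l i) (l' i)) else 0)" .
qed

lemma increment_product_sq_integrable:
  assumes o: "ordered_corners n l r"
  shows "sq_integrable M (increment_product w n l r)"
proof -
  have "increment_product w n l r \<in> borel_measurable M"
    unfolding increment_product_def[abs_def] using ordered_cornersD[OF o]
    by (intro borel_measurable_prod borel_measurable_diff random_variable) auto
  then show ?thesis
    using increment_product_inner(2)[OF o o] by (simp add: sq_integrable_def power2_eq_square)
qed

lemma step_integral_sq_integrable:
  assumes "steps_in_simplex n S"
  shows "sq_integrable M (step_integral w n S)"
proof -
  have "sq_integrable M (\<lambda>\<omega>. \<Sum>x\<leftarrow>S. (case x of (c, l, r) \<Rightarrow> c * increment_product w n l r \<omega>))"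
  proof (rule sq_integrable_sum_list)
    fix x assume "x \<in> set S"
    then show "sq_integrable M (\<lambda>\<omega>. case x of (c, l, r) \<Rightarrow> c * increment_product w n l r \<omega>)"
      using assms by (cases x) (auto simp: steps_in_simplex_iff intro!: sq_integrable_scale increment_product_sq_integrable)
  qed
  then show ?thesis by (simp add: step_integral_products[abs_def])
qed

lemma step_integral_Cons:
  "step_integral w n ((c, l, r) # S) \<omega> = c * increment_product w n l r \<omega> + step_integral w n S \<omega>"
  by (simp add: step_integral_products)

lemma step_kernel_Cons:
  "step_kernel n ((c, l, r) # S) t = c * box_indicator n l r t + step_kernel n S t"
  by (simp add: step_kernel_box)

lemma steps_in_simplex_Cons:
  "steps_in_simplex n ((c, l, r) # S) \<longleftrightarrow> ordered_corners n l r \<and> steps_in_simplex n S"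
  by (simp add: steps_in_simplex_iff)

lemma step_integral_inner_single:
  assumes o: "ordered_corners n l r" and T: "steps_in_simplex m T"
  shows "(\<integral>\<omega>. increment_product w n l r \<omega> * step_integral w m T \<omega> \<partial>M) =
    (if n = m then \<integral>t. box_indicator n l r t * step_kernel n T t \<partial>simplex_measure n else 0)"
  using T
proof (induction T)
  case Nil
  then show ?case by (simp add: step_integral_def step_kernel_def)
next
  case (Cons s T)
  obtain c l' r' where s: "s = (c, l', r')" by (cases s)
  have o': "ordered_corners m l' r'" and T: "steps_in_simplex m T"
    using Cons.prems by (simp_all add: s steps_in_simplex_Cons)
  have "(\<integral>\<omega>. increment_product w n l r \<omega> * step_integral w m (s # T) \<omega> \<partial>M) =
      (\<integral>\<omega>. c * (increment_product w n l r \<omega> * increment_product w m l' r' \<omega>) +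
        increment_product w n l r \<omega> * step_integral w m T \<omega> \<partial>M)"
    by (simp add: s step_integral_Cons algebra_simps)
  also have "\<dots> = c * (\<integral>\<omega>. increment_product w n l r \<omega> * increment_product w m l' r' \<omega> \<partial>M) +
      (\<integral>\<omega>. increment_product w n l r \<omega> * step_integral w m T \<omega> \<partial>M)"
    using increment_product_inner(2)[OF o o']
      sq_integrable_mult[OF increment_product_sq_integrable[OF o] step_integral_sq_integrable[OF T]]
    by simp
  also have "\<dots> = (if n = m then \<integral>t. box_indicator n l r t * step_kernel n (s # T) t \<partial>simplex_measure n else 0)"
  proof (cases "n = m")
    case True
    have o'': "ordered_corners n l' r'" using o' True by simp
    have "(\<integral>t. box_indicator n l r t * step_kernel n (s # T) t \<partial>simplex_measure n) =
        (\<integral>t. c * (box_indicator n l r t * box_indicator n l' r' t) + box_indicator n l r t * step_kernel n T t \<partial>simplex_measure n)"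
      by (simp add: s step_kernel_Cons algebra_simps)
    also have "\<dots> = c * (\<integral>t. box_indicator n l r t * box_indicator n l' r' t \<partial>simplex_measure n) +
        (\<integral>t. box_indicator n l r t * step_kernel n T t \<partial>simplex_measure n)"
      using sq_integrable_mult[OF box_indicator_sq_integrable[of n l r] box_indicator_sq_integrable[of n l' r']]
        sq_integrable_mult[OF box_indicator_sq_integrable[of n l r] step_kernel_sq_integrable[of n T]]
      by simp
    also have "(\<integral>t. box_indicator n l r t * box_indicator n l' r' t \<partial>simplex_measure n) =
        (\<integral>\<omega>. increment_product w n l r \<omega> * increment_product w m l' r' \<omega> \<partial>M)"
      unfolding increment_product_inner(1)[OF o o'] integral_simplex_two_boxes[OF o'' o]
      using True by (simp add: min.commute max.commute)
    finally show ?thesis using Cons.IH[OF T] True by simp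
  next
    case False
    then show ?thesis using Cons.IH[OF T] increment_product_inner(1)[OF o o'] by simp
  qed
  finally show ?case .
qed

lemma step_integral_inner:
  assumes S: "steps_in_simplex n S" and T: "steps_in_simplex m T"
  shows "(\<integral>\<omega>. step_integral w n S \<omega> * step_integral w m T \<omega> \<partial>M) =
    (if n = m then \<integral>t. step_kernel n S t * step_kernel n T t \<partial>simplex_measure n else 0)"
  using S
proof (induction S)
  case Nil
  then show ?case by (simp add: step_integral_def step_kernel_def)
next
  case (Cons s S)
  obtain c l r where s: "s = (c, l, r)" by (cases s)
  have o: "ordered_corners n l r" and S: "steps_in_simplex n S"
    using Cons.prems by (simp_all add: s steps_in_simplex_Cons)
  have "(\<integral>\<omega>. step_integral w n (s # S) \<omega> * step_integral w m T \<omega> \<partial>M) =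
      (\<integral>\<omega>. c * (increment_product w n l r \<omega> * step_integral w m T \<omega>) + step_integral w n S \<omega> * step_integral w m T \<omega> \<partial>M)"
    by (simp add: s step_integral_Cons algebra_simps)
  also have "\<dots> = c * (\<integral>\<omega>. increment_product w n l r \<omega> * step_integral w m T \<omega> \<partial>M) +
      (\<integral>\<omega>. step_integral w n S \<omega> * step_integral w m T \<omega> \<partial>M)"
    using sq_integrable_mult[OF increment_product_sq_integrable[OF o] step_integral_sq_integrable[OF T]]
      sq_integrable_mult[OF step_integral_sq_integrable[OF S] step_integral_sq_integrable[OF T]] by simp
  also have "\<dots> = (if n = m then \<integral>t. step_kernel n (s # S) t * step_kernel n T t \<partial>simplex_measure n else 0)"
  proof -
    have "(\<integral>t. step_kernel n (s # S) t * step_kernel n T t \<partial>simplex_measure n) =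
        (\<integral>t. c * (box_indicator n l r t * step_kernel n T t) + step_kernel n S t * step_kernel n T t \<partial>simplex_measure n)"
      by (simp add: s step_kernel_Cons algebra_simps)
    also have "\<dots> = c * (\<integral>t. box_indicator n l r t * step_kernel n T t \<partial>simplex_measure n) +
        (\<integral>t. step_kernel n S t * step_kernel n T t \<partial>simplex_measure n)"
      using sq_integrable_mult[OF box_indicator_sq_integrable[of n l r] step_kernel_sq_integrable[of n T]]
        sq_integrable_mult[OF step_kernel_sq_integrable[of n S] step_kernel_sq_integrable[of n T]] by simp
    finally show ?thesis using Cons.IH[OF S] step_integral_inner_single[OF o T] by (cases "n = m") simp_all
  qed
  finally show ?case .
qed

definition step_corners :: "steps \<Rightarrow> real set" where
  "step_corners T = (\<lambda>(c, l, r). l 0) ` set T \<union> (\<lambda>(c, l, r). r 0) ` set T"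

lemma step_corners: "finite (step_corners T)" "steps_in_simplex 1 T \<Longrightarrow> step_corners T \<subseteq> {0..1}"
  by (auto simp: step_corners_def steps_in_simplex_def)

lemma step_cornersD: "(c, l, r) \<in> set T \<Longrightarrow> l 0 \<in> step_corners T \<and> r 0 \<in> step_corners T"
  by (force simp: step_corners_def)

lemma increment_product_step_character:
  assumes o: "ordered_corners n l r" and T: "steps_in_simplex 1 T"
  shows "(\<integral>\<omega>. of_real (increment_product w n l r \<omega>) * cis (step_integral w 1 T \<omega>) \<partial>M) =
    (\<Prod>i<n. \<i> * of_real (\<integral>\<omega>. (w (r i) \<omega> - w (l i) \<omega>) * step_integral w 1 T \<omega> \<partial>M)) *
      of_real (exp (- (\<integral>\<omega>. (step_integral w 1 T \<omega>)\<^sup>2 \<partial>M) / 2))"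
proof -
  let ?P = "{0} \<union> (l ` {..<n} \<union> r ` {..<n}) \<union> step_corners T"
  obtain N q where q: "wiener_grid M w N q" "q ` {..N} = ?P"
    using wiener_grid_of_set[of ?P] corners_01[OF o] step_corners(1)[of T] step_corners(2)[OF T] by auto
  interpret wiener_grid M w N q by fact
  obtain a b where ab: "adapted n a b" "\<forall>i<n. q (a i) = l i \<and> q (b i) = r i"
    using adapted_corners[OF o] q(2) by auto
  obtain h where h: "\<And>\<omega>. step_integral w 1 T \<omega> = linear h \<omega>"
    using step_integral_linear[OF T] step_cornersD[of _ _ _ T] q(2) by blast
  have eq: "increment_product w n l r \<omega> = grid_product n a b \<omega>" for \<omega>
    using ab(2) by (intro increment_product_cong) auto
  have p: "(\<Prod>i<n. \<i> * complex_of_real (\<integral>\<omega>. (w (r i) \<omega> - w (l i) \<omega>) * linear h \<omega> \<partial>M)) =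
      (\<Prod>i<n. \<i> * complex_of_real (\<integral>\<omega>. (w (q (b i)) \<omega> - w (q (a i)) \<omega>) * linear h \<omega> \<partial>M))"
    using ab(2) by (intro prod.cong) auto
  show ?thesis unfolding h eq p by (rule increment_product_character[OF ab(1)])
qed

text \<open>
  Over grids of mesh \<open>1 / m\<close> that contain the corners of \<open>T\<close>, the character of the step integral is
  approximated by products \<open>chaos_product\<close> up to a constant factor, and \<open>Y\<close> is orthogonal to all of these.
\<close>

lemma character_orthogonal:
  assumes Y: "sq_integrable M Y"
    and orth: "\<And>n l r. ordered_corners n l r \<Longrightarrow> (\<integral>\<omega>. Y \<omega> * increment_product w n l r \<omega> \<partial>M) = 0"
    and T: "steps_in_simplex 1 T"
  shows "(\<integral>\<omega>. of_real (Y \<omega>) * cis (step_integral w 1 T \<omega>) \<partial>M) = 0"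
proof -
  let ?X = "step_integral w 1 T"
  define v where "v = (\<integral>\<omega>. (?X \<omega>)\<^sup>2 \<partial>M)"
  define B where "B = (\<Sum>(c, l, r)\<leftarrow>T. \<bar>c\<bar>)"
  let ?I = "\<integral>\<omega>. of_real (Y \<omega>) * cis (?X \<omega>) \<partial>M"
  have Xm: "?X \<in> borel_measurable M" by (rule sq_integrable_measurable[OF step_integral_sq_integrable[OF T]])
  have v0: "0 \<le> v" by (simp add: v_def)
  have bound: "exp (v / 2) * norm ?I \<le> L2n M Y * sqrt (exp v * (B\<^sup>2 / real m * v))"
    if m: "0 < m" "B\<^sup>2 \<le> real m" for m
  proof -
    let ?P = "step_corners T \<union> (\<lambda>j. real j / real m) ` {..m}"
    have "(\<lambda>j. real j / real m) ` {..m} \<subseteq> {0..1}" using m by auto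
    then obtain N q where q: "wiener_grid M w N q" "q ` {..N} = ?P"
      using wiener_grid_of_set[of ?P] step_corners(1)[of T] step_corners(2)[OF T] by auto
    interpret wiener_grid M w N q by fact
    obtain h where h: "\<And>\<omega>. ?X \<omega> = linear h \<omega>" "\<And>k. \<bar>h k\<bar> \<le> B"
      using step_integral_linear[OF T] step_cornersD[of _ _ _ T] q(2) unfolding B_def by blast
    have v: "v = variance_of h" unfolding v_def h(1) by (rule linear_second_moment)
    let ?D = "\<lambda>\<omega>. of_real (exp (variance_of h / 2)) * cis (linear h \<omega>) - chaos_product h \<omega>"
    have D: "?D \<in> borel_measurable M"
    proof -
      have "(\<lambda>\<omega>. cis (linear h \<omega>)) \<in> borel_measurable M" unfolding h(1)[symmetric] by (rule measurable_compose[OF Xm cis_measurable])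
      then show ?thesis
        by (intro borel_measurable_diff borel_measurable_times chaos_product_distance(3)) auto
    qed
    have iX: "integrable M (\<lambda>\<omega>. of_real (Y \<omega>) * cis (?X \<omega>))"
      by (rule L2_bound_complex(1)[OF Y measurable_compose[OF Xm cis_measurable]]) simp
    have iD: "integrable M (\<lambda>\<omega>. of_real (Y \<omega>) * ?D \<omega>)"
      by (rule L2_bound_complex(1)[OF Y D chaos_product_distance(2)])
    have eq: "of_real (Y \<omega>) * chaos_product h \<omega> = of_real (exp (v / 2)) * (of_real (Y \<omega>) * cis (?X \<omega>)) - of_real (Y \<omega>) * ?D \<omega>" for \<omega>
      unfolding v h(1) by (simp add: algebra_simps)
    have "0 = (\<integral>\<omega>. of_real (Y \<omega>) * chaos_product h \<omega> \<partial>M)"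
      using chaos_product_orthogonal[OF Y orth] by simp
    also have "\<dots> = of_real (exp (v / 2)) * ?I - (\<integral>\<omega>. of_real (Y \<omega>) * ?D \<omega> \<partial>M)"
      unfolding eq using iX iD by simp
    finally have "of_real (exp (v / 2)) * ?I = (\<integral>\<omega>. of_real (Y \<omega>) * ?D \<omega> \<partial>M)" by simp
    then have "norm (of_real (exp (v / 2)) * ?I) = norm (\<integral>\<omega>. of_real (Y \<omega>) * ?D \<omega> \<partial>M)" by (rule arg_cong)
    then have "exp (v / 2) * norm ?I = norm (\<integral>\<omega>. of_real (Y \<omega>) * ?D \<omega> \<partial>M)"
      by (simp add: norm_mult)
    also have "\<dots> \<le> L2n M Y * sqrt (\<integral>\<omega>. (norm (?D \<omega>))\<^sup>2 \<partial>M)"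
      by (rule L2_bound_complex(2)[OF Y D chaos_product_distance(2)])
    also have "\<dots> \<le> L2n M Y * sqrt (exp v * (B\<^sup>2 / real m * v))"
    proof (intro mult_left_mono L2n_nonneg real_sqrt_le_mono)
      have x: "(h k)\<^sup>2 * len k \<le> B\<^sup>2 / real m" if k: "k < N" for k
      proof -
        have "(h k)\<^sup>2 \<le> B\<^sup>2" using h(2)[of k] by (metis abs_ge_zero power2_abs power_mono)
        then have "(h k)\<^sup>2 * len k \<le> B\<^sup>2 * (1 / real m)"
          using mesh_le[OF m(1) _ k] len_pos[OF k] q(2) by (intro mult_mono) auto
        then show ?thesis by simp
      qed
      have "exp v - (\<Prod>k<N. 1 + (h k)\<^sup>2 * len k) \<le> exp v * (B\<^sup>2 / real m * v)"
      proof (rule one_plus_ge_exp_quadratic[OF _ x])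
        show "0 \<le> (h k)\<^sup>2 * len k" if "k < N" for k using len_pos[OF that] by simp
        show "B\<^sup>2 / real m \<le> 1" using m by simp
        show "v = (\<Sum>k<N. (h k)\<^sup>2 * len k)" by (simp add: v variance_of_def)
      qed
      then show "(\<integral>\<omega>. (norm (?D \<omega>))\<^sup>2 \<partial>M) \<le> exp v * (B\<^sup>2 / real m * v)"
        unfolding chaos_product_distance(1) v .
    qed
    finally show ?thesis .
  qed
  have "exp (v / 2) * norm ?I \<le> 0"
  proof (rule LIMSEQ_le_const)
    have "(\<lambda>m. B\<^sup>2 / real m) \<longlonglongrightarrow> 0" by (rule lim_const_over_n)
    then have "(\<lambda>m. L2n M Y * sqrt (exp v * (B\<^sup>2 / real m * v))) \<longlonglongrightarrow> L2n M Y * sqrt (exp v * (0 * v))"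
      by (intro tendsto_intros)
    then show "(\<lambda>m. L2n M Y * sqrt (exp v * (B\<^sup>2 / real m * v))) \<longlonglongrightarrow> 0" by simp
    obtain m0 where m0: "B\<^sup>2 \<le> real m0" using real_arch_simple by blast
    show "\<exists>N. \<forall>m\<ge>N. exp (v / 2) * norm ?I \<le> L2n M Y * sqrt (exp v * (B\<^sup>2 / real m * v))"
    proof (intro exI[of _ "Suc m0"] allI impI)
      fix m assume "Suc m0 \<le> m"
      then show "exp (v / 2) * norm ?I \<le> L2n M Y * sqrt (exp v * (B\<^sup>2 / real m * v))"
        using m0 by (intro bound) auto
    qed
  qed
  then have "norm ?I \<le> 0" by (simp add: mult_le_0_iff not_le)
  then show ?thesis by simp
qed

end

section \<open>Multiple Wiener integrals\<close>

lemma (in finite_measure) L2_tendsto_character: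
  assumes X: "L2_tendsto M X Y F" and G: "G \<in> borel_measurable M"
  shows "((\<lambda>i. \<integral>\<omega>. of_real (X i \<omega>) * cis (G \<omega>) \<partial>M) \<longlongrightarrow> (\<integral>\<omega>. of_real (Y \<omega>) * cis (G \<omega>) \<partial>M)) F"
proof -
  note D = L2_tendstoD[OF X]
  have c: "(\<lambda>\<omega>. cis (G \<omega>)) \<in> borel_measurable M" "integrable M (\<lambda>\<omega>. (norm (cis (G \<omega>)))\<^sup>2)"
    using G by auto
  have "((\<lambda>i. (\<integral>\<omega>. of_real (X i \<omega>) * cis (G \<omega>) \<partial>M) - (\<integral>\<omega>. of_real (Y \<omega>) * cis (G \<omega>) \<partial>M)) \<longlongrightarrow> 0) F"
  proof (rule Lim_null_comparison)
    show "\<forall>\<^sub>F i in F. norm ((\<integral>\<omega>. of_real (X i \<omega>) * cis (G \<omega>) \<partial>M) - (\<integral>\<omega>. of_real (Y \<omega>) * cis (G \<omega>) \<partial>M)) \<le>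
        L2n M (\<lambda>\<omega>. X i \<omega> - Y \<omega>) * sqrt (\<integral>\<omega>. (norm (cis (G \<omega>)))\<^sup>2 \<partial>M)"
      using D(2)
    proof eventually_elim
      case (elim i)
      have "(\<integral>\<omega>. of_real (X i \<omega>) * cis (G \<omega>) \<partial>M) - (\<integral>\<omega>. of_real (Y \<omega>) * cis (G \<omega>) \<partial>M) =
          (\<integral>\<omega>. of_real (X i \<omega> - Y \<omega>) * cis (G \<omega>) \<partial>M)"
        using L2_bound_complex(1)[OF elim c] L2_bound_complex(1)[OF D(1) c]
        by (simp add: left_diff_distrib)
      then show ?case using L2_bound_complex(2)[OF sq_integrable_diff[OF elim D(1)] c] by simp
    qed
    show "((\<lambda>i. L2n M (\<lambda>\<omega>. X i \<omega> - Y \<omega>) * sqrt (\<integral>\<omega>. (norm (cis (G \<omega>)))\<^sup>2 \<partial>M)) \<longlongrightarrow> 0) F"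
      by (rule tendsto_mult_left_zero[OF D(3)])
  qed
  then show ?thesis by (simp add: LIM_zero_iff)
qed

lemma (in finite_measure) L2_tendsto_in_character:
  assumes X: "L2_tendsto M G H F" and Y: "sq_integrable M Y"
  shows "((\<lambda>i. \<integral>\<omega>. of_real (Y \<omega>) * cis (G i \<omega>) \<partial>M) \<longlongrightarrow> (\<integral>\<omega>. of_real (Y \<omega>) * cis (H \<omega>) \<partial>M)) F"
proof -
  note D = L2_tendstoD[OF X]
  note mH = sq_integrable_measurable[OF D(1)]
  have "((\<lambda>i. (\<integral>\<omega>. of_real (Y \<omega>) * cis (G i \<omega>) \<partial>M) - (\<integral>\<omega>. of_real (Y \<omega>) * cis (H \<omega>) \<partial>M)) \<longlongrightarrow> 0) F"
  proof (rule Lim_null_comparison)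
    show "\<forall>\<^sub>F i in F. norm ((\<integral>\<omega>. of_real (Y \<omega>) * cis (G i \<omega>) \<partial>M) - (\<integral>\<omega>. of_real (Y \<omega>) * cis (H \<omega>) \<partial>M)) \<le>
        L2n M Y * L2n M (\<lambda>\<omega>. G i \<omega> - H \<omega>)"
      using D(2)
    proof eventually_elim
      case (elim i)
      note mG = sq_integrable_measurable[OF elim]
      have c: "integrable M (\<lambda>\<omega>. (norm (cis (f \<omega>)))\<^sup>2)" for f by simp
      have m: "(\<lambda>\<omega>. cis (G i \<omega>)) \<in> borel_measurable M" "(\<lambda>\<omega>. cis (H \<omega>)) \<in> borel_measurable M"
        using mG mH by simp_all
      have md: "(\<lambda>\<omega>. cis (G i \<omega>) - cis (H \<omega>)) \<in> borel_measurable M" using m by simp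
      have le: "(norm (cis (G i \<omega>) - cis (H \<omega>)))\<^sup>2 \<le> (G i \<omega> - H \<omega>)\<^sup>2" for \<omega>
        using norm_cis_diff_le[of "G i \<omega>" "H \<omega>"] by (metis abs_ge_zero norm_ge_zero power2_abs power_mono)
      have sd: "integrable M (\<lambda>\<omega>. (G i \<omega> - H \<omega>)\<^sup>2)" by (rule sq_integrable_square[OF sq_integrable_diff[OF elim D(1)]])
      have id: "integrable M (\<lambda>\<omega>. (norm (cis (G i \<omega>) - cis (H \<omega>)))\<^sup>2)"
        by (rule Bochner_Integration.integrable_bound[OF sd]) (use md le in auto)
      have "(\<integral>\<omega>. of_real (Y \<omega>) * cis (G i \<omega>) \<partial>M) - (\<integral>\<omega>. of_real (Y \<omega>) * cis (H \<omega>) \<partial>M) =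
          (\<integral>\<omega>. of_real (Y \<omega>) * (cis (G i \<omega>) - cis (H \<omega>)) \<partial>M)"
        using L2_bound_complex(1)[OF Y m(1) c] L2_bound_complex(1)[OF Y m(2) c]
        by (simp add: right_diff_distrib)
      also have "norm \<dots> \<le> L2n M Y * sqrt (\<integral>\<omega>. (norm (cis (G i \<omega>) - cis (H \<omega>)))\<^sup>2 \<partial>M)"
        by (rule L2_bound_complex(2)[OF Y md id])
      also have "\<dots> \<le> L2n M Y * L2n M (\<lambda>\<omega>. G i \<omega> - H \<omega>)"
        unfolding L2n_def[of M "\<lambda>\<omega>. G i \<omega> - H \<omega>"]
        by (intro mult_left_mono L2n_nonneg real_sqrt_le_mono integral_mono id sd le)
      finally show ?case .
    qed
    show "((\<lambda>i. L2n M Y * L2n M (\<lambda>\<omega>. G i \<omega> - H \<omega>)) \<longlongrightarrow> 0) F"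
      by (rule tendsto_mult_right_zero[OF D(3)])
  qed
  then show ?thesis by (simp add: LIM_zero_iff)
qed

lemma sq_integrable_simplex_1:
  assumes "sq_integrable leb01 f"
  shows "sq_integrable (simplex_measure 1) (\<lambda>t. f (t 0))"
  using sq_integrable_cube_imp_simplex[OF product_sq_integrable_cube[of 1 "\<lambda>_. f"]] assms by simp

lemma integral_simplex_1:
  fixes f :: "real \<Rightarrow> real"
  assumes f: "f \<in> borel_measurable leb01"
  shows "(\<integral>t. f (t 0) \<partial>simplex_measure 1) = (\<integral>x. f x \<partial>leb01)"
proof -
  have m: "(\<lambda>t. f (t 0)) \<in> borel_measurable (cube 1)"
    by (rule measurable_compose[OF cube_component f]) simp
  have "(\<integral>t. f (t 0) \<partial>simplex_measure 1) = (\<integral>t. indicator (chamber 1) t *\<^sub>R f (t 0) \<partial>cube 1)"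
    by (rule integral_simplex_eq(2)[OF cube_measurable_imp_simplex[OF m]])
  also have "\<dots> = (\<integral>t. f (t 0) \<partial>cube 1)"
  proof (rule integral_cong_AE)
    show "AE t in cube 1. indicator (chamber 1) t *\<^sub>R f (t 0) = f (t 0)"
      using AE_space cube_AE_pos[of 1] by eventually_elim (simp add: chamber_def)
  qed (use m chamber_sets[of 1] in auto)
  also have "\<dots> = (\<integral>x. f x \<partial>distr (cube 1) leb01 (\<lambda>t. t 0))"
    by (rule integral_distr[symmetric]) (use cube_component[of 0 1] f in auto)
  also have "distr (cube 1) leb01 (\<lambda>t. t 0) = leb01"
    unfolding cube_def by (rule distr_PiM_component) (auto intro: leb01_prob)
  finally show ?thesis .
qed

lemma AE_simplex_1:
  assumes "AE x in leb01. P x"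
  shows "AE t in simplex_measure 1. P (t 0)"
proof -
  have "AE t in cube 1. P (t 0)"
    unfolding cube_def by (rule AE_PiM_component[OF leb01_prob _ assms]) simp
  then show ?thesis unfolding AE_simplex_iff by eventually_elim simp
qed

context wiener_process
begin

abbreviation wint :: "nat \<Rightarrow> ((nat \<Rightarrow> real) \<Rightarrow> real) \<Rightarrow> ('a \<Rightarrow> real) \<Rightarrow> bool" where
  "wint \<equiv> has_wiener_integral M w"

lemma wint_sq_integrable:
  assumes "wint n a X"
  shows "sq_integrable M X" "sq_integrable (simplex_measure n) a"
  using assms by (auto simp: has_wiener_integral_def L2_tendsto_def)

lemma wint_inner:
  assumes "wint n a X" "wint m b Y"
  shows "(\<integral>\<omega>. X \<omega> * Y \<omega> \<partial>M) = (if n = m then \<integral>t. a t * b t \<partial>simplex_measure n else 0)"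
proof -
  obtain S where S: "\<And>k. steps_in_simplex n (S k)"
    "L2_tendsto (simplex_measure n) (\<lambda>k. step_kernel n (S k)) a sequentially"
    "L2_tendsto M (\<lambda>k. step_integral w n (S k)) X sequentially"
    using assms(1) by (auto simp: has_wiener_integral_def)
  obtain T where T: "\<And>k. steps_in_simplex m (T k)"
    "L2_tendsto (simplex_measure m) (\<lambda>k. step_kernel m (T k)) b sequentially"
    "L2_tendsto M (\<lambda>k. step_integral w m (T k)) Y sequentially"
    using assms(2) by (auto simp: has_wiener_integral_def)
  have lim: "(\<lambda>k. \<integral>\<omega>. step_integral w n (S k) \<omega> * step_integral w m (T k) \<omega> \<partial>M) \<longlonglongrightarrow> (\<integral>\<omega>. X \<omega> * Y \<omega> \<partial>M)"
    by (rule L2_tendsto_inner[OF S(3) T(3)])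
  show ?thesis
  proof (cases "n = m")
    case True
    have "(\<lambda>k. \<integral>t. step_kernel n (S k) t * step_kernel n (T k) t \<partial>simplex_measure n) \<longlonglongrightarrow> (\<integral>t. a t * b t \<partial>simplex_measure n)"
      using L2_tendsto_inner[OF S(2)] T(2) True by simp
    moreover have "(\<lambda>k. \<integral>t. step_kernel n (S k) t * step_kernel n (T k) t \<partial>simplex_measure n) \<longlonglongrightarrow> (\<integral>\<omega>. X \<omega> * Y \<omega> \<partial>M)"
      using lim[unfolded step_integral_inner[OF S(1) T(1)]] True by simp
    ultimately have "(\<integral>\<omega>. X \<omega> * Y \<omega> \<partial>M) = (\<integral>t. a t * b t \<partial>simplex_measure n)"
      by (rule LIMSEQ_unique[rotated])
    then show ?thesis using True by simp
  next
    case False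
    then show ?thesis using lim by (simp add: step_integral_inner[OF S(1) T(1)] LIMSEQ_const_iff)
  qed
qed

lemma wint_box:
  assumes "ordered_corners n l r"
  shows "wint n (box_indicator n l r) (increment_product w n l r)"
proof -
  have "step_integral w n [(1, l, r)] = increment_product w n l r"
    by (simp add: step_integral_products fun_eq_iff)
  then show ?thesis
    unfolding has_wiener_integral_def
    using assms box_indicator_sq_integrable increment_product_sq_integrable[OF assms]
    by (intro exI[of _ "\<lambda>_. [(1, l, r)]"]) (simp add: steps_in_simplex_iff step_kernel_single L2_tendsto_const)
qed

lemma wint_step: "steps_in_simplex n S \<Longrightarrow> wint n (step_kernel n S) (step_integral w n S)"
  unfolding has_wiener_integral_def
  by (intro exI[of _ "\<lambda>_. S"]) (simp add: L2_tendsto_const step_kernel_sq_integrable step_integral_sq_integrable)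

lemma step_integral_add_scale:
  "step_integral w n (S @ map (\<lambda>(d, l, r). (c * d, l, r)) T) \<omega> = step_integral w n S \<omega> + c * step_integral w n T \<omega>"
proof -
  have "step_integral w n (map (\<lambda>(d, l, r). (c * d, l, r)) T) \<omega> = c * step_integral w n T \<omega>"
    unfolding step_integral_def sum_list_const_mult[symmetric] map_map
    by (intro arg_cong[where f=sum_list] map_cong) (auto simp: mult.assoc)
  then show ?thesis by (simp add: step_integral_def)
qed

lemma wint_add_scale:
  assumes "wint n a X" "wint n b Y"
  shows "wint n (\<lambda>t. a t + c * b t) (\<lambda>\<omega>. X \<omega> + c * Y \<omega>)"
proof -
  obtain S where S: "\<And>k. steps_in_simplex n (S k)"
    "L2_tendsto (simplex_measure n) (\<lambda>k. step_kernel n (S k)) a sequentially"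
    "L2_tendsto M (\<lambda>k. step_integral w n (S k)) X sequentially"
    using assms(1) by (auto simp: has_wiener_integral_def)
  obtain T where T: "\<And>k. steps_in_simplex n (T k)"
    "L2_tendsto (simplex_measure n) (\<lambda>k. step_kernel n (T k)) b sequentially"
    "L2_tendsto M (\<lambda>k. step_integral w n (T k)) Y sequentially"
    using assms(2) by (auto simp: has_wiener_integral_def)
  let ?U = "\<lambda>k. S k @ map (\<lambda>(d, l, r). (c * d, l, r)) (T k)"
  have "step_kernel n (?U k) = (\<lambda>t. step_kernel n (S k) t + c * step_kernel n (T k) t)" for k
    by (rule ext) (rule step_kernel_add_scale)
  moreover have "step_integral w n (?U k) = (\<lambda>\<omega>. step_integral w n (S k) \<omega> + c * step_integral w n (T k) \<omega>)" for k
    by (rule ext) (rule step_integral_add_scale)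
  ultimately show ?thesis
    unfolding has_wiener_integral_def
    using steps_in_simplex_add_scale[OF S(1) T(1)] L2_tendsto_add[OF S(2) L2_tendsto_scale[OF T(2)]]
      L2_tendsto_add[OF S(3) L2_tendsto_scale[OF T(3)]]
    by (intro exI[of _ ?U]) simp
qed

lemma wint_cong_AE:
  assumes "wint n a X" "AE t in simplex_measure n. a t = b t" "b \<in> borel_measurable (simplex_measure n)"
    "AE \<omega> in M. X \<omega> = Y \<omega>" "Y \<in> borel_measurable M"
  shows "wint n b Y"
proof -
  obtain S where S: "\<forall>k. steps_in_simplex n (S k)"
    "L2_tendsto (simplex_measure n) (\<lambda>k. step_kernel n (S k)) a sequentially"
    "L2_tendsto M (\<lambda>k. step_integral w n (S k)) X sequentially"
    using assms(1) by (auto simp: has_wiener_integral_def)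
  then show ?thesis
    unfolding has_wiener_integral_def
    by (intro exI[of _ S] conjI L2_tendsto_cong_AE[OF S(2) assms(2,3)] L2_tendsto_cong_AE[OF S(3) assms(4,5)])
qed

lemma wint_unique:
  assumes X: "wint n a X" and Y: "wint n b Y" and ab: "AE t in simplex_measure n. a t = b t"
  shows "AE \<omega> in M. X \<omega> = Y \<omega>"
proof -
  have d: "wint n (\<lambda>t. a t + - 1 * b t) (\<lambda>\<omega>. X \<omega> + - 1 * Y \<omega>)" by (rule wint_add_scale[OF X Y])
  have "(\<integral>\<omega>. (X \<omega> + - 1 * Y \<omega>) * (X \<omega> + - 1 * Y \<omega>) \<partial>M) = (\<integral>t. (a t + - 1 * b t) * (a t + - 1 * b t) \<partial>simplex_measure n)"
    using wint_inner[OF d d] by simp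
  also have "\<dots> = 0"
    by (rule integral_eq_zero_AE) (use ab in eventually_elim, simp)
  finally have "L2n M (\<lambda>\<omega>. X \<omega> - Y \<omega>) = 0" by (simp add: L2n_def power2_eq_square)
  from L2n_eq_0_imp_AE[OF _ this] show ?thesis
    using wint_sq_integrable(1)[OF X] wint_sq_integrable(1)[OF Y] by (auto intro: sq_integrable_diff)
qed

lemma step_integral_diff_norm:
  assumes "steps_in_simplex n S" "steps_in_simplex n T"
  shows "L2n M (\<lambda>\<omega>. step_integral w n S \<omega> - step_integral w n T \<omega>) =
    L2n (simplex_measure n) (\<lambda>t. step_kernel n S t - step_kernel n T t)"
proof -
  note d = wint_add_scale[OF wint_step[OF assms(1)] wint_step[OF assms(2)], of "- 1"]
  from wint_inner[OF d d] show ?thesis by (simp add: L2n_def power2_eq_square)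
qed

text \<open>By the isometry, approximating step kernels have step integrals that form a Cauchy sequence.\<close>

lemma wint_exists:
  assumes "sq_integrable (simplex_measure n) a"
  shows "\<exists>X. wint n a X"
proof -
  obtain S where S: "\<And>k. steps_in_simplex n (S k)"
    "L2_tendsto (simplex_measure n) (\<lambda>k. step_kernel n (S k)) a sequentially"
    using step_kernels_dense[OF assms] by blast
  have "\<exists>X. L2_tendsto M (\<lambda>k. step_integral w n (S k)) X sequentially"
    using L2_tendsto_Cauchy[OF S(2)]
    by (intro L2_complete step_integral_sq_integrable S) (simp add: step_integral_diff_norm[OF S(1) S(1)])
  then show ?thesis using S unfolding has_wiener_integral_def by blast
qed

text \<open>
  The isometry in the other direction: if the step integrals converge, then so do their kernels, and
  the limit kernel can be made symmetric by changing it outside the simplex.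
\<close>

lemma wint_of_limit:
  assumes S: "\<And>k. steps_in_simplex n (S k)" and X: "L2_tendsto M (\<lambda>k. step_integral w n (S k)) X sequentially"
  shows "\<exists>a. symmetric_kernel n a \<and> wint n a X"
proof -
  have "\<exists>a. L2_tendsto (simplex_measure n) (\<lambda>k. step_kernel n (S k)) a sequentially"
    using L2_tendsto_Cauchy[OF X]
    by (intro L2_complete step_kernel_sq_integrable) (simp add: step_integral_diff_norm[OF S S])
  then obtain b where b: "L2_tendsto (simplex_measure n) (\<lambda>k. step_kernel n (S k)) b sequentially" by blast
  have wb: "wint n b X" using S X b unfolding has_wiener_integral_def by blast
  obtain a where a: "symmetric_kernel n a" "AE t in simplex_measure n. b t = a t"
    using symmetrize_kernel[OF L2_tendstoD(1)[OF b]] by blast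
  have "a \<in> borel_measurable (simplex_measure n)"
    using a(1) by (auto simp: symmetric_kernel_def sq_integrable_def intro: cube_measurable_imp_simplex)
  then have "wint n a X"
    using wint_cong_AE[OF wb a(2)] sq_integrable_measurable[OF wint_sq_integrable(1)[OF wb]] by simp
  then show ?thesis using a(1) by blast
qed

lemma white_noise_exists: "\<exists>X. has_white_noise M w h X"
  unfolding has_white_noise_def
  by (intro wint_exists sq_integrable_simplex_1 rep_l2_01_sq_integrable)

lemma white_noise_sq_integrable: "has_white_noise M w h X \<Longrightarrow> sq_integrable M X"
  unfolding has_white_noise_def by (rule wint_sq_integrable)

lemma white_noise_add_scale:
  assumes "has_white_noise M w h X" "has_white_noise M w g Y"
  shows "has_white_noise M w (h + c *\<^sub>R g) (\<lambda>\<omega>. X \<omega> + c * Y \<omega>)"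
  unfolding has_white_noise_def
proof (rule wint_cong_AE)
  show "wint 1 (\<lambda>t. rep_l2_01 h (t 0) + c * rep_l2_01 g (t 0)) (\<lambda>\<omega>. X \<omega> + c * Y \<omega>)"
    using assms unfolding has_white_noise_def by (rule wint_add_scale)
  then show "(\<lambda>\<omega>. X \<omega> + c * Y \<omega>) \<in> borel_measurable M"
    by (rule sq_integrable_measurable[OF wint_sq_integrable(1)])
  show "AE t in simplex_measure 1. rep_l2_01 h (t 0) + c * rep_l2_01 g (t 0) = rep_l2_01 (h + c *\<^sub>R g) (t 0)"
    by (rule AE_simplex_1[OF eventually_mono[OF rep_l2_01_add_scale_AE[of h c g]]]) simp
  show "(\<lambda>t. rep_l2_01 (h + c *\<^sub>R g) (t 0)) \<in> borel_measurable (simplex_measure 1)"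
    by (rule sq_integrable_measurable[OF sq_integrable_simplex_1[OF rep_l2_01_sq_integrable]])
qed simp

lemma white_noise_inner:
  assumes "has_white_noise M w h X" "has_white_noise M w g Y"
  shows "(\<integral>\<omega>. X \<omega> * Y \<omega> \<partial>M) = inner h g"
  using wint_inner[OF assms[unfolded has_white_noise_def]]
    integral_simplex_1[of "\<lambda>x. rep_l2_01 h x * rep_l2_01 g x"]
  by (simp add: inner_l2_01_eq)

lemma white_noise_second_moment:
  "has_white_noise M w h X \<Longrightarrow> (\<integral>\<omega>. (X \<omega>)\<^sup>2 \<partial>M) = (norm h)\<^sup>2"
  using white_noise_inner[of h X h X] by (simp add: power2_eq_square[symmetric] dot_square_norm)

lemma white_noise_steps:
  assumes "has_white_noise M w h G"
  shows "\<exists>T. (\<forall>k. steps_in_simplex 1 (T k)) \<and> L2_tendsto M (\<lambda>k. step_integral w 1 (T k)) G sequentially"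
  using assms by (auto simp: has_white_noise_def has_wiener_integral_def)

text \<open>
  Testing a multiple integral with the character of a white noise gives the symmetric form of the
  kernel on the diagonal. On boxes this is the formula for independent normal variables, and both
  sides are continuous in the noise and in the kernel.
\<close>

lemma increment_product_white_noise_character:
  assumes o: "ordered_corners n l r" and G: "has_white_noise M w h G"
  shows "(\<integral>\<omega>. of_real (increment_product w n l r \<omega>) * cis (G \<omega>) \<partial>M) =
    \<i> ^ n * of_real ((\<integral>t. (\<Prod>i<n. rep_l2_01 h (t i)) * box_indicator n l r t \<partial>simplex_measure n) * exp (- (norm h)\<^sup>2 / 2))"
proof -
  obtain T where T: "\<And>k. steps_in_simplex 1 (T k)" "L2_tendsto M (\<lambda>k. step_integral w 1 (T k)) G sequentially"
    using white_noise_steps[OF G] by blast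
  have o1: "ordered_corners 1 (\<lambda>_. l i) (\<lambda>_. r i)" if "i < n" for i
    using ordered_cornersD[OF o that] by (simp add: ordered_corners_def)
  have inc1: "increment_product w 1 (\<lambda>_. l i) (\<lambda>_. r i) = (\<lambda>\<omega>. w (r i) \<omega> - w (l i) \<omega>)" for i
    by (simp add: increment_product_def fun_eq_iff)
  have cov: "(\<integral>\<omega>. (w (r i) \<omega> - w (l i) \<omega>) * G \<omega> \<partial>M) = (\<integral>x. indicator {l i<..r i} x * rep_l2_01 h x \<partial>leb01)" if "i < n" for i
    using wint_inner[OF wint_box[OF o1[OF that]] G[unfolded has_white_noise_def]]
      integral_simplex_1[of "\<lambda>x. indicator {l i<..r i} x * rep_l2_01 h x"]
    unfolding inc1 box_indicator_def by simp
  have "(\<lambda>k. (\<Prod>i<n. \<i> * of_real (\<integral>\<omega>. (w (r i) \<omega> - w (l i) \<omega>) * step_integral w 1 (T k) \<omega> \<partial>M)) *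
      of_real (exp (- (\<integral>\<omega>. (step_integral w 1 (T k) \<omega>)\<^sup>2 \<partial>M) / 2))) \<longlonglongrightarrow>
      (\<Prod>i<n. \<i> * of_real (\<integral>\<omega>. (w (r i) \<omega> - w (l i) \<omega>) * G \<omega> \<partial>M)) *
      of_real (exp (- (\<integral>\<omega>. (G \<omega>)\<^sup>2 \<partial>M) / 2))"
  proof (intro tendsto_intros)
    show "(\<lambda>k. \<integral>\<omega>. (step_integral w 1 (T k) \<omega>)\<^sup>2 \<partial>M) \<longlonglongrightarrow> (\<integral>\<omega>. (G \<omega>)\<^sup>2 \<partial>M)"
      unfolding power2_eq_square by (rule L2_tendsto_inner[OF T(2) T(2)])
    fix i assume "i \<in> {..<n}"
    then have "sq_integrable M (\<lambda>\<omega>. w (r i) \<omega> - w (l i) \<omega>)"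
      using increment_product_sq_integrable[OF o1[of i]] unfolding inc1 by simp
    then show "(\<lambda>k. \<integral>\<omega>. (w (r i) \<omega> - w (l i) \<omega>) * step_integral w 1 (T k) \<omega> \<partial>M) \<longlonglongrightarrow>
        (\<integral>\<omega>. (w (r i) \<omega> - w (l i) \<omega>) * G \<omega> \<partial>M)"
      by (intro L2_tendsto_inner[OF L2_tendsto_const T(2)])
  qed simp
  moreover have "(\<lambda>k. \<integral>\<omega>. of_real (increment_product w n l r \<omega>) * cis (step_integral w 1 (T k) \<omega>) \<partial>M) \<longlonglongrightarrow>
      (\<integral>\<omega>. of_real (increment_product w n l r \<omega>) * cis (G \<omega>) \<partial>M)"
    by (rule L2_tendsto_in_character[OF T(2) increment_product_sq_integrable[OF o]])
  ultimately have "(\<integral>\<omega>. of_real (increment_product w n l r \<omega>) * cis (G \<omega>) \<partial>M) =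
      (\<Prod>i<n. \<i> * of_real (\<integral>\<omega>. (w (r i) \<omega> - w (l i) \<omega>) * G \<omega> \<partial>M)) * of_real (exp (- (\<integral>\<omega>. (G \<omega>)\<^sup>2 \<partial>M) / 2))"
    unfolding increment_product_step_character[OF o T(1)] by (rule LIMSEQ_unique[rotated])
  also have "(\<Prod>i<n. \<i> * complex_of_real (\<integral>\<omega>. (w (r i) \<omega> - w (l i) \<omega>) * G \<omega> \<partial>M)) =
      (\<Prod>i<n. \<i> * complex_of_real (\<integral>x. indicator {l i<..r i} x * rep_l2_01 h x \<partial>leb01))"
    using cov by (intro prod.cong) auto
  also have "\<dots> = \<i> ^ n * of_real (\<integral>t. (\<Prod>i<n. rep_l2_01 h (t i)) * box_indicator n l r t \<partial>simplex_measure n)"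
    unfolding integral_simplex_box_product[OF o rep_l2_01_sq_integrable] by (simp add: prod.distrib)
  finally show ?thesis by (simp add: white_noise_second_moment[OF G])
qed

lemma tensor_power_sq_integrable:
  "sq_integrable (cube n) (\<lambda>t. \<Prod>i<n. rep_l2_01 (\<phi> i) (t i))"
  by (rule product_sq_integrable_cube) (rule rep_l2_01_sq_integrable)

lemma step_integral_white_noise_character:
  assumes S: "steps_in_simplex n S" and G: "has_white_noise M w h G"
  shows "(\<integral>\<omega>. of_real (step_integral w n S \<omega>) * cis (G \<omega>) \<partial>M) =
    \<i> ^ n * of_real ((\<integral>t. (\<Prod>i<n. rep_l2_01 h (t i)) * step_kernel n S t \<partial>simplex_measure n) * exp (- (norm h)\<^sup>2 / 2))"
  using S
proof (induction S)
  case Nil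
  then show ?case by (simp add: step_integral_def step_kernel_def)
next
  case (Cons s S)
  obtain c l r where s: "s = (c, l, r)" by (cases s)
  have o: "ordered_corners n l r" and S: "steps_in_simplex n S"
    using Cons.prems by (simp_all add: s steps_in_simplex_Cons)
  have cG: "(\<lambda>\<omega>. cis (G \<omega>)) \<in> borel_measurable M" "integrable M (\<lambda>\<omega>. (norm (cis (G \<omega>)))\<^sup>2)"
    using sq_integrable_measurable[OF white_noise_sq_integrable[OF G]] by auto
  note H = sq_integrable_cube_imp_simplex[OF tensor_power_sq_integrable[of n "\<lambda>_. h"]]
  have "(\<integral>\<omega>. of_real (step_integral w n (s # S) \<omega>) * cis (G \<omega>) \<partial>M) =
      (\<integral>\<omega>. of_real c * (of_real (increment_product w n l r \<omega>) * cis (G \<omega>)) + of_real (step_integral w n S \<omega>) * cis (G \<omega>) \<partial>M)"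
    by (simp add: s step_integral_Cons algebra_simps)
  also have "\<dots> = of_real c * (\<integral>\<omega>. of_real (increment_product w n l r \<omega>) * cis (G \<omega>) \<partial>M) +
      (\<integral>\<omega>. of_real (step_integral w n S \<omega>) * cis (G \<omega>) \<partial>M)"
    using L2_bound_complex(1)[OF increment_product_sq_integrable[OF o] cG]
      L2_bound_complex(1)[OF step_integral_sq_integrable[OF S] cG]
    by (subst Bochner_Integration.integral_add) simp_all
  also have "\<dots> = \<i> ^ n * of_real ((c * (\<integral>t. (\<Prod>i<n. rep_l2_01 h (t i)) * box_indicator n l r t \<partial>simplex_measure n) +
      (\<integral>t. (\<Prod>i<n. rep_l2_01 h (t i)) * step_kernel n S t \<partial>simplex_measure n)) * exp (- (norm h)\<^sup>2 / 2))"
    unfolding increment_product_white_noise_character[OF o G] Cons.IH[OF S] by (simp add: algebra_simps)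
  also have "c * (\<integral>t. (\<Prod>i<n. rep_l2_01 h (t i)) * box_indicator n l r t \<partial>simplex_measure n) +
      (\<integral>t. (\<Prod>i<n. rep_l2_01 h (t i)) * step_kernel n S t \<partial>simplex_measure n) =
      (\<integral>t. c * ((\<Prod>i<n. rep_l2_01 h (t i)) * box_indicator n l r t) + (\<Prod>i<n. rep_l2_01 h (t i)) * step_kernel n S t \<partial>simplex_measure n)"
    using sq_integrable_mult[OF H box_indicator_sq_integrable[of n l r]] sq_integrable_mult[OF H step_kernel_sq_integrable[of n S]]
    by simp
  also have "\<dots> = (\<integral>t. (\<Prod>i<n. rep_l2_01 h (t i)) * step_kernel n (s # S) t \<partial>simplex_measure n)"
    by (simp add: s step_kernel_Cons algebra_simps)
  finally show ?case .
qed

lemma wint_white_noise_character: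
  assumes X: "wint n a X" and a: "symmetric_kernel n a" and G: "has_white_noise M w h G"
  shows "(\<integral>\<omega>. of_real (X \<omega>) * cis (G \<omega>) \<partial>M) = \<i> ^ n * of_real (kernel_form n a (\<lambda>_. h) * exp (- (norm h)\<^sup>2 / 2))"
proof -
  obtain S where S: "\<And>k. steps_in_simplex n (S k)"
    "L2_tendsto (simplex_measure n) (\<lambda>k. step_kernel n (S k)) a sequentially"
    "L2_tendsto M (\<lambda>k. step_integral w n (S k)) X sequentially"
    using X by (auto simp: has_wiener_integral_def)
  let ?H = "\<lambda>t. \<Prod>i<n. rep_l2_01 h (t i)"
  note Hc = tensor_power_sq_integrable[of n "\<lambda>_. h"]
  note H = sq_integrable_cube_imp_simplex[OF Hc]
  have "(\<lambda>k. \<integral>t. ?H t * step_kernel n (S k) t \<partial>simplex_measure n) \<longlonglongrightarrow> (\<integral>t. ?H t * a t \<partial>simplex_measure n)"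
    by (rule L2_tendsto_inner[OF L2_tendsto_const[OF H] S(2)])
  then have "(\<lambda>k. \<i> ^ n * of_real ((\<integral>t. ?H t * step_kernel n (S k) t \<partial>simplex_measure n) * exp (- (norm h)\<^sup>2 / 2))) \<longlonglongrightarrow>
      \<i> ^ n * of_real ((\<integral>t. ?H t * a t \<partial>simplex_measure n) * exp (- (norm h)\<^sup>2 / 2))"
    by (intro tendsto_intros)
  moreover have "(\<lambda>k. \<integral>\<omega>. of_real (step_integral w n (S k) \<omega>) * cis (G \<omega>) \<partial>M) \<longlonglongrightarrow> (\<integral>\<omega>. of_real (X \<omega>) * cis (G \<omega>) \<partial>M)"
    by (rule L2_tendsto_character[OF S(3) sq_integrable_measurable[OF white_noise_sq_integrable[OF G]]])
  ultimately have eq: "(\<integral>\<omega>. of_real (X \<omega>) * cis (G \<omega>) \<partial>M) =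
      \<i> ^ n * of_real ((\<integral>t. ?H t * a t \<partial>simplex_measure n) * exp (- (norm h)\<^sup>2 / 2))"
    unfolding step_integral_white_noise_character[OF S(1) G] by (rule LIMSEQ_unique[rotated])
  have sym: "?H (t \<circ> \<pi>) = ?H t" if "\<pi> permutes {..<n}" for \<pi> t
    using prod.permute[OF that, of "\<lambda>i. rep_l2_01 h (t i)"] by (simp add: comp_def)
  have "integrable (cube n) (\<lambda>t. ?H t * a t)"
    using a by (intro sq_integrable_mult Hc) (simp add: symmetric_kernel_def)
  then have "(\<integral>t. ?H t * a t \<partial>cube n) = fact n *\<^sub>R (\<integral>t. ?H t * a t \<partial>simplex_measure n)"
    using sym a by (intro integral_cube_symmetric) (simp_all add: symmetric_kernel_def)
  then have "(\<integral>t. ?H t * a t \<partial>simplex_measure n) = kernel_form n a (\<lambda>_. h)"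
    by (simp add: kernel_form_def mult.commute)
  then show ?thesis using eq by simp
qed

lemma white_noise_character:
  assumes G: "has_white_noise M w h G"
  shows "(\<integral>\<omega>. cis (G \<omega>) \<partial>M) = of_real (exp (- (norm h)\<^sup>2 / 2))"
proof -
  interpret S: prob_space "cube 0" by (rule cube_prob)
  have o: "ordered_corners 0 (\<lambda>_. 0) (\<lambda>_. 0)" by (simp add: ordered_corners_def)
  have "(\<integral>t. (\<Prod>i<0. rep_l2_01 h (t i)) * box_indicator 0 (\<lambda>_. 0) (\<lambda>_. 0) t \<partial>simplex_measure 0) = 1"
    unfolding integral_simplex_box_product[OF o rep_l2_01_sq_integrable] by simp
  then show ?thesis
    using increment_product_white_noise_character[OF o G] by (simp add: increment_product_def)
qed

text \<open>
  Square integrable variables in the orthogonal complement of all multiple integrals, the constants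
  included as those of order 0.
\<close>

definition chaos_orthogonal :: "('a \<Rightarrow> real) \<Rightarrow> bool" where
  "chaos_orthogonal Y \<longleftrightarrow> sq_integrable M Y \<and>
     (\<forall>n l r. ordered_corners n l r \<longrightarrow> (\<integral>\<omega>. Y \<omega> * increment_product w n l r \<omega> \<partial>M) = 0)"

lemma chaos_orthogonal_character:
  assumes Y: "chaos_orthogonal Y" and G: "has_white_noise M w h G"
  shows "(\<integral>\<omega>. of_real (Y \<omega>) * cis (G \<omega>) \<partial>M) = 0"
proof -
  obtain T where T: "\<And>k. steps_in_simplex 1 (T k)" "L2_tendsto M (\<lambda>k. step_integral w 1 (T k)) G sequentially"
    using white_noise_steps[OF G] by blast
  have Ys: "sq_integrable M Y" using Y by (simp add: chaos_orthogonal_def)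
  have z: "(\<integral>\<omega>. of_real (Y \<omega>) * cis (step_integral w 1 (T k) \<omega>) \<partial>M) = 0" for k
    using Y by (intro character_orthogonal[OF Ys _ T(1)]) (simp add: chaos_orthogonal_def)
  show ?thesis
    using L2_tendsto_in_character[OF T(2) Ys] unfolding z by (simp add: LIMSEQ_const_iff)
qed

end

section \<open>Orthogonal expansions and second quantization\<close>

lemma step_integral_Nil: "step_integral w n [] = (\<lambda>_. 0)"
  by (simp add: step_integral_def fun_eq_iff)

lemma symmetric_kernel_zero: "symmetric_kernel n (\<lambda>_. 0)"
  by (simp add: symmetric_kernel_def sq_integrable_zero)

lemma kernel_form_zero: "kernel_form n (\<lambda>_. 0) \<phi> = 0"
  by (simp add: kernel_form_def)

lemma kernel_form_cong_AE:
  assumes a: "symmetric_kernel n a" and b: "symmetric_kernel n b"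
    and ae: "AE t in simplex_measure n. a t = b t"
  shows "kernel_form n a = kernel_form n b"
proof
  fix \<phi>
  have sq: "sq_integrable (cube n) a" "sq_integrable (cube n) b" using a b by (auto simp: symmetric_kernel_def)
  have P: "sq_integrable (cube n) (\<lambda>t. \<Prod>i<n. rep_l2_01 (\<phi> i) (t i))"
    by (rule product_sq_integrable_cube) (rule rep_l2_01_sq_integrable)
  have "(\<integral>t. a t * (\<Prod>i<n. rep_l2_01 (\<phi> i) (t i)) \<partial>cube n) = (\<integral>t. b t * (\<Prod>i<n. rep_l2_01 (\<phi> i) (t i)) \<partial>cube n)"
  proof (rule integral_cong_AE)
    show "(\<lambda>t. a t * (\<Prod>i<n. rep_l2_01 (\<phi> i) (t i))) \<in> borel_measurable (cube n)"
      "(\<lambda>t. b t * (\<Prod>i<n. rep_l2_01 (\<phi> i) (t i))) \<in> borel_measurable (cube n)"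
      by (intro borel_measurable_times sq_integrable_measurable[OF P] sq_integrable_measurable sq)+
    show "AE t in cube n. a t * (\<Prod>i<n. rep_l2_01 (\<phi> i) (t i)) = b t * (\<Prod>i<n. rep_l2_01 (\<phi> i) (t i))"
      using symmetric_AE_simplex_imp_cube[OF a b ae] by eventually_elim simp
  qed
  then show "kernel_form n a \<phi> = kernel_form n b \<phi>" by (simp add: kernel_form_def)
qed

lemma integral_box_kernel_form:
  assumes b: "symmetric_kernel n b" and o: "ordered_corners n l r"
  shows "(\<integral>t. b t * box_indicator n l r t \<partial>simplex_measure n) =
    fact n * kernel_form n b (\<lambda>i. abs_l2_01 (indicator {l i<..r i}))"
proof -
  have sq: "sq_integrable (cube n) b" using b by (simp add: symmetric_kernel_def)
  let ?\<phi> = "\<lambda>i. abs_l2_01 (indicator {l i<..r i})"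
  have P: "sq_integrable (cube n) (\<lambda>t. \<Prod>i<n. rep_l2_01 (?\<phi> i) (t i))"
    by (rule product_sq_integrable_cube) (rule rep_l2_01_sq_integrable)
  have "\<forall>i\<in>{..<n}. AE t in cube n. rep_l2_01 (?\<phi> i) (t i) = indicator {l i<..r i} (t i)"
    unfolding cube_def
    by (intro ballI AE_PiM_component leb01_prob rep_abs_l2_01_AE[OF sq_integrable_indicator_half_open])
  then have "AE t in cube n. \<forall>i\<in>{..<n}. rep_l2_01 (?\<phi> i) (t i) = indicator {l i<..r i} (t i)"
    by (intro AE_finite_allI) auto
  then have ae: "AE t in cube n. b t * (\<Prod>i<n. rep_l2_01 (?\<phi> i) (t i)) = b t * box_indicator n l r t"
    by eventually_elim (simp add: box_indicator_def)
  have "(\<integral>t. b t * box_indicator n l r t \<partial>simplex_measure n) = (\<integral>t. b t * box_indicator n l r t \<partial>cube n)"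
    by (rule integral_simplex_box[OF o sq_integrable_measurable[OF sq]])
  also have "\<dots> = (\<integral>t. b t * (\<Prod>i<n. rep_l2_01 (?\<phi> i) (t i)) \<partial>cube n)"
    using ae by (intro integral_cong_AE borel_measurable_times sq_integrable_measurable[OF P]
        sq_integrable_measurable[OF sq] box_indicator_measurable_cube) auto
  finally show ?thesis by (simp add: kernel_form_def)
qed

lemma simplex_kernels_eq_if_boxes:
  assumes a: "sq_integrable (simplex_measure n) a" and b: "sq_integrable (simplex_measure n) b"
    and eq: "\<And>l r. ordered_corners n l r \<Longrightarrow>
      (\<integral>t. a t * box_indicator n l r t \<partial>simplex_measure n) = (\<integral>t. b t * box_indicator n l r t \<partial>simplex_measure n)"
  shows "AE t in simplex_measure n. a t = b t"
proof -
  interpret finite_measure "simplex_measure n" by (rule finite_simplex_measure)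
  have "AE t in simplex_measure n. a t - b t = 0"
  proof (rule AE_zero_if_orthogonal_to_boxes)
    show "integrable (simplex_measure n) (\<lambda>t. a t - b t)"
      by (rule sq_integrable_imp_integrable[OF sq_integrable_diff[OF a b]])
    fix l r assume o: "ordered_corners n l r"
    show "(\<integral>t. (a t - b t) * box_indicator n l r t \<partial>simplex_measure n) = 0"
      using eq[OF o] sq_integrable_mult[OF a box_indicator_sq_integrable[of n l r]]
        sq_integrable_mult[OF b box_indicator_sq_integrable[of n l r]]
      by (simp add: left_diff_distrib)
  qed
  then show ?thesis by simp
qed

lemma symmetric_kernel_simplex: "symmetric_kernel n a \<Longrightarrow> sq_integrable (simplex_measure n) a"
  by (simp add: symmetric_kernel_def sq_integrable_cube_imp_simplex)

text \<open>
  The integral of a symmetric kernel over a box with ordered corners is a value of its form, and such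
  boxes determine the kernel.
\<close>

lemma kernel_form_inj:
  assumes "symmetric_kernel n a" "symmetric_kernel n b" "kernel_form n a = kernel_form n b"
  shows "AE t in simplex_measure n. a t = b t"
  using assms
  by (intro simplex_kernels_eq_if_boxes symmetric_kernel_simplex) (simp_all add: integral_box_kernel_form)

context wiener_process
begin

lemma wint_zero: "wint n (\<lambda>_. 0) (\<lambda>_. 0)"
  using wint_step[of n "[]"] by (simp add: steps_in_simplex_def step_integral_Nil step_kernel_def[abs_def])

definition chaos_sums :: "('a \<Rightarrow> real) set" where
  "chaos_sums = {(\<lambda>\<omega>. \<Sum>n<N. step_integral w n (S n) \<omega>) | N S.
     (\<forall>n. steps_in_simplex n (S n)) \<and> (\<forall>n\<ge>N. S n = [])}"

lemma chaos_sum_extend: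
  assumes "\<And>n. n \<ge> N \<Longrightarrow> S n = []" "N \<le> K"
  shows "(\<Sum>n<K. step_integral w n (S n) \<omega>) = (\<Sum>n<N. step_integral w n (S n) \<omega>)"
  using assms by (intro sum.mono_neutral_right) (auto simp: step_integral_Nil)

lemma chaos_sums_subspace: "L2_subspace M chaos_sums"
  unfolding L2_subspace_def
proof (intro conjI ballI allI)
  show "(\<lambda>_. 0) \<in> chaos_sums"
    unfolding chaos_sums_def
    by (intro CollectI exI[of _ 0] exI[of _ "\<lambda>_. []"]) (simp add: steps_in_simplex_def)
  fix f assume "f \<in> chaos_sums"
  then obtain N S where S: "\<And>n. steps_in_simplex n (S n)" "\<And>n. n \<ge> N \<Longrightarrow> S n = []"
    "f = (\<lambda>\<omega>. \<Sum>n<N. step_integral w n (S n) \<omega>)" unfolding chaos_sums_def by blast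
  show "sq_integrable M f" unfolding S(3) by (intro sq_integrable_sum step_integral_sq_integrable S)
  fix g c assume "g \<in> chaos_sums"
  then obtain K T where T: "\<And>n. steps_in_simplex n (T n)" "\<And>n. n \<ge> K \<Longrightarrow> T n = []"
    "g = (\<lambda>\<omega>. \<Sum>n<K. step_integral w n (T n) \<omega>)" unfolding chaos_sums_def by blast
  let ?U = "\<lambda>n. S n @ map (\<lambda>(d, l, r). (c * d, l, r)) (T n)" and ?L = "max N K"
  have "f \<omega> + c * g \<omega> = (\<Sum>n<?L. step_integral w n (?U n) \<omega>)" for \<omega>
  proof -
    have "f \<omega> = (\<Sum>n<?L. step_integral w n (S n) \<omega>)"
      using chaos_sum_extend[of N S ?L \<omega>, OF S(2) max.cobounded1] by (simp add: S(3))
    moreover have "g \<omega> = (\<Sum>n<?L. step_integral w n (T n) \<omega>)"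
      using chaos_sum_extend[of K T ?L \<omega>, OF T(2) max.cobounded2] by (simp add: T(3))
    ultimately show ?thesis by (simp only: step_integral_add_scale sum.distrib sum_distrib_left)
  qed
  then have "(\<lambda>\<omega>. f \<omega> + c * g \<omega>) = (\<lambda>\<omega>. \<Sum>n<?L. step_integral w n (?U n) \<omega>)" by (rule ext)
  moreover have "\<forall>n. steps_in_simplex n (?U n)" using steps_in_simplex_add_scale S(1) T(1) by blast
  moreover have "\<forall>n\<ge>?L. ?U n = []" using S(2) T(2) by simp
  ultimately show "(\<lambda>\<omega>. f \<omega> + c * g \<omega>) \<in> chaos_sums"
    unfolding chaos_sums_def by (intro CollectI exI[of _ ?L] exI[of _ ?U] conjI)
qed

lemma increment_product_in_chaos_sums:
  assumes o: "ordered_corners n l r"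
  shows "increment_product w n l r \<in> chaos_sums"
proof -
  let ?S = "\<lambda>m. if m = n then [(1, l, r)] else []"
  have "increment_product w n l r = (\<lambda>\<omega>. \<Sum>m<Suc n. step_integral w m (?S m) \<omega>)"
  proof
    fix \<omega>
    have "(\<Sum>m<Suc n. step_integral w m (?S m) \<omega>) = (\<Sum>m<Suc n. if m = n then increment_product w n l r \<omega> else 0)"
      by (intro sum.cong) (simp_all add: step_integral_Nil step_integral_products)
    then show "increment_product w n l r \<omega> = (\<Sum>m<Suc n. step_integral w m (?S m) \<omega>)" by simp
  qed
  moreover have "\<forall>m. steps_in_simplex m (?S m)" using o by (simp add: steps_in_simplex_iff)
  moreover have "\<forall>m\<ge>Suc n. ?S m = []" by simp
  ultimately show ?thesis
    unfolding chaos_sums_def by (intro CollectI exI[of _ "Suc n"] exI[of _ ?S] conjI)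
qed

text \<open>The projection to the closed span of the step integrals of order \<open>n\<close>.\<close>

lemma chaos_component:
  assumes l: "sq_integrable M l"
  shows "\<exists>J b. symmetric_kernel n b \<and> wint n b J \<and>
    (\<forall>T. steps_in_simplex n T \<longrightarrow> (\<integral>\<omega>. (l \<omega> - J \<omega>) * step_integral w n T \<omega> \<partial>M) = 0)"
proof -
  let ?V = "step_integral w n ` {S. steps_in_simplex n S}"
  have V: "L2_subspace M ?V"
    unfolding L2_subspace_def
  proof (intro conjI ballI allI)
    show "(\<lambda>_. 0) \<in> ?V"
      using step_integral_Nil[of w n] by (intro image_eqI[of _ _ "[]"]) (simp_all add: steps_in_simplex_def)
    fix f assume "f \<in> ?V"
    then obtain S where S: "f = step_integral w n S" "steps_in_simplex n S" by auto
    then show "sq_integrable M f" by (simp add: step_integral_sq_integrable)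
    fix g c assume "g \<in> ?V"
    then obtain T where T: "g = step_integral w n T" "steps_in_simplex n T" by auto
    have "(\<lambda>\<omega>. f \<omega> + c * g \<omega>) = step_integral w n (S @ map (\<lambda>(d, l, r). (c * d, l, r)) T)"
      unfolding S(1) T(1) by (intro ext) (rule step_integral_add_scale[symmetric])
    then show "(\<lambda>\<omega>. f \<omega> + c * g \<omega>) \<in> ?V"
      using steps_in_simplex_add_scale[OF S(2) T(2)] by auto
  qed
  obtain v J where v: "\<And>k::nat. v k \<in> ?V" "L2_tendsto M v J sequentially"
    and o: "\<And>h. h \<in> ?V \<Longrightarrow> (\<integral>\<omega>. (l \<omega> - J \<omega>) * h \<omega> \<partial>M) = 0"
    using L2_projection[OF V l] by blast
  have "\<forall>k. \<exists>S. steps_in_simplex n S \<and> v k = step_integral w n S" using v(1) by auto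
  from choice[OF this] obtain S where S: "\<And>k. steps_in_simplex n (S k)" "\<And>k. v k = step_integral w n (S k)" by auto
  have "v = (\<lambda>k. step_integral w n (S k))" using S(2) by auto
  then have vl: "L2_tendsto M (\<lambda>k. step_integral w n (S k)) J sequentially" using v(2) by simp
  obtain b where "symmetric_kernel n b" "wint n b J" using wint_of_limit[of n S J, OF S(1) vl] by blast
  then show ?thesis using o by blast
qed

text \<open>
  The sum of the first \<open>N\<close> components is the best approximation of \<open>l\<close> by finite sums of step
  integrals of order below \<open>N\<close>, as the remainder is orthogonal to all of them. Such sums come
  arbitrarily close to \<open>l\<close> by hypothesis.
\<close>

lemma chaos_expansion:
  assumes l: "sq_integrable M l"
    and tot: "\<And>Y. chaos_orthogonal Y \<Longrightarrow> (\<integral>\<omega>. l \<omega> * Y \<omega> \<partial>M) = 0"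
  shows "\<exists>J b. (\<forall>n. symmetric_kernel n (b n) \<and> wint n (b n) (J n)) \<and>
    L2_tendsto M (\<lambda>N \<omega>. \<Sum>n<N. J n \<omega>) l sequentially"
proof -
  have "\<forall>n. \<exists>p. symmetric_kernel n (snd p) \<and> wint n (snd p) (fst p) \<and>
    (\<forall>T. steps_in_simplex n T \<longrightarrow> (\<integral>\<omega>. (l \<omega> - fst p \<omega>) * step_integral w n T \<omega> \<partial>M) = 0)"
    using chaos_component[OF l] by (metis fst_conv snd_conv)
  from choice[OF this] obtain p where p: "\<And>n. symmetric_kernel n (snd (p n))" "\<And>n. wint n (snd (p n)) (fst (p n))"
    "\<And>n T. steps_in_simplex n T \<Longrightarrow> (\<integral>\<omega>. (l \<omega> - fst (p n) \<omega>) * step_integral w n T \<omega> \<partial>M) = 0" by blast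
  define J where "J n = fst (p n)" for n
  define b where "b n = snd (p n)" for n
  have b: "symmetric_kernel n (b n)" "wint n (b n) (J n)" for n using p by (simp_all add: J_def b_def)
  have Js: "sq_integrable M (J n)" for n by (rule wint_sq_integrable(1)[OF b(2)])
  have o: "(\<integral>\<omega>. (l \<omega> - J n \<omega>) * step_integral w n T \<omega> \<partial>M) = 0" if "steps_in_simplex n T" for n T
    using p(3)[OF that] by (simp add: J_def)
  define R where "R N \<omega> = l \<omega> - (\<Sum>n<N. J n \<omega>)" for N \<omega>
  have Rs: "sq_integrable M (R N)" for N
    unfolding R_def[abs_def] by (intro sq_integrable_diff l sq_integrable_sum Js)
  have Ro: "(\<integral>\<omega>. R N \<omega> * step_integral w m T \<omega> \<partial>M) = 0" if T: "steps_in_simplex m T" and m: "m < N" for N m T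
  proof -
    note Ts = step_integral_sq_integrable[OF T]
    have "(\<integral>\<omega>. R N \<omega> * step_integral w m T \<omega> \<partial>M) =
        (\<integral>\<omega>. (l \<omega> - J m \<omega>) * step_integral w m T \<omega> - (\<Sum>n\<in>{..<N} - {m}. J n \<omega> * step_integral w m T \<omega>) \<partial>M)"
    proof (intro Bochner_Integration.integral_cong refl)
      fix \<omega>
      have "(\<Sum>n<N. J n \<omega>) = J m \<omega> + (\<Sum>n\<in>{..<N} - {m}. J n \<omega>)" using m by (simp add: sum.remove)
      then show "R N \<omega> * step_integral w m T \<omega> =
          (l \<omega> - J m \<omega>) * step_integral w m T \<omega> - (\<Sum>n\<in>{..<N} - {m}. J n \<omega> * step_integral w m T \<omega>)"
        by (simp add: R_def sum_distrib_right[symmetric] algebra_simps)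
    qed
    also have "\<dots> = (\<integral>\<omega>. (l \<omega> - J m \<omega>) * step_integral w m T \<omega> \<partial>M) - (\<Sum>n\<in>{..<N} - {m}. \<integral>\<omega>. J n \<omega> * step_integral w m T \<omega> \<partial>M)"
      using sq_integrable_mult[OF sq_integrable_diff[OF l Js] Ts] sq_integrable_mult[OF Js Ts]
      by (subst Bochner_Integration.integral_diff) (auto simp: Bochner_Integration.integral_sum)
    also have "(\<Sum>n\<in>{..<N} - {m}. \<integral>\<omega>. J n \<omega> * step_integral w m T \<omega> \<partial>M) = 0"
      using wint_inner[OF b(2) wint_step[OF T]] by (intro sum.neutral) auto
    finally show ?thesis using o[OF T] by simp
  qed
  have RJ: "(\<integral>\<omega>. R N \<omega> * J m \<omega> \<partial>M) = 0" if m: "m < N" for N m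
  proof -
    obtain S where S: "\<And>k. steps_in_simplex m (S k)" "L2_tendsto M (\<lambda>k. step_integral w m (S k)) (J m) sequentially"
      using b(2)[of m] by (auto simp: has_wiener_integral_def)
    have "(\<lambda>k. \<integral>\<omega>. R N \<omega> * step_integral w m (S k) \<omega> \<partial>M) \<longlonglongrightarrow> (\<integral>\<omega>. R N \<omega> * J m \<omega> \<partial>M)"
      by (rule L2_tendsto_inner[OF L2_tendsto_const[OF Rs] S(2)])
    then show ?thesis by (simp add: Ro[OF S(1) m] LIMSEQ_const_iff)
  qed
  have best: "L2n M (R N) \<le> L2n M (\<lambda>\<omega>. l \<omega> - f \<omega>)"
    if S: "\<And>n. steps_in_simplex n (S n)" "\<And>n. n \<ge> K \<Longrightarrow> S n = []" "f = (\<lambda>\<omega>. \<Sum>n<K. step_integral w n (S n) \<omega>)"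
      and K: "K \<le> N" for S K f N
  proof -
    have f: "f = (\<lambda>\<omega>. \<Sum>n<N. step_integral w n (S n) \<omega>)"
      unfolding S(3) by (rule ext) (rule chaos_sum_extend[of K S N, OF S(2) K, symmetric])
    have SJ: "sq_integrable M (\<lambda>\<omega>. \<Sum>n<N. J n \<omega>)" by (intro sq_integrable_sum Js)
    have fs: "sq_integrable M f" unfolding f by (intro sq_integrable_sum step_integral_sq_integrable S)
    have "(\<integral>\<omega>. R N \<omega> * f \<omega> \<partial>M) = (\<Sum>n<N. \<integral>\<omega>. R N \<omega> * step_integral w n (S n) \<omega> \<partial>M)"
      unfolding f sum_distrib_left
      by (intro Bochner_Integration.integral_sum sq_integrable_mult Rs step_integral_sq_integrable S)
    then have z1: "(\<integral>\<omega>. R N \<omega> * f \<omega> \<partial>M) = 0" using Ro[OF S(1)] by simp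
    have "(\<integral>\<omega>. R N \<omega> * (\<Sum>n<N. J n \<omega>) \<partial>M) = (\<Sum>n<N. \<integral>\<omega>. R N \<omega> * J n \<omega> \<partial>M)"
      unfolding sum_distrib_left by (intro Bochner_Integration.integral_sum sq_integrable_mult Rs Js)
    then have z2: "(\<integral>\<omega>. R N \<omega> * (\<Sum>n<N. J n \<omega>) \<partial>M) = 0" using RJ by simp
    have "(\<integral>\<omega>. R N \<omega> * R N \<omega> \<partial>M) = (\<integral>\<omega>. R N \<omega> * (l \<omega> - f \<omega>) + R N \<omega> * f \<omega> - R N \<omega> * (\<Sum>n<N. J n \<omega>) \<partial>M)"
      by (intro Bochner_Integration.integral_cong refl) (simp add: R_def algebra_simps)
    also have "\<dots> = (\<integral>\<omega>. R N \<omega> * (l \<omega> - f \<omega>) \<partial>M)"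
      using sq_integrable_mult[OF Rs sq_integrable_diff[OF l fs], of N] sq_integrable_mult[OF Rs fs, of N]
        sq_integrable_mult[OF Rs SJ] z1 z2 by simp
    also have "\<dots> \<le> L2n M (R N) * L2n M (\<lambda>\<omega>. l \<omega> - f \<omega>)"
      using L2_Cauchy_Schwarz[OF Rs sq_integrable_diff[OF l fs], of N] by linarith
    finally have "L2n M (R N) * L2n M (R N) \<le> L2n M (R N) * L2n M (\<lambda>\<omega>. l \<omega> - f \<omega>)"
      using L2n_square[of M "R N"] by (simp add: power2_eq_square)
    then show ?thesis
      using L2n_nonneg[of M "R N"] L2n_nonneg[of M "\<lambda>\<omega>. l \<omega> - f \<omega>"]
      by (cases "L2n M (R N) = 0") (auto simp: mult_le_cancel_left)
  qed
  have "\<exists>v. (\<forall>k::nat. v k \<in> chaos_sums) \<and> L2_tendsto M v l sequentially"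
  proof (rule L2_limit_of_subspace[OF chaos_sums_subspace l])
    fix Y assume "sq_integrable M Y" "\<And>h. h \<in> chaos_sums \<Longrightarrow> (\<integral>\<omega>. Y \<omega> * h \<omega> \<partial>M) = 0"
    then have "chaos_orthogonal Y" unfolding chaos_orthogonal_def using increment_product_in_chaos_sums by blast
    then show "(\<integral>\<omega>. l \<omega> * Y \<omega> \<partial>M) = 0" by (rule tot)
  qed
  then obtain v where v: "\<And>k::nat. v k \<in> chaos_sums" "L2_tendsto M v l sequentially" by blast
  have "(\<lambda>N. L2n M (R N)) \<longlonglongrightarrow> 0"
  proof (rule LIMSEQ_I)
    fix e :: real assume "0 < e"
    from order_tendstoD(2)[OF L2_tendstoD(3)[OF v(2)] this]
    obtain k where k: "L2n M (\<lambda>\<omega>. v k \<omega> - l \<omega>) < e" by (auto simp: eventually_sequentially)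
    obtain K S where S: "\<And>n. steps_in_simplex n (S n)" "\<And>n. n \<ge> K \<Longrightarrow> S n = []"
      "v k = (\<lambda>\<omega>. \<Sum>n<K. step_integral w n (S n) \<omega>)" using v(1)[of k] unfolding chaos_sums_def by blast
    have "norm (L2n M (R N) - 0) < e" if "N \<ge> K" for N
    proof -
      have "L2n M (R N) \<le> L2n M (\<lambda>\<omega>. l \<omega> - v k \<omega>)" by (rule best[OF S that])
      also have "\<dots> < e" using k by (simp only: L2n_minus_commute[of M l])
      finally show ?thesis by (simp add: L2n_nonneg)
    qed
    then show "\<exists>N0. \<forall>N\<ge>N0. norm (L2n M (R N) - 0) < e" by blast
  qed
  then have "(\<lambda>N. L2n M (\<lambda>\<omega>. (\<Sum>n<N. J n \<omega>) - l \<omega>)) \<longlonglongrightarrow> 0"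
    by (simp only: R_def[abs_def] L2n_minus_commute[of M l])
  then have "L2_tendsto M (\<lambda>N \<omega>. \<Sum>n<N. J n \<omega>) l sequentially"
    by (intro L2_tendstoI l always_eventually allI sq_integrable_sum Js)
  then show ?thesis using b by blast
qed

lemma chaos_expansion_inner:
  assumes J: "\<And>n. wint n (b n) (J n)" and lim: "L2_tendsto M (\<lambda>N \<omega>. \<Sum>n<N. J n \<omega>) l sequentially"
    and X: "wint m c X"
  shows "(\<integral>\<omega>. l \<omega> * X \<omega> \<partial>M) = (\<integral>t. b m t * c t \<partial>simplex_measure m)"
proof -
  note Xs = wint_sq_integrable(1)[OF X] and Js = wint_sq_integrable(1)[OF J]
  have "(\<integral>\<omega>. (\<Sum>n<N. J n \<omega>) * X \<omega> \<partial>M) = (\<integral>t. b m t * c t \<partial>simplex_measure m)" if "N > m" for N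
  proof -
    have "(\<integral>\<omega>. (\<Sum>n<N. J n \<omega>) * X \<omega> \<partial>M) = (\<Sum>n<N. \<integral>\<omega>. J n \<omega> * X \<omega> \<partial>M)"
      unfolding sum_distrib_right by (intro Bochner_Integration.integral_sum sq_integrable_mult Js Xs)
    also have "\<dots> = (\<Sum>n<N. if n = m then \<integral>t. b m t * c t \<partial>simplex_measure m else 0)"
      using wint_inner[OF J X] by (intro sum.cong) auto
    finally show ?thesis using that by simp
  qed
  then have "\<forall>\<^sub>F N in sequentially. (\<integral>\<omega>. (\<Sum>n<N. J n \<omega>) * X \<omega> \<partial>M) = (\<integral>t. b m t * c t \<partial>simplex_measure m)"
    by (intro eventually_mono[OF eventually_gt_at_top[of m]])
  then have "(\<lambda>N. \<integral>\<omega>. (\<Sum>n<N. J n \<omega>) * X \<omega> \<partial>M) \<longlonglongrightarrow> (\<integral>t. b m t * c t \<partial>simplex_measure m)"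
    by (rule tendsto_eventually)
  with L2_tendsto_inner_right[OF lim Xs] show ?thesis by (rule LIMSEQ_unique)
qed

lemma single_term_expansion:
  assumes X: "sq_integrable M X" and Z: "\<And>m. sq_integrable M (Z m)"
    and Zn: "AE \<omega> in M. Z n \<omega> = X \<omega>" and Z0: "\<And>m. m \<noteq> n \<Longrightarrow> AE \<omega> in M. Z m \<omega> = 0"
  shows "L2_tendsto M (\<lambda>N \<omega>. \<Sum>m<N. Z m \<omega>) X sequentially"
proof (rule L2_tendstoI[OF X])
  show "\<forall>\<^sub>F N in sequentially. sq_integrable M (\<lambda>\<omega>. \<Sum>m<N. Z m \<omega>)" by (intro always_eventually allI sq_integrable_sum Z)
  have "L2n M (\<lambda>\<omega>. (\<Sum>m<N. Z m \<omega>) - X \<omega>) = 0" if N: "N > n" for N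
  proof -
    have ae: "AE \<omega> in M. \<forall>m\<in>{..<N}. Z m \<omega> = (if m = n then X \<omega> else 0)"
    proof (rule AE_finite_allI[OF finite_lessThan])
      fix m show "AE \<omega> in M. Z m \<omega> = (if m = n then X \<omega> else 0)"
        using Zn Z0[of m] by (cases "m = n") simp_all
    qed
    have "(\<integral>\<omega>. ((\<Sum>m<N. Z m \<omega>) - X \<omega>)\<^sup>2 \<partial>M) = 0"
    proof (rule integral_eq_zero_AE)
      show "AE \<omega> in M. ((\<Sum>m<N. Z m \<omega>) - X \<omega>)\<^sup>2 = 0"
        using ae
      proof eventually_elim
        case (elim \<omega>)
        have "(\<Sum>m<N. Z m \<omega>) = (\<Sum>m<N. if m = n then X \<omega> else 0)" using elim by (intro sum.cong) auto
        then show ?case using N by simp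
      qed
    qed
    then show ?thesis by (simp add: L2n_def)
  qed
  then have "\<forall>\<^sub>F N in sequentially. L2n M (\<lambda>\<omega>. (\<Sum>m<N. Z m \<omega>) - X \<omega>) = 0"
    by (intro eventually_mono[OF eventually_gt_at_top[of n]])
  then show "(\<lambda>N. L2n M (\<lambda>\<omega>. (\<Sum>m<N. Z m \<omega>) - X \<omega>)) \<longlonglongrightarrow> 0" by (rule tendsto_eventually)
qed

text \<open>
  On a single chaos the second quantization is determined by the form: the expansion of a multiple
  integral has one term, the form determines the kernel, and the kernel determines the integral.
\<close>

lemma second_quantization_wint:
  assumes a: "symmetric_kernel n a" "wint n a \<alpha>" and b: "symmetric_kernel n b" "wint n b J"
    and form: "kernel_form n b = (\<lambda>\<phi>. kernel_form n a (\<lambda>i. adjoint A (\<phi> i)))"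
  shows "wint n b (second_quantization M w A \<alpha>)"
proof -
  let ?a = "\<lambda>m. if m = n then a else (\<lambda>_. 0)" and ?b = "\<lambda>m. if m = n then b else (\<lambda>_. 0)"
  have e1: "ito_wiener_expansion M w (\<lambda>m. kernel_form m (?a m)) (\<lambda>m. if m = n then \<alpha> else (\<lambda>_. 0)) \<alpha>"
    unfolding ito_wiener_expansion_def
  proof (intro conjI allI single_term_expansion[where n=n])
    show "noise_form M w m (kernel_form m (?a m)) (if m = n then \<alpha> else (\<lambda>_. 0))" for m
      unfolding noise_form_def using a wint_zero symmetric_kernel_zero by (intro exI[of _ "?a m"]) simp
  qed (use wint_sq_integrable(1)[OF a(2)] in \<open>auto simp: sq_integrable_zero\<close>)
  have e2: "ito_wiener_expansion M w (\<lambda>m \<phi>. kernel_form m (?a m) (\<lambda>i. adjoint A (\<phi> i))) (\<lambda>m. if m = n then J else (\<lambda>_. 0)) J"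
    unfolding ito_wiener_expansion_def
  proof (intro conjI allI single_term_expansion[where n=n])
    have "(\<lambda>\<phi>. kernel_form m (?a m) (\<lambda>i. adjoint A (\<phi> i))) = kernel_form m (?b m)" for m
      using form by (auto simp: kernel_form_zero fun_eq_iff)
    then show "noise_form M w m (\<lambda>\<phi>. kernel_form m (?a m) (\<lambda>i. adjoint A (\<phi> i))) (if m = n then J else (\<lambda>_. 0))" for m
      unfolding noise_form_def using b wint_zero symmetric_kernel_zero by (intro exI[of _ "?b m"]) simp
  qed (use wint_sq_integrable(1)[OF b(2)] in \<open>auto simp: sq_integrable_zero\<close>)
  have "has_second_quantization M w A \<alpha> J"
    unfolding has_second_quantization_def using e1 e2 by blast
  then have "has_second_quantization M w A \<alpha> (second_quantization M w A \<alpha>)"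
    unfolding second_quantization_def by (rule someI[of "has_second_quantization M w A \<alpha>"])
  then obtain F Y Z where Y: "ito_wiener_expansion M w F Y \<alpha>"
    and Z: "ito_wiener_expansion M w (\<lambda>n \<phi>. F n (\<lambda>i. adjoint A (\<phi> i))) Z (second_quantization M w A \<alpha>)"
    unfolding has_second_quantization_def by blast
  have "\<forall>m. \<exists>c. symmetric_kernel m c \<and> F m = kernel_form m c \<and> wint m c (Y m)"
    using Y by (simp add: ito_wiener_expansion_def noise_form_def)
  from choice[OF this] obtain c where c: "\<And>m. symmetric_kernel m (c m)" "\<And>m. F m = kernel_form m (c m)" "\<And>m. wint m (c m) (Y m)"
    by blast
  have "\<forall>m. \<exists>d. symmetric_kernel m d \<and> (\<lambda>\<phi>. F m (\<lambda>i. adjoint A (\<phi> i))) = kernel_form m d \<and> wint m d (Z m)"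
    using Z by (simp add: ito_wiener_expansion_def noise_form_def)
  from choice[OF this] obtain d where d: "\<And>m. symmetric_kernel m (d m)"
    "\<And>m. (\<lambda>\<phi>. F m (\<lambda>i. adjoint A (\<phi> i))) = kernel_form m (d m)" "\<And>m. wint m (d m) (Z m)"
    by blast
  have Ylim: "L2_tendsto M (\<lambda>N \<omega>. \<Sum>n<N. Y n \<omega>) \<alpha> sequentially" using Y by (simp add: ito_wiener_expansion_def)
  have Zlim: "L2_tendsto M (\<lambda>N \<omega>. \<Sum>n<N. Z n \<omega>) (second_quantization M w A \<alpha>) sequentially"
    using Z by (simp add: ito_wiener_expansion_def)
  have sa: "symmetric_kernel m (?a m)" and sb: "symmetric_kernel m (?b m)" for m
    using a(1) b(1) symmetric_kernel_zero by auto
  have ca: "AE t in simplex_measure m. c m t = ?a m t" for m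
  proof (rule simplex_kernels_eq_if_boxes[OF symmetric_kernel_simplex[OF c(1)] symmetric_kernel_simplex[OF sa]])
    fix l r assume o: "ordered_corners m l r"
    have "(\<integral>t. c m t * box_indicator m l r t \<partial>simplex_measure m) = (\<integral>\<omega>. \<alpha> \<omega> * increment_product w m l r \<omega> \<partial>M)"
      using chaos_expansion_inner[OF c(3) Ylim wint_box[OF o]] by simp
    also have "\<dots> = (\<integral>t. ?a m t * box_indicator m l r t \<partial>simplex_measure m)"
      using wint_inner[OF a(2) wint_box[OF o]] by auto
    finally show "(\<integral>t. c m t * box_indicator m l r t \<partial>simplex_measure m) = (\<integral>t. ?a m t * box_indicator m l r t \<partial>simplex_measure m)" .
  qed
  have Fa: "F m = kernel_form m (?a m)" for m
    unfolding c(2) by (rule kernel_form_cong_AE[OF c(1) sa ca])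
  have "kernel_form m (d m) = kernel_form m (?b m)" for m
    using d(2)[of m] form unfolding Fa by (auto simp: kernel_form_zero fun_eq_iff split: if_splits)
  then have db: "AE t in simplex_measure m. d m t = ?b m t" for m
    by (rule kernel_form_inj[OF d(1) sb])
  have wb: "wint m (?b m) (if m = n then J else (\<lambda>_. 0))" for m using b(2) wint_zero by simp
  have ZJ: "AE \<omega> in M. Z m \<omega> = (if m = n then J else (\<lambda>_. 0)) \<omega>" for m
    by (rule wint_unique[OF d(3) wb db])
  have "L2_tendsto M (\<lambda>N \<omega>. \<Sum>m<N. Z m \<omega>) J sequentially"
  proof (rule single_term_expansion[where n=n])
    show "AE \<omega> in M. Z n \<omega> = J \<omega>" using ZJ[of n] by simp
    show "AE \<omega> in M. Z m \<omega> = 0" if "m \<noteq> n" for m using ZJ[of m] that by simp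
  qed (rule wint_sq_integrable(1)[OF b(2)] wint_sq_integrable(1)[OF d(3)])+
  from L2_tendsto_unique[OF this Zlim] have "AE \<omega> in M. J \<omega> = second_quantization M w A \<alpha> \<omega>" by simp
  moreover have "second_quantization M w A \<alpha> \<in> borel_measurable M"
    by (rule sq_integrable_measurable[OF L2_tendstoD(1)[OF Zlim]])
  ultimately show ?thesis
    using wint_cong_AE[OF b(2)] sq_integrable_measurable[OF wint_sq_integrable(2)[OF b(2)]] by simp
qed

end

text \<open>
  With a free index, the rules for coordinates match every application of a real function, which
  misleads the measurability prover in what follows.
\<close>

declare cube_component_borel [measurable del] simplex_measurable_component [measurable del]

section \<open>Gaussian integrals in time and frequency\<close>

abbreviation time_freq :: "(real \<times> real) measure" where
  "time_freq \<equiv> leb01 \<Otimes>\<^sub>M lborel"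

abbreviation time_freq2 :: "((real \<times> real) \<times> (real \<times> real)) measure" where
  "time_freq2 \<equiv> time_freq \<Otimes>\<^sub>M time_freq"

lemma time_freq_pair: "pair_sigma_finite leb01 lborel"
proof -
  interpret prob_space leb01 by (rule leb01_prob)
  show ?thesis ..
qed

lemma time_freq_sigma_finite: "sigma_finite_measure time_freq"
proof -
  interpret prob_space leb01 by (rule leb01_prob)
  show ?thesis
    by (intro sigma_finite_pair_measure) (rule sigma_finite_measure_axioms, rule sigma_finite_lborel)
qed

lemma space_time_freq: "space time_freq = {0..1} \<times> UNIV"
  by (simp add: space_pair_measure)

lemma time_freq_borel: "(\<lambda>p. p) \<in> measurable time_freq borel"
proof -
  have "fst \<in> borel_measurable time_freq"
    by (rule measurable_compose[OF measurable_fst]) (rule leb01_measurableI, simp)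
  moreover have "snd \<in> borel_measurable time_freq" by simp
  ultimately have "(\<lambda>p. (fst p, snd p)) \<in> borel_measurable time_freq" by (rule borel_measurable_Pair)
  then show ?thesis by simp
qed

lemma time_freq_measurableI: "f \<in> borel_measurable borel \<Longrightarrow> f \<in> borel_measurable time_freq"
  by (rule measurable_compose[OF time_freq_borel])

lemma integrable_time_freq_const:
  assumes f: "integrable lborel (f :: real \<Rightarrow> real)"
  shows "integrable time_freq (\<lambda>p. f (snd p))"
proof -
  interpret pair_sigma_finite leb01 lborel by (rule time_freq_pair)
  interpret L: prob_space leb01 by (rule leb01_prob)
  have [measurable]: "f \<in> borel_measurable borel" using f by auto
  show ?thesis
  proof (rule Fubini_integrable)
    show "(\<lambda>p. f (snd p)) \<in> borel_measurable time_freq" by measurable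
    show "integrable leb01 (\<lambda>t. \<integral>z. norm (f (snd (t, z))) \<partial>lborel)" by simp
    show "AE t in leb01. integrable lborel (\<lambda>z. f (snd (t, z)))" using f by simp
  qed
qed

lemma integrable_gauss_exp: "0 < a \<Longrightarrow> integrable lborel (\<lambda>z. exp (- (a * z\<^sup>2) / 2))" for a :: real
  using integrable_gauss_power[of "sqrt a" 0] by simp

lemma nn_integral_gauss:
  assumes a: "0 < a"
  shows "(\<integral>\<^sup>+z. ennreal (exp (- (a * (z + b)\<^sup>2))) \<partial>lborel) = ennreal (sqrt (pi / a))"
proof -
  define s where "s = 1 / sqrt (2 * a)"
  have s: "0 < s" "s\<^sup>2 = 1 / (2 * a)" using a by (simp_all add: s_def power_divide)
  have "exp (- (a * (z + b)\<^sup>2)) = sqrt (pi / a) * normal_density (- b) s z" for z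
    using a unfolding normal_density_def s(2) by (simp add: field_simps)
  then have "(\<integral>\<^sup>+z. ennreal (exp (- (a * (z + b)\<^sup>2))) \<partial>lborel) = (\<integral>\<^sup>+z. ennreal (sqrt (pi / a) * normal_density (- b) s z) \<partial>lborel)"
    by simp
  also have "\<dots> = ennreal (\<integral>z. sqrt (pi / a) * normal_density (- b) s z \<partial>lborel)"
    using s a by (intro nn_integral_eq_integral) auto
  also have "\<dots> = ennreal (sqrt (pi / a))" using s by simp
  finally show ?thesis .
qed

lemma nn_integral_inverse_sqrt: "(\<integral>\<^sup>+t. ennreal (1 / sqrt t) * indicator {0..1} t \<partial>lborel) = 2"
proof -
  have "((\<lambda>x. x powr (- (1/2))) has_integral (1 powr (- (1/2) + 1) / (- (1/2) + 1))) {0..1::real}"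
    by (rule has_integral_powr_from_0) auto
  then have "(\<integral>\<^sup>+t. ennreal (t powr (- (1/2))) * indicator {0..1} t \<partial>lborel) = ennreal (1 powr (- (1/2) + 1) / (- (1/2) + 1))"
    by (intro nn_integral_has_integral_lebesgue') auto
  moreover have "ennreal (1 / sqrt t) * indicator {0..1} t = ennreal (t powr (- (1/2))) * indicator {0..1} t" for t :: real
    by (auto simp: powr_minus_divide powr_half_sqrt split: split_indicator)
  ultimately show ?thesis by simp
qed

lemma nn_integral_leb01:
  assumes "f \<in> borel_measurable borel"
  shows "(\<integral>\<^sup>+t. f t \<partial>leb01) = (\<integral>\<^sup>+t. f t * indicator {0..1} t \<partial>lborel)"
  by (rule nn_integral_restrict_space) simp

lemma nn_integral_inverse_sqrt_leb01: "(\<integral>\<^sup>+t. ennreal (1 / sqrt t) \<partial>leb01) = 2"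
  by (subst nn_integral_leb01) (simp_all add: nn_integral_inverse_sqrt)

lemma nn_integral_inverse_sqrt_shift:
  assumes "0 \<le> s" "s \<le> 1"
  shows "(\<integral>\<^sup>+t. (if s < t then ennreal (1 / sqrt (t - s)) else 0) \<partial>leb01) \<le> 2"
proof -
  have m: "(\<lambda>t::real. ennreal (1 / sqrt t) * indicator {0..1} t) \<in> borel_measurable borel" by measurable
  have "(\<integral>\<^sup>+t. (if s < t then ennreal (1 / sqrt (t - s)) else 0) \<partial>leb01) =
      (\<integral>\<^sup>+t. (if s < t then ennreal (1 / sqrt (t - s)) else 0) * indicator {0..1} t \<partial>lborel)"
    by (rule nn_integral_leb01) measurable
  also have "\<dots> \<le> (\<integral>\<^sup>+t. ennreal (1 / sqrt (- s + 1 * t)) * indicator {0..1} (- s + 1 * t) \<partial>lborel)"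
    using assms by (intro nn_integral_mono) (auto split: split_indicator)
  also have "\<dots> = (\<integral>\<^sup>+t. ennreal (1 / sqrt t) * indicator {0..1} t \<partial>lborel)"
    using nn_integral_real_affine[OF m, of 1 "- s"] by simp
  finally show ?thesis by (simp add: nn_integral_inverse_sqrt)
qed

lemma integrable_time_freq_gauss:
  assumes k: "0 < k"
  shows "integrable time_freq (\<lambda>p. exp (- (k * (fst p * (snd p)\<^sup>2))))"
proof (rule integrableI_bounded)
  interpret pair_sigma_finite leb01 lborel by (rule time_freq_pair)
  have m: "(\<lambda>p. exp (- (k * (fst p * (snd p)\<^sup>2)))) \<in> borel_measurable time_freq"
    by (intro time_freq_measurableI borel_measurable_continuous_onI continuous_intros)
  show "(\<lambda>p. exp (- (k * (fst p * (snd p)\<^sup>2)))) \<in> borel_measurable time_freq" by (rule m)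
  have "(\<integral>\<^sup>+p. ennreal (norm (exp (- (k * (fst p * (snd p)\<^sup>2))))) \<partial>time_freq) =
      (\<integral>\<^sup>+t. \<integral>\<^sup>+z. ennreal (exp (- (k * (t * z\<^sup>2)))) \<partial>lborel \<partial>leb01)"
    using m by (subst lborel.nn_integral_fst[symmetric]) auto
  also have "\<dots> = (\<integral>\<^sup>+t. ennreal (sqrt (pi / k)) * ennreal (1 / sqrt t) \<partial>leb01)"
  proof (rule nn_integral_cong_AE)
    have "AE t in lborel. t \<noteq> (0::real)" by (rule AE_lborel_singleton)
    then have "AE t in lborel. t \<in> {0..1} \<longrightarrow> (\<integral>\<^sup>+z. ennreal (exp (- (k * (t * z\<^sup>2)))) \<partial>lborel) =
        ennreal (sqrt (pi / k)) * ennreal (1 / sqrt t)"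
    proof eventually_elim
      case (elim t)
      show ?case
      proof
        assume "t \<in> {0..1}"
        then have t: "0 < t" using elim by simp
        have "(\<integral>\<^sup>+z. ennreal (exp (- (k * (t * z\<^sup>2)))) \<partial>lborel) = ennreal (sqrt (pi / (k * t)))"
          using nn_integral_gauss[of "k * t" 0] k t by (simp add: mult.assoc)
        also have "sqrt (pi / (k * t)) = sqrt (pi / k) * (1 / sqrt t)" using k t by (simp add: real_sqrt_divide real_sqrt_mult)
        also have "ennreal \<dots> = ennreal (sqrt (pi / k)) * ennreal (1 / sqrt t)" using k t by (intro ennreal_mult) auto
        finally show "(\<integral>\<^sup>+z. ennreal (exp (- (k * (t * z\<^sup>2)))) \<partial>lborel) = ennreal (sqrt (pi / k)) * ennreal (1 / sqrt t)" .
      qed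
    qed
    then show "AE t in leb01. (\<integral>\<^sup>+z. ennreal (exp (- (k * (t * z\<^sup>2)))) \<partial>lborel) = ennreal (sqrt (pi / k)) * ennreal (1 / sqrt t)"
      by (subst AE_restrict_space_iff) auto
  qed
  also have "\<dots> = ennreal (sqrt (pi / k)) * (\<integral>\<^sup>+t. ennreal (1 / sqrt t) \<partial>leb01)"
    by (rule nn_integral_cmult) (rule leb01_measurableI, measurable)
  also have "\<dots> < \<infinity>" by (simp add: nn_integral_inverse_sqrt_leb01 ennreal_mult_less_top)
  finally show "(\<integral>\<^sup>+p. ennreal (norm (exp (- (k * (fst p * (snd p)\<^sup>2))))) \<partial>time_freq) < \<infinity>" .
qed

text \<open>
  The exponent is a multiple of the variance of \<open>z w(s) + z' w(t)\<close>, which is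
  \<open>(z + z')\<^sup>2 s + z'\<^sup>2 (t - s)\<close> for \<open>s < t\<close>. The two frequencies therefore separate, and integrating
  them out leaves a multiple of \<open>1 / sqrt (s (t - s))\<close>, which is integrable over the square.
\<close>

definition two_point :: "real \<Rightarrow> (real \<times> real) \<times> (real \<times> real) \<Rightarrow> real" where
  "two_point k P = exp (- (k * (norm (snd (fst P) *\<^sub>R ind01 (fst (fst P)) + snd (snd P) *\<^sub>R ind01 (fst (snd P))))\<^sup>2))"

lemma time_freq2_borel: "(\<lambda>P. P) \<in> measurable time_freq2 borel"
proof -
  have "fst \<in> borel_measurable time_freq2" "snd \<in> borel_measurable time_freq2"
    by (rule measurable_compose[OF measurable_fst time_freq_borel], rule measurable_compose[OF measurable_snd time_freq_borel])
  then have "(\<lambda>P. (fst P, snd P)) \<in> borel_measurable time_freq2" by (rule borel_measurable_Pair)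
  then show ?thesis by simp
qed

lemma continuous_ind01 [continuous_intros]: "continuous_on S f \<Longrightarrow> continuous_on S (\<lambda>x. ind01 (f x))"
proof (rule continuous_on_compose2[of UNIV ind01 S f])
  show "continuous_on UNIV ind01" by (rule continuous_at_imp_continuous_on) (simp add: isCont_ind01)
qed simp_all

lemma two_point_continuous: "continuous_on UNIV (two_point k)"
  unfolding two_point_def[abs_def] by (intro continuous_intros)

lemma nn_two_point_inner:
  assumes k: "0 < k" and st: "0 < s" "s < t" "t \<le> 1"
  shows "(\<integral>\<^sup>+z'. \<integral>\<^sup>+z. ennreal (two_point k ((s, z), (t, z'))) \<partial>lborel \<partial>lborel) =
    ennreal (pi / k) * (ennreal (1 / sqrt s) * ennreal (1 / sqrt (t - s)))"
proof -
  have e: "two_point k ((s, z), (t, z')) = exp (- ((k * (t - s)) * (z' + 0)\<^sup>2)) * exp (- ((k * s) * (z + z')\<^sup>2))" for z z'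
  proof -
    have n: "(norm (z *\<^sub>R ind01 s + z' *\<^sub>R ind01 t))\<^sup>2 = (z + z')\<^sup>2 * s + z'\<^sup>2 * (t - s)"
      using st by (intro norm_two_ind01) auto
    show ?thesis unfolding two_point_def fst_conv snd_conv n by (simp add: exp_add[symmetric] algebra_simps)
  qed
  have "(\<integral>\<^sup>+z'. \<integral>\<^sup>+z. ennreal (two_point k ((s, z), (t, z'))) \<partial>lborel \<partial>lborel) =
      (\<integral>\<^sup>+z'. ennreal (exp (- ((k * (t - s)) * (z' + 0)\<^sup>2))) * ennreal (sqrt (pi / (k * s))) \<partial>lborel)"
  proof (rule nn_integral_cong)
    fix z' :: real
    have "(\<integral>\<^sup>+z. ennreal (two_point k ((s, z), (t, z'))) \<partial>lborel) =
        (\<integral>\<^sup>+z. ennreal (exp (- ((k * (t - s)) * (z' + 0)\<^sup>2))) * ennreal (exp (- ((k * s) * (z + z')\<^sup>2))) \<partial>lborel)"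
      unfolding e by (intro nn_integral_cong) (simp add: ennreal_mult)
    also have "\<dots> = ennreal (exp (- ((k * (t - s)) * (z' + 0)\<^sup>2))) * (\<integral>\<^sup>+z. ennreal (exp (- ((k * s) * (z + z')\<^sup>2))) \<partial>lborel)"
      by (rule nn_integral_cmult) measurable
    also have "(\<integral>\<^sup>+z. ennreal (exp (- ((k * s) * (z + z')\<^sup>2))) \<partial>lborel) = ennreal (sqrt (pi / (k * s)))"
      using k st by (intro nn_integral_gauss) simp
    finally show "(\<integral>\<^sup>+z. ennreal (two_point k ((s, z), (t, z'))) \<partial>lborel) =
        ennreal (exp (- ((k * (t - s)) * (z' + 0)\<^sup>2))) * ennreal (sqrt (pi / (k * s)))" .
  qed
  also have "\<dots> = (\<integral>\<^sup>+z'. ennreal (exp (- ((k * (t - s)) * (z' + 0)\<^sup>2))) \<partial>lborel) * ennreal (sqrt (pi / (k * s)))"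
    by (rule nn_integral_multc) measurable
  also have "(\<integral>\<^sup>+z'. ennreal (exp (- ((k * (t - s)) * (z' + 0)\<^sup>2))) \<partial>lborel) = ennreal (sqrt (pi / (k * (t - s))))"
    using k st by (intro nn_integral_gauss) simp
  also have "ennreal (sqrt (pi / (k * (t - s)))) * ennreal (sqrt (pi / (k * s))) =
      ennreal (sqrt (pi / k) * sqrt (pi / k) * (1 / sqrt s * (1 / sqrt (t - s))))"
    using k st by (subst ennreal_mult[symmetric]) (simp_all add: real_sqrt_divide real_sqrt_mult mult_ac)
  also have "sqrt (pi / k) * sqrt (pi / k) = pi / k" using k by simp
  also have "ennreal (pi / k * (1 / sqrt s * (1 / sqrt (t - s)))) = ennreal (pi / k) * (ennreal (1 / sqrt s) * ennreal (1 / sqrt (t - s)))"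
    using k st by (simp add: ennreal_mult[symmetric])
  finally show ?thesis .
qed

text \<open>The value for \<open>s < t\<close> and zero otherwise; the two orders of the times are added up.\<close>

definition two_time :: "real \<Rightarrow> real \<Rightarrow> ennreal" where
  "two_time s t = ennreal (1 / sqrt s) * (if s < t then ennreal (1 / sqrt (t - s)) else 0)"

lemma two_point_commute: "two_point k ((s, z), (t, z')) = two_point k ((t, z'), (s, z))"
  by (simp add: two_point_def add.commute)

lemma two_point_section_measurable:
  "(\<lambda>P. ennreal (two_point k ((f P, g P), (f' P, g' P)))) \<in> borel_measurable N"
  if "f \<in> borel_measurable N" "g \<in> borel_measurable N" "f' \<in> borel_measurable N" "g' \<in> borel_measurable N"
proof -
  have "(\<lambda>P. ((f P, g P), (f' P, g' P))) \<in> borel_measurable N" using that by (intro borel_measurable_Pair)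
  from measurable_compose[OF this borel_measurable_continuous_onI[OF two_point_continuous[of k]]]
  show ?thesis by simp
qed

lemma nn_two_point_frequencies:
  assumes k: "0 < k" and st: "0 < s" "s \<le> 1" "0 < t" "t \<le> 1" "s \<noteq> t"
  shows "(\<integral>\<^sup>+z. \<integral>\<^sup>+z'. ennreal (two_point k ((s, z), (t, z'))) \<partial>lborel \<partial>lborel) =
    ennreal (pi / k) * (two_time s t + two_time t s)"
proof (cases "s < t")
  case True
  have m: "(\<lambda>(z, z'). ennreal (two_point k ((s, z), (t, z')))) \<in> borel_measurable (lborel \<Otimes>\<^sub>M lborel)"
    unfolding split_beta by (intro two_point_section_measurable) measurable
  have "(\<integral>\<^sup>+z. \<integral>\<^sup>+z'. ennreal (two_point k ((s, z), (t, z'))) \<partial>lborel \<partial>lborel) =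
      (\<integral>\<^sup>+z'. \<integral>\<^sup>+z. ennreal (two_point k ((s, z), (t, z'))) \<partial>lborel \<partial>lborel)"
    using lborel_pair.Fubini'[OF m] by simp
  then show ?thesis
    using nn_two_point_inner[OF k st(1) True st(4)] True by (simp add: two_time_def)
next
  case False
  then have "t < s" using st by simp
  then show ?thesis
    using nn_two_point_inner[OF k st(3) _ st(2)] by (simp add: two_time_def two_point_commute[of k s _ t])
qed

lemma two_time_measurable [measurable]: "(\<lambda>(s, t). two_time s t) \<in> borel_measurable (leb01 \<Otimes>\<^sub>M leb01)"
proof -
  have [measurable]: "fst \<in> borel_measurable (leb01 \<Otimes>\<^sub>M leb01)" "snd \<in> borel_measurable (leb01 \<Otimes>\<^sub>M leb01)"
    by (rule measurable_compose[OF measurable_fst], rule leb01_measurableI, simp)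
      (rule measurable_compose[OF measurable_snd], rule leb01_measurableI, simp)
  have "(\<lambda>p. two_time (fst p) (snd p)) \<in> borel_measurable (leb01 \<Otimes>\<^sub>M leb01)"
    unfolding two_time_def by measurable
  then show ?thesis by (simp add: split_beta)
qed

lemma nn_two_time: "(\<integral>\<^sup>+s. \<integral>\<^sup>+t. two_time s t \<partial>leb01 \<partial>leb01) \<le> 4"
proof -
  have "(\<integral>\<^sup>+s. \<integral>\<^sup>+t. two_time s t \<partial>leb01 \<partial>leb01) \<le> (\<integral>\<^sup>+s. ennreal (1 / sqrt s) * 2 \<partial>leb01)"
  proof (rule nn_integral_mono)
    fix s assume "s \<in> space leb01"
    then have s: "0 \<le> s" "s \<le> 1" by auto
    have "(\<integral>\<^sup>+t. two_time s t \<partial>leb01) = ennreal (1 / sqrt s) * (\<integral>\<^sup>+t. (if s < t then ennreal (1 / sqrt (t - s)) else 0) \<partial>leb01)"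
      unfolding two_time_def by (rule nn_integral_cmult) (rule leb01_measurableI, measurable)
    also have "\<dots> \<le> ennreal (1 / sqrt s) * 2"
      by (intro mult_left_mono nn_integral_inverse_sqrt_shift s) simp
    finally show "(\<integral>\<^sup>+t. two_time s t \<partial>leb01) \<le> ennreal (1 / sqrt s) * 2" .
  qed
  also have "\<dots> = (\<integral>\<^sup>+s. ennreal (1 / sqrt s) \<partial>leb01) * 2"
    by (rule nn_integral_multc) (rule leb01_measurableI, measurable)
  also have "\<dots> = 4" by (simp add: nn_integral_inverse_sqrt_leb01)
  finally show ?thesis .
qed

lemma integrable_two_point:
  assumes k: "0 < k"
  shows "integrable time_freq2 (two_point k)"
proof (rule integrableI_bounded)
  interpret T: sigma_finite_measure time_freq by (rule time_freq_sigma_finite)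
  interpret L: prob_space leb01 by (rule leb01_prob)
  interpret TF: pair_sigma_finite leb01 lborel by (rule time_freq_pair)
  interpret LL: pair_sigma_finite leb01 leb01 ..
  have id01 [measurable]: "(\<lambda>x. x) \<in> borel_measurable leb01" by (rule leb01_measurableI) simp
  show m: "two_point k \<in> borel_measurable time_freq2"
    by (rule measurable_compose[OF time_freq2_borel borel_measurable_continuous_onI[OF two_point_continuous]])
  have m1: "(\<lambda>p. \<integral>\<^sup>+p'. ennreal (two_point k (p, p')) \<partial>time_freq) \<in> borel_measurable time_freq"
    using m by (intro T.borel_measurable_nn_integral) simp
  have mid: "(\<lambda>p'. ennreal (two_point k (p, p'))) \<in> borel_measurable time_freq" if "p \<in> space time_freq" for p
    using measurable_compose[OF measurable_Pair1'[OF that] m] by simp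
  have "(\<integral>\<^sup>+P. ennreal (norm (two_point k P)) \<partial>time_freq2) =
      (\<integral>\<^sup>+P. ennreal (two_point k P) \<partial>time_freq2)" by (simp add: two_point_def)
  also have "\<dots> = (\<integral>\<^sup>+p. \<integral>\<^sup>+p'. ennreal (two_point k (p, p')) \<partial>time_freq \<partial>time_freq)"
    using m by (subst T.nn_integral_fst[symmetric]) auto
  also have "\<dots> = (\<integral>\<^sup>+s. \<integral>\<^sup>+z. \<integral>\<^sup>+p'. ennreal (two_point k ((s, z), p')) \<partial>time_freq \<partial>lborel \<partial>leb01)"
    using m1 by (subst lborel.nn_integral_fst[symmetric]) auto
  also have "\<dots> = (\<integral>\<^sup>+s. \<integral>\<^sup>+z. \<integral>\<^sup>+t. \<integral>\<^sup>+z'. ennreal (two_point k ((s, z), (t, z'))) \<partial>lborel \<partial>leb01 \<partial>lborel \<partial>leb01)"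
  proof (intro nn_integral_cong)
    fix s z :: real assume "s \<in> space leb01"
    then show "(\<integral>\<^sup>+p'. ennreal (two_point k ((s, z), p')) \<partial>time_freq) =
        (\<integral>\<^sup>+t. \<integral>\<^sup>+z'. ennreal (two_point k ((s, z), (t, z'))) \<partial>lborel \<partial>leb01)"
      using mid[of "(s, z)"] by (subst lborel.nn_integral_fst[symmetric]) (auto simp: space_time_freq)
  qed
  also have "\<dots> = (\<integral>\<^sup>+s. \<integral>\<^sup>+t. \<integral>\<^sup>+z. \<integral>\<^sup>+z'. ennreal (two_point k ((s, z), (t, z'))) \<partial>lborel \<partial>lborel \<partial>leb01 \<partial>leb01)"
  proof (intro nn_integral_cong)
    fix s assume "s \<in> space leb01"
    have "(\<lambda>q. \<integral>\<^sup>+z'. ennreal (two_point k ((s, snd q), (fst q, z'))) \<partial>lborel) \<in> borel_measurable time_freq"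
    proof (rule lborel.borel_measurable_nn_integral)
      have fst_m: "(\<lambda>q. h (fst q)) \<in> borel_measurable (time_freq \<Otimes>\<^sub>M lborel)"
        if "h \<in> borel_measurable borel" for h :: "real \<times> real \<Rightarrow> real"
        by (rule measurable_compose[OF measurable_fst time_freq_measurableI[OF that]])
      show "(\<lambda>(q, z'). ennreal (two_point k ((s, snd q), (fst q, z')))) \<in> borel_measurable (time_freq \<Otimes>\<^sub>M lborel)"
        unfolding split_beta using fst_m[of fst] fst_m[of snd] by (intro two_point_section_measurable) simp_all
    qed
    then have "(\<lambda>(t, z). \<integral>\<^sup>+z'. ennreal (two_point k ((s, z), (t, z'))) \<partial>lborel) \<in> borel_measurable time_freq"
      by (simp add: split_beta)
    from TF.Fubini'[OF this]
    show "(\<integral>\<^sup>+z. \<integral>\<^sup>+t. \<integral>\<^sup>+z'. ennreal (two_point k ((s, z), (t, z'))) \<partial>lborel \<partial>leb01 \<partial>lborel) =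
        (\<integral>\<^sup>+t. \<integral>\<^sup>+z. \<integral>\<^sup>+z'. ennreal (two_point k ((s, z), (t, z'))) \<partial>lborel \<partial>lborel \<partial>leb01)" by simp
  qed
  also have "\<dots> = (\<integral>\<^sup>+s. \<integral>\<^sup>+t. ennreal (pi / k) * (two_time s t + two_time t s) \<partial>leb01 \<partial>leb01)"
  proof (rule nn_integral_cong_AE)
    have ne: "AE x in leb01. x \<noteq> a" for a :: real
      using AE_lborel_singleton[of a] by (subst AE_restrict_space_iff) (auto elim!: eventually_mono)
    show "AE s in leb01. (\<integral>\<^sup>+t. \<integral>\<^sup>+z. \<integral>\<^sup>+z'. ennreal (two_point k ((s, z), (t, z'))) \<partial>lborel \<partial>lborel \<partial>leb01) =
        (\<integral>\<^sup>+t. ennreal (pi / k) * (two_time s t + two_time t s) \<partial>leb01)"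
      using ne[of 0] AE_space[of leb01]
    proof eventually_elim
      case (elim s)
      show ?case
      proof (rule nn_integral_cong_AE)
        show "AE t in leb01. (\<integral>\<^sup>+z. \<integral>\<^sup>+z'. ennreal (two_point k ((s, z), (t, z'))) \<partial>lborel \<partial>lborel) =
            ennreal (pi / k) * (two_time s t + two_time t s)"
          using ne[of 0] ne[of s] AE_space[of leb01]
        proof eventually_elim
          fix t assume "t \<noteq> 0" "t \<noteq> s" "t \<in> space leb01"
          then show "(\<integral>\<^sup>+z. \<integral>\<^sup>+z'. ennreal (two_point k ((s, z), (t, z'))) \<partial>lborel \<partial>lborel) =
            ennreal (pi / k) * (two_time s t + two_time t s)"
            using elim k by (intro nn_two_point_frequencies) auto
        qed
      qed
    qed
  qed
  also have "\<dots> = ennreal (pi / k) * ((\<integral>\<^sup>+s. \<integral>\<^sup>+t. two_time s t \<partial>leb01 \<partial>leb01) + (\<integral>\<^sup>+s. \<integral>\<^sup>+t. two_time t s \<partial>leb01 \<partial>leb01))"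
  proof -
    have 1: "(\<lambda>t. two_time s t) \<in> borel_measurable leb01" "(\<lambda>t. two_time t s) \<in> borel_measurable leb01" for s
      unfolding two_time_def by (rule leb01_measurableI, measurable)+
    have 2: "(\<lambda>s. \<integral>\<^sup>+t. two_time s t \<partial>leb01) \<in> borel_measurable leb01"
      by (rule L.borel_measurable_nn_integral) (rule two_time_measurable)
    have 3: "(\<lambda>s. \<integral>\<^sup>+t. two_time t s \<partial>leb01) \<in> borel_measurable leb01"
      using measurable_compose[OF measurable_pair_swap' two_time_measurable]
      by (intro L.borel_measurable_nn_integral) (simp add: split_beta)
    have "(\<integral>\<^sup>+s. \<integral>\<^sup>+t. ennreal (pi / k) * (two_time s t + two_time t s) \<partial>leb01 \<partial>leb01) =
        (\<integral>\<^sup>+s. ennreal (pi / k) * ((\<integral>\<^sup>+t. two_time s t \<partial>leb01) + (\<integral>\<^sup>+t. two_time t s \<partial>leb01)) \<partial>leb01)"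
      using 1 by (intro nn_integral_cong) (simp add: nn_integral_cmult nn_integral_add)
    then show ?thesis using 2 3 by (simp add: nn_integral_cmult nn_integral_add)
  qed
  also have "(\<integral>\<^sup>+s. \<integral>\<^sup>+t. two_time t s \<partial>leb01 \<partial>leb01) = (\<integral>\<^sup>+s. \<integral>\<^sup>+t. two_time s t \<partial>leb01 \<partial>leb01)"
    using LL.Fubini'[OF two_time_measurable] by simp
  also have "ennreal (pi / k) * ((\<integral>\<^sup>+s. \<integral>\<^sup>+t. two_time s t \<partial>leb01 \<partial>leb01) + (\<integral>\<^sup>+s. \<integral>\<^sup>+t. two_time s t \<partial>leb01 \<partial>leb01)) \<le>
      ennreal (pi / k) * (4 + 4)"
    by (intro mult_left_mono add_mono nn_two_time) simp
  also have "\<dots> < \<infinity>" by (simp add: ennreal_mult_less_top)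
  finally show "(\<integral>\<^sup>+P. ennreal (norm (two_point k P)) \<partial>time_freq2) < \<infinity>" .
qed

section \<open>The local time\<close>

text \<open>
  If all inner products are close to the same number, then the squared distance of \<open>X \<epsilon>\<close> and
  \<open>X \<delta>\<close>, a combination of three inner products with total weight zero, is small.
\<close>

lemma L2_tendsto_of_bounds:
  fixes X :: "real \<Rightarrow> 'a \<Rightarrow> real"
  assumes sq: "\<And>\<epsilon>. 0 < \<epsilon> \<Longrightarrow> sq_integrable M (X \<epsilon>)"
    and R: "(\<lambda>n. R (1 / real (Suc n))) \<longlonglongrightarrow> 0"
    and bound: "\<And>\<rho> \<epsilon> \<delta>. 0 < \<epsilon> \<Longrightarrow> \<epsilon> \<le> \<rho> \<Longrightarrow> 0 < \<delta> \<Longrightarrow> \<delta> \<le> \<rho> \<Longrightarrow> \<bar>(\<integral>\<omega>. X \<epsilon> \<omega> * X \<delta> \<omega> \<partial>M) - L\<bar> \<le> R \<rho>"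
  shows "\<exists>Y. L2_tendsto M X Y (at_right 0)"
proof -
  define d where "d n = sqrt (4 * R (1 / real (Suc n)))" for n
  have d: "d \<longlonglongrightarrow> 0"
  proof -
    have "(\<lambda>n. sqrt (4 * R (1 / real (Suc n)))) \<longlonglongrightarrow> sqrt (4 * 0)" by (intro tendsto_intros R)
    then show ?thesis by (simp add: d_def[abs_def])
  qed
  have close: "L2n M (\<lambda>\<omega>. X \<epsilon> \<omega> - X \<delta> \<omega>) \<le> d n"
    if "0 < \<epsilon>" "\<epsilon> \<le> 1 / real (Suc n)" "0 < \<delta>" "\<delta> \<le> 1 / real (Suc n)" for \<epsilon> \<delta> n
  proof -
    have "(\<integral>\<omega>. (X \<epsilon> \<omega> - 1 * X \<delta> \<omega>)\<^sup>2 \<partial>M) =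
        (\<integral>\<omega>. X \<epsilon> \<omega> * X \<epsilon> \<omega> \<partial>M) - 2 * (\<integral>\<omega>. X \<epsilon> \<omega> * X \<delta> \<omega> \<partial>M) + (\<integral>\<omega>. X \<delta> \<omega> * X \<delta> \<omega> \<partial>M)"
      using integral_square_diff_scale[OF sq[OF that(1)] sq[OF that(3)], of 1] by (simp add: power2_eq_square)
    also have "\<dots> \<le> 4 * R (1 / real (Suc n))"
      using bound[OF that(1,2) that(1,2)] bound[OF that] bound[OF that(3,4) that(3,4)] by linarith
    finally show ?thesis unfolding L2n_def d_def by (intro real_sqrt_le_mono) simp
  qed
  have d0: "0 \<le> d n" for n
    using close[of "1 / real (Suc n)" n "1 / real (Suc n)"] L2n_nonneg[of M] by (metis (no_types) divide_pos_pos of_nat_0_less_iff order_refl order_trans zero_less_Suc zero_less_one)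
  let ?e = "\<lambda>n. 1 / real (Suc n)"
  have e: "0 < ?e n" "m \<ge> n \<Longrightarrow> ?e m \<le> ?e n" for n m by (simp_all add: frac_le)
  have "\<exists>Y. L2_tendsto M (\<lambda>n. X (?e n)) Y sequentially"
  proof (rule L2_complete)
    show "sq_integrable M (X (?e n))" for n by (rule sq[OF e(1)])
    fix \<eta> :: real assume "0 < \<eta>"
    from order_tendstoD(2)[OF d this] obtain N where N: "d N < \<eta>" by (auto simp: eventually_sequentially)
    have "L2n M (\<lambda>\<omega>. X (?e m) \<omega> - X (?e n) \<omega>) < \<eta>" if "m \<ge> N" "n \<ge> N" for m n
      using close[OF e(1) e(2)[OF that(1)] e(1) e(2)[OF that(2)]] N by simp
    then show "\<exists>N. \<forall>m\<ge>N. \<forall>n\<ge>N. L2n M (\<lambda>\<omega>. X (?e m) \<omega> - X (?e n) \<omega>) < \<eta>" by blast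
  qed
  then obtain Y where Y: "L2_tendsto M (\<lambda>n. X (?e n)) Y sequentially" by blast
  note D = L2_tendstoD[OF Y]
  have lim: "L2n M (\<lambda>\<omega>. X \<epsilon> \<omega> - Y \<omega>) \<le> d n" if "0 < \<epsilon>" "\<epsilon> \<le> ?e n" for \<epsilon> n
  proof (rule LIMSEQ_le_const)
    show "(\<lambda>m. d n + L2n M (\<lambda>\<omega>. X (?e m) \<omega> - Y \<omega>)) \<longlonglongrightarrow> d n"
      using tendsto_add[OF tendsto_const D(3)] by simp
    have "L2n M (\<lambda>\<omega>. X \<epsilon> \<omega> - Y \<omega>) \<le> d n + L2n M (\<lambda>\<omega>. X (?e m) \<omega> - Y \<omega>)" if m: "m \<ge> n" for m
      using L2n_triangle_diff[OF sq[OF \<open>0 < \<epsilon>\<close>] sq[OF e(1)[of m]] D(1)]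
        close[OF \<open>0 < \<epsilon>\<close> \<open>\<epsilon> \<le> ?e n\<close> e(1) e(2)[OF m]] by linarith
    then show "\<exists>N. \<forall>m\<ge>N. L2n M (\<lambda>\<omega>. X \<epsilon> \<omega> - Y \<omega>) \<le> d n + L2n M (\<lambda>\<omega>. X (?e m) \<omega> - Y \<omega>)" by blast
  qed
  have "((\<lambda>\<epsilon>. L2n M (\<lambda>\<omega>. X \<epsilon> \<omega> - Y \<omega>)) \<longlongrightarrow> 0) (at_right 0)"
  proof (rule tendstoI)
    fix \<eta> :: real assume "0 < \<eta>"
    from order_tendstoD(2)[OF d this] obtain n where n: "d n < \<eta>" by (auto simp: eventually_sequentially)
    show "\<forall>\<^sub>F \<epsilon> in at_right 0. dist (L2n M (\<lambda>\<omega>. X \<epsilon> \<omega> - Y \<omega>)) 0 < \<eta>"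
      unfolding eventually_at_right_field
    proof (intro exI[of _ "?e n"] conjI allI impI e(1))
      fix \<epsilon> :: real assume "0 < \<epsilon>" "\<epsilon> < ?e n"
      then have "L2n M (\<lambda>\<omega>. X \<epsilon> \<omega> - Y \<omega>) < \<eta>" using lim[of \<epsilon> n] n by linarith
      then show "dist (L2n M (\<lambda>\<omega>. X \<epsilon> \<omega> - Y \<omega>)) 0 < \<eta>" by (simp add: L2n_nonneg)
    qed
  qed
  moreover have "\<forall>\<^sub>F \<epsilon> in at_right 0. sq_integrable M (X \<epsilon>)"
    by (rule eventually_at_rightI[of 0 1]) (auto intro: sq)
  ultimately show ?thesis using L2_tendstoI[OF D(1)] by blast
qed

text \<open>
  The lower bound for \<open>A\<close> says that the variance of a linear combination of values of \<open>x\<close> is at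
  least \<open>c\<^sup>2\<close> times the variance of the same combination of values of \<open>w\<close>.
\<close>

locale image_process = wiener_process M w for M :: "'a measure" and w +
  fixes A :: "l2_01 \<Rightarrow> l2_01" and x :: "real \<Rightarrow> 'a \<Rightarrow> real" and c u :: real
  assumes A: "bounded_linear A" and c: "0 < c" and lower: "\<And>h. c * norm h \<le> norm (A h)"
    and joint: "(\<lambda>(t, \<omega>). x t \<omega>) \<in> borel_measurable (leb01 \<Otimes>\<^sub>M M)"
    and noise: "\<And>t. t \<in> {0..1} \<Longrightarrow> has_white_noise M w (A (ind01 t)) (x t)"
begin

definition smoothed :: "real \<Rightarrow> 'a \<Rightarrow> real" where
  "smoothed \<epsilon> \<omega> = (LBINT t:{0..1}. gauss_kernel \<epsilon> (x t \<omega> - u))"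

text \<open>
  A point \<open>p\<close> is a pair of a time and a frequency. The white noise in direction \<open>wave p\<close> is the
  frequency times the value of \<open>x\<close> at the time, and \<open>phase p\<close> is its character; \<open>damping \<epsilon> p\<close>
  collects the remaining factors of the Fourier representation of the smoothed local time.
\<close>

definition wave :: "real \<times> real \<Rightarrow> l2_01" where "wave p = snd p *\<^sub>R A (ind01 (fst p))"

definition phase :: "real \<times> real \<Rightarrow> 'a \<Rightarrow> complex" where "phase p \<omega> = cis (snd p * x (fst p) \<omega>)"

definition damping :: "real \<Rightarrow> real \<times> real \<Rightarrow> complex" where
  "damping \<epsilon> p = cis (- (snd p * u)) * of_real (exp (- (\<epsilon> * (snd p)\<^sup>2) / 2))"

lemma white_noise_scale:
  assumes "has_white_noise M w h X"
  shows "has_white_noise M w (a *\<^sub>R h) (\<lambda>\<omega>. a * X \<omega>)"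
  using white_noise_add_scale[OF assms assms, of "a - 1"] by (simp add: algebra_simps)

lemma wave_noise:
  assumes "p \<in> space time_freq"
  shows "has_white_noise M w (wave p) (\<lambda>\<omega>. snd p * x (fst p) \<omega>)"
  unfolding wave_def using assms by (intro white_noise_scale noise) (auto simp: space_time_freq)

lemma continuous_wave: "continuous_on S wave"
  unfolding wave_def[abs_def]
  by (intro continuous_on_scaleR continuous_on_snd continuous_on_id bounded_linear.continuous_on[OF A]
      continuous_ind01 continuous_on_fst)

lemma wave_ind01: "wave p = A (snd p *\<^sub>R ind01 (fst p))"
  using A by (simp add: wave_def linear_simps)

lemma wave_lower: "c\<^sup>2 * (norm (snd p *\<^sub>R ind01 (fst p) + snd p' *\<^sub>R ind01 (fst p')))\<^sup>2 \<le> (norm (wave p + wave p'))\<^sup>2"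
proof -
  have "wave p + wave p' = A (snd p *\<^sub>R ind01 (fst p) + snd p' *\<^sub>R ind01 (fst p'))"
    using A by (simp add: wave_ind01 linear_simps)
  then have "c * norm (snd p *\<^sub>R ind01 (fst p) + snd p' *\<^sub>R ind01 (fst p')) \<le> norm (wave p + wave p')"
    using lower by simp
  from power_mono[OF this, of 2] c show ?thesis by (simp add: power_mult_distrib)
qed

lemma norm_wave_lower: "p \<in> space time_freq \<Longrightarrow> c\<^sup>2 * (fst p * (snd p)\<^sup>2) \<le> (norm (wave p))\<^sup>2"
  using wave_lower[of p "(0, 0)"]
  by (auto simp: space_time_freq wave_def norm_ind01 power_mult_distrib mult.commute)

lemma x_path_measurable: "\<omega> \<in> space M \<Longrightarrow> (\<lambda>t. x t \<omega>) \<in> borel_measurable leb01"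
  using measurable_compose[OF measurable_Pair2' joint] by simp

lemma phase_measurable: "(\<lambda>(p, \<omega>). phase p \<omega>) \<in> borel_measurable (time_freq \<Otimes>\<^sub>M M)"
proof -
  have "(\<lambda>q. (fst (fst q), snd q)) \<in> measurable (time_freq \<Otimes>\<^sub>M M) (leb01 \<Otimes>\<^sub>M M)"
    by (intro measurable_Pair measurable_snd measurable_compose[OF measurable_fst measurable_fst])
  from measurable_compose[OF this joint] have 1: "(\<lambda>q. x (fst (fst q)) (snd q)) \<in> borel_measurable (time_freq \<Otimes>\<^sub>M M)" by simp
  have 2: "(\<lambda>q. snd (fst q)) \<in> borel_measurable (time_freq \<Otimes>\<^sub>M M)"
    by (rule measurable_compose[OF measurable_fst]) simp
  from measurable_compose[OF borel_measurable_times[OF 2 1] cis_measurable] show ?thesis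
    by (simp add: phase_def split_beta)
qed

lemma damping_measurable: "damping \<epsilon> \<in> borel_measurable time_freq"
  unfolding damping_def[abs_def] by (intro time_freq_measurableI borel_measurable_continuous_onI continuous_intros) simp

lemma norm_damping: "norm (damping \<epsilon> p) = exp (- (\<epsilon> * (snd p)\<^sup>2) / 2)"
  by (simp add: damping_def norm_mult)

lemma norm_phase: "norm (phase p \<omega>) = 1" by (simp add: phase_def)

lemma integrable_norm_damping: "0 < \<epsilon> \<Longrightarrow> integrable time_freq (\<lambda>p. norm (damping \<epsilon> p))"
  unfolding norm_damping by (rule integrable_time_freq_const[OF integrable_gauss_exp])

lemma smoothed_fourier:
  assumes e: "0 < \<epsilon>" and w: "\<omega> \<in> space M"
  shows "of_real (smoothed \<epsilon> \<omega>) = (1 / (2 * pi)) * (\<integral>p. damping \<epsilon> p * phase p \<omega> \<partial>time_freq)"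
    "integrable time_freq (\<lambda>p. damping \<epsilon> p * phase p \<omega>)"
proof -
  interpret TF: pair_sigma_finite leb01 lborel by (rule time_freq_pair)
  have pm: "(\<lambda>p. phase p \<omega>) \<in> borel_measurable time_freq"
    using measurable_compose[OF measurable_Pair2'[OF w] phase_measurable] by simp
  show int: "integrable time_freq (\<lambda>p. damping \<epsilon> p * phase p \<omega>)"
    by (rule Bochner_Integration.integrable_bound[OF integrable_norm_damping[OF e]])
      (use pm damping_measurable in \<open>auto simp: norm_mult norm_phase\<close>)
  have "of_real (smoothed \<epsilon> \<omega>) = (\<integral>t. complex_of_real (gauss_kernel \<epsilon> (x t \<omega> - u)) \<partial>leb01)"
    unfolding smoothed_def set_lebesgue_integral_def
    by (simp add: integral_restrict_space)
  also have "\<dots> = (\<integral>t. (1 / (2 * pi)) * (\<integral>z. damping \<epsilon> (t, z) * phase (t, z) \<omega> \<partial>lborel) \<partial>leb01)"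
  proof (intro Bochner_Integration.integral_cong refl)
    fix t
    have "cis (z * (x t \<omega> - u)) * of_real (exp (- (\<epsilon> * z\<^sup>2) / 2)) = damping \<epsilon> (t, z) * phase (t, z) \<omega>" for z
    proof -
      have "cis (z * (x t \<omega> - u)) = cis (- (z * u)) * cis (z * x t \<omega>)" by (simp add: cis_mult algebra_simps)
      then show ?thesis by (simp add: damping_def phase_def mult_ac)
    qed
    then show "complex_of_real (gauss_kernel \<epsilon> (x t \<omega> - u)) = (1 / (2 * pi)) * (\<integral>z. damping \<epsilon> (t, z) * phase (t, z) \<omega> \<partial>lborel)"
      unfolding fourier_gauss_kernel[OF e] by simp
  qed
  also have "\<dots> = (1 / (2 * pi)) * (\<integral>t. \<integral>z. damping \<epsilon> (t, z) * phase (t, z) \<omega> \<partial>lborel \<partial>leb01)"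
    by (rule integral_mult_right_zero)
  also have "(\<integral>t. \<integral>z. damping \<epsilon> (t, z) * phase (t, z) \<omega> \<partial>lborel \<partial>leb01) = (\<integral>p. damping \<epsilon> p * phase p \<omega> \<partial>time_freq)"
    by (rule TF.integral_fst'[OF int])
  finally show "of_real (smoothed \<epsilon> \<omega>) = (1 / (2 * pi)) * (\<integral>p. damping \<epsilon> p * phase p \<omega> \<partial>time_freq)" .
qed

lemma gauss_kernel_bound: "0 < \<epsilon> \<Longrightarrow> 0 \<le> gauss_kernel \<epsilon> y \<and> gauss_kernel \<epsilon> y \<le> 1 / sqrt (2 * pi * \<epsilon>)"
  unfolding gauss_kernel_def by (auto intro!: divide_right_mono mult_nonneg_nonneg simp: divide_le_eq)

lemma smoothed_sq_integrable:
  assumes e: "0 < \<epsilon>"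
  shows "sq_integrable M (smoothed \<epsilon>)"
proof (rule sq_integrable_bounded)
  interpret L: prob_space leb01 by (rule leb01_prob)
  interpret LM: pair_sigma_finite leb01 M ..
  have eq: "smoothed \<epsilon> \<omega> = (\<integral>t. gauss_kernel \<epsilon> (x t \<omega> - u) \<partial>leb01)" for \<omega>
    unfolding smoothed_def set_lebesgue_integral_def by (simp add: integral_restrict_space)
  have g: "gauss_kernel \<epsilon> \<in> borel_measurable borel"
    unfolding gauss_kernel_def[abs_def] by measurable
  have "(\<lambda>q. x (snd q) (fst q)) \<in> borel_measurable (M \<Otimes>\<^sub>M leb01)"
    using measurable_compose[OF measurable_pair_swap' joint] by (simp add: split_beta)
  then have "(\<lambda>q. x (snd q) (fst q) - u) \<in> borel_measurable (M \<Otimes>\<^sub>M leb01)" by simp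
  from measurable_compose[OF this g] have "(\<lambda>(\<omega>, t). gauss_kernel \<epsilon> (x t \<omega> - u)) \<in> borel_measurable (M \<Otimes>\<^sub>M leb01)"
    by (simp add: split_beta)
  then show "smoothed \<epsilon> \<in> borel_measurable M"
    unfolding eq[abs_def] by (rule L.borel_measurable_lebesgue_integral)
  fix \<omega> assume w: "\<omega> \<in> space M"
  have m: "(\<lambda>t. gauss_kernel \<epsilon> (x t \<omega> - u)) \<in> borel_measurable leb01"
    using x_path_measurable[OF w] by (intro measurable_compose[OF _ g]) simp
  have i: "integrable leb01 (\<lambda>t. gauss_kernel \<epsilon> (x t \<omega> - u))"
    by (rule L.integrable_const_bound[where B="1 / sqrt (2 * pi * \<epsilon>)"]) (use m gauss_kernel_bound[OF e] in auto)
  have "\<bar>smoothed \<epsilon> \<omega>\<bar> = (\<integral>t. gauss_kernel \<epsilon> (x t \<omega> - u) \<partial>leb01)"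
    unfolding eq using gauss_kernel_bound[OF e] by (simp add: integral_nonneg_AE)
  also have "\<dots> \<le> (\<integral>t. 1 / sqrt (2 * pi * \<epsilon>) \<partial>leb01)"
    using gauss_kernel_bound[OF e] by (intro integral_mono i) auto
  also have "\<dots> = 1 / sqrt (2 * pi * \<epsilon>)" using L.prob_space by simp
  finally show "\<bar>smoothed \<epsilon> \<omega>\<bar> \<le> 1 / sqrt (2 * pi * \<epsilon>)" .
qed

text \<open>Expectations against the smoothed local time are Fourier integrals of characters.\<close>

lemma smoothed_expectation:
  assumes e: "0 < \<epsilon>" and Z: "integrable M (Z :: 'a \<Rightarrow> complex)"
  shows "(\<integral>\<omega>. Z \<omega> * of_real (smoothed \<epsilon> \<omega>) \<partial>M) =
    (1 / (2 * pi)) * (\<integral>p. damping \<epsilon> p * (\<integral>\<omega>. Z \<omega> * phase p \<omega> \<partial>M) \<partial>time_freq)"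
proof -
  interpret T: sigma_finite_measure time_freq by (rule time_freq_sigma_finite)
  interpret TM: pair_sigma_finite time_freq M ..
  have [measurable]: "Z \<in> borel_measurable M" using Z by auto
  note [measurable] = phase_measurable damping_measurable
  have int: "integrable (time_freq \<Otimes>\<^sub>M M) (\<lambda>(p, \<omega>). Z \<omega> * (damping \<epsilon> p * phase p \<omega>))"
  proof (rule TM.Fubini_integrable)
    show "(\<lambda>(p, \<omega>). Z \<omega> * (damping \<epsilon> p * phase p \<omega>)) \<in> borel_measurable (time_freq \<Otimes>\<^sub>M M)"
    proof -
      have "(\<lambda>q. Z (snd q)) \<in> borel_measurable (time_freq \<Otimes>\<^sub>M M)" "(\<lambda>q. damping \<epsilon> (fst q)) \<in> borel_measurable (time_freq \<Otimes>\<^sub>M M)"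
        by measurable
      then show ?thesis using phase_measurable unfolding split_beta by (intro borel_measurable_times)
    qed
    show "integrable time_freq (\<lambda>p. \<integral>\<omega>. norm (case (p, \<omega>) of (p, \<omega>) \<Rightarrow> Z \<omega> * (damping \<epsilon> p * phase p \<omega>)) \<partial>M)"
      using integrable_norm_damping[OF e] by (simp add: norm_mult norm_phase)
    show "AE p in time_freq. integrable M (\<lambda>\<omega>. case (p, \<omega>) of (p, \<omega>) \<Rightarrow> Z \<omega> * (damping \<epsilon> p * phase p \<omega>))"
    proof (rule AE_I2)
      fix p assume p: "p \<in> space time_freq"
      have "(\<lambda>\<omega>. phase p \<omega>) \<in> borel_measurable M"
        using measurable_compose[OF measurable_Pair1'[OF p] phase_measurable] by simp
      then have "integrable M (\<lambda>\<omega>. Z \<omega> * (damping \<epsilon> p * phase p \<omega>))"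
        by (intro Bochner_Integration.integrable_bound[OF integrable_mult_left[OF integrable_norm[OF Z], of "norm (damping \<epsilon> p)"]])
          (auto simp: norm_mult norm_phase)
      then show "integrable M (\<lambda>\<omega>. case (p, \<omega>) of (p, \<omega>) \<Rightarrow> Z \<omega> * (damping \<epsilon> p * phase p \<omega>))" by simp
    qed
  qed
  have "(\<integral>\<omega>. Z \<omega> * of_real (smoothed \<epsilon> \<omega>) \<partial>M) = (\<integral>\<omega>. (1 / (2 * pi)) * (\<integral>p. Z \<omega> * (damping \<epsilon> p * phase p \<omega>) \<partial>time_freq) \<partial>M)"
    by (intro Bochner_Integration.integral_cong refl) (simp add: smoothed_fourier(1)[OF e] mult_ac)
  also have "\<dots> = (1 / (2 * pi)) * (\<integral>\<omega>. \<integral>p. Z \<omega> * (damping \<epsilon> p * phase p \<omega>) \<partial>time_freq \<partial>M)"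
    by (rule integral_mult_right_zero)
  also have "(\<integral>\<omega>. \<integral>p. Z \<omega> * (damping \<epsilon> p * phase p \<omega>) \<partial>time_freq \<partial>M) =
      (\<integral>p. \<integral>\<omega>. Z \<omega> * (damping \<epsilon> p * phase p \<omega>) \<partial>M \<partial>time_freq)"
    by (rule TM.Fubini_integral) (use int in simp)
  also have "\<dots> = (\<integral>p. damping \<epsilon> p * (\<integral>\<omega>. Z \<omega> * phase p \<omega> \<partial>M) \<partial>time_freq)"
    unfolding integral_mult_right_zero[symmetric] by (simp add: mult_ac)
  finally show ?thesis .
qed

lemma phases_expectation:
  assumes "p \<in> space time_freq" "p' \<in> space time_freq"
  shows "(\<integral>\<omega>. phase p \<omega> * phase p' \<omega> \<partial>M) = of_real (exp (- (norm (wave p + wave p'))\<^sup>2 / 2))"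
proof -
  have "has_white_noise M w (wave p + 1 *\<^sub>R wave p') (\<lambda>\<omega>. snd p * x (fst p) \<omega> + 1 * (snd p' * x (fst p') \<omega>))"
    by (intro white_noise_add_scale wave_noise assms)
  from white_noise_character[OF this] show ?thesis by (simp add: phase_def cis_mult)
qed

lemma phase_integrable: "p \<in> space time_freq \<Longrightarrow> integrable M (phase p)"
  unfolding phase_def[abs_def]
  by (rule integrable_cis[OF sq_integrable_measurable[OF white_noise_sq_integrable[OF wave_noise]]])

definition pair_char :: "(real \<times> real) \<times> (real \<times> real) \<Rightarrow> real" where
  "pair_char P = exp (- (norm (wave (fst P) + wave (snd P)))\<^sup>2 / 2)"

lemma pair_char_measurable: "pair_char \<in> borel_measurable time_freq2"
proof -
  have "continuous_on UNIV pair_char"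
    unfolding pair_char_def[abs_def]
    by (intro continuous_intros continuous_on_compose2[OF continuous_wave[of UNIV]]) auto
  from measurable_compose[OF time_freq2_borel borel_measurable_continuous_onI[OF this]] show ?thesis .
qed

lemma pair_char_bound: "pair_char P \<le> two_point (c\<^sup>2 / 2) P"
  using wave_lower[of "fst P" "snd P"] by (simp add: pair_char_def two_point_def)

lemma integrable_pair_char: "integrable time_freq2 pair_char"
proof (rule Bochner_Integration.integrable_bound[OF integrable_two_point[of "c\<^sup>2 / 2"] pair_char_measurable])
  show "0 < c\<^sup>2 / 2" using c by simp
  show "AE P in time_freq2. norm (pair_char P) \<le> norm (two_point (c\<^sup>2 / 2) P)"
    using pair_char_bound by (simp add: pair_char_def two_point_def)
qed

lemma integrable_damped_pair:
  assumes "0 \<le> \<epsilon>" "0 \<le> \<delta>"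
  shows "integrable time_freq2 (\<lambda>P. damping \<delta> (fst P) * damping \<epsilon> (snd P) * of_real (pair_char P))"
proof (rule Bochner_Integration.integrable_bound[OF integrable_pair_char])
  show "(\<lambda>P. damping \<delta> (fst P) * damping \<epsilon> (snd P) * of_real (pair_char P)) \<in> borel_measurable time_freq2"
    by (intro borel_measurable_times measurable_compose[OF measurable_fst damping_measurable]
        measurable_compose[OF measurable_snd damping_measurable] measurable_compose[OF pair_char_measurable borel_measurable_of_real])
  have "norm (damping \<epsilon> p) \<le> 1" if "0 \<le> \<epsilon>" for \<epsilon> p unfolding norm_damping using that by simp
  then show "AE P in time_freq2. norm (damping \<delta> (fst P) * damping \<epsilon> (snd P) * of_real (pair_char P)) \<le> norm (pair_char P)"
    using assms by (intro AE_I2) (simp add: norm_mult mult_le_one mult_left_le_one_le)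
qed

lemma smoothed_inner:
  assumes e: "0 < \<epsilon>" and d: "0 < \<delta>"
  shows "of_real (\<integral>\<omega>. smoothed \<epsilon> \<omega> * smoothed \<delta> \<omega> \<partial>M) =
    (1 / (2 * pi))\<^sup>2 * (\<integral>P. damping \<delta> (fst P) * damping \<epsilon> (snd P) * of_real (pair_char P) \<partial>time_freq2)"
proof -
  interpret T: sigma_finite_measure time_freq by (rule time_freq_sigma_finite)
  interpret TT: pair_sigma_finite time_freq time_freq ..
  have int: "integrable time_freq2 (\<lambda>P. damping \<delta> (fst P) * damping \<epsilon> (snd P) * of_real (pair_char P))"
    using e d by (intro integrable_damped_pair) auto
  have "of_real (\<integral>\<omega>. smoothed \<epsilon> \<omega> * smoothed \<delta> \<omega> \<partial>M) = (\<integral>\<omega>. of_real (smoothed \<epsilon> \<omega>) * complex_of_real (smoothed \<delta> \<omega>) \<partial>M)"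
    by (simp only: of_real_mult[symmetric] integral_complex_of_real)
  also have "\<dots> = (1 / (2 * pi)) * (\<integral>p. damping \<delta> p * (\<integral>\<omega>. of_real (smoothed \<epsilon> \<omega>) * phase p \<omega> \<partial>M) \<partial>time_freq)"
    by (intro smoothed_expectation d integrable_of_real sq_integrable_imp_integrable smoothed_sq_integrable e)
  also have "(\<integral>p. damping \<delta> p * (\<integral>\<omega>. of_real (smoothed \<epsilon> \<omega>) * phase p \<omega> \<partial>M) \<partial>time_freq) =
      (\<integral>p. (1 / (2 * pi)) * (\<integral>p'. damping \<delta> p * damping \<epsilon> p' * of_real (pair_char (p, p')) \<partial>time_freq) \<partial>time_freq)"
  proof (intro Bochner_Integration.integral_cong refl)
    fix p assume p: "p \<in> space time_freq"
    have "(\<integral>\<omega>. of_real (smoothed \<epsilon> \<omega>) * phase p \<omega> \<partial>M) = (\<integral>\<omega>. phase p \<omega> * of_real (smoothed \<epsilon> \<omega>) \<partial>M)"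
      by (simp add: mult.commute)
    also have "\<dots> = (1 / (2 * pi)) * (\<integral>p'. damping \<epsilon> p' * (\<integral>\<omega>. phase p \<omega> * phase p' \<omega> \<partial>M) \<partial>time_freq)"
      by (rule smoothed_expectation[OF e phase_integrable[OF p]])
    also have "(\<integral>p'. damping \<epsilon> p' * (\<integral>\<omega>. phase p \<omega> * phase p' \<omega> \<partial>M) \<partial>time_freq) =
        (\<integral>p'. damping \<epsilon> p' * of_real (pair_char (p, p')) \<partial>time_freq)"
      by (intro Bochner_Integration.integral_cong refl) (simp add: phases_expectation[OF p] pair_char_def)
    finally have "(\<integral>\<omega>. of_real (smoothed \<epsilon> \<omega>) * phase p \<omega> \<partial>M) =
        (1 / (2 * pi)) * (\<integral>p'. damping \<epsilon> p' * of_real (pair_char (p, p')) \<partial>time_freq)" .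
    moreover have "(\<integral>p'. damping \<delta> p * damping \<epsilon> p' * of_real (pair_char (p, p')) \<partial>time_freq) =
        damping \<delta> p * (\<integral>p'. damping \<epsilon> p' * of_real (pair_char (p, p')) \<partial>time_freq)"
      by (simp add: mult.assoc)
    ultimately show "damping \<delta> p * (\<integral>\<omega>. of_real (smoothed \<epsilon> \<omega>) * phase p \<omega> \<partial>M) =
        (1 / (2 * pi)) * (\<integral>p'. damping \<delta> p * damping \<epsilon> p' * of_real (pair_char (p, p')) \<partial>time_freq)"
      by (simp only: mult_ac)
  qed
  also have "\<dots> = (1 / (2 * pi)) * (\<integral>p. \<integral>p'. damping \<delta> p * damping \<epsilon> p' * of_real (pair_char (p, p')) \<partial>time_freq \<partial>time_freq)"
    by (rule integral_mult_right_zero)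
  also have "(\<integral>p. \<integral>p'. damping \<delta> p * damping \<epsilon> p' * of_real (pair_char (p, p')) \<partial>time_freq \<partial>time_freq) =
      (\<integral>P. damping \<delta> (fst P) * damping \<epsilon> (snd P) * of_real (pair_char P) \<partial>time_freq2)"
    using TT.integral_fst'[OF int] by simp
  finally show ?thesis by (simp add: power2_eq_square)
qed

abbreviation frequency_gap :: "real \<Rightarrow> (real \<times> real) \<times> (real \<times> real) \<Rightarrow> real" where
  "frequency_gap \<rho> P \<equiv> 1 - exp (- (\<rho> * ((snd (fst P))\<^sup>2 + (snd (snd P))\<^sup>2)) / 2)"

definition damping_error :: "real \<Rightarrow> real" where
  "damping_error \<rho> = (\<integral>P. pair_char P * frequency_gap \<rho> P \<partial>time_freq2)"

lemma integrable_damping_error: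
  assumes "0 \<le> \<rho>"
  shows "integrable time_freq2 (\<lambda>P. pair_char P * frequency_gap \<rho> P)"
    "norm (pair_char P * frequency_gap \<rho> P) \<le> pair_char P"
    "(\<lambda>P. pair_char P * frequency_gap \<rho> P) \<in> borel_measurable time_freq2"
proof -
  show m: "(\<lambda>P. pair_char P * frequency_gap \<rho> P) \<in> borel_measurable time_freq2"
  proof (intro borel_measurable_times pair_char_measurable)
    have "continuous_on UNIV (\<lambda>P::(real \<times> real) \<times> real \<times> real. 1 - exp (- (\<rho> * ((snd (fst P))\<^sup>2 + (snd (snd P))\<^sup>2)) / 2))"
      by (intro continuous_intros) auto
    from measurable_compose[OF time_freq2_borel borel_measurable_continuous_onI[OF this]]
    show "(\<lambda>P. 1 - exp (- (\<rho> * ((snd (fst P))\<^sup>2 + (snd (snd P))\<^sup>2)) / 2)) \<in> borel_measurable time_freq2" .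
  qed
  have b: "norm (pair_char P * frequency_gap \<rho> P) \<le> pair_char P" for P
  proof -
    have "0 \<le> \<rho> * ((snd (fst P))\<^sup>2 + (snd (snd P))\<^sup>2)" using assms by simp
    then have "\<bar>1 - exp (- (\<rho> * ((snd (fst P))\<^sup>2 + (snd (snd P))\<^sup>2)) / 2)\<bar> \<le> 1" by simp
    then show ?thesis unfolding real_norm_def abs_mult
      by (simp add: pair_char_def mult_left_le)
  qed
  then show "norm (pair_char P * frequency_gap \<rho> P) \<le> pair_char P" .
  show "integrable time_freq2 (\<lambda>P. pair_char P * frequency_gap \<rho> P)"
    using b by (intro Bochner_Integration.integrable_bound[OF integrable_pair_char m] AE_I2) (metis abs_ge_self order_trans real_norm_def)
qed

lemma damping_error_tendsto: "(\<lambda>n. damping_error (1 / real (Suc n))) \<longlonglongrightarrow> 0"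
proof -
  have "(\<lambda>n. damping_error (1 / real (Suc n))) \<longlonglongrightarrow> (\<integral>P. 0 \<partial>time_freq2)"
    unfolding damping_error_def
  proof (rule integral_dominated_convergence[where w=pair_char])
    show "(\<lambda>P. pair_char P * frequency_gap (1 / real (Suc n)) P) \<in> borel_measurable time_freq2" for n
      by (rule integrable_damping_error(3)) simp
    show "AE P in time_freq2. norm (pair_char P * frequency_gap (1 / real (Suc n)) P) \<le> pair_char P" for n
      by (intro AE_I2 integrable_damping_error(2)) simp
    show "AE P in time_freq2. (\<lambda>n. pair_char P * frequency_gap (1 / real (Suc n)) P) \<longlonglongrightarrow> 0"
    proof (rule AE_I2)
      fix P :: "(real \<times> real) \<times> real \<times> real"
      have "(\<lambda>n. 1 / real (Suc n)) \<longlonglongrightarrow> 0" by (rule LIMSEQ_Suc[OF lim_1_over_n])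
      then have "(\<lambda>n. pair_char P * frequency_gap (1 / real (Suc n)) P) \<longlonglongrightarrow>
          pair_char P * frequency_gap 0 P"
        by (intro tendsto_intros) auto
      then show "(\<lambda>n. pair_char P * frequency_gap (1 / real (Suc n)) P) \<longlonglongrightarrow> 0" by simp
    qed
  qed (auto intro: integrable_pair_char)
  then show ?thesis by simp
qed

definition local_energy :: complex where
  "local_energy = (1 / (2 * pi))\<^sup>2 * (\<integral>P. damping 0 (fst P) * damping 0 (snd P) * of_real (pair_char P) \<partial>time_freq2)"

text \<open>
  The undamped double integral, which converges absolutely by the two-point bound, is the common limit
  of the inner products; damping by at most \<open>\<rho>\<close> changes it by at most \<open>damping_error \<rho>\<close>.
\<close>

lemma smoothed_inner_bound:
  assumes e: "0 < \<epsilon>" "\<epsilon> \<le> \<rho>" and d: "0 < \<delta>" "\<delta> \<le> \<rho>"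
  shows "\<bar>(\<integral>\<omega>. smoothed \<epsilon> \<omega> * smoothed \<delta> \<omega> \<partial>M) - Re local_energy\<bar> \<le> damping_error \<rho>"
proof -
  let ?N = "time_freq2"
  let ?f = "\<lambda>P. damping \<delta> (fst P) * damping \<epsilon> (snd P) * of_real (pair_char P)"
  let ?g = "\<lambda>P. damping 0 (fst P) * damping 0 (snd P) * of_real (pair_char P)"
  have pi: "norm ((1 / (2 * pi))\<^sup>2 :: complex) \<le> 1"
  proof -
    have "1 / (2 * pi) \<le> 1" using pi_gt3 by simp
    then have "(1 / (2 * pi))\<^sup>2 \<le> 1" by (intro power_le_one) auto
    then show ?thesis by (simp add: norm_power norm_divide norm_mult)
  qed
  have diff: "norm (?f P - ?g P) \<le> pair_char P * frequency_gap \<rho> P" for P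
  proof -
    let ?z = "snd (fst P)" and ?z' = "snd (snd P)"
    define E where "E = exp (- (\<delta> * ?z\<^sup>2) / 2) * exp (- (\<epsilon> * ?z'\<^sup>2) / 2)"
    have "?f P - ?g P = (cis (- (?z * u)) * cis (- (?z' * u))) * of_real ((E - 1) * pair_char P)"
      by (simp add: damping_def E_def algebra_simps)
    then have n: "norm (?f P - ?g P) = \<bar>E - 1\<bar> * pair_char P"
      by (simp add: norm_mult abs_mult pair_char_def del: of_real_mult)
    have "E = exp (- (\<delta> * ?z\<^sup>2 + \<epsilon> * ?z'\<^sup>2) / 2)" by (simp add: E_def exp_add[symmetric] add_divide_distrib)
    moreover have "\<delta> * ?z\<^sup>2 + \<epsilon> * ?z'\<^sup>2 \<le> \<rho> * (?z\<^sup>2 + ?z'\<^sup>2)"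
      using e d by (simp add: distrib_left add_mono mult_right_mono)
    moreover have "0 \<le> \<delta> * ?z\<^sup>2 + \<epsilon> * ?z'\<^sup>2" using e d by simp
    ultimately have "\<bar>E - 1\<bar> \<le> 1 - exp (- (\<rho> * (?z\<^sup>2 + ?z'\<^sup>2)) / 2)" by simp
    then show ?thesis unfolding n by (subst mult.commute) (intro mult_left_mono, simp_all add: pair_char_def)
  qed
  have i: "integrable ?N ?f" "integrable ?N ?g"
    using e d by (intro integrable_damped_pair; simp)+
  have "\<bar>(\<integral>\<omega>. smoothed \<epsilon> \<omega> * smoothed \<delta> \<omega> \<partial>M) - Re local_energy\<bar> =
      \<bar>Re (of_real (\<integral>\<omega>. smoothed \<epsilon> \<omega> * smoothed \<delta> \<omega> \<partial>M) - local_energy)\<bar>" by simp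
  also have "\<dots> \<le> norm (of_real (\<integral>\<omega>. smoothed \<epsilon> \<omega> * smoothed \<delta> \<omega> \<partial>M) - local_energy)" by (rule abs_Re_le_cmod)
  also have "of_real (\<integral>\<omega>. smoothed \<epsilon> \<omega> * smoothed \<delta> \<omega> \<partial>M) - local_energy = (1 / (2 * pi))\<^sup>2 * (\<integral>P. ?f P - ?g P \<partial>?N)"
    unfolding smoothed_inner[OF e(1) d(1)] local_energy_def Bochner_Integration.integral_diff[OF i]
    by (simp add: right_diff_distrib)
  also have "norm \<dots> \<le> 1 * (\<integral>P. norm (?f P - ?g P) \<partial>?N)"
    unfolding norm_mult by (intro mult_mono pi integral_norm_bound) auto
  also have "\<dots> \<le> damping_error \<rho>"
    unfolding damping_error_def mult_1
  proof (rule integral_mono[OF _ _ diff])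
    show "integrable ?N (\<lambda>P. norm (?f P - ?g P))" using i by (intro integrable_norm Bochner_Integration.integrable_diff)
    show "integrable ?N (\<lambda>P. pair_char P * frequency_gap \<rho> P)"
      using e by (intro integrable_damping_error(1)) simp
  qed
  finally show ?thesis .
qed

lemma local_time_exists: "\<exists>l. is_local_time M x u l"
proof -
  have "\<exists>Y. L2_tendsto M smoothed Y (at_right 0)"
    by (rule L2_tendsto_of_bounds[OF smoothed_sq_integrable damping_error_tendsto smoothed_inner_bound])
  then show ?thesis by (simp add: is_local_time_def smoothed_def[abs_def])
qed

lemma local_time_smoothed: "is_local_time M x u l \<Longrightarrow> L2_tendsto M smoothed l (at_right 0)"
  by (simp add: is_local_time_def smoothed_def[abs_def])

text \<open>The local time lies in the closed span of the step integrals, as all characters of \<open>x\<close> do.\<close>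

lemma local_time_chaos_orthogonal:
  assumes l: "is_local_time M x u l" and Y: "chaos_orthogonal Y"
  shows "(\<integral>\<omega>. l \<omega> * Y \<omega> \<partial>M) = 0"
proof -
  have Ys: "sq_integrable M Y" using Y by (simp add: chaos_orthogonal_def)
  have z: "(\<integral>\<omega>. smoothed \<epsilon> \<omega> * Y \<omega> \<partial>M) = 0" if e: "0 < \<epsilon>" for \<epsilon>
  proof -
    have "complex_of_real (\<integral>\<omega>. smoothed \<epsilon> \<omega> * Y \<omega> \<partial>M) = (\<integral>\<omega>. of_real (Y \<omega>) * of_real (smoothed \<epsilon> \<omega>) \<partial>M)"
      by (simp only: of_real_mult[symmetric] integral_complex_of_real mult.commute)
    also have "\<dots> = (1 / (2 * pi)) * (\<integral>p. damping \<epsilon> p * (\<integral>\<omega>. of_real (Y \<omega>) * phase p \<omega> \<partial>M) \<partial>time_freq)"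
      by (intro smoothed_expectation e integrable_of_real sq_integrable_imp_integrable Ys)
    also have "(\<integral>p. damping \<epsilon> p * (\<integral>\<omega>. of_real (Y \<omega>) * phase p \<omega> \<partial>M) \<partial>time_freq) = (\<integral>p. 0 \<partial>time_freq)"
    proof (intro Bochner_Integration.integral_cong refl)
      fix p assume "p \<in> space time_freq"
      from chaos_orthogonal_character[OF Y wave_noise[OF this]]
      show "damping \<epsilon> p * (\<integral>\<omega>. of_real (Y \<omega>) * phase p \<omega> \<partial>M) = 0" by (simp add: phase_def)
    qed
    finally show ?thesis by simp
  qed
  have "((\<lambda>\<epsilon>. \<integral>\<omega>. smoothed \<epsilon> \<omega> * Y \<omega> \<partial>M) \<longlongrightarrow> (\<integral>\<omega>. l \<omega> * Y \<omega> \<partial>M)) (at_right 0)"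
    by (rule L2_tendsto_inner_right[OF local_time_smoothed[OF l] Ys])
  moreover have "((\<lambda>\<epsilon>. \<integral>\<omega>. smoothed \<epsilon> \<omega> * Y \<omega> \<partial>M) \<longlongrightarrow> 0) (at_right 0)"
    by (rule tendsto_eventually, rule eventually_at_rightI[of 0 1]) (auto intro: z)
  ultimately show ?thesis by (rule tendsto_unique[OF trivial_limit_at_right_real])
qed

end

section \<open>Polarization of symmetric forms\<close>

lemma rep_l2_01_sum_AE:
  "finite I \<Longrightarrow> AE x in leb01. rep_l2_01 (\<Sum>i\<in>I. r i *\<^sub>R \<phi> i) x = (\<Sum>i\<in>I. r i * rep_l2_01 (\<phi> i) x)"
proof (induction I rule: finite_induct)
  case empty
  have "AE x in leb01. rep_l2_01 0 x = (\<lambda>_. 0) x"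
    unfolding zero_l2_01_def map_fun_apply id_apply
    using rep_abs_l2_01_AE[OF sq_integrable_zero] by simp
  then show ?case by simp
next
  case (insert i I)
  have "AE x in leb01. rep_l2_01 ((\<Sum>i\<in>I. r i *\<^sub>R \<phi> i) + r i *\<^sub>R \<phi> i) x = rep_l2_01 (\<Sum>i\<in>I. r i *\<^sub>R \<phi> i) x + r i * rep_l2_01 (\<phi> i) x"
    by (rule rep_l2_01_add_scale_AE)
  with insert.IH show ?case
  proof eventually_elim
    case (elim x)
    then show ?case using insert.hyps by (simp add: add.commute)
  qed
qed

lemma kernel_form_diagonal_sum:
  assumes a: "symmetric_kernel n a" and I: "finite I"
  shows "kernel_form n a (\<lambda>_. \<Sum>i\<in>I. r i *\<^sub>R \<phi> i) =
    (1 / fact n) * (\<integral>t. a t * (\<Prod>j<n. \<Sum>i\<in>I. r i * rep_l2_01 (\<phi> i) (t j)) \<partial>cube n)"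
proof -
  let ?h = "\<Sum>i\<in>I. r i *\<^sub>R \<phi> i"
  have am: "a \<in> borel_measurable (cube n)" using a by (auto simp: symmetric_kernel_def sq_integrable_def)
  have sq: "sq_integrable leb01 (\<lambda>x. \<Sum>i\<in>I. r i * rep_l2_01 (\<phi> i) x)"
    by (intro sq_integrable_sum sq_integrable_scale rep_l2_01_sq_integrable)
  have m1: "(\<lambda>t. \<Prod>j<n. rep_l2_01 ?h (t j)) \<in> borel_measurable (cube n)"
    by (rule sq_integrable_measurable[OF product_sq_integrable_cube[OF rep_l2_01_sq_integrable]])
  have m2: "(\<lambda>t. \<Prod>j<n. \<Sum>i\<in>I. r i * rep_l2_01 (\<phi> i) (t j)) \<in> borel_measurable (cube n)"
    by (rule sq_integrable_measurable[OF product_sq_integrable_cube[OF sq]])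
  have "\<forall>j\<in>{..<n}. AE t in cube n. rep_l2_01 ?h (t j) = (\<Sum>i\<in>I. r i * rep_l2_01 (\<phi> i) (t j))"
    unfolding cube_def by (intro ballI AE_PiM_component leb01_prob rep_l2_01_sum_AE I)
  then have "AE t in cube n. \<forall>j\<in>{..<n}. rep_l2_01 ?h (t j) = (\<Sum>i\<in>I. r i * rep_l2_01 (\<phi> i) (t j))"
    by (intro AE_finite_allI) auto
  then have "AE t in cube n. a t * (\<Prod>j<n. rep_l2_01 ?h (t j)) = a t * (\<Prod>j<n. \<Sum>i\<in>I. r i * rep_l2_01 (\<phi> i) (t j))"
    by eventually_elim simp
  then have "(\<integral>t. a t * (\<Prod>j<n. rep_l2_01 ?h (t j)) \<partial>cube n) = (\<integral>t. a t * (\<Prod>j<n. \<Sum>i\<in>I. r i * rep_l2_01 (\<phi> i) (t j)) \<partial>cube n)"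
    by (intro integral_cong_AE borel_measurable_times am m1 m2)
  then show ?thesis by (simp add: kernel_form_def)
qed

lemma kernel_form_homogeneous:
  assumes a: "symmetric_kernel n a"
  shows "kernel_form n a (\<lambda>_. r *\<^sub>R h) = r ^ n * kernel_form n a (\<lambda>_. h)"
proof -
  have "kernel_form n a (\<lambda>_. \<Sum>i\<in>{0::nat}. r *\<^sub>R h) = (1 / fact n) * (\<integral>t. r ^ n * (a t * (\<Prod>j<n. rep_l2_01 h (t j))) \<partial>cube n)"
    unfolding kernel_form_diagonal_sum[OF a finite.insertI[OF finite.emptyI]] by (simp add: prod.distrib mult_ac)
  then show ?thesis by (simp add: kernel_form_def)
qed

lemma alternating_superset_sum:
  assumes U: "finite U" and R: "R \<subseteq> U"
  shows "(\<Sum>S | S \<subseteq> U \<and> R \<subseteq> S. (-1) ^ card S) = (if R = U then (-1) ^ card U else (0::real))"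
proof -
  have fR: "finite R" "finite (U - R)" using U R finite_subset by auto
  have "(\<Sum>S | S \<subseteq> U \<and> R \<subseteq> S. (-1) ^ card S) = (\<Sum>T\<in>Pow (U - R). (-1) ^ card (R \<union> T) :: real)"
    by (rule sum.reindex_bij_witness[where i="\<lambda>T. R \<union> T" and j="\<lambda>S. S - R"]) (use R in \<open>auto simp: Un_absorb1\<close>)
  also have "\<dots> = (\<Sum>T\<in>Pow (U - R). (-1) ^ card R * ((\<Prod>x\<in>T. -1) * (\<Prod>x\<in>(U - R) - T. 1)))"
  proof (intro sum.cong refl)
    fix T assume "T \<in> Pow (U - R)"
    then have "finite T" "R \<inter> T = {}" using fR finite_subset by auto
    then show "(-1) ^ card (R \<union> T) = (-1) ^ card R * ((\<Prod>x\<in>T. -1) * (\<Prod>x\<in>(U - R) - T. 1 :: real))"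
      using fR by (simp add: card_Un_disjoint power_add)
  qed
  also have "\<dots> = (-1) ^ card R * (\<Prod>x\<in>U - R. -1 + (1::real))"
    unfolding sum_distrib_left[symmetric] prod_add[OF fR(2)] ..
  also have "\<dots> = (if R = U then (-1) ^ card U else 0)"
    using fR R by (auto simp: power_0_left card_gt_0_iff)
  finally show ?thesis .
qed

definition rearrangements :: "nat \<Rightarrow> (nat \<Rightarrow> nat) set" where
  "rearrangements n = {f \<in> {..<n} \<rightarrow>\<^sub>E {..<n}. f ` {..<n} = {..<n}}"

text \<open>A surjective choice of arguments is a permutation, which a symmetric form does not see.\<close>

lemma kernel_form_rearrange:
  assumes a: "symmetric_kernel n a" and f: "f \<in> rearrangements n"
  shows "(\<integral>t. a t * (\<Prod>j<n. rep_l2_01 (\<phi> (f j)) (t j)) \<partial>cube n) = fact n * kernel_form n a \<phi>"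
proof -
  define \<pi> where "\<pi> i = (if i < n then f i else i)" for i
  have img: "f ` {..<n} = {..<n}" using f by (simp add: rearrangements_def)
  have "inj_on f {..<n}" by (rule eq_card_imp_inj_on) (simp_all add: img)
  then have "bij_betw \<pi> {..<n} {..<n}"
    using img by (auto simp: bij_betw_def \<pi>_def inj_on_def image_def)
  then have \<pi>: "\<pi> permutes {..<n}" by (intro bij_imp_permutes) (auto simp: \<pi>_def)
  let ?\<rho> = "inv \<pi>"
  have \<rho>: "?\<rho> permutes {..<n}" by (rule permutes_inv[OF \<pi>])
  let ?g = "\<lambda>t. a t * (\<Prod>j<n. rep_l2_01 (\<phi> j) (t j))"
  have am: "a \<in> borel_measurable (cube n)" using a by (auto simp: symmetric_kernel_def sq_integrable_def)
  have gm: "?g \<in> borel_measurable (cube n)"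
    by (intro borel_measurable_times am sq_integrable_measurable[OF product_sq_integrable_cube[OF rep_l2_01_sq_integrable]])
  have "(\<integral>t. a t * (\<Prod>j<n. rep_l2_01 (\<phi> (f j)) (t j)) \<partial>cube n) = (\<integral>t. ?g (t \<circ> ?\<rho>) \<partial>cube n)"
  proof (intro Bochner_Integration.integral_cong refl)
    fix t assume t: "t \<in> space (cube n)"
    have "(\<Prod>j<n. rep_l2_01 (\<phi> j) ((t \<circ> ?\<rho>) j)) = (\<Prod>j<n. rep_l2_01 (\<phi> (\<pi> j)) ((t \<circ> ?\<rho>) (\<pi> j)))"
      using prod.permute[OF \<pi>, of "\<lambda>j. rep_l2_01 (\<phi> j) ((t \<circ> ?\<rho>) j)"] by (simp add: comp_def)
    also have "\<dots> = (\<Prod>j<n. rep_l2_01 (\<phi> (f j)) (t j))"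
    proof (intro prod.cong refl)
      fix j assume "j \<in> {..<n}"
      then have "\<pi> j = f j" by (simp add: \<pi>_def)
      then show "rep_l2_01 (\<phi> (\<pi> j)) ((t \<circ> ?\<rho>) (\<pi> j)) = rep_l2_01 (\<phi> (f j)) (t j)"
        using permutes_inverses(2)[OF \<pi>, of j] by simp
    qed
    finally show "a t * (\<Prod>j<n. rep_l2_01 (\<phi> (f j)) (t j)) = ?g (t \<circ> ?\<rho>)"
      using a \<rho> t by (simp add: symmetric_kernel_def)
  qed
  also have "\<dots> = (\<integral>t. ?g t \<partial>cube n)" by (rule integral_cube_permute(1)[OF \<rho> gm])
  finally show ?thesis by (simp add: kernel_form_def)
qed

text \<open>
  The alternating sum of the diagonal values over subsets keeps exactly the choices that use every
  argument, so a symmetric form is determined by its diagonal.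
\<close>

lemma kernel_form_polarization:
  assumes a: "symmetric_kernel n a"
  shows "(\<Sum>S\<in>Pow {..<n}. (-1) ^ card S * kernel_form n a (\<lambda>_. \<Sum>i\<in>S. \<phi> i)) =
    (-1) ^ n * real (card (rearrangements n)) * kernel_form n a \<phi>"
proof -
  let ?U = "{..<n}"
  let ?F = "\<lambda>f. \<integral>t. a t * (\<Prod>j<n. rep_l2_01 (\<phi> (f j)) (t j)) \<partial>cube n"
  have sq: "sq_integrable (cube n) a" using a by (simp add: symmetric_kernel_def)
  have int: "integrable (cube n) (\<lambda>t. a t * (\<Prod>j<n. rep_l2_01 (\<phi> (f j)) (t j)))" for f
    by (intro sq_integrable_mult sq product_sq_integrable_cube rep_l2_01_sq_integrable)
  have fin: "finite (?U \<rightarrow>\<^sub>E ?U)" by (intro finite_PiE) auto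
  have diag: "fact n * kernel_form n a (\<lambda>_. \<Sum>i\<in>S. \<phi> i) = (\<Sum>f\<in>?U \<rightarrow>\<^sub>E ?U. if f ` ?U \<subseteq> S then ?F f else 0)"
    if S: "S \<subseteq> ?U" for S
  proof -
    have fS: "finite S" using S finite_subset by blast
    have "fact n * kernel_form n a (\<lambda>_. \<Sum>i\<in>S. \<phi> i) = (\<integral>t. a t * (\<Prod>j<n. \<Sum>i\<in>S. rep_l2_01 (\<phi> i) (t j)) \<partial>cube n)"
      using kernel_form_diagonal_sum[OF a fS, of "\<lambda>_. 1" \<phi>] by simp
    also have "\<dots> = (\<integral>t. (\<Sum>f\<in>?U \<rightarrow>\<^sub>E S. a t * (\<Prod>j<n. rep_l2_01 (\<phi> (f j)) (t j))) \<partial>cube n)"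
      using fS by (simp add: prod_sum_PiE sum_distrib_left)
    also have "\<dots> = (\<Sum>f\<in>?U \<rightarrow>\<^sub>E S. ?F f)" by (intro Bochner_Integration.integral_sum int)
    also have "?U \<rightarrow>\<^sub>E S = {f \<in> ?U \<rightarrow>\<^sub>E ?U. f ` ?U \<subseteq> S}" using S by (auto simp: PiE_iff extensional_def)
    also have "(\<Sum>f\<in>\<dots>. ?F f) = (\<Sum>f\<in>?U \<rightarrow>\<^sub>E ?U. if f ` ?U \<subseteq> S then ?F f else 0)"
      using fin by (rule sum.inter_filter)
    finally show ?thesis .
  qed
  have "fact n * (\<Sum>S\<in>Pow ?U. (-1) ^ card S * kernel_form n a (\<lambda>_. \<Sum>i\<in>S. \<phi> i)) =
      (\<Sum>S\<in>Pow ?U. (-1) ^ card S * (fact n * kernel_form n a (\<lambda>_. \<Sum>i\<in>S. \<phi> i)))"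
    unfolding sum_distrib_left by (simp only: mult.left_commute)
  also have "\<dots> = (\<Sum>S\<in>Pow ?U. \<Sum>f\<in>?U \<rightarrow>\<^sub>E ?U. if f ` ?U \<subseteq> S then (-1) ^ card S * ?F f else 0)"
    by (intro sum.cong refl) (simp add: diag sum_distrib_left if_distrib cong: if_cong)
  also have "\<dots> = (\<Sum>f\<in>?U \<rightarrow>\<^sub>E ?U. \<Sum>S\<in>Pow ?U. if f ` ?U \<subseteq> S then (-1) ^ card S * ?F f else 0)"
    by (rule sum.swap)
  also have "\<dots> = (\<Sum>f\<in>?U \<rightarrow>\<^sub>E ?U. if f ` ?U = ?U then (-1) ^ n * ?F f else 0)"
  proof (intro sum.cong refl)
    fix f assume f: "f \<in> ?U \<rightarrow>\<^sub>E ?U"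
    have "(\<Sum>S\<in>Pow ?U. if f ` ?U \<subseteq> S then (-1) ^ card S * ?F f else 0) = (\<Sum>S | S \<in> Pow ?U \<and> f ` ?U \<subseteq> S. (-1) ^ card S * ?F f)"
      by (rule sum.inter_filter[symmetric]) simp
    also have "\<dots> = (\<Sum>S | S \<subseteq> ?U \<and> f ` ?U \<subseteq> S. (-1) ^ card S) * ?F f"
      by (simp add: sum_distrib_right)
    also have "(\<Sum>S | S \<subseteq> ?U \<and> f ` ?U \<subseteq> S. (-1) ^ card S) = (if f ` ?U = ?U then (-1) ^ card ?U else (0::real))"
      by (rule alternating_superset_sum) (use f in auto)
    finally show "(\<Sum>S\<in>Pow ?U. if f ` ?U \<subseteq> S then (-1) ^ card S * ?F f else 0) = (if f ` ?U = ?U then (-1) ^ n * ?F f else 0)"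
      by simp
  qed
  also have "\<dots> = (\<Sum>f\<in>rearrangements n. (-1) ^ n * ?F f)"
    unfolding rearrangements_def by (rule sum.inter_filter[OF fin, symmetric])
  also have "\<dots> = (\<Sum>f\<in>rearrangements n. (-1) ^ n * (fact n * kernel_form n a \<phi>))"
    by (intro sum.cong refl) (simp add: kernel_form_rearrange[OF a])
  also have "\<dots> = fact n * ((-1) ^ n * real (card (rearrangements n)) * kernel_form n a \<phi>)" by simp
  finally show ?thesis by simp
qed

lemma card_rearrangements_pos: "0 < card (rearrangements n)"
proof -
  have "finite (rearrangements n)"
    unfolding rearrangements_def by (rule finite_subset[of _ "{..<n} \<rightarrow>\<^sub>E {..<n}"]) (auto intro: finite_PiE)
  moreover have "restrict id {..<n} \<in> rearrangements n" by (auto simp: rearrangements_def)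
  ultimately show ?thesis by (auto simp: card_gt_0_iff)
qed

section \<open>The kernels of the local time\<close>

text \<open>
  For coordinates in the unit interval this is 1 if the largest coordinate is at most \<open>s\<close>, and 0
  otherwise. It turns the moving lower limit of integration in the kernels into a factor.
\<close>

definition box_power :: "nat \<Rightarrow> real \<Rightarrow> (nat \<Rightarrow> real) \<Rightarrow> real" where
  "box_power n s t = (\<Prod>i<n. indicator {0..s} (t i))"

lemma box_power_measurable: "(\<lambda>q. box_power n (fst q) (snd q)) \<in> borel_measurable (leb01 \<Otimes>\<^sub>M cube n)"
proof -
  have m1: "fst \<in> borel_measurable (leb01 \<Otimes>\<^sub>M cube n)"
    by (rule measurable_compose[OF measurable_fst leb01_measurableI]) simp
  have m2: "(\<lambda>q. snd q i) \<in> borel_measurable (leb01 \<Otimes>\<^sub>M cube n)" for i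
    by (rule measurable_compose[OF measurable_snd cube_component_borel])
  have "(\<lambda>q. indicator {0..fst q} (snd q i) :: real) \<in> borel_measurable (leb01 \<Otimes>\<^sub>M cube n)" for i
  proof -
    have "(\<lambda>q. if 0 \<le> snd q i \<and> snd q i \<le> fst q then 1 else (0::real)) \<in> borel_measurable (leb01 \<Otimes>\<^sub>M cube n)"
    proof (rule measurable_If)
      show "{q \<in> space (leb01 \<Otimes>\<^sub>M cube n). 0 \<le> snd q i \<and> snd q i \<le> fst q} \<in> sets (leb01 \<Otimes>\<^sub>M cube n)"
        by (intro sets.sets_Collect_conj borel_measurable_le m1 m2 borel_measurable_const)
    qed simp_all
    then show ?thesis by (simp add: indicator_def of_bool_def)
  qed
  then show ?thesis unfolding box_power_def by (intro borel_measurable_prod)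
qed

lemma box_power_cube: "box_power n s \<in> borel_measurable (cube n)"
proof -
  have "(\<lambda>t. indicator {0..s} (t i) :: real) \<in> borel_measurable (cube n)" for i
    by (rule measurable_compose[OF cube_component_borel]) simp
  then show ?thesis unfolding box_power_def[abs_def] by (intro borel_measurable_prod)
qed

lemma box_power_eq_0:
  assumes "i < n" "t i \<notin> {0..s}"
  shows "box_power n s t = 0"
proof -
  have "indicator {0..s} (t i) = (0::real)" using assms(2) unfolding indicator_def by (simp only: if_False of_bool_eq)
  with assms(1) show ?thesis unfolding box_power_def by (intro prod_zero bexI[of _ i]) auto
qed

lemma box_power_01: "box_power n s t = 0 \<or> box_power n s t = 1"
proof (cases "\<exists>i<n. t i \<notin> {0..s}")
  case True
  then show ?thesis using box_power_eq_0 by blast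
next
  case False
  then show ?thesis unfolding box_power_def by (intro disjI2 prod.neutral) auto
qed

lemma integral_box_power: "s \<in> {0..1} \<Longrightarrow> (\<integral>t. box_power n s t \<partial>cube n) = s ^ n"
proof -
  assume s: "s \<in> {0..1}"
  interpret prob_space leb01 by (rule leb01_prob)
  have "(\<integral>t. box_power n s t \<partial>cube n) = (\<Prod>i<n. \<integral>x. indicator {0..s} x \<partial>leb01)"
    unfolding box_power_def by (rule integral_cube_product[OF sq_integrable_imp_integrable[OF sq_integrable_indicator01]])
  also have "\<dots> = s ^ n" unfolding integral_leb01_indicator using s by simp
  finally show ?thesis .
qed

lemma max_coord_le_iff:
  assumes "t \<in> space (cube n)" "0 \<le> s"
  shows "max_coord n t \<le> s \<longleftrightarrow> (\<forall>i<n. t i \<in> {0..s})"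
proof (cases "n = 0")
  case False
  have "Max (t ` {..<n}) \<le> s \<longleftrightarrow> (\<forall>y\<in>t ` {..<n}. y \<le> s)"
    using False by (intro Max_le_iff) auto
  then show ?thesis using False space_cube_range[OF assms(1)] by (auto simp: max_coord_def)
qed (use assms in \<open>simp add: max_coord_def\<close>)

lemma max_coord_nonneg: "t \<in> space (cube n) \<Longrightarrow> 0 \<le> max_coord n t"
proof (cases "n = 0")
  case False
  assume t: "t \<in> space (cube n)"
  have "0 \<le> t 0" using space_cube_range[OF t, of 0] False by simp
  also have "t 0 \<le> Max (t ` {..<n})" using False by (intro Max_ge) auto
  finally show ?thesis using False by (simp add: max_coord_def)
qed (simp add: max_coord_def)

context image_process
begin

definition deviation :: "real \<Rightarrow> real" where "deviation s = norm (A (ind01 s))"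

definition weight :: "nat \<Rightarrow> real \<Rightarrow> real" where "weight n s = hermite_gauss n u (deviation s)"

definition local_kernel :: "nat \<Rightarrow> (nat \<Rightarrow> real) \<Rightarrow> real" where
  "local_kernel n t = (LBINT s:{max_coord n t..1}. weight n s)"

lemma continuous_deviation: "continuous_on UNIV deviation"
  unfolding deviation_def[abs_def]
  by (intro continuous_on_norm bounded_linear.continuous_on[OF A] continuous_ind01 continuous_on_id)

lemma weight_measurable: "weight n \<in> borel_measurable borel"
  unfolding weight_def[abs_def]
  by (rule measurable_compose[OF borel_measurable_continuous_onI[OF continuous_deviation] hermite_gauss_measurable])

lemma deviation_lower: "s \<in> {0..1} \<Longrightarrow> c * sqrt s \<le> deviation s"
  using lower[of "ind01 s"] by (simp add: deviation_def norm_ind01)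

text \<open>
  The norm of \<open>A (ind01 s)\<close> is at least \<open>c sqrt s\<close>, so the singularity of the Hermite weight at time 0 is at
  most of order \<open>1 / sqrt s ^ (n + 1)\<close>.
\<close>

lemma weight_bound: "\<exists>C\<ge>0. \<forall>s\<in>{0<..1}. \<bar>weight n s\<bar> * sqrt s ^ n \<le> C / sqrt s"
proof -
  obtain C where C: "0 \<le> C" "\<And>s. 0 < s \<Longrightarrow> \<bar>hermite_gauss n u s\<bar> \<le> C / s ^ Suc n"
    using hermite_gauss_bound by blast
  have "\<bar>weight n s\<bar> * sqrt s ^ n \<le> (C / c ^ Suc n) / sqrt s" if s: "s \<in> {0<..1}" for s
  proof -
    have l: "0 < c * sqrt s" "c * sqrt s \<le> deviation s" using s c deviation_lower[of s] by auto
    have "\<bar>weight n s\<bar> \<le> C / deviation s ^ Suc n"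
      unfolding weight_def using l by (intro C(2)) linarith
    also have "\<dots> \<le> C / (c * sqrt s) ^ Suc n"
      using l C(1) by (intro divide_left_mono power_mono mult_pos_pos zero_less_power[of "deviation s"] zero_less_power[OF l(1)]) auto
    finally have "\<bar>weight n s\<bar> * sqrt s ^ n \<le> C / (c * sqrt s) ^ Suc n * sqrt s ^ n"
      using s by (intro mult_right_mono) auto
    also have "\<dots> = (C / c ^ Suc n) / sqrt s"
      using s c by (simp add: power_mult_distrib field_simps)
    finally show ?thesis .
  qed
  then show ?thesis using C(1) c by (intro exI[of _ "C / c ^ Suc n"]) auto
qed

lemma local_kernel_eq:
  assumes t: "t \<in> space (cube n)"
  shows "local_kernel n t = (\<integral>s. box_power n s t * weight n s \<partial>leb01)"
proof -
  have "(\<integral>s. box_power n s t * weight n s \<partial>leb01) = (\<integral>s. indicator {0..1} s *\<^sub>R (box_power n s t * weight n s) \<partial>lborel)"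
    by (rule integral_restrict_space) simp
  also have "\<dots> = (\<integral>s. indicator {max_coord n t..1} s *\<^sub>R weight n s \<partial>lborel)"
  proof (intro Bochner_Integration.integral_cong refl)
    fix s :: real
    show "indicator {0..1} s *\<^sub>R (box_power n s t * weight n s) = indicator {max_coord n t..1} s *\<^sub>R weight n s"
    proof (cases "s \<in> {0..1}")
      case True
      then have s: "0 \<le> s" by simp
      show ?thesis
      proof (cases "max_coord n t \<le> s")
        case le: True
        then have "box_power n s t = 1"
          using max_coord_le_iff[OF t s] unfolding box_power_def by (intro prod.neutral) auto
        then show ?thesis using True le by simp
      next
        case nle: False
        then obtain i where "i < n" "t i \<notin> {0..s}" using max_coord_le_iff[OF t s] by blast
        then have "box_power n s t = 0" by (rule box_power_eq_0)
        then show ?thesis using nle by simp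
      qed
    next
      case False
      then show ?thesis using max_coord_nonneg[OF t] by (auto split: split_indicator)
    qed
  qed
  finally show ?thesis by (simp add: local_kernel_def set_lebesgue_integral_def)
qed

lemma weighted_box_measurable: "(\<lambda>q. box_power n (fst q) (snd q) * weight n (fst q)) \<in> borel_measurable (leb01 \<Otimes>\<^sub>M cube n)"
  by (intro borel_measurable_times box_power_measurable measurable_compose[OF measurable_fst leb01_measurableI[OF weight_measurable]])

lemma local_kernel_measurable: "local_kernel n \<in> borel_measurable (cube n)"
proof -
  interpret L: prob_space leb01 by (rule leb01_prob)
  have "(\<lambda>(t, s). box_power n s t * weight n s) \<in> borel_measurable (cube n \<Otimes>\<^sub>M leb01)"
    using measurable_compose[OF measurable_pair_swap' weighted_box_measurable] by (simp add: split_beta)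
  then have "(\<lambda>t. \<integral>s. box_power n s t * weight n s \<partial>leb01) \<in> borel_measurable (cube n)"
    by (rule L.borel_measurable_lebesgue_integral)
  then show ?thesis by (subst measurable_cong[OF local_kernel_eq])
qed

text \<open>
  Square integrability: Cauchy--Schwarz with the weight \<open>1 / sqrt s\<close> leaves
  \<open>weight\<^sup>2 s\<^sup>n sqrt s\<close>, which is of order \<open>1 / sqrt s\<close> for every \<open>n\<close>.
\<close>

lemma local_kernel_sq_integrable: "sq_integrable (cube n) (local_kernel n)"
  unfolding sq_integrable_def
proof (intro conjI local_kernel_measurable integrableI_bounded)
  interpret L: prob_space leb01 by (rule leb01_prob)
  interpret C: prob_space "cube n" by (rule cube_prob)
  interpret LC: pair_sigma_finite leb01 "cube n" ..
  show "(\<lambda>t. (local_kernel n t)\<^sup>2) \<in> borel_measurable (cube n)" using local_kernel_measurable by simp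
  obtain K where K: "0 \<le> K" "\<And>s. s \<in> {0<..1} \<Longrightarrow> \<bar>weight n s\<bar> * sqrt s ^ n \<le> K / sqrt s" using weight_bound by blast
  let ?F = "\<lambda>t s. ennreal (box_power n s t * (\<bar>weight n s\<bar> * sqrt (sqrt s)))"
  let ?G = "\<lambda>s. ennreal (1 / sqrt (sqrt s))"
  have ne0: "AE s in leb01. s \<in> {0<..1}"
    using AE_lborel_singleton[of 0] by (subst AE_restrict_space_iff) (auto elim!: eventually_mono)
  have bm: "(\<lambda>s. box_power n s t) \<in> borel_measurable leb01" if "t \<in> space (cube n)" for t
    using measurable_compose[OF measurable_Pair2'[OF that] box_power_measurable] by simp
  have sqm: "(\<lambda>s. \<bar>weight n s\<bar> * sqrt (sqrt s)) \<in> borel_measurable leb01"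
    by (rule leb01_measurableI) (use weight_measurable in measurable)
  have Fm: "?F t \<in> borel_measurable leb01" if "t \<in> space (cube n)" for t
    using bm[OF that] sqm by measurable
  have Gm: "?G \<in> borel_measurable leb01" by (rule leb01_measurableI) measurable
  have point: "ennreal (norm ((local_kernel n t)\<^sup>2)) \<le> 2 * (\<integral>\<^sup>+s. ennreal (box_power n s t * ((weight n s)\<^sup>2 * sqrt s)) \<partial>leb01)"
    if t: "t \<in> space (cube n)" for t
  proof -
    have "ennreal \<bar>local_kernel n t\<bar> \<le> (\<integral>\<^sup>+s. ennreal (norm (box_power n s t * weight n s)) \<partial>leb01)"
    proof (cases "integrable leb01 (\<lambda>s. box_power n s t * weight n s)")
      case True
      from integral_norm_bound_ennreal[OF this] show ?thesis unfolding local_kernel_eq[OF t] by simp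
    next
      case False
      then show ?thesis unfolding local_kernel_eq[OF t] by (simp add: not_integrable_integral_eq)
    qed
    also have "\<dots> = (\<integral>\<^sup>+s. ?F t s * ?G s \<partial>leb01)"
    proof (rule nn_integral_cong_AE)
      show "AE s in leb01. ennreal (norm (box_power n s t * weight n s)) = ?F t s * ?G s"
        using ne0
      proof eventually_elim
        case (elim s)
        have b: "0 \<le> box_power n s t" using box_power_01[of n s t] by auto
        have "norm (box_power n s t * weight n s) = (box_power n s t * (\<bar>weight n s\<bar> * sqrt (sqrt s))) * (1 / sqrt (sqrt s))"
          using elim b by (simp add: abs_mult)
        then show ?case using b elim by (simp add: ennreal_mult[symmetric] del: times_divide_eq_right mult_1_right)
      qed
    qed
    finally have "(ennreal \<bar>local_kernel n t\<bar>)\<^sup>2 \<le> (\<integral>\<^sup>+s. ?F t s * ?G s \<partial>leb01)\<^sup>2" by (intro power_mono) auto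
    also have "\<dots> \<le> (\<integral>\<^sup>+s. (?F t s)\<^sup>2 \<partial>leb01) * (\<integral>\<^sup>+s. (?G s)\<^sup>2 \<partial>leb01)"
      by (rule Cauchy_Schwarz_nn_integral[OF Fm[OF t] Gm])
    also have "(\<integral>\<^sup>+s. (?G s)\<^sup>2 \<partial>leb01) = (\<integral>\<^sup>+s. ennreal (1 / sqrt s) \<partial>leb01)"
      by (intro nn_integral_cong) (auto simp: ennreal_power power_divide)
    also have "\<dots> = 2" by (rule nn_integral_inverse_sqrt_leb01)
    also have "(\<integral>\<^sup>+s. (?F t s)\<^sup>2 \<partial>leb01) = (\<integral>\<^sup>+s. ennreal (box_power n s t * ((weight n s)\<^sup>2 * sqrt s)) \<partial>leb01)"
    proof (intro nn_integral_cong)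
      fix s assume "s \<in> space leb01"
      then have s: "0 \<le> s" by simp
      have b: "0 \<le> box_power n s t" "(box_power n s t)\<^sup>2 = box_power n s t" using box_power_01[of n s t] by auto
      then show "(?F t s)\<^sup>2 = ennreal (box_power n s t * ((weight n s)\<^sup>2 * sqrt s))"
        using s by (simp add: ennreal_power power_mult_distrib)
    qed
    finally show ?thesis by (simp add: ennreal_power mult.commute)
  qed
  have "(\<integral>\<^sup>+t. ennreal (norm ((local_kernel n t)\<^sup>2)) \<partial>cube n) \<le>
      (\<integral>\<^sup>+t. 2 * (\<integral>\<^sup>+s. ennreal (box_power n s t * ((weight n s)\<^sup>2 * sqrt s)) \<partial>leb01) \<partial>cube n)"
    by (intro nn_integral_mono point)
  also have "\<dots> = 2 * (\<integral>\<^sup>+t. \<integral>\<^sup>+s. ennreal (box_power n s t * ((weight n s)\<^sup>2 * sqrt s)) \<partial>leb01 \<partial>cube n)"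
  proof (rule nn_integral_cmult)
    have "(\<lambda>(t, s). ennreal (box_power n s t * ((weight n s)\<^sup>2 * sqrt s))) \<in> borel_measurable (cube n \<Otimes>\<^sub>M leb01)"
    proof -
      have "(\<lambda>s. (weight n s)\<^sup>2 * sqrt s) \<in> borel_measurable leb01"
        by (rule leb01_measurableI) (use weight_measurable in measurable)
      then have "(\<lambda>q. box_power n (fst q) (snd q) * ((weight n (fst q))\<^sup>2 * sqrt (fst q))) \<in> borel_measurable (leb01 \<Otimes>\<^sub>M cube n)"
        by (intro borel_measurable_times[OF box_power_measurable] measurable_compose[OF measurable_fst])
      from measurable_compose[OF measurable_pair_swap' this] show ?thesis by (simp add: split_beta)
    qed
    then show "(\<lambda>t. \<integral>\<^sup>+s. ennreal (box_power n s t * ((weight n s)\<^sup>2 * sqrt s)) \<partial>leb01) \<in> borel_measurable (cube n)"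
      by (rule L.borel_measurable_nn_integral)
  qed
  also have "(\<integral>\<^sup>+t. \<integral>\<^sup>+s. ennreal (box_power n s t * ((weight n s)\<^sup>2 * sqrt s)) \<partial>leb01 \<partial>cube n) =
      (\<integral>\<^sup>+s. \<integral>\<^sup>+t. ennreal (box_power n s t * ((weight n s)\<^sup>2 * sqrt s)) \<partial>cube n \<partial>leb01)"
  proof (rule LC.Fubini')
    have "(\<lambda>s. (weight n s)\<^sup>2 * sqrt s) \<in> borel_measurable leb01"
      by (rule leb01_measurableI) (use weight_measurable in measurable)
    then have "(\<lambda>q. box_power n (fst q) (snd q) * ((weight n (fst q))\<^sup>2 * sqrt (fst q))) \<in> borel_measurable (leb01 \<Otimes>\<^sub>M cube n)"
      by (intro borel_measurable_times[OF box_power_measurable] measurable_compose[OF measurable_fst])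
    then show "(\<lambda>(s, t). ennreal (box_power n s t * ((weight n s)\<^sup>2 * sqrt s))) \<in> borel_measurable (leb01 \<Otimes>\<^sub>M cube n)"
      by (simp add: split_beta)
  qed
  also have "\<dots> \<le> (\<integral>\<^sup>+s. ennreal (K\<^sup>2) * ennreal (1 / sqrt s) \<partial>leb01)"
  proof (rule nn_integral_mono_AE)
    show "AE s in leb01. (\<integral>\<^sup>+t. ennreal (box_power n s t * ((weight n s)\<^sup>2 * sqrt s)) \<partial>cube n) \<le> ennreal (K\<^sup>2) * ennreal (1 / sqrt s)"
      using ne0
    proof eventually_elim
      case (elim s)
      have bi: "integrable (cube n) (box_power n s)"
        by (rule C.integrable_const_bound[where B=1]) (use box_power_cube[of n s] box_power_01[of n s] in \<open>auto intro!: AE_I2\<close>, metis abs_zero abs_one zero_le_one order_refl)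
      have b0: "0 \<le> box_power n s t" for t using box_power_01[of n s t] by auto
      have "(\<integral>\<^sup>+t. ennreal (box_power n s t * ((weight n s)\<^sup>2 * sqrt s)) \<partial>cube n) =
          ennreal (\<integral>t. box_power n s t * ((weight n s)\<^sup>2 * sqrt s) \<partial>cube n)"
        using bi b0 elim by (intro nn_integral_eq_integral) auto
      also have "(\<integral>t. box_power n s t * ((weight n s)\<^sup>2 * sqrt s) \<partial>cube n) = s ^ n * ((weight n s)\<^sup>2 * sqrt s)"
        using elim by (simp add: integral_box_power)
      also have "\<dots> = (\<bar>weight n s\<bar> * sqrt s ^ n)\<^sup>2 * sqrt s"
      proof -
        have "(sqrt s ^ n)\<^sup>2 = s ^ n" using elim by (simp add: power_mult[symmetric] mult.commute[of n 2] power_mult)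
        then show ?thesis by (simp add: power_mult_distrib)
      qed
      also have "ennreal \<dots> \<le> ennreal ((K / sqrt s)\<^sup>2 * sqrt s)"
        using K(2)[OF elim] elim by (intro ennreal_leI mult_right_mono power_mono) auto
      also have "(K / sqrt s)\<^sup>2 * sqrt s = K\<^sup>2 * (1 / sqrt s)"
        using elim by (simp add: power2_eq_square field_simps)
      also have "ennreal \<dots> = ennreal (K\<^sup>2) * ennreal (1 / sqrt s)" using elim by (intro ennreal_mult) auto
      finally show ?case .
    qed
  qed
  also have "\<dots> = ennreal (K\<^sup>2) * 2"
    by (subst nn_integral_cmult) (use nn_integral_inverse_sqrt_leb01 in \<open>auto intro!: leb01_measurableI\<close>)
  finally have "(\<integral>\<^sup>+t. ennreal (norm ((local_kernel n t)\<^sup>2)) \<partial>cube n) \<le> 2 * (ennreal (K\<^sup>2) * 2)"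
    by (simp add: mult_left_mono)
  also have "\<dots> < \<infinity>" by (simp add: ennreal_mult_less_top)
  finally show "(\<integral>\<^sup>+t. ennreal (norm ((local_kernel n t)\<^sup>2)) \<partial>cube n) < \<infinity>" .
qed

lemma local_kernel_symmetric: "symmetric_kernel n (local_kernel n)"
  unfolding symmetric_kernel_def
proof (intro conjI allI impI local_kernel_sq_integrable)
  fix \<pi> t assume \<pi>: "\<pi> permutes {..<n}" and t: "t \<in> space (cube n)"
  have "box_power n s (t \<circ> \<pi>) = box_power n s t" for s
    unfolding box_power_def using prod.permute[OF \<pi>, of "\<lambda>i. indicator {0..s} (t i) :: real"] by (simp add: comp_def)
  then show "local_kernel n (t \<circ> \<pi>) = local_kernel n t"
    by (simp add: local_kernel_eq[OF t] local_kernel_eq[OF cube_permute_space[OF \<pi> t]])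
qed

lemma integrable_inverse_sqrt: "integrable leb01 (\<lambda>s. 1 / sqrt s)"
proof (rule integrableI_bounded)
  show "(\<lambda>s. 1 / sqrt s) \<in> borel_measurable leb01" by (rule leb01_measurableI) measurable
  have "(\<integral>\<^sup>+s. ennreal (norm (1 / sqrt s)) \<partial>leb01) = (\<integral>\<^sup>+s. ennreal (1 / sqrt s) \<partial>leb01)"
    by (intro nn_integral_cong) auto
  then show "(\<integral>\<^sup>+s. ennreal (norm (1 / sqrt s)) \<partial>leb01) < \<infinity>" by (simp add: nn_integral_inverse_sqrt_leb01)
qed

text \<open>
  By Fubini the time integral moves outside, and the box of side \<open>s\<close> integrates the product of the
  arguments to the product of their inner products with \<open>ind01 s\<close>.
\<close>

lemma local_kernel_form:
  "kernel_form n (local_kernel n) \<psi> = (1 / fact n) * (\<integral>s. weight n s * (\<Prod>i<n. inner (ind01 s) (\<psi> i)) \<partial>leb01)"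
proof -
  interpret L: prob_space leb01 by (rule leb01_prob)
  interpret C: prob_space "cube n" by (rule cube_prob)
  interpret LC: pair_sigma_finite leb01 "cube n" ..
  obtain K where K: "0 \<le> K" "\<And>s. s \<in> {0<..1} \<Longrightarrow> \<bar>weight n s\<bar> * sqrt s ^ n \<le> K / sqrt s" using weight_bound by blast
  let ?P = "\<lambda>t. \<Prod>i<n. rep_l2_01 (\<psi> i) (t i)"
  let ?f = "\<lambda>s t. box_power n s t * weight n s * ?P t"
  have Pm: "?P \<in> borel_measurable (cube n)"
    by (rule sq_integrable_measurable[OF product_sq_integrable_cube[OF rep_l2_01_sq_integrable]])
  have fm: "(\<lambda>(s, t). ?f s t) \<in> borel_measurable (leb01 \<Otimes>\<^sub>M cube n)"
    unfolding split_beta by (intro borel_measurable_times[OF weighted_box_measurable] measurable_compose[OF measurable_snd Pm])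
  have fprod: "box_power n s t * ?P t = (\<Prod>i<n. indicator {0..s} (t i) * rep_l2_01 (\<psi> i) (t i))" for s t
    by (simp add: box_power_def prod.distrib)
  have fw: "?f s t = weight n s * (\<Prod>i<n. indicator {0..s} (t i) * rep_l2_01 (\<psi> i) (t i))" for s t
    unfolding fprod[symmetric] by (simp only: mult_ac)
  have sqi: "sq_integrable leb01 (\<lambda>x. indicator {0..s} x * rep_l2_01 (\<psi> i) x)" for s i
  proof -
    have "integrable leb01 (\<lambda>x. (indicator {0..s} x * rep_l2_01 (\<psi> i) x)\<^sup>2)"
    proof (rule Bochner_Integration.integrable_bound[OF sq_integrable_square[OF rep_l2_01_sq_integrable[of "\<psi> i"]]])
      show "(\<lambda>x. (indicator {0..s} x * rep_l2_01 (\<psi> i) x)\<^sup>2) \<in> borel_measurable leb01" by measurable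
    qed (auto split: split_indicator)
    then show ?thesis by (simp add: sq_integrable_def)
  qed
  have inner_int: "integrable (cube n) (?f s)" for s
    unfolding fw by (intro integrable_mult_right C.sq_integrable_imp_integrable product_sq_integrable_cube sqi)
  have norm_int: "(\<integral>t. norm (?f s t) \<partial>cube n) \<le> (\<Prod>i<n. norm (\<psi> i)) * (K / sqrt s)" if s: "s \<in> {0<..1}" for s
  proof -
    have ai: "integrable leb01 (\<lambda>x. indicator {0..s} x * \<bar>rep_l2_01 (\<psi> i) x\<bar>)" for i
      using L.sq_integrable_imp_integrable[OF sqi[of s i], THEN integrable_norm]
      by (rule Bochner_Integration.integrable_cong[THEN iffD1, rotated 2]) (auto simp: abs_mult)
    have one: "(\<integral>x. indicator {0..s} x * \<bar>rep_l2_01 (\<psi> i) x\<bar> \<partial>leb01) \<le> sqrt s * norm (\<psi> i)" for i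
    proof -
      have aP: "sq_integrable leb01 (\<lambda>x. \<bar>rep_l2_01 (\<psi> i) x\<bar>)"
        using rep_l2_01_sq_integrable[of "\<psi> i"] by (auto simp: sq_integrable_def)
      have "L2n leb01 (indicator {0..s}) = sqrt s"
      proof -
        have "(\<integral>x. (indicator {0..s} x :: real)\<^sup>2 \<partial>leb01) = (\<integral>x. indicator {0..s} x \<partial>leb01)"
          by (intro Bochner_Integration.integral_cong) (auto split: split_indicator)
        then show ?thesis using s integral_leb01_indicator[of s] by (simp add: L2n_def)
      qed
      moreover have "L2n leb01 (\<lambda>x. \<bar>rep_l2_01 (\<psi> i) x\<bar>) = norm (\<psi> i)" by (simp add: norm_l2_01_eq L2n_def)
      ultimately show ?thesis using L2_Cauchy_Schwarz[OF sq_integrable_indicator01[of 0 s] aP] by simp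
    qed
    have "(\<integral>t. norm (?f s t) \<partial>cube n) = (\<integral>t. \<bar>weight n s\<bar> * (\<Prod>i<n. (\<lambda>x. indicator {0..s} x * \<bar>rep_l2_01 (\<psi> i) x\<bar>) (t i)) \<partial>cube n)"
    proof (intro Bochner_Integration.integral_cong refl)
      fix t
      have "norm (?f s t) = \<bar>weight n s\<bar> * \<bar>box_power n s t * ?P t\<bar>" by (simp add: abs_mult mult_ac)
      also have "\<bar>box_power n s t * ?P t\<bar> = (\<Prod>i<n. indicator {0..s} (t i) * \<bar>rep_l2_01 (\<psi> i) (t i)\<bar>)"
        unfolding fprod abs_prod by (simp add: abs_mult)
      finally show "norm (?f s t) = \<bar>weight n s\<bar> * (\<Prod>i<n. (\<lambda>x. indicator {0..s} x * \<bar>rep_l2_01 (\<psi> i) x\<bar>) (t i))" .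
    qed
    also have "\<dots> = \<bar>weight n s\<bar> * (\<Prod>i<n. \<integral>x. indicator {0..s} x * \<bar>rep_l2_01 (\<psi> i) x\<bar> \<partial>leb01)"
      unfolding integral_mult_right_zero using integral_cube_product[of n "\<lambda>i x. indicator {0..s} x * \<bar>rep_l2_01 (\<psi> i) x\<bar>"] ai by simp
    also have "\<dots> \<le> \<bar>weight n s\<bar> * (\<Prod>i<n. sqrt s * norm (\<psi> i))"
      using one by (intro mult_left_mono prod_mono conjI integral_nonneg_AE) auto
    also have "\<dots> = (\<Prod>i<n. norm (\<psi> i)) * (\<bar>weight n s\<bar> * sqrt s ^ n)" by (simp add: prod.distrib mult_ac)
    also have "\<dots> \<le> (\<Prod>i<n. norm (\<psi> i)) * (K / sqrt s)"
      using K(2)[OF s] by (intro mult_left_mono prod_nonneg) auto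
    finally show ?thesis .
  qed
  have ne0: "AE s in leb01. s \<in> {0<..1}"
    using AE_lborel_singleton[of 0] by (subst AE_restrict_space_iff) (auto elim!: eventually_mono)
  have int: "integrable (leb01 \<Otimes>\<^sub>M cube n) (\<lambda>(s, t). ?f s t)"
  proof (rule LC.Fubini_integrable[OF fm])
    show "integrable leb01 (\<lambda>s. \<integral>t. norm (case (s, t) of (s, t) \<Rightarrow> ?f s t) \<partial>cube n)"
    proof (rule Bochner_Integration.integrable_bound[OF integrable_mult_right[OF integrable_mult_right[OF integrable_inverse_sqrt, of K], of "\<Prod>i<n. norm (\<psi> i)"]])
      have "(\<lambda>(s, t). norm (?f s t)) \<in> borel_measurable (leb01 \<Otimes>\<^sub>M cube n)"
        using measurable_compose[OF fm borel_measurable_norm] by (simp add: split_beta)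
      then show "(\<lambda>s. \<integral>t. norm (case (s, t) of (s, t) \<Rightarrow> ?f s t) \<partial>cube n) \<in> borel_measurable leb01"
        using C.borel_measurable_lebesgue_integral by simp
      show "AE s in leb01. norm (\<integral>t. norm (case (s, t) of (s, t) \<Rightarrow> ?f s t) \<partial>cube n) \<le> norm ((\<Prod>i<n. norm (\<psi> i)) * (K * (1 / sqrt s)))"
        using ne0
      proof eventually_elim
        case (elim s)
        have "0 \<le> (\<integral>t. norm (?f s t) \<partial>cube n)" by simp
        then have "norm (\<integral>t. norm (?f s t) \<partial>cube n) = (\<integral>t. norm (?f s t) \<partial>cube n)"
          by (rule trans[OF real_norm_def abs_of_nonneg])
        also have "\<dots> \<le> (\<Prod>i<n. norm (\<psi> i)) * (K * (1 / sqrt s))" using norm_int[OF elim] by simp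
        also have "\<dots> \<le> norm \<dots>" unfolding real_norm_def by (rule abs_ge_self)
        finally show ?case by (simp only: prod.case)
      qed
    qed
    show "AE s in leb01. integrable (cube n) (\<lambda>t. case (s, t) of (s, t) \<Rightarrow> ?f s t)" using inner_int by simp
  qed
  have "(\<integral>t. local_kernel n t * ?P t \<partial>cube n) = (\<integral>t. \<integral>s. ?f s t \<partial>leb01 \<partial>cube n)"
    by (intro Bochner_Integration.integral_cong refl) (simp add: local_kernel_eq)
  also have "\<dots> = (\<integral>s. \<integral>t. ?f s t \<partial>cube n \<partial>leb01)" by (rule LC.Fubini_integral[OF int])
  also have "\<dots> = (\<integral>s. weight n s * (\<Prod>i<n. inner (ind01 s) (\<psi> i)) \<partial>leb01)"
  proof (intro Bochner_Integration.integral_cong refl)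
    fix s
    have "(\<integral>t. ?f s t \<partial>cube n) = (\<integral>t. weight n s * (\<Prod>i<n. (\<lambda>x. indicator {0..s} x * rep_l2_01 (\<psi> i) x) (t i)) \<partial>cube n)"
      by (intro Bochner_Integration.integral_cong refl fw)
    also have "\<dots> = weight n s * (\<Prod>i<n. \<integral>x. indicator {0..s} x * rep_l2_01 (\<psi> i) x \<partial>leb01)"
      unfolding integral_mult_right_zero
      using integral_cube_product[of n "\<lambda>i x. indicator {0..s} x * rep_l2_01 (\<psi> i) x"] L.sq_integrable_imp_integrable[OF sqi] by simp
    finally show "(\<integral>t. ?f s t \<partial>cube n) = weight n s * (\<Prod>i<n. inner (ind01 s) (\<psi> i))" by (simp add: inner_ind01)
  qed
  finally show ?thesis by (simp add: kernel_form_def)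
qed

end

section \<open>The expansion of the local time\<close>

lemma power_series_coefficients_zero:
  fixes a :: "nat \<Rightarrow> real"
  assumes "\<And>y. (\<lambda>n. a n * y ^ n) sums 0"
  shows "a n = 0"
proof (induction n rule: less_induct)
  case (less n)
  have "(\<lambda>m. a (m + n) * y ^ m) sums 0" if y: "y \<noteq> 0" for y
  proof -
    have "(\<lambda>m. a (m + n) * y ^ (m + n)) sums 0"
      using sums_zero_iff_shift[of n "\<lambda>n. a n * y ^ n" 0] less assms[of y] by simp
    from sums_mult[OF this, of "1 / y ^ n"] show ?thesis using y by (simp add: power_add)
  qed
  then have "((\<lambda>_. 0) \<longlongrightarrow> a (0 + n)) (at (0::real))"
    by (intro powser_limit_0_strong[of 1 "\<lambda>m. a (m + n)" "\<lambda>_. 0"]) auto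
  then show ?case by (simp add: tendsto_const_iff)
qed

lemma adjoint_l2_01_add_scale:
  assumes A: "bounded_linear (A :: l2_01 \<Rightarrow> l2_01)"
  shows "adjoint A (r *\<^sub>R h) = r *\<^sub>R adjoint A h" "adjoint A (\<Sum>i\<in>I. \<phi> i) = (\<Sum>i\<in>I. adjoint A (\<phi> i))"
proof -
  show "adjoint A (r *\<^sub>R h) = r *\<^sub>R adjoint A h"
    by (rule vector_eq_ldot[THEN iffD1]) (simp add: adjoint_l2_01[OF A, symmetric])
  show "adjoint A (\<Sum>i\<in>I. \<phi> i) = (\<Sum>i\<in>I. adjoint A (\<phi> i))"
    by (rule vector_eq_ldot[THEN iffD1]) (simp add: adjoint_l2_01[OF A, symmetric] inner_sum_right)
qed

text \<open>Characters are bounded, so the expansion may be tested against them term by term.\<close>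

lemma (in wiener_process) chaos_expansion_character:
  assumes b: "\<And>n. symmetric_kernel n (b n)" "\<And>n. wint n (b n) (J n)"
    and lim: "L2_tendsto M (\<lambda>N \<omega>. \<Sum>n<N. J n \<omega>) l sequentially"
    and G: "has_white_noise M w h G"
  shows "(\<lambda>n. \<i> ^ n * of_real (kernel_form n (b n) (\<lambda>_. h))) sums
    (of_real (exp ((norm h)\<^sup>2 / 2)) * (\<integral>\<omega>. of_real (l \<omega>) * cis (G \<omega>) \<partial>M))"
proof -
  let ?e = "complex_of_real (exp ((norm h)\<^sup>2 / 2))"
  note Gm = sq_integrable_measurable[OF white_noise_sq_integrable[OF G]]
  have c: "(\<lambda>\<omega>. cis (G \<omega>)) \<in> borel_measurable M" "integrable M (\<lambda>\<omega>. (norm (cis (G \<omega>)))\<^sup>2)"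
    using measurable_compose[OF Gm cis_measurable] by auto
  have ee: "?e * of_real (exp (- (norm h)\<^sup>2 / 2)) = 1"
    by (simp only: of_real_mult[symmetric] exp_add[symmetric]) simp
  have "(\<lambda>N. ?e * (\<integral>\<omega>. of_real (\<Sum>n<N. J n \<omega>) * cis (G \<omega>) \<partial>M)) \<longlonglongrightarrow> ?e * (\<integral>\<omega>. of_real (l \<omega>) * cis (G \<omega>) \<partial>M)"
    by (intro tendsto_mult_left L2_tendsto_character[OF lim Gm])
  moreover have "?e * (\<integral>\<omega>. of_real (\<Sum>n<N. J n \<omega>) * cis (G \<omega>) \<partial>M) = (\<Sum>n<N. \<i> ^ n * of_real (kernel_form n (b n) (\<lambda>_. h)))" for N
  proof -
    have "(\<integral>\<omega>. of_real (\<Sum>n<N. J n \<omega>) * cis (G \<omega>) \<partial>M) = (\<Sum>n<N. \<integral>\<omega>. of_real (J n \<omega>) * cis (G \<omega>) \<partial>M)"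
      unfolding of_real_sum sum_distrib_right
      by (intro Bochner_Integration.integral_sum L2_bound_complex(1)[OF wint_sq_integrable(1)[OF b(2)] c])
    also have "\<dots> = (\<Sum>n<N. \<i> ^ n * of_real (kernel_form n (b n) (\<lambda>_. h)) * of_real (exp (- (norm h)\<^sup>2 / 2)))"
      by (intro sum.cong refl) (simp add: wint_white_noise_character[OF b(2) b(1) G])
    also have "?e * \<dots> = (\<Sum>n<N. \<i> ^ n * of_real (kernel_form n (b n) (\<lambda>_. h)) * (?e * of_real (exp (- (norm h)\<^sup>2 / 2))))"
      unfolding sum_distrib_left by (simp only: mult_ac)
    finally show ?thesis unfolding ee by simp
  qed
  ultimately show ?thesis unfolding sums_def by (simp only:)
qed

context image_process
begin

lemma local_kernel_form_adjoint:
  "kernel_form n (local_kernel n) (\<lambda>i. adjoint A (\<phi> i)) =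
    (1 / fact n) * (\<integral>s. weight n s * (\<Prod>i<n. inner (A (ind01 s)) (\<phi> i)) \<partial>leb01)"
  by (simp add: local_kernel_form adjoint_l2_01[OF A])

lemma continuous_wave_function:
  assumes "continuous_on UNIV f"
  shows "(\<lambda>p. f (wave p)) \<in> borel_measurable time_freq"
  by (intro time_freq_measurableI borel_measurable_continuous_onI continuous_on_compose2[OF assms continuous_wave]) auto

text \<open>
  Since \<open>v = (v + h) - h\<close>, the square of the norm of \<open>v\<close> is at most twice the sum of those of \<open>v + h\<close> and
  \<open>h\<close>: half of the decay in the frequency absorbs the shift.
\<close>

lemma wave_shift_lower:
  assumes "p \<in> space time_freq"
  shows "exp (- (norm (wave p + h))\<^sup>2 / 2) \<le> exp ((norm h)\<^sup>2 / 2) * exp (- (c\<^sup>2 / 4 * (fst p * (snd p)\<^sup>2)))"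
proof -
  have "norm (wave p) \<le> norm (wave p + h) + norm h" using norm_triangle_ineq4[of "wave p + h" h] by simp
  then have "(norm (wave p))\<^sup>2 \<le> (norm (wave p + h) + norm h)\<^sup>2" by (intro power_mono) auto
  also have "\<dots> \<le> 2 * (norm (wave p + h))\<^sup>2 + 2 * (norm h)\<^sup>2"
    using sum_squares_bound[of "norm (wave p + h)" "norm h"] by (simp add: power2_sum)
  finally have "- (norm (wave p + h))\<^sup>2 / 2 \<le> (norm h)\<^sup>2 / 2 - c\<^sup>2 / 4 * (fst p * (snd p)\<^sup>2)"
    using norm_wave_lower[OF assms] by simp
  then show ?thesis by (simp add: exp_add[symmetric])
qed

text \<open>
  The damping is removed by dominated convergence; one frequency only needs the variance of
  \<open>z x(t)\<close>, which is at least \<open>c\<^sup>2 t z\<^sup>2\<close>.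
\<close>

lemma local_time_white_noise_character:
  assumes l: "is_local_time M x u l" and G: "has_white_noise M w h G"
  shows "(\<integral>\<omega>. of_real (l \<omega>) * cis (G \<omega>) \<partial>M) =
    (1 / (2 * pi)) * (\<integral>p. damping 0 p * of_real (exp (- (norm (wave p + h))\<^sup>2 / 2)) \<partial>time_freq)"
proof -
  let ?e = "\<lambda>n. 1 / real (Suc n)"
  let ?g = "\<lambda>p. exp (- (norm (wave p + h))\<^sup>2 / 2)"
  note Gm = sq_integrable_measurable[OF white_noise_sq_integrable[OF G]]
  have e: "0 < ?e n" for n by simp
  have e0: "?e \<longlonglongrightarrow> 0" by (rule LIMSEQ_Suc[OF lim_1_over_n])
  then have "filterlim ?e (at_right 0) sequentially" by (simp add: filterlim_at)
  from L2_tendsto_filterlim[OF local_time_smoothed[OF l] this]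
  have "(\<lambda>n. \<integral>\<omega>. of_real (smoothed (?e n) \<omega>) * cis (G \<omega>) \<partial>M) \<longlonglongrightarrow> (\<integral>\<omega>. of_real (l \<omega>) * cis (G \<omega>) \<partial>M)"
    by (rule L2_tendsto_character[OF _ Gm])
  moreover have "(\<integral>\<omega>. of_real (smoothed (?e n) \<omega>) * cis (G \<omega>) \<partial>M) =
      (1 / (2 * pi)) * (\<integral>p. damping (?e n) p * of_real (?g p) \<partial>time_freq)" for n
  proof -
    have "(\<integral>\<omega>. of_real (smoothed (?e n) \<omega>) * cis (G \<omega>) \<partial>M) = (\<integral>\<omega>. cis (G \<omega>) * of_real (smoothed (?e n) \<omega>) \<partial>M)"
      by (simp only: mult.commute)
    also have "\<dots> = (1 / (2 * pi)) * (\<integral>p. damping (?e n) p * (\<integral>\<omega>. cis (G \<omega>) * phase p \<omega> \<partial>M) \<partial>time_freq)"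
      by (rule smoothed_expectation[OF e integrable_cis[OF Gm]])
    also have "(\<integral>p. damping (?e n) p * (\<integral>\<omega>. cis (G \<omega>) * phase p \<omega> \<partial>M) \<partial>time_freq) =
        (\<integral>p. damping (?e n) p * of_real (?g p) \<partial>time_freq)"
    proof (intro Bochner_Integration.integral_cong refl)
      fix p assume p: "p \<in> space time_freq"
      have "has_white_noise M w (wave p + 1 *\<^sub>R h) (\<lambda>\<omega>. snd p * x (fst p) \<omega> + 1 * G \<omega>)"
        by (rule white_noise_add_scale[OF wave_noise[OF p] G])
      from white_noise_character[OF this] have "(\<integral>\<omega>. cis (G \<omega>) * phase p \<omega> \<partial>M) = of_real (?g p)"
        by (simp add: phase_def cis_mult add.commute)
      then show "damping (?e n) p * (\<integral>\<omega>. cis (G \<omega>) * phase p \<omega> \<partial>M) = damping (?e n) p * of_real (?g p)" by simp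
    qed
    finally show ?thesis .
  qed
  moreover have "(\<lambda>n. (1 / (2 * pi)) * (\<integral>p. damping (?e n) p * of_real (?g p) \<partial>time_freq)) \<longlonglongrightarrow>
      (1 / (2 * pi)) * (\<integral>p. damping 0 p * complex_of_real (?g p) \<partial>time_freq)"
  proof (intro tendsto_mult_left)
    have gm: "(\<lambda>p. complex_of_real (?g p)) \<in> borel_measurable time_freq"
      by (rule continuous_wave_function) (intro continuous_intros, simp)
    show "(\<lambda>n. \<integral>p. damping (?e n) p * of_real (?g p) \<partial>time_freq) \<longlonglongrightarrow> (\<integral>p. damping 0 p * complex_of_real (?g p) \<partial>time_freq)"
    proof (rule integral_dominated_convergence[where w="\<lambda>p. exp ((norm h)\<^sup>2 / 2) * exp (- (c\<^sup>2 / 4 * (fst p * (snd p)\<^sup>2)))"])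
      show "(\<lambda>p. damping 0 p * complex_of_real (?g p)) \<in> borel_measurable time_freq"
        "(\<lambda>p. damping (?e n) p * complex_of_real (?g p)) \<in> borel_measurable time_freq" for n
        by (intro borel_measurable_times damping_measurable gm)+
      show "integrable time_freq (\<lambda>p. exp ((norm h)\<^sup>2 / 2) * exp (- (c\<^sup>2 / 4 * (fst p * (snd p)\<^sup>2))))"
        using c by (intro integrable_mult_right integrable_time_freq_gauss) simp
      show "AE p in time_freq. (\<lambda>n. damping (?e n) p * complex_of_real (?g p)) \<longlonglongrightarrow> damping 0 p * complex_of_real (?g p)"
      proof (intro AE_I2 tendsto_mult_right)
        fix p
        show "(\<lambda>n. damping (?e n) p) \<longlonglongrightarrow> damping 0 p"
          unfolding damping_def by (intro tendsto_intros e0) simp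
      qed
      show "AE p in time_freq. norm (damping (?e n) p * complex_of_real (?g p)) \<le>
          exp ((norm h)\<^sup>2 / 2) * exp (- (c\<^sup>2 / 4 * (fst p * (snd p)\<^sup>2)))" for n
      proof (rule AE_I2)
        fix p assume p: "p \<in> space time_freq"
        have "norm (damping (?e n) p * complex_of_real (?g p)) \<le> 1 * ?g p"
          unfolding norm_mult norm_damping by (intro mult_mono) auto
        then show "norm (damping (?e n) p * complex_of_real (?g p)) \<le> exp ((norm h)\<^sup>2 / 2) * exp (- (c\<^sup>2 / 4 * (fst p * (snd p)\<^sup>2)))"
          using wave_shift_lower[OF p, of h] by simp
      qed
    qed
  qed
  ultimately show ?thesis using LIMSEQ_unique by simp
qed

text \<open>
  The terms of the expansion of \<open>exp (- inner (wave p) h)\<close>, with the remaining factors of the Fourier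
  integral, and a common integrable bound for their absolute partial sums. The bound comes from
  \<open>\<bar>inner v h\<bar> \<le> (norm v)\<^sup>2 / 4 + (norm h)\<^sup>2\<close>.
\<close>

definition fourier_term :: "l2_01 \<Rightarrow> nat \<Rightarrow> real \<times> real \<Rightarrow> complex" where
  "fourier_term h n p = damping 0 p * of_real (exp (- (norm (wave p))\<^sup>2 / 2) * ((- inner (wave p) h) ^ n / fact n))"

definition fourier_bound :: "l2_01 \<Rightarrow> real \<times> real \<Rightarrow> real" where
  "fourier_bound h p = exp ((norm h)\<^sup>2) * exp (- (c\<^sup>2 / 4 * (fst p * (snd p)\<^sup>2)))"

lemma integrable_fourier_bound: "integrable time_freq (fourier_bound h)"
  unfolding fourier_bound_def[abs_def] using c by (intro integrable_mult_right integrable_time_freq_gauss) simp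

lemma fourier_term_measurable: "fourier_term h n \<in> borel_measurable time_freq"
proof -
  have "(\<lambda>p. complex_of_real (exp (- (norm (wave p))\<^sup>2 / 2) * ((- inner (wave p) h) ^ n / fact n))) \<in> borel_measurable time_freq"
    by (rule continuous_wave_function) (intro continuous_intros, simp_all)
  then show ?thesis unfolding fourier_term_def[abs_def] by (intro borel_measurable_times damping_measurable)
qed

lemma fourier_partial_sum_bound:
  assumes p: "p \<in> space time_freq"
  shows "(\<Sum>n<N. norm (fourier_term h n p)) \<le> fourier_bound h p"
proof -
  let ?v = "norm (wave p)" and ?b = "inner (wave p) h"
  have n: "norm (fourier_term h n p) = exp (- ?v\<^sup>2 / 2) * (\<bar>?b\<bar> ^ n / fact n)" for n
    by (simp add: fourier_term_def norm_mult norm_damping abs_mult power_abs del: of_real_mult of_real_divide)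
  have "(\<Sum>n<N. \<bar>?b\<bar> ^ n / fact n) \<le> exp \<bar>?b\<bar>"
    using sum_le_suminf[OF summable_exp[of "\<bar>?b\<bar>"], of "{..<N}"] by (simp add: exp_def divide_inverse mult.commute)
  then have "(\<Sum>n<N. norm (fourier_term h n p)) \<le> exp (- ?v\<^sup>2 / 2) * exp \<bar>?b\<bar>"
    unfolding n sum_distrib_left[symmetric] by (intro mult_left_mono) auto
  also have "\<dots> = exp (\<bar>?b\<bar> - ?v\<^sup>2 / 2)" by (simp add: exp_add[symmetric])
  also have "\<dots> \<le> exp ((norm h)\<^sup>2 - c\<^sup>2 / 4 * (fst p * (snd p)\<^sup>2))"
  proof -
    have "\<bar>?b\<bar> \<le> ?v * norm h" by (rule Cauchy_Schwarz_ineq2)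
    also have "?v * norm h \<le> ?v\<^sup>2 / 4 + (norm h)\<^sup>2"
      using sum_squares_bound[of "?v / 2" "norm h"] by (simp add: power2_eq_square)
    finally have "\<bar>?b\<bar> - ?v\<^sup>2 / 2 \<le> (norm h)\<^sup>2 - ?v\<^sup>2 / 4" by simp
    also have "\<dots> \<le> (norm h)\<^sup>2 - c\<^sup>2 / 4 * (fst p * (snd p)\<^sup>2)" using norm_wave_lower[OF p] by simp
    finally show ?thesis by simp
  qed
  also have "\<dots> = fourier_bound h p" by (simp add: fourier_bound_def exp_add[symmetric])
  finally show ?thesis .
qed

lemma fourier_term_bound:
  assumes "p \<in> space time_freq"
  shows "norm (fourier_term h n p) \<le> fourier_bound h p"
proof -
  have "norm (fourier_term h n p) \<le> (\<Sum>m<Suc n. norm (fourier_term h m p))"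
    by (rule member_le_sum) auto
  then show ?thesis using fourier_partial_sum_bound[OF assms, of h "Suc n"] by linarith
qed

lemma integrable_fourier_term: "integrable time_freq (fourier_term h n)"
proof (rule Bochner_Integration.integrable_bound[OF integrable_fourier_bound[of h] fourier_term_measurable])
  show "AE p in time_freq. norm (fourier_term h n p) \<le> norm (fourier_bound h p)"
  proof (rule AE_I2)
    fix p assume "p \<in> space time_freq"
    from fourier_term_bound[OF this, of h n] show "norm (fourier_term h n p) \<le> norm (fourier_bound h p)" by simp
  qed
qed

lemma integral_fourier_term:
  "(\<integral>p. fourier_term h n p \<partial>time_freq) = 2 * pi * (\<i> ^ n * of_real (kernel_form n (local_kernel n) (\<lambda>_. adjoint A h)))"
proof -
  interpret TF: pair_sigma_finite leb01 lborel by (rule time_freq_pair)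
  have ne0: "AE t in leb01. t \<in> {0<..1}"
    using AE_lborel_singleton[of 0] by (subst AE_restrict_space_iff) (auto elim!: eventually_mono)
  let ?c = "\<lambda>t. inner (A (ind01 t)) h"
  have "(\<integral>p. fourier_term h n p \<partial>time_freq) = (\<integral>t. \<integral>z. fourier_term h n (t, z) \<partial>lborel \<partial>leb01)"
    by (rule TF.integral_fst'[OF integrable_fourier_term, symmetric])
  also have "\<dots> = (\<integral>t. 2 * pi * \<i> ^ n * of_real (1 / fact n * (weight n t * ?c t ^ n)) \<partial>leb01)"
  proof (rule integral_cong_AE)
    show "(\<lambda>t. \<integral>z. fourier_term h n (t, z) \<partial>lborel) \<in> borel_measurable leb01"
      using TF.integrable_fst'[OF integrable_fourier_term] by (rule borel_measurable_integrable)
    have "continuous_on UNIV ?c"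
      by (intro continuous_on_inner continuous_on_const bounded_linear.continuous_on[OF A] continuous_ind01 continuous_on_id)
    then have "(\<lambda>t. 1 / fact n * (weight n t * ?c t ^ n)) \<in> borel_measurable borel"
      using weight_measurable borel_measurable_continuous_onI[of ?c] by measurable
    from measurable_compose[OF this borel_measurable_of_real]
    show "(\<lambda>t. 2 * pi * \<i> ^ n * complex_of_real (1 / fact n * (weight n t * ?c t ^ n))) \<in> borel_measurable leb01"
      by (intro leb01_measurableI borel_measurable_times borel_measurable_const)
    show "AE t in leb01. (\<integral>z. fourier_term h n (t, z) \<partial>lborel) = 2 * pi * \<i> ^ n * of_real (1 / fact n * (weight n t * ?c t ^ n))"
      using ne0
    proof eventually_elim
      case (elim t)
      have d: "0 < deviation t"
      proof -
        have "0 < c * sqrt t" using elim c by simp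
        also have "\<dots> \<le> deviation t" using elim by (intro deviation_lower) auto
        finally show ?thesis .
      qed
      have "fourier_term h n (t, z) = of_real (?c t ^ n / fact n) *
          (cis (- (z * u)) * of_real ((- z) ^ n * exp (- ((deviation t)\<^sup>2 * z\<^sup>2) / 2)))" for z
      proof -
        have "(norm (wave (t, z)))\<^sup>2 = (deviation t)\<^sup>2 * z\<^sup>2"
          by (simp add: wave_def deviation_def power_mult_distrib mult.commute)
        moreover have "(- inner (wave (t, z)) h) ^ n = ?c t ^ n * (- z) ^ n"
          by (simp add: wave_def power_mult_distrib[symmetric] mult.commute)
        ultimately show ?thesis by (simp add: fourier_term_def damping_def)
      qed
      then have "(\<integral>z. fourier_term h n (t, z) \<partial>lborel) = of_real (?c t ^ n / fact n) *
          (\<integral>z. cis (- (z * u)) * of_real ((- z) ^ n * exp (- ((deviation t)\<^sup>2 * z\<^sup>2) / 2)) \<partial>lborel)"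
        by (simp only: integral_mult_right_zero)
      also have "\<dots> = of_real (?c t ^ n / fact n) * (2 * pi * \<i> ^ n * of_real (weight n t))"
        unfolding fourier_hermite[OF d] weight_def ..
      finally show ?case by (simp add: mult_ac)
    qed
  qed
  also have "\<dots> = 2 * pi * \<i> ^ n * of_real (\<integral>t. 1 / fact n * (weight n t * ?c t ^ n) \<partial>leb01)"
    by (simp only: integral_mult_right_zero integral_complex_of_real)
  also have "(\<integral>t. 1 / fact n * (weight n t * ?c t ^ n) \<partial>leb01) = kernel_form n (local_kernel n) (\<lambda>_. adjoint A h)"
    by (simp only: local_kernel_form_adjoint[of n "\<lambda>_. h"] integral_mult_right_zero prod_constant card_lessThan)
  finally show ?thesis by (simp add: mult.assoc)
qed

text \<open>
  Expanding \<open>exp (- inner (wave p) h)\<close> under the Fourier integral produces the forms of the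
  Hermite kernels, evaluated on the image of \<open>h\<close> under the adjoint.
\<close>

lemma local_time_character_series:
  assumes l: "is_local_time M x u l" and G: "has_white_noise M w h G"
  shows "(\<lambda>n. \<i> ^ n * of_real (kernel_form n (local_kernel n) (\<lambda>_. adjoint A h))) sums
    (of_real (exp ((norm h)\<^sup>2 / 2)) * (\<integral>\<omega>. of_real (l \<omega>) * cis (G \<omega>) \<partial>M))"
proof -
  let ?k = "\<lambda>n. \<i> ^ n * of_real (kernel_form n (local_kernel n) (\<lambda>_. adjoint A h))"
  let ?E = "\<lambda>p. damping 0 p * complex_of_real (exp (- (norm (wave p))\<^sup>2 / 2) * exp (- inner (wave p) h))"
  have tsums: "(\<lambda>n. fourier_term h n p) sums ?E p" for p
  proof -
    have "(\<lambda>n. (- inner (wave p) h) ^ n / fact n) sums exp (- inner (wave p) h)"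
      using exp_converges[of "- inner (wave p) h"] by (simp add: divide_inverse mult.commute)
    then show ?thesis
      unfolding fourier_term_def by (intro sums_mult sums_of_real)
  qed
  have "(\<lambda>N. \<integral>p. (\<Sum>n<N. fourier_term h n p) \<partial>time_freq) \<longlonglongrightarrow> (\<integral>p. ?E p \<partial>time_freq)"
  proof (rule integral_dominated_convergence[OF _ _ integrable_fourier_bound[of h]])
    show "(\<lambda>p. \<Sum>n<N. fourier_term h n p) \<in> borel_measurable time_freq" for N
      by (intro borel_measurable_sum fourier_term_measurable)
    show "?E \<in> borel_measurable time_freq"
      by (intro borel_measurable_times damping_measurable continuous_wave_function continuous_intros) simp
    show "AE p in time_freq. (\<lambda>N. \<Sum>n<N. fourier_term h n p) \<longlonglongrightarrow> ?E p"
      using tsums by (intro AE_I2) (simp add: sums_def)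
    show "AE p in time_freq. norm (\<Sum>n<N. fourier_term h n p) \<le> fourier_bound h p" for N
    proof (rule AE_I2)
      fix p assume "p \<in> space time_freq"
      from fourier_partial_sum_bound[OF this, where N=N and h=h] norm_sum[of "\<lambda>n. fourier_term h n p" "{..<N}"]
      show "norm (\<Sum>n<N. fourier_term h n p) \<le> fourier_bound h p" by linarith
    qed
  qed
  moreover have "(\<integral>p. (\<Sum>n<N. fourier_term h n p) \<partial>time_freq) = 2 * pi * (\<Sum>n<N. ?k n)" for N
    unfolding sum_distrib_left integral_fourier_term[symmetric]
    by (intro Bochner_Integration.integral_sum integrable_fourier_term)
  moreover have "(\<integral>p. ?E p \<partial>time_freq) = 2 * pi * (of_real (exp ((norm h)\<^sup>2 / 2)) * (\<integral>\<omega>. of_real (l \<omega>) * cis (G \<omega>) \<partial>M))"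
  proof -
    have "?E p = of_real (exp ((norm h)\<^sup>2 / 2)) * (damping 0 p * of_real (exp (- (norm (wave p + h))\<^sup>2 / 2)))" for p
    proof -
      have "(norm (wave p + h))\<^sup>2 = (norm (wave p))\<^sup>2 + 2 * inner (wave p) h + (norm h)\<^sup>2"
        unfolding power2_norm_eq_inner by (simp add: inner_add_left inner_add_right inner_commute)
      then have e: "exp ((norm h)\<^sup>2 / 2) * exp (- (norm (wave p + h))\<^sup>2 / 2) = exp (- (norm (wave p))\<^sup>2 / 2) * exp (- inner (wave p) h)"
        by (simp add: exp_add[symmetric] field_simps)
      show ?thesis unfolding e[symmetric] by (simp add: mult_ac)
    qed
    then have "(\<integral>p. ?E p \<partial>time_freq) = of_real (exp ((norm h)\<^sup>2 / 2)) * (\<integral>p. damping 0 p * of_real (exp (- (norm (wave p + h))\<^sup>2 / 2)) \<partial>time_freq)"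
      by (simp only: integral_mult_right_zero)
    then show ?thesis unfolding local_time_white_noise_character[OF l G] by simp
  qed
  ultimately have "(\<lambda>N. 2 * pi * (\<Sum>n<N. ?k n)) \<longlonglongrightarrow> 2 * pi * (of_real (exp ((norm h)\<^sup>2 / 2)) * (\<integral>\<omega>. of_real (l \<omega>) * cis (G \<omega>) \<partial>M))"
    by simp
  from tendsto_mult_left[OF this, of "1 / (2 * pi)"] show ?thesis by (simp add: sums_def)
qed

text \<open>
  Along the line through \<open>h\<close> both series for the expectation against the character are power series
  in the parameter, so their coefficients agree. The powers of the imaginary unit are split off by
  taking real and imaginary parts.
\<close>

lemma expansion_form_diagonal:
  assumes l: "is_local_time M x u l"
    and b: "\<And>n. symmetric_kernel n (b n)" "\<And>n. wint n (b n) (J n)"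
    and lim: "L2_tendsto M (\<lambda>N \<omega>. \<Sum>n<N. J n \<omega>) l sequentially"
  shows "kernel_form n (b n) (\<lambda>_. h) = kernel_form n (local_kernel n) (\<lambda>_. adjoint A h)"
proof -
  define d where "d n = kernel_form n (b n) (\<lambda>_. h) - kernel_form n (local_kernel n) (\<lambda>_. adjoint A h)" for n
  obtain G where G: "has_white_noise M w h G" using white_noise_exists by blast
  have s: "(\<lambda>n. \<i> ^ n * of_real (d n * y ^ n)) sums 0" for y :: real
  proof -
    note yG = white_noise_scale[OF G, of y]
    have "(\<lambda>n. \<i> ^ n * of_real (kernel_form n (b n) (\<lambda>_. y *\<^sub>R h)) -
        \<i> ^ n * of_real (kernel_form n (local_kernel n) (\<lambda>_. adjoint A (y *\<^sub>R h)))) sums 0"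
      using sums_diff[OF chaos_expansion_character[OF b lim yG] local_time_character_series[OF l yG]] by simp
    moreover have "\<i> ^ n * of_real (kernel_form n (b n) (\<lambda>_. y *\<^sub>R h)) -
        \<i> ^ n * of_real (kernel_form n (local_kernel n) (\<lambda>_. adjoint A (y *\<^sub>R h))) = \<i> ^ n * of_real (d n * y ^ n)" for n
      unfolding adjoint_l2_01_add_scale(1)[OF A] kernel_form_homogeneous[OF b(1)] kernel_form_homogeneous[OF local_kernel_symmetric] d_def
      by (simp add: algebra_simps)
    ultimately show ?thesis by simp
  qed
  have "Re (\<i> ^ n) * d n = 0"
  proof (rule power_series_coefficients_zero[of "\<lambda>n. Re (\<i> ^ n) * d n"])
    fix y show "(\<lambda>n. Re (\<i> ^ n) * d n * y ^ n) sums 0"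
      using sums_Re[OF s[of y]] by (simp add: mult.assoc)
  qed
  moreover have "Im (\<i> ^ n) * d n = 0"
  proof (rule power_series_coefficients_zero[of "\<lambda>n. Im (\<i> ^ n) * d n"])
    fix y show "(\<lambda>n. Im (\<i> ^ n) * d n * y ^ n) sums 0"
      using sums_Im[OF s[of y]] by (simp add: mult.assoc)
  qed
  moreover have "\<i> ^ n \<noteq> 0" by simp
  then have "Re (\<i> ^ n) \<noteq> 0 \<or> Im (\<i> ^ n) \<noteq> 0" by (simp add: complex_eq_iff)
  ultimately show ?thesis by (auto simp: d_def)
qed

lemma expansion_form:
  assumes l: "is_local_time M x u l"
    and b: "\<And>n. symmetric_kernel n (b n)" "\<And>n. wint n (b n) (J n)"
    and lim: "L2_tendsto M (\<lambda>N \<omega>. \<Sum>n<N. J n \<omega>) l sequentially"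
  shows "kernel_form n (b n) = (\<lambda>\<phi>. kernel_form n (local_kernel n) (\<lambda>i. adjoint A (\<phi> i)))"
proof
  fix \<phi>
  have "(-1) ^ n * real (card (rearrangements n)) * kernel_form n (b n) \<phi> =
      (-1) ^ n * real (card (rearrangements n)) * kernel_form n (local_kernel n) (\<lambda>i. adjoint A (\<phi> i))"
    unfolding kernel_form_polarization[OF b(1), symmetric] kernel_form_polarization[OF local_kernel_symmetric, symmetric]
      expansion_form_diagonal[OF l b lim] adjoint_l2_01_add_scale(2)[OF A] ..
  then show "kernel_form n (b n) \<phi> = kernel_form n (local_kernel n) (\<lambda>i. adjoint A (\<phi> i))"
    using card_rearrangements_pos[of n] by simp
qed

lemma kernel_form_space_cong:
  assumes "\<And>t. t \<in> space (cube n) \<Longrightarrow> a t = b t"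
  shows "kernel_form n a = kernel_form n b"
  unfolding kernel_form_def using assms
  by (intro ext arg_cong2[where f="(*)"] Bochner_Integration.integral_cong refl) simp

lemma symmetric_kernel_space_cong:
  assumes a: "symmetric_kernel n a" and eq: "\<And>t. t \<in> space (cube n) \<Longrightarrow> b t = a t"
  shows "symmetric_kernel n b"
proof -
  have "b \<in> borel_measurable (cube n)"
    using a eq by (subst measurable_cong[OF eq]) (auto simp: symmetric_kernel_def sq_integrable_def)
  then have "sq_integrable (cube n) b"
    using a eq by (intro sq_integrable_cong_AE[of "cube n" a b]) (auto simp: symmetric_kernel_def)
  then show ?thesis
    using a eq cube_permute_space unfolding symmetric_kernel_def by simp
qed

text \<open>
  The second quantization of the integral of the kernel is an integral of the same kernel as the
  component of the local time, so the two agree almost surely, and so do the partial sums.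
\<close>

lemma local_time_expansion:
  assumes l: "is_local_time M x u l" and a: "\<And>n t. t \<in> space (cube n) \<Longrightarrow> a n t = local_kernel n t"
  shows "\<exists>F. ito_wiener_expansion M w F (\<lambda>n. second_quantization M w A (wiener_integral M w n (a n))) l"
proof -
  have ls: "sq_integrable M l" using local_time_smoothed[OF l] by (rule L2_tendstoD)
  obtain J b where b: "\<And>n. symmetric_kernel n (b n)" "\<And>n. wint n (b n) (J n)"
    and lim: "L2_tendsto M (\<lambda>N \<omega>. \<Sum>n<N. J n \<omega>) l sequentially"
    using chaos_expansion[OF ls local_time_chaos_orthogonal[OF l]] by blast
  let ?Y = "\<lambda>n. second_quantization M w A (wiener_integral M w n (a n))"
  have sa: "symmetric_kernel n (a n)" for n
    by (rule symmetric_kernel_space_cong[OF local_kernel_symmetric a])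
  have wa: "wint n (a n) (wiener_integral M w n (a n))" for n
    unfolding wiener_integral_def by (rule someI_ex[OF wint_exists[OF symmetric_kernel_simplex[OF sa]]])
  have form: "kernel_form n (b n) = (\<lambda>\<phi>. kernel_form n (a n) (\<lambda>i. adjoint A (\<phi> i)))" for n
  proof -
    have "kernel_form n (a n) = kernel_form n (local_kernel n)" by (rule kernel_form_space_cong) (rule a)
    then show ?thesis using expansion_form[OF l b lim] by simp
  qed
  have wY: "wint n (b n) (?Y n)" for n
    by (rule second_quantization_wint[OF sa wa b(1) b(2) form])
  have YJ: "AE \<omega> in M. ?Y n \<omega> = J n \<omega>" for n
    by (rule wint_unique[OF wY b(2)]) simp
  have Ys: "sq_integrable M (?Y n)" and Js: "sq_integrable M (J n)" for n
    using wint_sq_integrable(1)[OF wY] wint_sq_integrable(1)[OF b(2)] by auto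
  have "L2n M (\<lambda>\<omega>. (\<Sum>n<N. ?Y n \<omega>) - l \<omega>) = L2n M (\<lambda>\<omega>. (\<Sum>n<N. J n \<omega>) - l \<omega>)" for N
  proof -
    have "AE \<omega> in M. \<forall>n\<in>{..<N}. ?Y n \<omega> = J n \<omega>" using YJ by (intro AE_finite_allI) auto
    then have "AE \<omega> in M. ((\<Sum>n<N. ?Y n \<omega>) - l \<omega>)\<^sup>2 = ((\<Sum>n<N. J n \<omega>) - l \<omega>)\<^sup>2"
      by eventually_elim simp
    then have "(\<integral>\<omega>. ((\<Sum>n<N. ?Y n \<omega>) - l \<omega>)\<^sup>2 \<partial>M) = (\<integral>\<omega>. ((\<Sum>n<N. J n \<omega>) - l \<omega>)\<^sup>2 \<partial>M)"
      by (intro integral_cong_AE borel_measurable_power borel_measurable_diff borel_measurable_sum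
          sq_integrable_measurable[OF Ys] sq_integrable_measurable[OF Js] sq_integrable_measurable[OF ls])
    then show ?thesis by (simp add: L2n_def)
  qed
  then have "L2_tendsto M (\<lambda>N \<omega>. \<Sum>n<N. ?Y n \<omega>) l sequentially"
    using L2_tendstoD(3)[OF lim] by (intro L2_tendstoI ls always_eventually allI sq_integrable_sum Ys) simp
  moreover have "noise_form M w n (kernel_form n (b n)) (?Y n)" for n
    unfolding noise_form_def using b(1) wY by blast
  ultimately show ?thesis unfolding ito_wiener_expansion_def
    by (intro exI[of _ "\<lambda>n. kernel_form n (b n)"] conjI allI)
qed

end

theorem lemma16:
  fixes M :: "'a measure" and w x :: "real \<Rightarrow> 'a \<Rightarrow> real"
    and A :: "l2_01 \<Rightarrow> l2_01" and \<sigma> :: "real \<Rightarrow> real"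
    and u :: real and a :: "nat \<Rightarrow> (nat \<Rightarrow> real) \<Rightarrow> real"
  assumes "wiener_process M w"
    and "bounded_linear A" and "onorm A \<le> 1"
    and "\<exists>B. bounded_linear B \<and> B \<circ> A = id \<and> A \<circ> B = id"
    and "(\<lambda>(t, \<omega>). x t \<omega>) \<in> borel_measurable (leb01 \<Otimes>\<^sub>M M)"
    and "\<And>t. t \<in> {0..1} \<Longrightarrow> has_white_noise M w (A (ind01 t)) (x t)"
    and "\<And>t. t \<in> {0..1} \<Longrightarrow> \<sigma> t = norm (A (ind01 t))"
    and "\<And>n t. a n t =
          (LBINT s:{max_coord n t..1}.
             1 / \<sigma> s ^ n * hermite n (u / \<sigma> s) * gauss_kernel ((\<sigma> s)\<^sup>2) u)"
  shows "(\<forall>n. symmetric_kernel n (a n)) \<and>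
    (\<exists>l. is_local_time M x u l) \<and>
    (\<forall>l. is_local_time M x u l \<longrightarrow>
       (\<exists>F. ito_wiener_expansion M w F
              (\<lambda>n. second_quantization M w A (wiener_integral M w n (a n))) l))"
proof -
  obtain c where c: "0 < c" "\<And>h. c * norm h \<le> norm (A h)"
    using assms(4) invertible_bounded_below[of _ A] by blast
  interpret image_process M w A x c u
    using assms(1) assms(2) c assms(5,6) by (intro image_process.intro image_process_axioms.intro)
  have eq: "a n t = local_kernel n t" if t: "t \<in> space (cube n)" for n t
  proof -
    have "a n t = (LBINT s:{max_coord n t..1}. weight n s)"
      unfolding assms(8)
    proof (rule set_lebesgue_integral_cong)
      show "\<forall>s. s \<in> {max_coord n t..1} \<longrightarrow>
          1 / \<sigma> s ^ n * hermite n (u / \<sigma> s) * gauss_kernel ((\<sigma> s)\<^sup>2) u = weight n s"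
        using max_coord_nonneg[OF t] assms(7) by (simp add: weight_def hermite_gauss_def deviation_def)
    qed simp
    then show ?thesis by (simp add: local_kernel_def)
  qed
  have "symmetric_kernel n (a n)" for n
    by (rule symmetric_kernel_space_cong[OF local_kernel_symmetric eq])
  then show ?thesis using local_time_exists local_time_expansion[OF _ eq] by blast
qed

end
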